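(* Let $\gamma>0$, $\Omega>2\gamma$ and $\lambda>0$. For $\theta_0\in G:=(-\pi,\pi)$ define the value function $$S(\theta_0)=\inf_{v\in\mathcal{U}}\ \mathbb{E}\Big[\int_0^{\tau^v(\theta_0)} e^{-\lambda s}\,ds\Big],\qquad \tau^v(\theta_0):=\inf\{t\ge 0:\ \theta(t;v,0,\theta_0)\in\{-\pi,\pi\}\},$$ and set $S(\pm\pi)=0$. Then $S$ is the unique continuous viscosity solution on $G$ of the degenerate elliptic Hamilton–Jacobi–Bellman equation $$-\tfrac12\sigma^2(x)\,u''(x)+H(x,u(x),u'(x))=0,\qquad x\in G,$$ with boundary condition $u(-\pi)=u(\pi)=0$, where $\sigma(x)=2\sqrt{2\gamma}\,\sin x$ (so $\tfrac12\sigma^2(x)=4\gamma\sin^2 x$) and $$H(x,u,p)=\sup_{\alpha\in[-\Omega,\Omega]}\Big\{-\big[\alpha-2\gamma\sin(2x)\big]p+\lambda u-1\Big\}.$$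
   Context: Fix a filtered probability space carrying a standard one-dimensional Brownian motion $W$. $\mathcal{U}$ denotes the set of piecewise continuous control signals $v:[0,\infty)\to[-\Omega,\Omega]$ that are progressively measurable with respect to the filtration. For $v\in\mathcal{U}$, $t_0\ge0$ and $\theta_0$, $\theta(t;v,t_0,\theta_0)$ denotes the solution at time $t\ge t_0$, started at $\theta_0$ at time $t_0$, of the controlled SDE (the angle of a continuously monitored qubit state in the $x$–$z$ plane of the Bloch sphere) $$d\theta = v(t)\,dt-2\gamma\sin(2\theta)\,dt-2\sqrt{2\gamma}\,\sin(\theta)\,dW.$$ Here $\gamma>0$ is the measurement strength, $\Omega$ the control bound and $\lambda$ the discount factor. Viscosity solutions are understood in the standard Crandall–Ishii–Lions sense, with the Dirichlet boundary condition imposed on $\partial G=\{-\pi,\pi\}$. *)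

theory Defs
  imports "HOL-Probability.Probability"
begin

definition time_filtration :: "'a measure \<Rightarrow> (real \<Rightarrow> 'a measure) \<Rightarrow> bool" where
  "time_filtration M F \<longleftrightarrow> (\<forall>t. subalgebra M (F t)) \<and>
     (\<forall>s t. 0 \<le> s \<longrightarrow> s \<le> t \<longrightarrow> sets (F s) \<subseteq> sets (F t))"

definition brownian_motion :: "'a measure \<Rightarrow> (real \<Rightarrow> 'a measure) \<Rightarrow> (real \<Rightarrow> 'a \<Rightarrow> real) \<Rightarrow> bool" where
  "brownian_motion M F W \<longleftrightarrow>
     (\<forall>\<omega>\<in>space M. W 0 \<omega> = 0 \<and> continuous_on {0..} (\<lambda>t. W t \<omega>)) \<and>
     (\<forall>t\<ge>0. W t \<in> borel_measurable (F t)) \<and>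
     (\<forall>s t. 0 \<le> s \<longrightarrow> s < t \<longrightarrow>
        distributed M lborel (\<lambda>\<omega>. W t \<omega> - W s \<omega>) (\<lambda>x. ennreal (normal_density 0 (sqrt (t - s)) x)) \<and>
        (\<forall>A\<in>sets (F s). \<forall>B\<in>sets borel.
           measure M (A \<inter> {\<omega>\<in>space M. W t \<omega> - W s \<omega> \<in> B})
             = measure M A * measure M {\<omega>\<in>space M. W t \<omega> - W s \<omega> \<in> B}))"

definition progressive :: "'a measure \<Rightarrow> (real \<Rightarrow> 'a measure) \<Rightarrow> (real \<Rightarrow> 'a \<Rightarrow> real) \<Rightarrow> bool" where
  "progressive M F X \<longleftrightarrow>
     (\<forall>T\<ge>0. (\<lambda>(t, \<omega>). X t \<omega>) \<in> borel_measurable (restrict_space borel {0..T} \<Otimes>\<^sub>M F T))"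

definition simple_ok :: "'a measure \<Rightarrow> (real \<Rightarrow> 'a measure) \<Rightarrow> nat \<Rightarrow> (nat \<Rightarrow> real) \<Rightarrow> (nat \<Rightarrow> 'a \<Rightarrow> real) \<Rightarrow> bool" where
  "simple_ok M F n tt \<xi> \<longleftrightarrow> 0 \<le> tt 0 \<and> (\<forall>i<n. tt i < tt (Suc i)) \<and>
     (\<forall>i<n. \<xi> i \<in> borel_measurable (F (tt i))) \<and>
     (\<exists>B. \<forall>i<n. \<forall>\<omega>\<in>space M. \<bar>\<xi> i \<omega>\<bar> \<le> B)"

definition simple_proc :: "nat \<Rightarrow> (nat \<Rightarrow> real) \<Rightarrow> (nat \<Rightarrow> 'a \<Rightarrow> real) \<Rightarrow> real \<Rightarrow> 'a \<Rightarrow> real" where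
  "simple_proc n tt \<xi> t \<omega> = (\<Sum>i<n. \<xi> i \<omega> * indicator {tt i<..tt (Suc i)} t)"

definition simple_int :: "(real \<Rightarrow> 'a \<Rightarrow> real) \<Rightarrow> nat \<Rightarrow> (nat \<Rightarrow> real) \<Rightarrow> (nat \<Rightarrow> 'a \<Rightarrow> real) \<Rightarrow> real \<Rightarrow> 'a \<Rightarrow> real" where
  "simple_int W n tt \<xi> t \<omega> =
     (\<Sum>i<n. \<xi> i \<omega> * (W (min t (tt (Suc i))) \<omega> - W (min t (tt i)) \<omega>))"

definition ito_integral :: "'a measure \<Rightarrow> (real \<Rightarrow> 'a measure) \<Rightarrow> (real \<Rightarrow> 'a \<Rightarrow> real)
    \<Rightarrow> (real \<Rightarrow> 'a \<Rightarrow> real) \<Rightarrow> (real \<Rightarrow> 'a \<Rightarrow> real) \<Rightarrow> bool" where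
  "ito_integral M F W H Y \<longleftrightarrow> progressive M F H \<and> (\<forall>t\<ge>0. Y t \<in> borel_measurable M) \<and>
     (\<forall>T\<ge>0. (\<integral>\<^sup>+\<omega>. (\<integral>\<^sup>+t\<in>{0..T}. ennreal ((H t \<omega>)\<^sup>2) \<partial>lborel) \<partial>M) < \<infinity> \<and>
       (\<exists>n tt \<xi>. (\<forall>k. simple_ok M F (n k) (tt k) (\<xi> k)) \<and>
          ((\<lambda>k. \<integral>\<^sup>+\<omega>. (\<integral>\<^sup>+t\<in>{0..T}. ennreal ((simple_proc (n k) (tt k) (\<xi> k) t \<omega> - H t \<omega>)\<^sup>2) \<partial>lborel) \<partial>M)
             \<longlongrightarrow> 0) sequentially \<and>
          (\<forall>t\<in>{0..T}. ((\<lambda>k. \<integral>\<^sup>+\<omega>. ennreal ((simple_int W (n k) (tt k) (\<xi> k) t \<omega> - Y t \<omega>)\<^sup>2) \<partial>M)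
             \<longlongrightarrow> 0) sequentially)))"

definition piecewise_continuous :: "(real \<Rightarrow> real) \<Rightarrow> bool" where
  "piecewise_continuous f \<longleftrightarrow> (\<forall>T\<ge>0. \<exists>D. finite D \<and> D \<subseteq> {0..T} \<and>
     (\<forall>t\<in>{0..T} - D. continuous (at t within {0..}) f) \<and>
     (\<forall>t\<in>D. (0 < t \<longrightarrow> (\<exists>l. (f \<longlongrightarrow> l) (at_left t))) \<and> (\<exists>l. (f \<longlongrightarrow> l) (at_right t))))"

definition admissible :: "'a measure \<Rightarrow> (real \<Rightarrow> 'a measure) \<Rightarrow> real \<Rightarrow> (real \<Rightarrow> 'a \<Rightarrow> real) \<Rightarrow> bool" where
  "admissible M F \<Omega> v \<longleftrightarrow> progressive M F v \<and>
     (\<forall>t\<ge>0. \<forall>\<omega>\<in>space M. v t \<omega> \<in> {-\<Omega>..\<Omega>}) \<and>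
     (\<forall>\<omega>\<in>space M. piecewise_continuous (\<lambda>t. v t \<omega>))"

definition sde_solution :: "'a measure \<Rightarrow> (real \<Rightarrow> 'a measure) \<Rightarrow> (real \<Rightarrow> 'a \<Rightarrow> real) \<Rightarrow> real
    \<Rightarrow> (real \<Rightarrow> 'a \<Rightarrow> real) \<Rightarrow> real \<Rightarrow> (real \<Rightarrow> 'a \<Rightarrow> real) \<Rightarrow> bool" where
  "sde_solution M F W \<gamma> v \<theta>0 X \<longleftrightarrow> progressive M F X \<and>
     (\<forall>\<omega>\<in>space M. X 0 \<omega> = \<theta>0 \<and> continuous_on {0..} (\<lambda>t. X t \<omega>)) \<and>
     (\<exists>Y. ito_integral M F W (\<lambda>t \<omega>. - 2 * sqrt (2 * \<gamma>) * sin (X t \<omega>)) Y \<and>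
        (\<forall>t\<ge>0. AE \<omega> in M. X t \<omega> = \<theta>0 + integral {0..t} (\<lambda>s. v s \<omega> - 2 * \<gamma> * sin (2 * X s \<omega>)) + Y t \<omega>))"

text \<open>Exit time from G = (-pi, pi) (infinite if never exits).\<close>
definition exit_time :: "(real \<Rightarrow> 'a \<Rightarrow> real) \<Rightarrow> 'a \<Rightarrow> ereal" where
  "exit_time X \<omega> = Inf {ereal t | t. 0 \<le> t \<and> X t \<omega> \<in> {-pi, pi}}"

definition cost :: "'a measure \<Rightarrow> real \<Rightarrow> (real \<Rightarrow> 'a \<Rightarrow> real) \<Rightarrow> real" where
  "cost M lam X = enn2real (\<integral>\<^sup>+\<omega>. (\<integral>\<^sup>+s\<in>{s. 0 \<le> s \<and> ereal s < exit_time X \<omega>}.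
       ennreal (exp (- lam * s)) \<partial>lborel) \<partial>M)"

definition value_fn :: "'a measure \<Rightarrow> (real \<Rightarrow> 'a measure) \<Rightarrow> (real \<Rightarrow> 'a \<Rightarrow> real)
    \<Rightarrow> real \<Rightarrow> real \<Rightarrow> real \<Rightarrow> real \<Rightarrow> real" where
  "value_fn M F W \<gamma> \<Omega> lam \<theta>0 =
     (if -pi < \<theta>0 \<and> \<theta>0 < pi
      then Inf {cost M lam X | v X. admissible M F \<Omega> v \<and> sde_solution M F W \<gamma> v \<theta>0 X}
      else 0)"

definition hjb_H :: "real \<Rightarrow> real \<Rightarrow> real \<Rightarrow> real \<Rightarrow> real \<Rightarrow> real \<Rightarrow> real" where
  "hjb_H \<gamma> \<Omega> lam x u p = (SUP \<alpha>\<in>{-\<Omega>..\<Omega>}. - (\<alpha> - 2 * \<gamma> * sin (2 * x)) * p + lam * u - 1)"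

definition sigma_fn :: "real \<Rightarrow> real \<Rightarrow> real" where
  "sigma_fn \<gamma> x = 2 * sqrt (2 * \<gamma>) * sin x"

definition C2_with :: "(real \<Rightarrow> real) \<Rightarrow> (real \<Rightarrow> real) \<Rightarrow> (real \<Rightarrow> real) \<Rightarrow> bool" where
  "C2_with \<phi> \<phi>1 \<phi>2 \<longleftrightarrow> (\<forall>x. (\<phi> has_real_derivative \<phi>1 x) (at x) \<and> (\<phi>1 has_real_derivative \<phi>2 x) (at x))
     \<and> continuous_on UNIV \<phi>2"

definition viscosity_solution :: "real \<Rightarrow> real \<Rightarrow> real \<Rightarrow> (real \<Rightarrow> real) \<Rightarrow> bool" where
  "viscosity_solution \<gamma> \<Omega> lam u \<longleftrightarrow>
     continuous_on {-pi..pi} u \<and> u (-pi) = 0 \<and> u pi = 0 \<and>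
     (\<forall>x\<in>{-pi<..<pi}. \<forall>\<phi> \<phi>1 \<phi>2. C2_with \<phi> \<phi>1 \<phi>2 \<longrightarrow>
        (\<exists>e>0. \<forall>y\<in>{-pi<..<pi} \<inter> ball x e. u y - \<phi> y \<le> u x - \<phi> x) \<longrightarrow>
        - (1/2) * (sigma_fn \<gamma> x)\<^sup>2 * \<phi>2 x + hjb_H \<gamma> \<Omega> lam x (u x) (\<phi>1 x) \<le> 0) \<and>
     (\<forall>x\<in>{-pi<..<pi}. \<forall>\<phi> \<phi>1 \<phi>2. C2_with \<phi> \<phi>1 \<phi>2 \<longrightarrow>
        (\<exists>e>0. \<forall>y\<in>{-pi<..<pi} \<inter> ball x e. u y - \<phi> y \<ge> u x - \<phi> x) \<longrightarrow>
        - (1/2) * (sigma_fn \<gamma> x)\<^sup>2 * \<phi>2 x + hjb_H \<gamma> \<Omega> lam x (u x) (\<phi>1 x) \<ge> 0)"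

end

theory Submission
 imports Defs "HOL-Real_Asymp.Real_Asymp"
begin

text \<open>The value function is explicit up to a linear second order equation. Pushing away from \<open>0\<close> with full strength
suggests \<open>U x = (1 - G \<bar>x\<bar> / G pi) / lam\<close>, where \<open>G\<close> solves the linear equation on \<open>[0, pi)\<close> that is singular at
both ends, with \<open>G 0 = 1\<close> and the slope at \<open>0\<close> forced by boundedness. \<open>U\<close> is a viscosity solution: it is classical away
from \<open>0\<close>, where it has a concave kink. Multiplying the zeroth order coefficient by a cutoff that vanishes near \<open>0\<close>
gives smooth functions \<open>U H\<close> close to \<open>U G\<close> which are classical subsolutions on the whole interval. They are used twice:
as test functions, they bound every viscosity solution from below by \<open>U G\<close> (and \<open>U G\<close> itself bounds it from above); in
Dynkin's formula, they bound the cost of every admissible control from below. Dynkin's inequality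
is obtained for sums over a time grid by a second order Taylor expansion, which only needs the defining \<open>L\<^sup>2\<close>
approximation of the stochastic integral. The optimal control is the constant \<open>\<Omega>\<close> (or \<open>- \<Omega>\<close>): its equation is
solved path by path by the Doss-Sussmann substitution with the explicit flow of \<open>- 2 * sqrt (2 * \<gamma>) * sin\<close>, and the path
started in \<open>[0, pi)\<close> is positive for positive times, so along it the drift is optimal and the Dynkin inequality is sharp.\<close>

section \<open>A contraction principle for Volterra equations\<close>

text \<open>The noise coefficient vanishes at -pi, 0 and pi, so ellipticity fails exactly where the
  value function has its kink and where the boundary data are imposed. The condition \<Omega> > 2 *
  \<gamma> compensates: under full control the drift is at least \<Omega> - 2 * \<gamma> > 0, which
  bounds the slope of the profile. The kink keeps \<open>U G\<close> from being its own barrier: it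
  is no smooth test function at 0 and has no second derivative there for a Taylor step. Switching
  off the zeroth order term near 0 freezes the profile to a constant, hence smoothness, and gives
  the residual of the equation a sign. The distance from \<open>U H\<close> to \<open>U G\<close> is
  read off a Wronskian, damped by an integrating factor that is flat at 0; comparison then needs no
  doubling of variables. Solutions of the stochastic equation are known only through L2 limits and
  through equalities that hold almost surely at each fixed time. Hence stopping times are replaced
  by the indicator \<open>alive\<close> of having stayed in an interval up to a grid time, and both
  cost bounds are limits of finite sums.\<close>

lemma volterra_fixed_point:
 fixes \<Phi> :: "(real => real) => real => real" and D :: "real set"
 assumes D: "\<And>t. t \<in> D ==> 0 \<le> t \<and> {0..t} \<subseteq> D"
  and D_ext: "\<And>t. t \<in> D ==> \<exists>T\<in>D. t < T"
  and cont: "\<And>u. continuous_on D u ==> continuous_on D (\<Phi> u)"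
  and lip: "\<And>T. T \<in> D ==> \<exists>L\<ge>0. \<forall>u v B n. continuous_on D u --> continuous_on D v --> 0 \<le> B -->
    (\<forall>s\<in>{0..T}. \<bar>u s - v s\<bar> \<le> B * s ^ n) -->
    (\<forall>s\<in>{0..T}. \<bar>\<Phi> u s - \<Phi> v s\<bar> \<le> L * B * s ^ Suc n / real (Suc n))"
  and u0: "continuous_on D u0"
 obtains g where "continuous_on D g" "\<And>t. t \<in> D ==> \<Phi> g t = g t"
  "\<And>t. t \<in> D ==> (%n. (\<Phi> ^^ n) u0 t) \<longlonglongrightarrow> g t"
proof -
 \<comment> \<open>Picard iteration without a fixed norm: \<open>lip\<close> trades a bound
   \<open>B * s ^ n\<close> for one with an extra factor \<open>L * s / (n + 1)\<close>, so
   successive differences are dominated by the exponential series of \<open>L * T\<close> on each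
   \<open>[0, T]\<close> in \<open>D\<close>, even if \<open>L\<close> grows with \<open>T\<close>.
   Convergence of the iterates is part of the conclusion because positivity and measurability are
   proved for iterates and passed to the limit.\<close>
 define U where "U n = (\<Phi> ^^ n) u0" for n
 have U_Suc: "U (Suc n) = \<Phi> (U n)" for n by (simp add: U_def)
 have Uc: "continuous_on D (U n)" for n
  by (induction n) (auto simp: U_def u0 intro: cont)
 have unif: "uniformly_convergent_on {0..T} U" if T: "T \<in> D" for T
 proof -
  from lip[OF T] obtain L where L0: "L \<ge> 0" and L: "\<And>u v B n s. continuous_on D u ==> continuous_on D v ==> 0 \<le> B ==>
    (\<And>s. s\<in>{0..T} ==> \<bar>u s - v s\<bar> \<le> B * s ^ n) ==> s\<in>{0..T} ==>
    \<bar>\<Phi> u s - \<Phi> v s\<bar> \<le> L * B * s ^ Suc n / real (Suc n)" by metis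
  have T0: "0 \<le> T" and TD: "{0..T} \<subseteq> D" using D[OF T] by auto
  have "compact ((%s. U 1 s - U 0 s) ` {0..T})"
   by (intro compact_continuous_image continuous_intros continuous_on_subset[OF Uc] TD) auto
  then have "bounded ((%s. U 1 s - U 0 s) ` {0..T})" by (rule compact_imp_bounded)
  then obtain B where B: "\<And>s. s \<in> {0..T} ==> \<bar>U 1 s - U 0 s\<bar> \<le> B"
   unfolding bounded_iff by fastforce
  have B0: "0 \<le> B" using B[of 0] T0 by auto
  have step: "\<bar>U (Suc n) s - U n s\<bar> \<le> (B * L ^ n / fact n) * s ^ n" if "s \<in> {0..T}" for n s
   using that
  proof (induction n arbitrary: s)
   case 0 then show ?case using B by (simp add: U_def)
  next
   case (Suc n)
   have "\<bar>\<Phi> (U (Suc n)) s - \<Phi> (U n) s\<bar> \<le> L * (B * L ^ n / fact n) * s ^ Suc n / real (Suc n)"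
    by (rule L) (use Uc Suc B0 L0 in auto)
   also have "\<dots> = (B * L ^ Suc n / fact (Suc n)) * s ^ Suc n"
    by (simp add: field_simps)
   finally show ?case by (simp only: U_Suc)
  qed
  have "summable (%n. B * ((L * T) ^ n /\<^sub>R fact n))"
   by (intro summable_mult summable_exp_generic)
  then have summ: "summable (%n. B * L ^ n / fact n * T ^ n)"
   by (simp add: power_mult_distrib field_simps)
  have "uniformly_convergent_on {0..T} (%n s. \<Sum>i<n. U (Suc i) s - U i s)"
  proof (rule Weierstrass_m_test'_ev[OF _ summ])
   show "\<forall>\<^sub>F n in sequentially. \<forall>x\<in>{0..T}. norm (U (Suc n) x - U n x) \<le> B * L ^ n / fact n * T ^ n"
   proof (intro always_eventually allI ballI)
    fix n x assume x: "x \<in> {0..T}"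
    have "norm (U (Suc n) x - U n x) \<le> (B * L ^ n / fact n) * x ^ n" using step[OF x] by simp
    also have "\<dots> \<le> (B * L ^ n / fact n) * T ^ n"
     using x B0 L0 by (intro mult_left_mono power_mono) auto
    finally show "norm (U (Suc n) x - U n x) \<le> B * L ^ n / fact n * T ^ n" .
   qed
  qed
  then have "uniformly_convergent_on {0..T} (%n s. U n s - U 0 s)"
   by (simp add: sum_lessThan_telescope[of "%i. U i s" n for s n])
  then obtain l where "uniform_limit {0..T} (%n s. U n s - U 0 s) l sequentially"
   by (auto simp: uniformly_convergent_on_def)
  then have "uniform_limit {0..T} (%n s. (U n s - U 0 s) + U 0 s) (%s. l s + U 0 s) sequentially"
   by (intro uniform_limit_intros)
  then show ?thesis by (auto simp: uniformly_convergent_on_def)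
 qed
 define g where "g t = lim (%n. U n t)" for t
 have ul: "uniform_limit {0..T} U g sequentially" if T: "T \<in> D" for T
  using unif[OF T] unfolding g_def by (simp add: uniformly_convergent_uniform_limit_iff)
 have tl: "(%n. U n t) \<longlonglongrightarrow> g t" if T: "t \<in> D" for t
  using tendsto_uniform_limitI[OF ul[OF T]] D[OF T] by auto
 have gc: "continuous_on {0..T} g" if T: "T \<in> D" for T
  using D[OF T] by (intro uniform_limit_theorem[OF _ ul[OF T]] always_eventually allI
    continuous_on_subset[OF Uc]) auto
 have gD: "continuous_on D g"
  unfolding continuous_on_eq_continuous_within
 proof
  fix t assume t: "t \<in> D"
  then obtain T where T: "T \<in> D" "t < T" using D_ext by blast
  have "at t within D = at t within {0..T}"
   by (rule at_within_nhd[of t "{..<T}"]) (use T t D in \<open>force\<close>)+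
  then show "continuous (at t within D) g"
   using gc[OF T(1)] T t D by (auto simp: continuous_on_eq_continuous_within)
 qed
 have "\<Phi> g t = g t" if t: "t \<in> D" for t
 proof -
  from lip[OF t] obtain L where L0: "L \<ge> 0" and L: "\<And>u v B n s. continuous_on D u ==> continuous_on D v ==> 0 \<le> B ==>
    (\<And>s. s\<in>{0..t} ==> \<bar>u s - v s\<bar> \<le> B * s ^ n) ==> s\<in>{0..t} ==>
    \<bar>\<Phi> u s - \<Phi> v s\<bar> \<le> L * B * s ^ Suc n / real (Suc n)" by metis
  have t0: "0 \<le> t" using D[OF t] by auto
  have "(%n. U (Suc n) t) \<longlonglongrightarrow> \<Phi> g t"
  proof (rule LIMSEQ_I)
   fix e :: real assume e: "e > 0"
   \<comment> \<open>The \<open>+ 1\<close> keeps the denominator positive. The case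
     \<open>n = 0\<close> of the Lipschitz hypothesis, with the constant \<open>d\<close> bounding
     the difference, then yields at most \<open>e / 2\<close>.\<close>
   define d where "d = e / (2 * (L * t + 1))"
   have d: "d > 0" using e L0 t0 by (auto simp: d_def intro!: divide_pos_pos add_nonneg_pos)
   from ul[OF t] d have "\<forall>\<^sub>F n in sequentially. \<forall>x\<in>{0..t}. dist (U n x) (g x) < d"
    by (auto simp: uniform_limit_iff)
   then obtain N where N: "\<And>n x. n \<ge> N ==> x \<in> {0..t} ==> \<bar>U n x - g x\<bar> < d"
    unfolding eventually_sequentially dist_real_def by blast
   show "\<exists>N. \<forall>n\<ge>N. norm (U (Suc n) t - \<Phi> g t) < e"
   proof (intro exI allI impI)
    fix n assume n: "n \<ge> N"
    have "\<bar>\<Phi> (U n) t - \<Phi> g t\<bar> \<le> L * d * t ^ Suc 0 / real (Suc 0)"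
     by (rule L) (use Uc gD d N[OF n] t0 in \<open>auto intro: less_imp_le\<close>)
    also have "\<dots> \<le> (L * t + 1) * d" using d by (simp add: algebra_simps)
    also have "\<dots> = e / 2"
    proof -
     have "L * t + 1 > 0" using L0 t0 by (intro add_nonneg_pos) auto
     then show ?thesis unfolding d_def by (auto simp: field_simps)
    qed
    also have "\<dots> < e" using e by simp
    finally show "norm (U (Suc n) t - \<Phi> g t) < e" by (simp add: U_Suc)
   qed
  qed
  moreover have "(%n. U (Suc n) t) \<longlonglongrightarrow> g t" using tl[OF t] by (rule LIMSEQ_Suc)
  ultimately show ?thesis by (rule LIMSEQ_unique)
 qed
 with gD tl show ?thesis using that unfolding U_def by blast
qed

section \<open>The radial profile of the value function\<close>

locale qubit_control =
 fixes \<gamma> \<Omega> lam :: real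
 assumes \<gamma>_pos: "\<gamma> > 0" and \<Omega>_gt: "\<Omega> > 2 * \<gamma>" and lam_pos: "lam > 0"
begin

definition drift :: "real => real" where "drift x = \<Omega> - 2 * \<gamma> * sin (2 * x)"

text \<open>The integrating factor of the first order equation satisfied by the slope of the
  profile: its logarithmic derivative is \<open>drift x / (4 * \<gamma> * (sin x)\<^sup>2)\<close>.
  The constant part \<Omega> of the drift integrates to the cotangent in the exponent, the part with
  \<open>sin (2 * x)\<close> to the factor \<open>1 / sin x\<close>.\<close>

definition intfac :: "real => real" where "intfac x = exp (- (\<Omega> / (4 * \<gamma>)) * cot x) / sin x"

text \<open>The density that variation of constants puts against the right-hand side. The value 0
  for nonpositive arguments is its continuous extension, as \<open>intfac\<close> vanishes faster
  than any power at 0.\<close>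

definition weight :: "real => real" where
 "weight x = (if x \<le> 0 then 0 else intfac x / (4 * \<gamma> * (sin x)\<^sup>2))"

text \<open>The solution \<open>g\<close> of
  \<open>4 * \<gamma> * (sin y)\<^sup>2 * g' + drift y * g = h\<close> that stays bounded at 0; the
  other solutions differ by multiples of \<open>1 / intfac\<close>, which blows up there. The value
  at 0 is what the equation gives once its leading coefficient vanishes.\<close>

definition slope_op :: "(real => real) => real => real" where
 "slope_op h y = (if y = 0 then h 0 / \<Omega> else integral {0..y} (%s. weight s * h s) / intfac y)"

text \<open>An upper bound for \<open>lam / drift\<close>. It is both the Lipschitz constant of the
  fixed point equation for the profile and the bound on the logarithmic slope of its
  solution.\<close>

definition lip_const :: real where "lip_const = lam / (\<Omega> - 2 * \<gamma>)"

lemma \<Omega>_pos: "\<Omega> > 0" using \<gamma>_pos \<Omega>_gt by linarith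

lemma lip_const_nonneg: "lip_const \<ge> 0"
 using lam_pos \<Omega>_gt by (auto simp: lip_const_def)

lemma drift_ge: "drift x \<ge> \<Omega> - 2 * \<gamma>"
 using \<gamma>_pos mult_left_mono[OF sin_le_one[of "2 * x"], of "2 * \<gamma>"] by (auto simp: drift_def)

lemma drift_pos: "drift x > 0" using drift_ge[of x] \<Omega>_gt by linarith

lemma drift_0 [simp]: "drift 0 = \<Omega>" by (simp add: drift_def)

lemma continuous_on_drift [continuous_intros]: "continuous_on A drift"
 unfolding drift_def by (intro continuous_intros)

lemma intfac_pos: "0 < x ==> x < pi ==> intfac x > 0"
 by (auto simp: intfac_def sin_gt_zero)

lemma intfac_deriv:
 assumes "0 < x" "x < pi"
 shows "(intfac has_real_derivative intfac x * drift x / (4 * \<gamma> * (sin x)\<^sup>2)) (at x)"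
proof -
 have s: "sin x > 0" using assms by (rule sin_gt_zero)
 have "((%x. exp (- (\<Omega> / (4 * \<gamma>)) * cot x) / sin x) has_real_derivative
  (exp (- (\<Omega> / (4 * \<gamma>)) * cot x) * (- (\<Omega> / (4 * \<gamma>)) * (- inverse ((sin x)\<^sup>2))) * sin x
   - exp (- (\<Omega> / (4 * \<gamma>)) * cot x) * cos x) / (sin x * sin x)) (at x)"
  using s by (intro DERIV_divide DERIV_fun_exp DERIV_cmult DERIV_cot DERIV_sin) auto
 also have "(exp (- (\<Omega> / (4 * \<gamma>)) * cot x) * (- (\<Omega> / (4 * \<gamma>)) * (- inverse ((sin x)\<^sup>2))) * sin x
   - exp (- (\<Omega> / (4 * \<gamma>)) * cot x) * cos x) / (sin x * sin x)
  = exp (- (\<Omega> / (4 * \<gamma>)) * cot x) * ((\<Omega> / (4 * \<gamma>)) * inverse ((sin x)\<^sup>2) * sin x - cos x) / (sin x * sin x)"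
  by (simp add: algebra_simps)
 also have "\<dots> = intfac x * drift x / (4 * \<gamma> * (sin x)\<^sup>2)"
  unfolding intfac_def drift_def sin_double
  using s \<gamma>_pos by (simp add: divide_simps) (simp add: algebra_simps power2_eq_square)
 finally show ?thesis unfolding intfac_def[abs_def] .
qed

lemma intfac_tendsto_0: "(intfac \<longlongrightarrow> 0) (at_right 0)"
proof -
 define k where "k = \<Omega> / (4 * \<gamma>)"
 have "k > 0" using \<gamma>_pos \<Omega>_pos by (auto simp: k_def)
 then show ?thesis unfolding intfac_def[abs_def] cot_def k_def[symmetric] by real_asymp
qed

lemma weight_tendsto_0: "(weight \<longlongrightarrow> 0) (at_right 0)"
proof -
 define k where "k = \<Omega> / (4 * \<gamma>)"
 have "k > 0" using \<gamma>_pos \<Omega>_pos by (auto simp: k_def)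
 then have "((%s::real. exp (- k * cot s) / sin s / (sin s)\<^sup>2) \<longlongrightarrow> 0) (at_right 0)"
  unfolding cot_def by real_asymp
 then have "((%s::real. (exp (- k * cot s) / sin s / (sin s)\<^sup>2) / (4 * \<gamma>)) \<longlongrightarrow> 0 / (4 * \<gamma>)) (at_right 0)"
  by (rule tendsto_divide) (use \<gamma>_pos in auto)
 then have "((%s::real. exp (- k * cot s) / sin s / (4 * \<gamma> * (sin s)\<^sup>2)) \<longlongrightarrow> 0) (at_right 0)"
  by (simp add: field_simps)
 moreover have "\<forall>\<^sub>F s in at_right 0. exp (- k * cot s) / sin s / (4 * \<gamma> * (sin s)\<^sup>2) = weight s"
  unfolding eventually_at_right_field by (auto simp: weight_def intfac_def k_def intro!: exI[of _ 1])
 ultimately show ?thesis by (rule Lim_transform_eventually)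
qed

lemma continuous_on_weight: "continuous_on {0..<pi} weight"
 unfolding continuous_on_eq_continuous_within
proof
 fix x :: real assume x: "x \<in> {0..<pi}"
 show "continuous (at x within {0..<pi}) weight"
 proof (cases "x = 0")
  case True
  have "at 0 within {0..<pi} = at_right (0::real)"
   by (rule at_within_nhd[of _ "{-1<..<pi}"]) auto
  then show ?thesis using True weight_tendsto_0 by (auto simp: continuous_within weight_def)
 next
  case False
  then have x': "0 < x" "x < pi" using x by auto
  then have s: "sin x > 0" by (rule sin_gt_zero)
  have "continuous (at x) (%x. intfac x / (4 * \<gamma> * (sin x)\<^sup>2))"
   using DERIV_isCont[OF intfac_deriv[OF x']] s \<gamma>_pos by (intro continuous_intros) auto
  then have "continuous (at x) weight"
   by (rule continuous_transform_within[where \<delta> = x]) (use x' in \<open>auto simp: weight_def dist_real_def\<close>)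
  then show ?thesis by (rule continuous_at_imp_continuous_at_within)
 qed
qed

lemma weight_nonneg: "x < pi ==> weight x \<ge> 0"
 using \<gamma>_pos intfac_pos[of x] by (auto simp: weight_def)

lemma continuous_weight_mult:
 assumes "continuous_on {0..<pi} h" "y < pi"
 shows "continuous_on {0..y} (%s. weight s * h s)"
 using assms by (intro continuous_intros continuous_on_subset[OF continuous_on_weight] continuous_on_subset[OF assms(1)]) auto

text \<open>\<open>weight * drift\<close> is the derivative of \<open>intfac\<close>, and
  \<open>intfac\<close> vanishes at 0. Consequently \<open>slope_op drift\<close> is constantly 1
  and \<open>slope_op h y\<close> is a weighted average of \<open>h / drift\<close> over
  \<open>[0, y]\<close>; the bounds on \<open>slope_op\<close> rest on this.\<close>

lemma has_integral_weight_drift: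
 assumes y: "0 < y" "y < pi"
 shows "((%s. weight s * drift s) has_integral intfac y) {0..y}"
proof -
 define m where "m x = (if x \<le> 0 then 0 else intfac x)" for x
 have mc: "continuous_on {0..y} m"
  unfolding continuous_on_eq_continuous_within
 proof
  fix x assume x: "x \<in> {0..y}"
  show "continuous (at x within {0..y}) m"
  proof (cases "x = 0")
   case True
   have *: "at 0 within {0..y} = at_right (0::real)"
    by (rule at_within_nhd[of _ "{-1<..<y}"]) (use y in auto)
   have "(m \<longlongrightarrow> 0) (at_right 0)"
    by (rule Lim_transform_eventually[OF intfac_tendsto_0])
     (auto simp: eventually_at_right_field m_def intro!: exI[of _ 1])
   then show ?thesis using True by (auto simp: continuous_within m_def *)
  next
   case False
   then have x': "0 < x" "x < pi" using x y by auto
   have "continuous (at x) intfac" using DERIV_isCont[OF intfac_deriv[OF x']] .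
   then have "continuous (at x) m"
    by (rule continuous_transform_within[where \<delta> = x]) (use x' in \<open>auto simp: m_def dist_real_def\<close>)
   then show ?thesis by (rule continuous_at_imp_continuous_at_within)
  qed
 qed
 have "((%s. weight s * drift s) has_integral m y - m 0) {0..y}"
 proof (rule fundamental_theorem_of_calculus_interior[OF _ mc])
  fix x assume x: "x \<in> {0<..<y}"
  then have x': "0 < x" "x < pi" using y by auto
  have "(m has_real_derivative intfac x * drift x / (4 * \<gamma> * (sin x)\<^sup>2)) (at x)"
   by (rule has_field_derivative_transform_within[OF intfac_deriv[OF x'], where d = x])
    (use x' in \<open>auto simp: m_def dist_real_def\<close>)
  then show "(m has_vector_derivative weight x * drift x) (at x)"
   using x' by (simp add: weight_def has_real_derivative_iff_has_vector_derivative)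
 qed (use y in auto)
 then show ?thesis using y by (simp add: m_def)
qed

lemma weight_integral_bound:
 assumes h: "continuous_on {0..<pi} h" and y: "0 < y" "y < pi"
  and b: "\<And>s. s \<in> {0..y} ==> \<bar>h s\<bar> \<le> C * drift s"
 shows "\<bar>integral {0..y} (%s. weight s * h s)\<bar> \<le> C * intfac y"
proof -
 have i: "(%s. weight s * h s) integrable_on {0..y}"
  by (intro integrable_continuous_real continuous_weight_mult h y)
 have j: "((%s. C * (weight s * drift s)) has_integral C * intfac y) {0..y}"
  by (intro has_integral_mult_right has_integral_weight_drift y)
 have "norm (integral {0..y} (%s. weight s * h s)) \<le> integral {0..y} (%s. C * (weight s * drift s))"
 proof (rule integral_norm_bound_integral[OF i])
  show "(%s. C * (weight s * drift s)) integrable_on {0..y}" using j by (rule has_integral_integrable)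
  fix s assume s: "s \<in> {0..y}"
  have "norm (weight s * h s) = weight s * \<bar>h s\<bar>" using weight_nonneg[of s] s y by (simp add: abs_mult)
  also have "\<dots> \<le> weight s * (C * drift s)" using weight_nonneg[of s] s y b by (intro mult_left_mono) auto
  finally show "norm (weight s * h s) \<le> C * (weight s * drift s)" by (simp add: mult_ac)
 qed
 then show ?thesis unfolding integral_unique[OF j] by simp
qed

lemma slope_op_bound:
 assumes h: "continuous_on {0..<pi} h" and y: "0 \<le> y" "y < pi"
  and b: "\<And>s. s \<in> {0..y} ==> \<bar>h s\<bar> \<le> C * drift s"
 shows "\<bar>slope_op h y\<bar> \<le> C"
proof (cases "y = 0")
 case True
 then show ?thesis using b[of 0] \<Omega>_pos by (auto simp: slope_op_def divide_le_eq abs_mult field_simps)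
next
 case False
 then have y': "0 < y" using y by auto
 show ?thesis using weight_integral_bound[OF h y' y(2) b] intfac_pos[OF y' y(2)] False
  by (auto simp: slope_op_def divide_le_eq abs_mult)
qed

lemma slope_op_nonneg:
 assumes h: "continuous_on {0..<pi} h" and y: "0 \<le> y" "y < pi" and b: "\<And>s. s \<in> {0..y} ==> 0 \<le> h s"
 shows "0 \<le> slope_op h y"
proof -
 have "0 \<le> integral {0..y} (%s. weight s * h s)"
  by (rule integral_nonneg) (use y weight_nonneg b in \<open>auto intro!: integrable_continuous_real continuous_weight_mult h\<close>)
 then show ?thesis using b[of 0] y \<Omega>_pos intfac_pos[of y] by (cases "y = 0") (auto simp: slope_op_def)
qed

lemma slope_op_diff:
 assumes f: "continuous_on {0..<pi} f" and g: "continuous_on {0..<pi} g" and y: "0 \<le> y" "y < pi"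
 shows "slope_op f y - slope_op g y = slope_op (%s. f s - g s) y"
proof -
 have "integral {0..y} (%s. weight s * (f s - g s)) = integral {0..y} (%s. weight s * f s) - integral {0..y} (%s. weight s * g s)"
  unfolding right_diff_distrib
  by (rule integral_diff) (intro integrable_continuous_real continuous_weight_mult f g y)+
 then show ?thesis by (simp add: slope_op_def diff_divide_distrib)
qed

lemma slope_op_deriv:
 assumes h: "continuous_on {0..<pi} h" and y: "0 < y" "y < pi"
 shows "(slope_op h has_real_derivative (h y - drift y * slope_op h y) / (4 * \<gamma> * (sin y)\<^sup>2)) (at y)"
proof -
 define z where "z = (y + pi) / 2"
 have z: "y < z" "z < pi" using y by (auto simp: z_def)
 have c: "continuous_on {0..z} (%s. weight s * h s)" by (rule continuous_weight_mult[OF h z(2)])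
 have "((%y. integral {0..y} (%s. weight s * h s)) has_real_derivative weight y * h y) (at y within {0..z})"
  by (rule integral_has_real_derivative[OF c]) (use y z in auto)
 then have d: "((%y. integral {0..y} (%s. weight s * h s)) has_real_derivative weight y * h y) (at y)"
  using at_within_interior[of y "{0..z}"] y z by simp
 have m: "intfac y > 0" by (rule intfac_pos[OF y])
 have "((%y. integral {0..y} (%s. weight s * h s) / intfac y) has_real_derivative
  (weight y * h y * intfac y - integral {0..y} (%s. weight s * h s) * (intfac y * drift y / (4 * \<gamma> * (sin y)\<^sup>2)))
   / (intfac y * intfac y)) (at y)"
  using m by (intro DERIV_divide d intfac_deriv y) auto
 also have "(weight y * h y * intfac y - integral {0..y} (%s. weight s * h s) * (intfac y * drift y / (4 * \<gamma> * (sin y)\<^sup>2)))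
   / (intfac y * intfac y) = (h y - drift y * slope_op h y) / (4 * \<gamma> * (sin y)\<^sup>2)"
  using m y \<gamma>_pos sin_gt_zero[OF y] by (simp add: weight_def slope_op_def field_simps)
 finally show ?thesis
  by (rule has_field_derivative_transform_within[where d = y]) (use y in \<open>auto simp: slope_op_def dist_real_def\<close>)
qed

text \<open>Only 0 is delicate, where the defining quotient degenerates to 0/0. Subtracting from
  \<open>h\<close> the multiple of \<open>drift\<close> with the same value at 0 changes
  \<open>slope_op h\<close> by exactly the constant \<open>h 0 / \<Omega>\<close>; the rest
  \<open>f\<close> vanishes at 0, so its averages over short intervals are small.\<close>

lemma continuous_on_slope_op:
 assumes h: "continuous_on {0..<pi} h"
 shows "continuous_on {0..<pi} (slope_op h)"
 unfolding continuous_on_eq_continuous_within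
proof
 fix x :: real assume x: "x \<in> {0..<pi}"
 show "continuous (at x within {0..<pi}) (slope_op h)"
 proof (cases "x = 0")
  case False
  then have "0 < x" "x < pi" using x by auto
  from continuous_at_imp_continuous_at_within[OF DERIV_isCont[OF slope_op_deriv[OF h this]]]
  show ?thesis .
 next
  case True
  define f where "f s = h s - h 0 / \<Omega> * drift s" for s
  have fc: "continuous_on {0..<pi} f" unfolding f_def by (intro continuous_intros h)
  have f0: "f 0 = 0" using \<Omega>_pos by (simp add: f_def)
  have key: "slope_op h y - h 0 / \<Omega> = slope_op f y" if y: "0 \<le> y" "y < pi" for y
  proof -
   have "slope_op (%s. h 0 / \<Omega> * drift s) y = h 0 / \<Omega>"
   proof (cases "y = 0")
    case True then show ?thesis using \<Omega>_pos by (simp add: slope_op_def)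
   next
    case False
    then have y': "0 < y" using y by auto
    have "((%s. h 0 / \<Omega> * (weight s * drift s)) has_integral h 0 / \<Omega> * intfac y) {0..y}"
     by (intro has_integral_mult_right has_integral_weight_drift y' y)
    then have "integral {0..y} (%s. weight s * (h 0 / \<Omega> * drift s)) = h 0 / \<Omega> * intfac y"
     by (intro integral_unique) (simp add: mult_ac)
    then show ?thesis using intfac_pos[OF y' y(2)] False \<Omega>_pos by (simp add: slope_op_def)
   qed
   moreover have "slope_op h y - slope_op (%s. h 0 / \<Omega> * drift s) y = slope_op f y"
    unfolding f_def by (rule slope_op_diff) (intro continuous_intros h y)+
   ultimately show ?thesis by simp
  qed
  have "(slope_op h \<longlongrightarrow> h 0 / \<Omega>) (at 0 within {0..<pi})"
  proof (rule tendstoI)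
   fix e :: real assume e: "e > 0"
   define e' where "e' = e / 2 * (\<Omega> - 2 * \<gamma>)"
   have e': "e' > 0" using e \<Omega>_gt by (auto simp: e'_def)
   from fc have "continuous (at 0 within {0..<pi}) f" by (auto simp: continuous_on_eq_continuous_within)
   then have "\<exists>d>0. \<forall>s\<in>{0..<pi}. dist s 0 < d --> dist (f s) (f 0) < e'"
    using e' unfolding continuous_within_eps_delta by blast
   then obtain d where d: "d > 0" "\<And>s. s \<in> {0..<pi} ==> dist s 0 < d ==> dist (f s) (f 0) < e'"
    by blast
   have "dist (slope_op h y) (h 0 / \<Omega>) < e" if y: "y \<in> {0..<pi}" "y < d" for y
   proof -
    have "\<bar>slope_op f y\<bar> \<le> e / 2"
    proof (rule slope_op_bound[OF fc])
     fix s assume s: "s \<in> {0..y}"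
     have "\<bar>f s\<bar> \<le> e'" using d(2)[of s] s y f0 by (simp add: dist_real_def)
     also have "\<dots> \<le> e / 2 * drift s" unfolding e'_def using e drift_ge by (intro mult_left_mono) auto
     finally show "\<bar>f s\<bar> \<le> e / 2 * drift s" .
    qed (use y in auto)
    then show ?thesis using key[of y] y e by (auto simp: dist_real_def)
   qed
   then show "\<forall>\<^sub>F x in at 0 within {0..<pi}. dist (slope_op h x) (h 0 / \<Omega>) < e"
    using d(1) unfolding eventually_at by (auto simp: dist_real_def intro!: exI[of _ d])
  qed
  then show ?thesis using True by (simp add: continuous_within slope_op_def)
 qed
qed

text \<open>The equation is \<open>4 * \<gamma> * (sin x)\<^sup>2 * G'' + drift x * G' = lam *
  \<eta> x * G\<close>. Solving for the slope by \<open>slope_op\<close> removes the singularity at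
  0 and leaves the Volterra equation \<open>G = 1 + \<integral> slope_op (lam * \<eta> * G)\<close>.
  The function \<eta> is the device that later yields both the true profile and its smooth
  approximations.\<close>

lemma linear_ode_solution:
 assumes \<eta>: "continuous_on {0..<pi} \<eta>" and \<eta>01: "\<And>x. x \<in> {0..<pi} ==> 0 \<le> \<eta> x \<and> \<eta> x \<le> 1"
 obtains G G1 where
  "continuous_on {0..<pi} G" "continuous_on {0..<pi} G1" "G 0 = 1" "G1 0 = lam * \<eta> 0 / \<Omega>"
  "\<And>x. x \<in> {0..<pi} ==> (G has_real_derivative G1 x) (at x within {0..<pi})"
  "\<And>x. x \<in> {0<..<pi} ==>
   (G1 has_real_derivative (lam * \<eta> x * G x - drift x * G1 x) / (4 * \<gamma> * (sin x)\<^sup>2)) (at x)"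
  "\<And>x. x \<in> {0..<pi} ==> 1 \<le> G x" "\<And>x. x \<in> {0..<pi} ==> 0 \<le> G1 x"
  "\<And>x. x \<in> {0..<pi} ==> G1 x \<le> lip_const * G x"
  "\<And>y. y \<in> {0..<pi} ==> (\<And>s. s \<in> {0..y} ==> \<eta> s = 0) ==> G1 y = 0"
proof -
 define P where "P u = slope_op (%s. lam * \<eta> s * u s)" for u
 define \<Phi> where "\<Phi> u x = 1 + integral {0..x} (P u)" for u x
 have hc: "continuous_on {0..<pi} (%s. lam * \<eta> s * u s)" if "continuous_on {0..<pi} u" for u
  using that by (intro continuous_intros \<eta>)
 have Pc: "continuous_on {0..<pi} (P u)" if "continuous_on {0..<pi} u" for u
  unfolding P_def by (intro continuous_on_slope_op hc that)
 have \<Phi>d: "(\<Phi> u has_real_derivative P u x) (at x within {0..<pi})" if u: "continuous_on {0..<pi} u" and x: "x \<in> {0..<pi}" for u x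
 proof -
  define z where "z = (x + pi) / 2"
  have z: "x < z" "z < pi" using x by (auto simp: z_def)
  have "continuous_on {0..z} (P u)" using z by (intro continuous_on_subset[OF Pc[OF u]]) auto
  then have "((%y. integral {0..y} (P u)) has_real_derivative P u x) (at x within {0..z})"
   by (rule integral_has_real_derivative) (use x z in auto)
  then have "(\<Phi> u has_real_derivative P u x) (at x within {0..z})"
   unfolding \<Phi>_def[abs_def] by (auto intro!: derivative_eq_intros)
  moreover have "at x within {0..z} = at x within {0..<pi}"
   by (rule at_within_nhd[of _ "{..<z}"]) (use x z in auto)
  ultimately show ?thesis by simp
 qed
 have lipP: "\<bar>P u s - P v s\<bar> \<le> lip_const * B * s ^ n"
  if u: "continuous_on {0..<pi} u" and v: "continuous_on {0..<pi} v" and B: "0 \<le> B"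
   and b: "\<And>r. r \<in> {0..s} ==> \<bar>u r - v r\<bar> \<le> B * r ^ n" and s: "0 \<le> s" "s < pi" for u v B s and n :: nat
 proof -
  have "P u s - P v s = slope_op (%r. lam * \<eta> r * u r - lam * \<eta> r * v r) s"
   unfolding P_def by (intro slope_op_diff hc u v s)
  also have "\<bar>\<dots>\<bar> \<le> lip_const * B * s ^ n"
  proof (rule slope_op_bound)
   show "continuous_on {0..<pi} (%r. lam * \<eta> r * u r - lam * \<eta> r * v r)" by (intro continuous_intros hc u v)
   fix r assume r: "r \<in> {0..s}"
   have "\<bar>lam * \<eta> r * u r - lam * \<eta> r * v r\<bar> = lam * (\<eta> r * \<bar>u r - v r\<bar>)"
    using lam_pos \<eta>01[of r] r s by (simp add: abs_mult right_diff_distrib[symmetric])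
   also have "\<dots> \<le> lam * (1 * (B * s ^ n))"
    using lam_pos \<eta>01[of r] r s b[of r] B
    by (intro mult_left_mono mult_mono order.trans[OF b[OF r]] power_mono) auto
   also have "\<dots> = lip_const * B * s ^ n * (\<Omega> - 2 * \<gamma>)" using \<Omega>_gt by (simp add: lip_const_def)
   also have "\<dots> \<le> lip_const * B * s ^ n * drift r"
    using drift_ge B s lip_const_nonneg by (intro mult_left_mono mult_nonneg_nonneg) auto
   finally show "\<bar>lam * \<eta> r * u r - lam * \<eta> r * v r\<bar> \<le> lip_const * B * s ^ n * drift r" .
  qed (use s in auto)
  finally show ?thesis .
 qed
 obtain G where G: "continuous_on {0..<pi} G" "\<And>t. t \<in> {0..<pi} ==> \<Phi> G t = G t"
  "\<And>t. t \<in> {0..<pi} ==> (%n. (\<Phi> ^^ n) (%_. 1) t) \<longlonglongrightarrow> G t"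
 proof (rule volterra_fixed_point[of "{0..<pi}" \<Phi> "%_. 1"])
  show "\<exists>T\<in>{0..<pi}. t < T" if "t \<in> {0..<pi}" for t
   using that by (intro bexI[of _ "(t + pi) / 2"]) auto
  show "continuous_on {0..<pi} (\<Phi> u)" if "continuous_on {0..<pi} u" for u
   using \<Phi>d[OF that] by (rule DERIV_continuous_on)
  fix T :: real assume T: "T \<in> {0..<pi}"
  have "\<bar>\<Phi> u s - \<Phi> v s\<bar> \<le> lip_const * B * s ^ Suc n / real (Suc n)"
   if u: "continuous_on {0..<pi} u" and v: "continuous_on {0..<pi} v" and B: "0 \<le> B"
   and b: "\<forall>r\<in>{0..T}. \<bar>u r - v r\<bar> \<le> B * r ^ n" and s: "s \<in> {0..T}" for u v B s and n :: nat
  proof -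
   have iu: "P u integrable_on {0..s}" and iv: "P v integrable_on {0..s}"
    using s T by (auto intro!: integrable_continuous_real continuous_on_subset[OF Pc[OF u]] continuous_on_subset[OF Pc[OF v]])
   have hi: "((%r. lip_const * B * r ^ n) has_integral lip_const * B * s ^ Suc n / real (Suc n) - lip_const * B * 0 ^ Suc n / real (Suc n)) {0..s}"
   proof (rule fundamental_theorem_of_calculus)
    show "((%r. lip_const * B * r ^ Suc n / real (Suc n)) has_vector_derivative lip_const * B * x ^ n) (at x within {0..s})" for x
     unfolding has_real_derivative_iff_has_vector_derivative[symmetric]
     by (rule derivative_eq_intros refl | simp)+
   qed (use s in auto)
   have "\<Phi> u s - \<Phi> v s = integral {0..s} (%r. P u r - P v r)"
    unfolding \<Phi>_def using integral_diff[OF iu iv] by simp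
   also have "norm \<dots> \<le> integral {0..s} (%r. lip_const * B * r ^ n)"
    by (rule integral_norm_bound_integral[OF integrable_diff[OF iu iv] has_integral_integrable[OF hi]])
     (use lipP[OF u v B] b s T in auto)
   also have "\<dots> = lip_const * B * s ^ Suc n / real (Suc n)" using integral_unique[OF hi] by simp
   finally show ?thesis by simp
  qed
  then show "\<exists>L\<ge>0. \<forall>u v B n. continuous_on {0..<pi} u --> continuous_on {0..<pi} v --> 0 \<le> B -->
    (\<forall>s\<in>{0..T}. \<bar>u s - v s\<bar> \<le> B * s ^ n) -->
    (\<forall>s\<in>{0..T}. \<bar>\<Phi> u s - \<Phi> v s\<bar> \<le> L * B * s ^ Suc n / real (Suc n))"
   using lip_const_nonneg by (intro exI[of _ lip_const]) auto
 qed auto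
 \<comment> \<open>Iterates started at the constant 1 never drop below 1, because
   \<open>slope_op\<close> preserves nonnegativity; the limit inherits this.\<close>
 have it: "continuous_on {0..<pi} ((\<Phi> ^^ n) (%_. 1)) \<and> (\<forall>x\<in>{0..<pi}. 1 \<le> (\<Phi> ^^ n) (%_. 1) x)" for n
 proof (induction n)
  case (Suc n)
  let ?u = "(\<Phi> ^^ n) (%_. 1)"
  have c: "continuous_on {0..<pi} ?u" and ge: "\<And>x. x \<in> {0..<pi} ==> 1 \<le> ?u x" using Suc by auto
  have "0 \<le> P ?u y" if "y \<in> {0..<pi}" for y
   unfolding P_def using that ge \<eta>01 lam_pos
   by (intro slope_op_nonneg hc c mult_nonneg_nonneg) (auto intro: order.trans[OF zero_le_one])
  then have "1 \<le> \<Phi> ?u x" if "x \<in> {0..<pi}" for x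
   using that by (subst \<Phi>_def) (auto intro!: integral_nonneg integrable_continuous_real continuous_on_subset[OF Pc[OF c]])
  moreover have "continuous_on {0..<pi} (\<Phi> ?u)" using \<Phi>d[OF c] by (rule DERIV_continuous_on)
  ultimately show ?case by simp
 qed auto
 have G1: "1 \<le> G x" if x: "x \<in> {0..<pi}" for x
  by (rule LIMSEQ_le_const[OF G(3)[OF x]]) (use it x in auto)
 have P0: "0 \<le> P G y" if "y \<in> {0..<pi}" for y
   unfolding P_def using that G1 \<eta>01 lam_pos
   by (intro slope_op_nonneg hc G mult_nonneg_nonneg) (auto intro: order.trans[OF zero_le_one])
 have Gd: "(G has_real_derivative P G x) (at x within {0..<pi})" if x: "x \<in> {0..<pi}" for x
  using \<Phi>d[OF G(1) x] by (rule has_field_derivative_transform_within[where d = 1]) (use x G(2) in auto)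
 have mono: "G s \<le> G y" if "0 \<le> s" "s \<le> y" "y < pi" for s y
 proof -
  have "integral {0..s} (P G) \<le> integral {0..y} (P G)"
   by (rule integral_subset_le) (use that P0 in \<open>auto intro!: integrable_continuous_real continuous_on_subset[OF Pc[OF G(1)]]\<close>)
  then show ?thesis using G(2)[of s] G(2)[of y] that by (auto simp: \<Phi>_def)
 qed
 \<comment> \<open>The averaging bound is applied with the maximum of \<open>G\<close> over
   \<open>[0, y]\<close>, which by monotonicity is \<open>G y\<close>; thus \<open>lip_const\<close>
   bounds the logarithmic derivative rather than the derivative.\<close>
 have Ple: "P G y \<le> lip_const * G y" if y: "y \<in> {0..<pi}" for y
 proof -
  have "\<bar>P G y\<bar> \<le> lip_const * G y"
   unfolding P_def
  proof (rule slope_op_bound[OF hc[OF G(1)]])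
   fix s assume s: "s \<in> {0..y}"
   have s': "1 \<le> G s" "0 \<le> \<eta> s" "\<eta> s \<le> 1" "G s \<le> G y" using s y G1[of s] \<eta>01[of s] mono[of s y] by auto
   have "\<bar>lam * \<eta> s * G s\<bar> = lam * (\<eta> s * G s)" using s' lam_pos by (simp add: abs_mult)
   also have "\<dots> \<le> lam * (1 * G y)" using s' lam_pos by (intro mult_left_mono mult_mono) auto
   also have "\<dots> = lip_const * G y * (\<Omega> - 2 * \<gamma>)" using \<Omega>_gt by (simp add: lip_const_def)
   also have "\<dots> \<le> lip_const * G y * drift s"
    using drift_ge lip_const_nonneg s' by (intro mult_left_mono mult_nonneg_nonneg) auto
   finally show "\<bar>lam * \<eta> s * G s\<bar> \<le> lip_const * G y * drift s" .
  qed (use y in auto)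
  then show ?thesis by simp
 qed
 show ?thesis
 proof (rule that[of G "P G"])
  show "G 0 = 1" using G(2)[of 0] by (simp add: \<Phi>_def)
  then show "P G 0 = lam * \<eta> 0 / \<Omega>" by (simp add: P_def slope_op_def)
  show "(P G has_real_derivative (lam * \<eta> x * G x - drift x * P G x) / (4 * \<gamma> * (sin x)\<^sup>2)) (at x)"
   if "x \<in> {0<..<pi}" for x
   using slope_op_deriv[OF hc[OF G(1)], of x] that by (simp add: P_def)
  show "P G y = 0" if "y \<in> {0..<pi}" "\<And>s. s \<in> {0..y} ==> \<eta> s = 0" for y
   using slope_op_bound[OF hc[OF G(1)], of y 0] that by (auto simp: P_def)
 qed (use G Pc[OF G(1)] Gd G1 P0 Ple in auto)
qed

end

text \<open>The second derivative is assumed at the single point \<open>x\<close> only. Its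
  definition bounds the derivative of the remainder by \<open>\<kappa> * \<bar>y - x\<bar>\<close>,
  and the mean value inequality on the segment integrates this bound. This is the regularity
  available at a contact point of a viscosity test.\<close>

lemma taylor_peano2:
 fixes f f1 :: "real => real"
 assumes d: "d > 0" and f: "\<And>y. \<bar>y - x\<bar> < d ==> (f has_real_derivative f1 y) (at y)"
  and f1: "(f1 has_real_derivative f2) (at x)" and k: "\<kappa> > 0"
 shows "\<exists>e>0. \<forall>y. \<bar>y - x\<bar> < e --> \<bar>f y - f x - f1 x * (y - x) - f2 / 2 * (y - x)\<^sup>2\<bar> \<le> \<kappa> * (y - x)\<^sup>2"
proof -
 from f1 have "((%y. (f1 y - f1 x) / (y - x)) \<longlongrightarrow> f2) (at x)"
  by (simp add: has_field_derivative_iff)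
 from tendstoD[OF this k] obtain e where e: "e > 0"
  "\<And>y. y \<noteq> x ==> dist y x < e ==> dist ((f1 y - f1 x) / (y - x)) f2 < \<kappa>"
  unfolding eventually_at by auto
 have s: "\<bar>f1 y - f1 x - f2 * (y - x)\<bar> \<le> \<kappa> * \<bar>y - x\<bar>" if "\<bar>y - x\<bar> < e" for y
 proof (cases "y = x")
  case False
  have "\<bar>(f1 y - f1 x) / (y - x) - f2\<bar> * \<bar>y - x\<bar> \<le> \<kappa> * \<bar>y - x\<bar>"
   using e(2)[OF False] that by (intro mult_right_mono) (auto simp: dist_real_def)
  also have "\<bar>(f1 y - f1 x) / (y - x) - f2\<bar> * \<bar>y - x\<bar> = \<bar>f1 y - f1 x - f2 * (y - x)\<bar>"
  proof -
   have "((f1 y - f1 x) / (y - x) - f2) * (y - x) = f1 y - f1 x - f2 * (y - x)"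
    using False by (subst left_diff_distrib) simp
   then show ?thesis by (simp add: abs_mult[symmetric])
  qed
  finally show ?thesis .
 qed simp
 have "\<bar>f y - f x - f1 x * (y - x) - f2 / 2 * (y - x)\<^sup>2\<bar> \<le> \<kappa> * (y - x)\<^sup>2" if y: "\<bar>y - x\<bar> < min d e" for y
 proof -
  define g where "g z = f z - f1 x * (z - x) - f2 / 2 * (z - x)\<^sup>2" for z
  have gd: "(g has_real_derivative f1 z - f1 x - f2 * (z - x)) (at z)" if "\<bar>z - x\<bar> < d" for z
   unfolding g_def using f[OF that] by (auto intro!: derivative_eq_intros)
  have seg: "\<bar>z - x\<bar> \<le> \<bar>y - x\<bar>" if "z \<in> closed_segment x y" for z
   using that by (auto simp: closed_segment_eq_real_ivl split: if_splits)
  have "norm (g y - g x) \<le> (\<kappa> * \<bar>y - x\<bar>) * norm (y - x)"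
  proof (rule field_differentiable_bound[of "closed_segment x y" g "%z. f1 z - f1 x - f2 * (z - x)"])
   fix z assume z: "z \<in> closed_segment x y"
   show "(g has_field_derivative f1 z - f1 x - f2 * (z - x)) (at z within closed_segment x y)"
   proof (rule has_field_derivative_at_within[OF gd])
    show "\<bar>z - x\<bar> < d" using seg[OF z] y by linarith
   qed
   have "norm (f1 z - f1 x - f2 * (z - x)) \<le> \<kappa> * \<bar>z - x\<bar>" using s[of z] seg[OF z] y by auto
   also have "\<dots> \<le> \<kappa> * \<bar>y - x\<bar>" using k seg[OF z] by (intro mult_left_mono) auto
   finally show "norm (f1 z - f1 x - f2 * (z - x)) \<le> \<kappa> * \<bar>y - x\<bar>" .
  qed auto
  then show ?thesis by (simp add: g_def power2_eq_square algebra_simps abs_mult_self_eq)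
 qed
 then show ?thesis using d e(1) by (intro exI[of _ "min d e"]) auto
qed

text \<open>If \<open>f2\<close> were positive, the Peano expansion with error constant
  \<open>f2 / 4\<close> would leave a growth of at least \<open>f2 / 4 * (y - x)\<^sup>2\<close>
  next to the critical point.\<close>

lemma second_derivative_local_max:
 fixes f f1 :: "real => real"
 assumes d: "d > 0" and f: "\<And>y. \<bar>y - x\<bar> < d ==> (f has_real_derivative f1 y) (at y)"
  and f1: "(f1 has_real_derivative f2) (at x)"
  and max: "\<And>y. \<bar>y - x\<bar> < d ==> f y \<le> f x"
 shows "f1 x = 0" "f2 \<le> 0"
proof -
 show z: "f1 x = 0"
  by (rule DERIV_local_max[OF f d]) (use d max in \<open>auto simp: abs_minus_commute\<close>)
 show "f2 \<le> 0"
 proof (rule ccontr)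
  assume "\<not> f2 \<le> 0"
  then have k: "f2 / 4 > 0" by auto
  from taylor_peano2[OF d f f1 k] obtain e where e: "e > 0"
   "\<And>y. \<bar>y - x\<bar> < e ==> \<bar>f y - f x - f1 x * (y - x) - f2 / 2 * (y - x)\<^sup>2\<bar> \<le> f2 / 4 * (y - x)\<^sup>2" by blast
  define y where "y = x + min d e / 2"
  have y: "\<bar>y - x\<bar> < d" "\<bar>y - x\<bar> < e" "y \<noteq> x" using d e(1) by (auto simp: y_def min_def abs_if)
  have "0 < f2 / 4 * (y - x)\<^sup>2" using k y by auto
  with e(2)[OF y(2)] max[OF y(1)] z show False by (auto simp: abs_le_iff)
 qed
qed

text \<open>The expression is affine in the control, so the supremum sits at the bang-bang value
  \<open>- \<Omega> * sgn p\<close>. For \<open>p = 0\<close> every control is optimal and this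
  value is 0, which is still admissible.\<close>

lemma hjb_H_eq:
 assumes "\<Omega> \<ge> 0"
 shows "hjb_H \<gamma> \<Omega> lam x u p = \<Omega> * \<bar>p\<bar> + 2 * \<gamma> * sin (2 * x) * p + lam * u - 1"
proof -
 have le: "\<alpha> * p \<ge> - \<Omega> * \<bar>p\<bar>" if "\<alpha> \<in> {-\<Omega>..\<Omega>}" for \<alpha>
 proof -
  have "\<bar>\<alpha> * p\<bar> \<le> \<Omega> * \<bar>p\<bar>" using that by (auto simp: abs_mult intro!: mult_right_mono)
  then show ?thesis by (auto simp: abs_le_iff)
 qed
 have eq: "- (- \<Omega> * sgn p) * p = \<Omega> * \<bar>p\<bar>" by (simp add: sgn_if abs_if)
 have mem: "- \<Omega> * sgn p \<in> {-\<Omega>..\<Omega>}" using assms by (auto simp: sgn_if)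
 show ?thesis unfolding hjb_H_def
 proof (rule cSup_eq_maximum)
  show "\<Omega> * \<bar>p\<bar> + 2 * \<gamma> * sin (2 * x) * p + lam * u - 1 \<in>
   (%\<alpha>. - (\<alpha> - 2 * \<gamma> * sin (2 * x)) * p + lam * u - 1) ` {-\<Omega>..\<Omega>}"
   by (rule image_eqI[OF _ mem]) (use eq in \<open>auto simp: algebra_simps\<close>)
  fix y assume "y \<in> (%\<alpha>. - (\<alpha> - 2 * \<gamma> * sin (2 * x)) * p + lam * u - 1) ` {-\<Omega>..\<Omega>}"
  then obtain \<alpha> where "\<alpha> \<in> {-\<Omega>..\<Omega>}" "y = - (\<alpha> - 2 * \<gamma> * sin (2 * x)) * p + lam * u - 1" by auto
  with le[of \<alpha>] show "y \<le> \<Omega> * \<bar>p\<bar> + 2 * \<gamma> * sin (2 * x) * p + lam * u - 1"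
   by (simp add: algebra_simps)
 qed
qed

lemma C2_with_quadratic:
 "C2_with (%y. c + p * (y - x) + q / 2 * (y - x)\<^sup>2) (%y. p + q * (y - x)) (%_. q)"
 unfolding C2_with_def by (auto intro!: derivative_eq_intros simp: field_simps)

section \<open>Viscosity tests by quadratics and comparison with smooth subsolutions\<close>

context qubit_control
begin

definition pde :: "real => real => real => real => real" where
 "pde x u p q = - (1/2) * (sigma_fn \<gamma> x)\<^sup>2 * q + hjb_H \<gamma> \<Omega> lam x u p"

lemma pde_eq: "pde x u p q = - (4 * \<gamma> * (sin x)\<^sup>2) * q + \<Omega> * \<bar>p\<bar> + 2 * \<gamma> * sin (2 * x) * p + lam * u - 1"
 using \<gamma>_pos \<Omega>_pos by (simp add: pde_def hjb_H_eq sigma_fn_def power_mult_distrib)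

lemma viscosity_solution_pde:
 "viscosity_solution \<gamma> \<Omega> lam u \<longleftrightarrow>
  continuous_on {-pi..pi} u \<and> u (-pi) = 0 \<and> u pi = 0 \<and>
  (\<forall>x\<in>{-pi<..<pi}. \<forall>\<phi> \<phi>1 \<phi>2. C2_with \<phi> \<phi>1 \<phi>2 -->
    (\<exists>e>0. \<forall>y\<in>{-pi<..<pi} \<inter> ball x e. u y - \<phi> y \<le> u x - \<phi> x) --> pde x (u x) (\<phi>1 x) (\<phi>2 x) \<le> 0) \<and>
  (\<forall>x\<in>{-pi<..<pi}. \<forall>\<phi> \<phi>1 \<phi>2. C2_with \<phi> \<phi>1 \<phi>2 -->
    (\<exists>e>0. \<forall>y\<in>{-pi<..<pi} \<inter> ball x e. u y - \<phi> y \<ge> u x - \<phi> x) --> pde x (u x) (\<phi>1 x) (\<phi>2 x) \<ge> 0)"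
 unfolding viscosity_solution_def pde_def ..

text \<open>\<open>C2_with\<close> asks for functions that are C2 on the whole line. A quadratic
  polynomial is one, so a local quadratic bound on \<open>w\<close>, that is a second order semijet,
  is all that has to be exhibited.\<close>

lemma viscosity_sub_quadratic:
 assumes w: "viscosity_solution \<gamma> \<Omega> lam w" and x: "x \<in> {-pi<..<pi}" and e: "e > 0"
  and le: "\<And>y. y \<in> {-pi<..<pi} ==> \<bar>y - x\<bar> < e ==> w y \<le> w x + p * (y - x) + q / 2 * (y - x)\<^sup>2"
 shows "pde x (w x) p q \<le> 0"
proof -
 have "(\<exists>e>0. \<forall>y\<in>{-pi<..<pi} \<inter> ball x e. w y - (0 + p * (y - x) + q / 2 * (y - x)\<^sup>2) \<le> w x - (0 + p * (x - x) + q / 2 * (x - x)\<^sup>2))"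
  using e le by (intro exI[of _ e]) (force simp: dist_real_def)
 with w C2_with_quadratic[of 0 p x q] x have "pde x (w x) (p + q * (x - x)) q \<le> 0"
  unfolding viscosity_solution_pde by blast
 then show ?thesis by simp
qed

lemma viscosity_super_quadratic:
 assumes w: "viscosity_solution \<gamma> \<Omega> lam w" and x: "x \<in> {-pi<..<pi}" and e: "e > 0"
  and le: "\<And>y. y \<in> {-pi<..<pi} ==> \<bar>y - x\<bar> < e ==> w y \<ge> w x + p * (y - x) + q / 2 * (y - x)\<^sup>2"
 shows "pde x (w x) p q \<ge> 0"
proof -
 have "(\<exists>e>0. \<forall>y\<in>{-pi<..<pi} \<inter> ball x e. w y - (0 + p * (y - x) + q / 2 * (y - x)\<^sup>2) \<ge> w x - (0 + p * (x - x) + q / 2 * (x - x)\<^sup>2))"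
  using e le by (intro exI[of _ e]) (force simp: dist_real_def)
 with w C2_with_quadratic[of 0 p x q] x have "pde x (w x) (p + q * (x - x)) q \<ge> 0"
  unfolding viscosity_solution_pde by blast
 then show ?thesis by simp
qed

text \<open>The contact function may be defined usefully only near \<open>x\<close> and may be twice
  differentiable only at \<open>x\<close>. Raising its curvature by \<open>2 * \<kappa>\<close>
  turns the Peano expansion into a quadratic that stays above it near \<open>x\<close>; the operator
  is affine in the second derivative, so \<kappa> can be sent to 0.\<close>

lemma viscosity_sub_C2_contact:
 assumes w: "viscosity_solution \<gamma> \<Omega> lam w" and x: "x \<in> {-pi<..<pi}" and d: "d > 0"
  and f: "\<And>y. \<bar>y - x\<bar> < d ==> (f has_real_derivative f1 y) (at y)"
  and f1: "(f1 has_real_derivative f2) (at x)"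
  and max: "\<And>y. y \<in> {-pi<..<pi} ==> w y - f y \<le> w x - f x"
 shows "pde x (w x) (f1 x) f2 \<le> 0"
proof -
 have "pde x (w x) (f1 x) (f2 + 2 * \<kappa>) \<le> 0" if k: "\<kappa> > 0" for \<kappa>
 proof -
  from taylor_peano2[OF d f f1 k] obtain e where e: "e > 0"
   "\<And>y. \<bar>y - x\<bar> < e ==> \<bar>f y - f x - f1 x * (y - x) - f2 / 2 * (y - x)\<^sup>2\<bar> \<le> \<kappa> * (y - x)\<^sup>2" by blast
  show ?thesis
  proof (rule viscosity_sub_quadratic[OF w x e(1)])
   fix y assume y: "y \<in> {-pi<..<pi}" "\<bar>y - x\<bar> < e"
   have "f y \<le> f x + f1 x * (y - x) + f2 / 2 * (y - x)\<^sup>2 + \<kappa> * (y - x)\<^sup>2" using e(2)[OF y(2)] by (auto simp: abs_le_iff)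
   then show "w y \<le> w x + f1 x * (y - x) + (f2 + 2 * \<kappa>) / 2 * (y - x)\<^sup>2"
    using max[OF y(1)] by (simp add: algebra_simps add_divide_distrib)
  qed
 qed
 then have "\<forall>\<^sub>F \<kappa> in at_right 0. pde x (w x) (f1 x) (f2 + 2 * \<kappa>) \<le> 0"
  by (auto simp: eventually_at_right_field intro!: exI[of _ 1])
 moreover have "((%\<kappa>. pde x (w x) (f1 x) (f2 + 2 * \<kappa>)) \<longlongrightarrow> pde x (w x) (f1 x) (f2 + 2 * 0)) (at_right 0)"
  unfolding pde_def by (intro tendsto_intros)
 ultimately have "pde x (w x) (f1 x) (f2 + 2 * 0) \<le> 0"
  by (intro tendsto_upperbound) auto
 then show ?thesis by simp
qed

lemma viscosity_super_C2_contact: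
 assumes w: "viscosity_solution \<gamma> \<Omega> lam w" and x: "x \<in> {-pi<..<pi}" and d: "d > 0"
  and f: "\<And>y. \<bar>y - x\<bar> < d ==> (f has_real_derivative f1 y) (at y)"
  and f1: "(f1 has_real_derivative f2) (at x)"
  and min: "\<And>y. y \<in> {-pi<..<pi} ==> w y - f y \<ge> w x - f x"
 shows "pde x (w x) (f1 x) f2 \<ge> 0"
proof -
 have "pde x (w x) (f1 x) (f2 - 2 * \<kappa>) \<ge> 0" if k: "\<kappa> > 0" for \<kappa>
 proof -
  from taylor_peano2[OF d f f1 k] obtain e where e: "e > 0"
   "\<And>y. \<bar>y - x\<bar> < e ==> \<bar>f y - f x - f1 x * (y - x) - f2 / 2 * (y - x)\<^sup>2\<bar> \<le> \<kappa> * (y - x)\<^sup>2" by blast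
  show ?thesis
  proof (rule viscosity_super_quadratic[OF w x e(1)])
   fix y assume y: "y \<in> {-pi<..<pi}" "\<bar>y - x\<bar> < e"
   have "f y \<ge> f x + f1 x * (y - x) + f2 / 2 * (y - x)\<^sup>2 - \<kappa> * (y - x)\<^sup>2" using e(2)[OF y(2)] by (auto simp: abs_le_iff)
   then show "w y \<ge> w x + f1 x * (y - x) + (f2 - 2 * \<kappa>) / 2 * (y - x)\<^sup>2"
    using min[OF y(1)] by (simp add: algebra_simps diff_divide_distrib)
  qed
 qed
 then have "\<forall>\<^sub>F \<kappa> in at_right 0. 0 \<le> pde x (w x) (f1 x) (f2 - 2 * \<kappa>)"
  by (auto simp: eventually_at_right_field intro!: exI[of _ 1])
 moreover have "((%\<kappa>. pde x (w x) (f1 x) (f2 - 2 * \<kappa>)) \<longlongrightarrow> pde x (w x) (f1 x) (f2 - 2 * 0)) (at_right 0)"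
  unfolding pde_def by (intro tendsto_intros)
 ultimately have "0 \<le> pde x (w x) (f1 x) (f2 - 2 * 0)"
  by (intro tendsto_lowerbound) auto
 then show ?thesis by simp
qed

text \<open>Since \<open>f\<close> is smooth, it can itself be used as a test function at a minimum
  \<open>z\<close> of \<open>w - f\<close>. There the two inequalities share slope and curvature and
  differ only in the term \<open>lam * u\<close>, whence \<open>lam * f z \<le> lam * w z\<close>. A
  minimum on the boundary is harmless because both functions vanish there.\<close>

lemma C2_subsolution_le_viscosity:
 assumes w: "viscosity_solution \<gamma> \<Omega> lam w" and fc: "continuous_on {-pi..pi} f" and fb: "f (-pi) = 0" "f pi = 0"
  and f: "\<And>y. y \<in> {-pi<..<pi} ==> (f has_real_derivative f1 y) (at y)"
  and f1: "\<And>y. y \<in> {-pi<..<pi} ==> (f1 has_real_derivative f2 y) (at y)"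
  and sub: "\<And>y. y \<in> {-pi<..<pi} ==> pde y (f y) (f1 y) (f2 y) \<le> 0" and x: "x \<in> {-pi..pi}"
 shows "f x \<le> w x"
proof -
 have wc: "continuous_on {-pi..pi} w" and wb: "w (-pi) = 0" "w pi = 0"
  using w by (auto simp: viscosity_solution_def)
 have "continuous_on {-pi..pi} (%y. w y - f y)" by (intro continuous_intros wc fc)
 from continuous_attains_inf[OF compact_Icc _ this] obtain z where z: "z \<in> {-pi..pi}"
  "\<And>y. y \<in> {-pi..pi} ==> w z - f z \<le> w y - f y" by auto
 have "0 \<le> w z - f z"
 proof (cases "z \<in> {-pi<..<pi}")
  case False then show ?thesis using z(1) wb fb by (cases "z = pi") auto
 next
  case True
  have "0 \<le> pde z (w z) (f1 z) (f2 z)"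
  proof (rule viscosity_super_C2_contact[OF w True, of "pi - \<bar>z\<bar>" f, OF _ f f1[OF True]])
   show "w z - f z \<le> w y - f y" if "y \<in> {-pi<..<pi}" for y using z(2)[of y] that by simp
  qed (use True in \<open>auto simp: abs_if split: if_splits\<close>)
  with sub[OF True] have "lam * f z \<le> lam * w z" by (simp add: pde_eq)
  then show ?thesis using lam_pos by simp
 qed
 then show ?thesis using z(2)[OF x] by auto
qed

definition curv :: "(real => real) => (real => real) => (real => real) => real => real" where
 "curv \<eta> G G1 x = (lam * \<eta> x * G x - drift x * G1 x) / (4 * \<gamma> * (sin x)\<^sup>2)"

text \<open>Continuity of \<open>G\<close> is recorded up to pi, that of \<open>G1\<close> only on
  the half-open interval, since the equation is singular at pi as well. The final clause says that
  the profile stays frozen at 1 as long as \<eta> vanishes, which makes the cut profiles smooth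
  across 0 after reflection.\<close>

definition profile :: "(real => real) => (real => real) => (real => real) => bool" where
 "profile \<eta> G G1 \<longleftrightarrow> continuous_on {0..pi} G \<and> continuous_on {0..<pi} G1 \<and> G 0 = 1 \<and> G1 0 = lam * \<eta> 0 / \<Omega> \<and>
  (\<forall>x\<in>{0..<pi}. (G has_real_derivative G1 x) (at x within {0..<pi})) \<and>
  (\<forall>x\<in>{0<..<pi}. (G1 has_real_derivative curv \<eta> G G1 x) (at x)) \<and>
  (\<forall>x\<in>{0..pi}. 1 \<le> G x \<and> G x \<le> exp (lip_const * pi)) \<and>
  (\<forall>x\<in>{0..<pi}. 0 \<le> G1 x \<and> G1 x \<le> lip_const * G x) \<and>
  (\<forall>x y. 0 \<le> x --> x \<le> y --> y \<le> pi --> G x \<le> G y) \<and>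
  (\<forall>y\<in>{0..<pi}. (\<forall>s\<in>{0..y}. \<eta> s = 0) --> G1 y = 0 \<and> G y = 1)"

text \<open>The endpoint pi is reached by monotonicity. \<open>G\<close> is increasing, and
  \<open>exp (- lip_const * x) * G x\<close> is decreasing because
  \<open>G1 \<le> lip_const * G\<close>; so \<open>G\<close> stays below
  \<open>exp (lip_const * pi)\<close> and has a left limit at pi, which is taken as its value
  there.\<close>

lemma profile_exists:
 assumes \<eta>: "continuous_on {0..<pi} \<eta>" and \<eta>01: "\<And>x. x \<in> {0..<pi} ==> 0 \<le> \<eta> x \<and> \<eta> x \<le> 1"
 shows "\<exists>G G1. profile \<eta> G G1"
proof -
 obtain G G1 where
  G: "continuous_on {0..<pi} G" "continuous_on {0..<pi} G1" "G 0 = 1" "G1 0 = lam * \<eta> 0 / \<Omega>"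
  and Gd: "\<And>x. x \<in> {0..<pi} ==> (G has_real_derivative G1 x) (at x within {0..<pi})"
  and G1d: "\<And>x. x \<in> {0<..<pi} ==> (G1 has_real_derivative (lam * \<eta> x * G x - drift x * G1 x) / (4 * \<gamma> * (sin x)\<^sup>2)) (at x)"
  and G_ge: "\<And>x. x \<in> {0..<pi} ==> 1 \<le> G x" and G1_ge: "\<And>x. x \<in> {0..<pi} ==> 0 \<le> G1 x"
  and G1_le: "\<And>x. x \<in> {0..<pi} ==> G1 x \<le> lip_const * G x"
  and G1_0: "\<And>y. y \<in> {0..<pi} ==> (\<And>s. s \<in> {0..y} ==> \<eta> s = 0) ==> G1 y = 0"
 proof (rule linear_ode_solution[of \<eta>])
  fix G G1 assume *: "continuous_on {0..<pi} G" "continuous_on {0..<pi} G1" "G 0 = 1" "G1 0 = lam * \<eta> 0 / \<Omega>"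
   "\<And>x. x \<in> {0..<pi} ==> (G has_real_derivative G1 x) (at x within {0..<pi})"
   "\<And>x. x \<in> {0<..<pi} ==> (G1 has_real_derivative (lam * \<eta> x * G x - drift x * G1 x) / (4 * \<gamma> * (sin x)\<^sup>2)) (at x)"
   "\<And>x. x \<in> {0..<pi} ==> 1 \<le> G x" "\<And>x. x \<in> {0..<pi} ==> 0 \<le> G1 x"
   "\<And>x. x \<in> {0..<pi} ==> G1 x \<le> lip_const * G x"
   "\<And>y. y \<in> {0..<pi} ==> (\<And>s. s \<in> {0..y} ==> \<eta> s = 0) ==> G1 y = 0"
  show thesis by (rule that[of G G1]; fact *)
 qed (use \<eta> \<eta>01 in auto)
 have Gd': "(G has_real_derivative G1 x) (at x)" if "0 < x" "x < pi" for x
  using Gd[of x] at_within_interior[of x "{0..<pi}"] that by simp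
 have mono: "G x \<le> G y" if xy: "0 \<le> x" "x \<le> y" "y < pi" for x y
 proof (rule DERIV_nonneg_imp_increasing_open[OF xy(2)])
  show "\<exists>l. (G has_real_derivative l) (at z) \<and> 0 \<le> l" if "x < z" "z < y" for z
  proof (intro exI conjI)
   show "(G has_real_derivative G1 z) (at z)" by (rule Gd') (use that xy in auto)
   show "0 \<le> G1 z" by (rule G1_ge) (use that xy in auto)
  qed
  show "continuous_on {x..y} G" by (rule continuous_on_subset[OF G(1)]) (use xy in auto)
 qed
 have bound: "G x \<le> exp (lip_const * pi)" if x: "x \<in> {0..<pi}" for x
 proof -
  have "exp (- lip_const * x) * G x \<le> exp (- lip_const * 0) * G 0"
  proof (rule DERIV_nonpos_imp_decreasing_open[of 0 x])
   show "\<exists>l. ((%x. exp (- lip_const * x) * G x) has_real_derivative l) (at z) \<and> l \<le> 0" if z: "0 < z" "z < x" for z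
   proof (intro exI conjI)
    have z': "z < pi" using z x by auto
    show "((%x. exp (- lip_const * x) * G x) has_real_derivative
      exp (- lip_const * z) * (- lip_const) * G z + G1 z * exp (- lip_const * z)) (at z)"
     by (rule DERIV_mult[OF _ Gd'[OF z(1) z']]) (auto intro!: derivative_eq_intros)
    have "exp (- lip_const * z) * (G1 z - lip_const * G z) \<le> 0"
     using G1_le[of z] z z' by (intro mult_nonneg_nonpos) auto
    then show "exp (- lip_const * z) * (- lip_const) * G z + G1 z * exp (- lip_const * z) \<le> 0"
     by (simp add: algebra_simps)
   qed
   show "continuous_on {0..x} (%x. exp (- lip_const * x) * G x)"
    by (intro continuous_intros continuous_on_subset[OF G(1)]) (use x in auto)
  qed (use x in auto)
  then have "G x \<le> exp (lip_const * x)" using G(3) by (simp add: exp_minus field_simps)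
  also have "\<dots> \<le> exp (lip_const * pi)" using x lip_const_nonneg by (auto intro: mult_left_mono)
  finally show ?thesis .
 qed
 define p where "p = Sup (G ` {0..<pi})"
 have ne: "G ` {0..<pi} \<noteq> {}" by auto
 have bdd: "bdd_above (G ` {0..<pi})" using bound by (auto intro!: bdd_aboveI[of _ "exp (lip_const * pi)"])
 have up: "G x \<le> p" if "x \<in> {0..<pi}" for x unfolding p_def using that bdd by (intro cSup_upper) auto
 have pb: "p \<le> exp (lip_const * pi)" unfolding p_def using ne bound by (intro cSup_least) auto
 have lim: "(G \<longlongrightarrow> p) (at_left pi)"
 proof (rule increasing_tendsto)
  show "\<forall>\<^sub>F n in at_left pi. G n \<le> p"
   unfolding eventually_at_left_field by (intro exI[of _ 0]) (auto intro: up)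
  fix x assume "x < p"
  then obtain y where y: "y \<in> {0..<pi}" "x < G y" unfolding p_def using less_cSup_iff[OF ne bdd] by auto
  show "\<forall>\<^sub>F n in at_left pi. x < G n"
   unfolding eventually_at_left_field
  proof (intro exI[of _ y] conjI allI impI)
   show "x < G z" if "y < z" "z < pi" for z using mono[of y z] y that by auto
  qed (use y in auto)
 qed
 define H where "H x = (if x < pi then G x else p)" for x
 have HG: "H x = G x" if "x < pi" for x using that by (simp add: H_def)
 have Hc: "continuous_on {0..pi} H"
  unfolding continuous_on_eq_continuous_within
 proof
  fix x assume x: "x \<in> {0..pi}"
  show "continuous (at x within {0..pi}) H"
  proof (cases "x = pi")
   case True
   have "(H \<longlongrightarrow> p) (at_left pi)"
    by (rule Lim_transform_eventually[OF lim]) (auto simp: eventually_at_left_field H_def intro!: exI[of _ 0])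
   moreover have "at pi within {0..pi} = at_left pi"
    by (rule at_within_nhd[of _ "{0<..}"]) auto
   ultimately show ?thesis using True by (simp add: continuous_within H_def)
  next
   case False
   then have xp: "x < pi" using x by auto
   have "continuous (at x within {0..<pi}) G" using G(1) x xp by (auto simp: continuous_on_eq_continuous_within)
   then have "continuous (at x within {0..<pi}) H"
    by (rule continuous_transform_within[where \<delta> = 1]) (use x xp in \<open>auto simp: H_def\<close>)
   moreover have "at x within {0..pi} = at x within {0..<pi}"
    by (rule at_within_nhd[of _ "{..<pi}"]) (use xp in auto)
   ultimately show ?thesis by simp
  qed
 qed
 have Hd: "(H has_real_derivative G1 x) (at x within {0..<pi})" if x: "x \<in> {0..<pi}" for x
  by (rule has_field_derivative_transform_within[OF Gd[OF x], where d = 1]) (use x in \<open>auto simp: H_def\<close>)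
 have Hcurv: "(G1 has_real_derivative curv \<eta> H G1 x) (at x)" if "x \<in> {0<..<pi}" for x
  using G1d[OF that] that by (simp add: curv_def H_def)
 have H_ge: "1 \<le> H x" if "x \<in> {0..pi}" for x
  using that G_ge[of x] up[of 0] G(3) by (cases "x < pi") (auto simp: H_def)
 have H_le: "H x \<le> exp (lip_const * pi)" if "x \<in> {0..pi}" for x
  using that bound[of x] pb by (auto simp: H_def)
 have Hm: "H x \<le> H y" if "0 \<le> x" "x \<le> y" "y \<le> pi" for x y
  using that mono[of x y] up[of x] by (auto simp: H_def)
 have H0: "G1 y = 0 \<and> H y = 1" if y: "y \<in> {0..<pi}" and z: "\<forall>s\<in>{0..y}. \<eta> s = 0" for y
 proof
  show "G1 y = 0" by (rule G1_0) (use y z in auto)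
  have "G y = G 0"
  proof (cases "y = 0")
   case False
   show ?thesis
   proof (rule DERIV_isconst_end[of 0 y G])
    show "0 < y" using False y by auto
    show "continuous_on {0..y} G" by (rule continuous_on_subset[OF G(1)]) (use y in auto)
    fix x assume x: "0 < x" "x < y"
    have "G1 x = 0" by (rule G1_0) (use x y z in auto)
    then show "(G has_real_derivative 0) (at x)" using Gd'[of x] x y by simp
   qed
  qed simp
  then show "H y = 1" using y G(3) by (simp add: H_def)
 qed
 have "profile \<eta> H G1"
  unfolding profile_def using Hc G(2,3,4) Hd Hcurv H_ge H_le Hm H0 G1_ge G1_le by (simp add: HG)
 then show ?thesis by blast
qed

text \<open>Normalised so that \<open>lam * U G x - 1 = - G \<bar>x\<bar> / G pi\<close>: the
  running cost is absorbed and the homogeneous linear equation for \<open>G\<close> becomes the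
  inhomogeneous one for \<open>U G\<close>, with value 0 at both endpoints.\<close>

definition U :: "(real => real) => real => real" where
 "U G x = (1 - G \<bar>x\<bar> / G pi) / lam"

definition U1 :: "(real => real) => (real => real) => real => real" where
 "U1 G G1 x = - sgn x * G1 \<bar>x\<bar> / (lam * G pi)"

definition U2 :: "(real => real) => (real => real) => (real => real) => real => real" where
 "U2 \<eta> G G1 x = - curv \<eta> G G1 \<bar>x\<bar> / (lam * G pi)"

lemma U_minus [simp]: "U G (- x) = U G x" by (simp add: U_def)

lemma has_real_derivative_compose_abs:
 assumes f: "(f has_real_derivative D) (at \<bar>x\<bar>)" and x: "x \<noteq> 0"
 shows "((%x. f \<bar>x\<bar>) has_real_derivative D * sgn x) (at x)"
proof -
 have "(abs has_real_derivative sgn x) (at x)"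
 proof -
  have "((%z. sgn x * z) has_real_derivative sgn x * 1) (at x)" by (intro DERIV_cmult DERIV_ident)
  then have "(abs has_real_derivative sgn x * 1) (at x)"
   by (rule has_field_derivative_transform_within[where d = "\<bar>x\<bar>"])
    (use x in \<open>auto simp: dist_real_def sgn_if abs_if split: if_splits\<close>)
  then show ?thesis by simp
 qed
 from DERIV_chain2[OF f this] show ?thesis .
qed

context
 fixes \<eta> G G1 assumes prof: "profile \<eta> G G1"
begin

lemma profile_props:
 shows "continuous_on {0..pi} G" "continuous_on {0..<pi} G1" "G 0 = 1" "G1 0 = lam * \<eta> 0 / \<Omega>"
  "\<And>x. x \<in> {0..<pi} ==> (G has_real_derivative G1 x) (at x within {0..<pi})"
  "\<And>x. x \<in> {0<..<pi} ==> (G1 has_real_derivative curv \<eta> G G1 x) (at x)"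
  "\<And>x. x \<in> {0..pi} ==> 1 \<le> G x" "\<And>x. x \<in> {0..pi} ==> G x \<le> exp (lip_const * pi)"
  "\<And>x. x \<in> {0..<pi} ==> 0 \<le> G1 x" "\<And>x. x \<in> {0..<pi} ==> G1 x \<le> lip_const * G x"
  "\<And>x y. 0 \<le> x ==> x \<le> y ==> y \<le> pi ==> G x \<le> G y"
  "\<And>y. y \<in> {0..<pi} ==> (\<And>s. s \<in> {0..y} ==> \<eta> s = 0) ==> G1 y = 0 \<and> G y = 1"
 using prof unfolding profile_def by blast+

lemma Gpi_ge: "1 \<le> G pi" by (rule profile_props) auto

lemma profile_deriv: "x \<in> {0<..<pi} ==> (G has_real_derivative G1 x) (at x)"
 using profile_props(5)[of x] at_within_interior[of x "{0..<pi}"] by simp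

lemma U_continuous: "continuous_on {-pi..pi} (U G)"
proof -
 have "continuous_on {-pi..pi} (%x. G \<bar>x\<bar>)"
  by (rule continuous_on_compose2[OF profile_props(1)]) (auto intro!: continuous_intros)
 then show ?thesis unfolding U_def[abs_def] using Gpi_ge lam_pos by (intro continuous_intros) auto
qed

lemma U_pi: "U G pi = 0" "U G (-pi) = 0"
 using Gpi_ge by (auto simp: U_def)

lemma U_antimono: "\<bar>x\<bar> \<le> \<bar>y\<bar> ==> \<bar>y\<bar> \<le> pi ==> U G y \<le> U G x"
 unfolding U_def using lam_pos Gpi_ge
 by (intro divide_right_mono diff_left_mono profile_props(11)) auto

lemma U_nonneg: "\<bar>x\<bar> \<le> pi ==> 0 \<le> U G x"
 using U_antimono[of x pi] U_pi by auto

lemma U_deriv: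
 assumes x: "\<bar>x\<bar> < pi" "x \<noteq> 0"
 shows "(U G has_real_derivative U1 G G1 x) (at x)"
proof -
 have "((%x. G \<bar>x\<bar>) has_real_derivative G1 \<bar>x\<bar> * sgn x) (at x)"
  by (rule has_real_derivative_compose_abs[OF profile_deriv]) (use x in auto)
 then have "((%x. (1 - G \<bar>x\<bar> / G pi) / lam) has_real_derivative (0 - G1 \<bar>x\<bar> * sgn x / G pi) / lam) (at x)"
  by (intro DERIV_cdivide DERIV_diff DERIV_const)
 moreover have "(0 - G1 \<bar>x\<bar> * sgn x / G pi) / lam = U1 G G1 x"
  by (simp add: U1_def mult.commute)
 ultimately show ?thesis unfolding U_def[abs_def] by simp
qed

lemma U1_deriv:
 assumes x: "\<bar>x\<bar> < pi" "x \<noteq> 0"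
 shows "(U1 G G1 has_real_derivative U2 \<eta> G G1 x) (at x)"
proof -
 have "((%x. G1 \<bar>x\<bar>) has_real_derivative curv \<eta> G G1 \<bar>x\<bar> * sgn x) (at x)"
  by (rule has_real_derivative_compose_abs[OF profile_props(6)]) (use x in auto)
 then have "((%z. - sgn x * G1 \<bar>z\<bar> / (lam * G pi)) has_real_derivative - sgn x * (curv \<eta> G G1 \<bar>x\<bar> * sgn x) / (lam * G pi)) (at x)"
  by (intro DERIV_cdivide DERIV_cmult)
 then have "(U1 G G1 has_real_derivative - sgn x * (curv \<eta> G G1 \<bar>x\<bar> * sgn x) / (lam * G pi)) (at x)"
  by (rule has_field_derivative_transform_within[where d = "\<bar>x\<bar>"])
   (use x in \<open>auto simp: U1_def dist_real_def sgn_if abs_if split: if_splits\<close>)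
 moreover have "- sgn x * (curv \<eta> G G1 \<bar>x\<bar> * sgn x) / (lam * G pi) = U2 \<eta> G G1 x"
  using x by (simp add: U2_def sgn_if)
 ultimately show ?thesis by simp
qed

text \<open>\<open>U1\<close> has the sign opposite to \<open>x\<close>, so the Hamiltonian
  linearises: \<open>\<Omega> * \<bar>p\<bar> + 2 * \<gamma> * sin (2 * x) * p\<close> becomes
  \<open>drift \<bar>x\<bar> * G1 \<bar>x\<bar> / (lam * G pi)\<close>, and the linear equation
  applies. The residual is 0 for \<eta> = 1 and nonpositive whenever \<eta> is at most 1.\<close>

lemma U_pde:
 assumes x: "\<bar>x\<bar> < pi" "x \<noteq> 0"
 shows "pde x (U G x) (U1 G G1 x) (U2 \<eta> G G1 x) = - (1 - \<eta> \<bar>x\<bar>) * G \<bar>x\<bar> / G pi"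
proof -
 have s: "sin \<bar>x\<bar> > 0" using x by (intro sin_gt_zero) auto
 have g: "G pi > 0" using Gpi_ge by auto
 have n: "G1 \<bar>x\<bar> \<ge> 0" by (rule profile_props) (use x in auto)
 have s2: "(sin x)\<^sup>2 = (sin \<bar>x\<bar>)\<^sup>2" by (simp add: abs_if)
 have s3: "sin (2 * x) * sgn x = sin (2 * \<bar>x\<bar>)" using x by (simp add: abs_if sgn_if)
 have p: "\<bar>U1 G G1 x\<bar> = G1 \<bar>x\<bar> / (lam * G pi)"
  using n g lam_pos x by (simp add: U1_def abs_mult abs_sgn_eq)
 have a: "- (4 * \<gamma> * (sin x)\<^sup>2) * U2 \<eta> G G1 x = (lam * \<eta> \<bar>x\<bar> * G \<bar>x\<bar> - drift \<bar>x\<bar> * G1 \<bar>x\<bar>) / (lam * G pi)"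
  using s \<gamma>_pos unfolding s2 U2_def curv_def by simp
 have b: "2 * \<gamma> * sin (2 * x) * U1 G G1 x = - (2 * \<gamma> * sin (2 * \<bar>x\<bar>) * G1 \<bar>x\<bar>) / (lam * G pi)"
  unfolding U1_def s3[symmetric] by simp
 have d: "lam * U G x = 1 - G \<bar>x\<bar> / G pi" using lam_pos by (simp add: U_def)
 show ?thesis unfolding pde_eq p a b d
  using lam_pos g by (simp add: drift_def field_simps)
qed

lemma U_bound: "\<bar>x\<bar> \<le> pi ==> U G x \<le> 1 / lam"
 unfolding U_def using lam_pos Gpi_ge profile_props(7)[of "\<bar>x\<bar>"] by (intro divide_right_mono) auto

end

section \<open>Smooth approximations of the profile and their convergence\<close>

definition cutoff :: "real => real => real" where "cutoff e x = max 0 (min 1 (x / e - 1))"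

lemma cutoff_props:
 assumes "e > 0"
 shows "continuous_on A (cutoff e)" "0 \<le> cutoff e x" "cutoff e x \<le> 1" "x \<le> e ==> cutoff e x = 0"
  "2 * e \<le> x ==> cutoff e x = 1"
proof -
 show "continuous_on A (cutoff e)" unfolding cutoff_def[abs_def] using assms by (intro continuous_intros) auto
qed (use assms in \<open>auto simp: cutoff_def field_simps\<close>)

text \<open>While the cutoff vanishes, \<open>G\<close> is 1 and both its slope and
  \<open>curv\<close> are 0, so on \<open>\<bar>x\<bar> \<le> e\<close> the reflected function is
  constant. Hence the formulas for \<open>U1\<close> and \<open>U2\<close>, derived for nonzero
  arguments, extend to 0, and the second derivative is continuous.\<close>

lemma cut_profile:
 assumes e: "0 < e" "e < pi" and prof: "profile (cutoff e) G G1"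
 shows "\<bar>x\<bar> < pi ==> (U G has_real_derivative U1 G G1 x) (at x)"
  and "\<bar>x\<bar> < pi ==> (U1 G G1 has_real_derivative U2 (cutoff e) G G1 x) (at x)"
  and "\<bar>x\<bar> < pi ==> pde x (U G x) (U1 G G1 x) (U2 (cutoff e) G G1 x) = - (1 - cutoff e \<bar>x\<bar>) * G \<bar>x\<bar> / G pi"
  and "\<bar>x\<bar> < pi ==> isCont (U2 (cutoff e) G G1) x"
proof -
 note P = profile_props[OF prof]
 have flat: "G1 \<bar>y\<bar> = 0 \<and> G \<bar>y\<bar> = 1 \<and> curv (cutoff e) G G1 \<bar>y\<bar> = 0" if "\<bar>y\<bar> \<le> e" for y
 proof -
  have "G1 \<bar>y\<bar> = 0 \<and> G \<bar>y\<bar> = 1" by (rule P(12)) (use that e cutoff_props(4)[OF e(1)] in auto)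
  then show ?thesis using cutoff_props(4)[OF e(1), of "\<bar>y\<bar>"] that by (auto simp: curv_def)
 qed
 show "(U G has_real_derivative U1 G G1 x) (at x)" if x: "\<bar>x\<bar> < pi"
 proof (cases "x = 0")
  case True
  have "((%_. U G 0) has_real_derivative 0) (at 0)" by simp
  then have "(U G has_real_derivative 0) (at 0)"
   by (rule has_field_derivative_transform_within[where d = e])
    (use e flat[of 0] flat in \<open>auto simp: U_def dist_real_def\<close>)
  then show ?thesis using True by (simp add: U1_def)
 qed (rule U_deriv[OF prof x])
 show "(U1 G G1 has_real_derivative U2 (cutoff e) G G1 x) (at x)" if x: "\<bar>x\<bar> < pi"
 proof (cases "x = 0")
  case True
  have "((%_. 0) has_real_derivative 0) (at (0::real))" by simp
  then have "(U1 G G1 has_real_derivative 0) (at 0)"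
   by (rule has_field_derivative_transform_within[where d = e])
    (use e flat in \<open>auto simp: U1_def dist_real_def\<close>)
  then show ?thesis using True flat[of 0] e by (simp add: U2_def)
 qed (rule U1_deriv[OF prof x])
 show "pde x (U G x) (U1 G G1 x) (U2 (cutoff e) G G1 x) = - (1 - cutoff e \<bar>x\<bar>) * G \<bar>x\<bar> / G pi" if x: "\<bar>x\<bar> < pi"
 proof (cases "x = 0")
  case True
  then show ?thesis using lam_pos flat[of 0] e cutoff_props(4)[OF e(1), of 0]
   by (simp add: pde_eq U_def U1_def field_simps)
 qed (rule U_pde[OF prof x])
 show "isCont (U2 (cutoff e) G G1) x" if x: "\<bar>x\<bar> < pi"
 proof (cases "\<bar>x\<bar> < e")
  case True
  have "isCont (%_. 0::real) x" by simp
  then show ?thesis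
   by (rule continuous_transform_within[where \<delta> = "e - \<bar>x\<bar>"])
    (use True flat in \<open>auto simp: U2_def dist_real_def\<close>)
 next
  case False
  then have x0: "0 < \<bar>x\<bar>" using e by auto
  have "isCont G1 \<bar>x\<bar>" by (rule DERIV_isCont[OF P(6)]) (use x x0 in auto)
  moreover have "isCont G \<bar>x\<bar>" by (rule DERIV_isCont[OF profile_deriv[OF prof]]) (use x x0 in auto)
  moreover have "isCont (cutoff e) \<bar>x\<bar>" using cutoff_props(1)[OF e(1), of UNIV] by (auto simp: continuous_on_eq_continuous_at)
  moreover have "isCont drift \<bar>x\<bar>" using continuous_on_drift[of UNIV] by (auto simp: continuous_on_eq_continuous_at)
  moreover have "sin \<bar>x\<bar> > 0" using x x0 by (intro sin_gt_zero) auto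
  ultimately have "isCont (curv (cutoff e) G G1) \<bar>x\<bar>" unfolding curv_def[abs_def] using \<gamma>_pos
   by (intro continuous_intros) auto
  then have "isCont (%x. curv (cutoff e) G G1 \<bar>x\<bar>) x"
   by (rule isCont_o2[rotated]) (intro continuous_intros)
  then show ?thesis unfolding U2_def[abs_def] using lam_pos Gpi_ge[OF prof]
   by (intro continuous_intros) auto
 qed
qed

text \<open>From \<open>2 * e\<close> on the cutoff is 1, so \<open>G\<close> and \<open>H\<close>
  solve the same linear equation and their Wronskian \<open>w\<close> satisfies Liouville's formula:
  \<open>intfac * w\<close> is constant. Transport from \<open>2 * e\<close> to \<delta> therefore
  gains the factor \<open>intfac (2 * e) / intfac \<delta>\<close>, which tends to 0 with
  \<open>e\<close>. Since \<open>(H / G)' = w / G\<^sup>2\<close> and \<open>G \<ge> 1\<close>, the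
  quotient hardly moves beyond \<delta>.\<close>

lemma wronskian_bound:
 assumes e: "0 < e" "2 * e \<le> \<delta>" "\<delta> < pi" and G: "profile (%_. 1) G G1" and H: "profile (cutoff e) H H1"
  and y: "\<delta> \<le> y" "y \<le> pi"
 shows "\<bar>H y / G y - H \<delta> / G \<delta>\<bar> \<le> lip_const * (exp (lip_const * pi))\<^sup>2 * (intfac (2 * e) / intfac \<delta>) * pi"
proof (cases "y = \<delta>")
 case True
 then show ?thesis using lip_const_nonneg intfac_pos[of "2 * e"] intfac_pos[of \<delta>] e by auto
next
 case False
 then have y': "\<delta> < y" using y by auto
 note PG = profile_props[OF G] and PH = profile_props[OF H]
 define E where "E = exp (lip_const * pi)"
 define w where "w x = H1 x * G x - H x * G1 x" for x
 define c where "c = lip_const * E\<^sup>2 * (intfac (2 * e) / intfac \<delta>)"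
 have E1: "E \<ge> 1" using lip_const_nonneg by (simp add: E_def)
 have mono: "intfac \<delta> \<le> intfac x" if x: "\<delta> \<le> x" "x < pi" for x
 proof (rule DERIV_nonneg_imp_nondecreasing[OF x(1)])
  fix z assume z: "\<delta> \<le> z" "z \<le> x"
  have z': "0 < z" "z < pi" using z x e by auto
  show "\<exists>l. (intfac has_real_derivative l) (at z) \<and> 0 \<le> l"
   using intfac_pos[OF z'] drift_pos[of z] \<gamma>_pos
   by (intro exI[of _ "intfac z * drift z / (4 * \<gamma> * (sin z)\<^sup>2)"] conjI intfac_deriv z') auto
 qed
 have w_bound: "\<bar>w x\<bar> \<le> lip_const * E\<^sup>2" if x: "x \<in> {0..<pi}" for x
 proof -
  have x': "x \<in> {0..pi}" using x by auto
  have g: "0 \<le> G1 x" "G1 x \<le> lip_const * E" "0 \<le> G x" "G x \<le> E"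
   using PG(7)[OF x'] PG(8)[OF x'] PG(9)[OF x] PG(10)[OF x] mult_left_mono[OF PG(8)[OF x'] lip_const_nonneg]
   by (auto simp: E_def)
  have h: "0 \<le> H1 x" "H1 x \<le> lip_const * E" "0 \<le> H x" "H x \<le> E"
   using PH(7)[OF x'] PH(8)[OF x'] PH(9)[OF x] PH(10)[OF x] mult_left_mono[OF PH(8)[OF x'] lip_const_nonneg]
   by (auto simp: E_def)
  have "0 \<le> H1 x * G x" "H1 x * G x \<le> lip_const * E * E" "0 \<le> H x * G1 x" "H x * G1 x \<le> E * (lip_const * E)"
   using g h E1 lip_const_nonneg by (auto intro!: mult_mono)
  then show ?thesis by (simp add: w_def power2_eq_square abs_le_iff mult_ac)
 qed
 have wd: "((%x. intfac x * w x) has_real_derivative 0) (at x)" if x: "2 * e \<le> x" "x < pi" for x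
 proof -
  have x0: "0 < x" using x e by auto
  have xi: "x \<in> {0<..<pi}" using x x0 by auto
  define a where "a = 4 * \<gamma> * (sin x)\<^sup>2"
  have a: "a > 0" using sin_gt_zero[OF x0 x(2)] \<gamma>_pos by (simp add: a_def)
  have c1: "cutoff e x = 1" using cutoff_props(5)[OF e(1) x(1)] .
  have "(w has_real_derivative (curv (cutoff e) H H1 x * G x + G1 x * H1 x) - (H1 x * G1 x + curv (%_. 1) G G1 x * H x)) (at x)"
   unfolding w_def[abs_def]
   by (intro DERIV_diff DERIV_mult PG(6)[OF xi] PH(6)[OF xi] profile_deriv[OF G xi] profile_deriv[OF H xi])
  also have "(curv (cutoff e) H H1 x * G x + G1 x * H1 x) - (H1 x * G1 x + curv (%_. 1) G G1 x * H x) = - drift x * w x / a"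
   using a unfolding curv_def c1 a_def[symmetric] w_def by (simp add: field_simps)
  finally have w': "(w has_real_derivative - drift x * w x / a) (at x)" .
  have "((%x. intfac x * w x) has_real_derivative intfac x * drift x / a * w x + (- drift x * w x / a) * intfac x) (at x)"
   unfolding a_def by (intro DERIV_mult intfac_deriv x0 x w'[unfolded a_def])
  then show ?thesis by simp
 qed
 \<comment> \<open>The conserved quantity is evaluated at \<open>2 * e\<close>, where only the crude
   bound \<open>w_bound\<close> is known; the smallness comes entirely from the integrating factor,
   which is increasing, so \<delta> is the worst point.\<close>
 have w_small: "\<bar>w x\<bar> \<le> c" if x: "\<delta> \<le> x" "x < pi" for x
 proof -
  have ex: "2 * e \<le> x" using x e by auto
  have "intfac x * w x = intfac (2 * e) * w (2 * e)"
  proof (cases "x = 2 * e")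
   case False
   then have "2 * e < x" using ex by auto
   then show ?thesis
    by (rule DERIV_isconst_end)
     (use x in \<open>auto intro!: DERIV_continuous_on[where D = "%_. 0"] has_field_derivative_at_within[OF wd] wd\<close>)
  qed simp
  then have "w x = intfac (2 * e) * w (2 * e) / intfac x" using intfac_pos[of x] x e by (simp add: field_simps)
  then have "\<bar>w x\<bar> = intfac (2 * e) * \<bar>w (2 * e)\<bar> / intfac x"
   using intfac_pos[of x] intfac_pos[of "2 * e"] x e by (simp add: abs_mult)
  also have "\<dots> \<le> intfac (2 * e) * (lip_const * E\<^sup>2) / intfac \<delta>"
   using w_bound[of "2 * e"] mono[OF x] intfac_pos[of \<delta>] intfac_pos[of "2 * e"] x e lip_const_nonneg
   by (intro frac_le mult_left_mono mult_nonneg_nonneg) auto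
  finally show ?thesis by (simp add: c_def mult_ac)
 qed
 have c0: "c \<ge> 0" using lip_const_nonneg intfac_pos[of "2 * e"] intfac_pos[of \<delta>] e by (auto simp: c_def)
 have Gne: "G x \<noteq> 0" if "x \<in> {0..pi}" for x using PG(7)[OF that] by auto
 have rd: "((%x. H x / G x) has_real_derivative w x / (G x * G x)) (at x)" if "\<delta> < x" "x < pi" for x
  unfolding w_def using that e
  by (intro DERIV_divide profile_deriv[OF G] profile_deriv[OF H] Gne) auto
 have "\<exists>l z. \<delta> < z \<and> z < y \<and> ((%x. H x / G x) has_real_derivative l) (at z) \<and> H y / G y - H \<delta> / G \<delta> = (y - \<delta>) * l"
 proof (rule MVT[OF y'])
  show "continuous_on {\<delta>..y} (%x. H x / G x)"
   using Gne e y by (intro continuous_intros continuous_on_subset[OF PG(1)] continuous_on_subset[OF PH(1)]) auto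
  show "(%x. H x / G x) differentiable at x" if "\<delta> < x" "x < y" for x
  proof -
   have "((%x. H x / G x) has_real_derivative w x / (G x * G x)) (at x)" by (rule rd) (use that y in auto)
   then show ?thesis unfolding real_differentiable_def by blast
  qed
 qed
 then obtain l z where z: "\<delta> < z" "z < y" "((%x. H x / G x) has_real_derivative l) (at z)"
  "H y / G y - H \<delta> / G \<delta> = (y - \<delta>) * l" by blast
 have zi: "z \<in> {0..pi}" "z < pi" using z y e by auto
 have "l = w z / (G z * G z)" using DERIV_unique[OF z(3) rd[of z]] z y by auto
 moreover have "1 * 1 \<le> G z * G z" using PG(7)[OF zi(1)] by (intro mult_mono) auto
 ultimately have "\<bar>l\<bar> \<le> \<bar>w z\<bar> / 1" unfolding abs_divide by (intro order.trans[OF _ frac_le[of "\<bar>w z\<bar>" "\<bar>w z\<bar>" 1 "G z * G z"]]) (auto simp: abs_mult)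
 then have l: "\<bar>l\<bar> \<le> c" using w_small[of z] z zi by auto
 have "\<bar>H y / G y - H \<delta> / G \<delta>\<bar> = (y - \<delta>) * \<bar>l\<bar>" unfolding z(4) using y by (simp add: abs_mult)
 also have "\<dots> \<le> pi * c" using l c0 y e by (intro mult_mono) auto
 finally show ?thesis by (simp add: c_def E_def mult_ac)
qed

text \<open>Close to 0 the two profiles cannot separate because both start at 1 with slopes at most
  \<open>C\<close>, uniformly in \<eta>; beyond \<delta> the Wronskian controls the quotient. The
  threshold \<delta> depends on \<kappa> only and is fixed before the cutoff width.\<close>

lemma cut_ratio_tendsto:
 assumes G: "profile (%_. 1) G G1" and \<kappa>: "\<kappa> > 0"
 shows "\<exists>e0>0. \<forall>e H H1. 0 < e --> e < e0 --> profile (cutoff e) H H1 --> (\<forall>y\<in>{0..pi}. \<bar>H y / G y - 1\<bar> \<le> \<kappa>)"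
proof -
 define E where "E = exp (lip_const * pi)"
 define C where "C = lip_const * E"
 have C0: "C \<ge> 0" using lip_const_nonneg by (simp add: C_def E_def)
 \<comment> \<open>Small enough that both profiles lie in \<open>[1, 1 + \<kappa> / 2]\<close> on
   \<open>[0, \<delta>]\<close>.\<close>
 define \<delta> where "\<delta> = min 1 (\<kappa> / (2 * (C + 1)))"
 have "C * \<delta> \<le> (C + 1) * (\<kappa> / (2 * (C + 1)))" unfolding \<delta>_def using C0 \<kappa> by (intro mult_mono) auto
 also have "\<dots> = \<kappa> / 2" using C0 by (simp add: field_simps)
 finally have \<delta>2: "C * \<delta> \<le> \<kappa> / 2" .
 have \<delta>: "0 < \<delta>" "\<delta> < pi" "C * \<delta> \<le> \<kappa> / 2" using \<delta>2 C0 \<kappa> pi_gt3 by (auto simp: \<delta>_def)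
 have near: "1 \<le> K x \<and> K x \<le> 1 + C * \<delta>" if K: "profile \<eta> K K1" and x: "0 \<le> x" "x \<le> \<delta>" for \<eta> K K1 x
 proof -
  note P = profile_props[OF K]
  have xi: "x \<in> {0..pi}" using x \<delta> by auto
  have "norm (K x - K 0) \<le> C * norm (x - 0)"
  proof (rule field_differentiable_bound[of "{0..\<delta>}" K K1])
   fix z assume z: "z \<in> {0..\<delta>}"
   then have zi: "z \<in> {0..<pi}" "z \<in> {0..pi}" using \<delta> by auto
   show "(K has_field_derivative K1 z) (at z within {0..\<delta>})"
    by (rule has_field_derivative_subset[OF P(5)[OF zi(1)]]) (use \<delta> in auto)
   have "K1 z \<le> C" using P(10)[OF zi(1)] mult_left_mono[OF P(8)[OF zi(2)] lip_const_nonneg] by (auto simp: C_def E_def)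
   then show "norm (K1 z) \<le> C" using P(9)[OF zi(1)] by auto
  qed (use x \<delta> in auto)
  moreover have "C * x \<le> C * \<delta>" using x C0 by (intro mult_left_mono) auto
  ultimately show ?thesis using P(3) P(7)[OF xi] x by auto
 qed
 define B where "B = lip_const * E\<^sup>2 * pi / intfac \<delta>"
 have B0: "B \<ge> 0" using lip_const_nonneg intfac_pos[OF \<delta>(1,2)] by (auto simp: B_def)
 have "\<kappa> / (2 * (B + 1)) > 0" using \<kappa> B0 by auto
 from tendstoD[OF intfac_tendsto_0 this] obtain b where b: "b > 0" "\<And>x. 0 < x ==> x < b ==> \<bar>intfac x\<bar> < \<kappa> / (2 * (B + 1))"
  unfolding eventually_at_right_field by auto
 \<comment> \<open>The first bound puts the end \<open>2 * e\<close> of the cutoff region before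
   \<delta>, the second makes \<open>intfac (2 * e)\<close> small enough for the Wronskian
   estimate.\<close>
 define e0 where "e0 = min (\<delta> / 2) (b / 2)"
 have "\<bar>H y / G y - 1\<bar> \<le> \<kappa>" if e: "0 < e" "e < e0" and H: "profile (cutoff e) H H1" and y: "y \<in> {0..pi}" for e H H1 y
 proof -
  have close: "\<bar>H x / G x - 1\<bar> \<le> \<kappa> / 2" if x: "0 \<le> x" "x \<le> \<delta>" for x
  proof -
   have g: "1 \<le> G x" "G x \<le> 1 + C * \<delta>" "1 \<le> H x" "H x \<le> 1 + C * \<delta>" using near[OF G x] near[OF H x] by auto
   have "\<bar>H x / G x - 1\<bar> = \<bar>H x - G x\<bar> / G x" using g by (simp add: field_simps abs_divide)
   also have "\<dots> \<le> (C * \<delta>) / 1" using g C0 \<delta> by (intro frac_le) auto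
   finally show ?thesis using \<delta> by auto
  qed
  show ?thesis
  proof (cases "y \<le> \<delta>")
   case True then show ?thesis using close[of y] y \<kappa> by auto
  next
   case False
   have e2: "2 * e \<le> \<delta>" "2 * e < b" using e by (auto simp: e0_def)
   have "\<bar>H y / G y - H \<delta> / G \<delta>\<bar> \<le> lip_const * E\<^sup>2 * (intfac (2 * e) / intfac \<delta>) * pi"
    unfolding E_def by (rule wronskian_bound[OF e(1) e2(1) \<delta>(2) G H]) (use False y in auto)
   also have "\<dots> = B * intfac (2 * e)" by (simp add: B_def)
   also have "\<dots> \<le> (B + 1) * (\<kappa> / (2 * (B + 1)))"
    using b(2)[of "2 * e"] e e2 B0 \<kappa> intfac_pos[of "2 * e"] \<delta> by (intro mult_mono) auto
   also have "\<dots> = \<kappa> / 2" using B0 by (simp add: field_simps)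
   finally have "\<bar>H y / G y - H \<delta> / G \<delta>\<bar> \<le> \<kappa> / 2" .
   moreover have "\<bar>H \<delta> / G \<delta> - 1\<bar> \<le> \<kappa> / 2" using close[of \<delta>] \<delta>(1) by auto
   ultimately show ?thesis by linarith
  qed
 qed
 then show ?thesis using b(1) \<delta>(1) by (intro exI[of _ e0]) (auto simp: e0_def)
qed

text \<open>\<open>U\<close> depends on the profile only through
  \<open>G \<bar>x\<bar> / G pi\<close>, so uniform closeness of \<open>H / G\<close> to 1, used at
  \<open>\<bar>x\<bar>\<close> and at pi, is enough.\<close>

lemma cut_U_tendsto:
 assumes G: "profile (%_. 1) G G1" and \<kappa>: "\<kappa> > 0"
 shows "\<exists>e0>0. \<forall>e H H1. 0 < e --> e < e0 --> profile (cutoff e) H H1 --> (\<forall>x\<in>{-pi..pi}. \<bar>U H x - U G x\<bar> \<le> \<kappa>)"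
proof -
 \<comment> \<open>The bound 1/2 keeps \<open>s = H pi / G pi\<close> at least 1/2; then
   \<open>\<bar>r - s\<bar> / s\<close> is at most \<open>2 * k / (1/2) = 4 * k\<close>.\<close>
 define k where "k = min (1/2) (\<kappa> * lam / 4)"
 have k: "0 < k" "k \<le> 1/2" "4 * k \<le> \<kappa> * lam" using \<kappa> lam_pos by (auto simp: k_def)
 from cut_ratio_tendsto[OF G k(1)] obtain e0 where e0: "e0 > 0"
  "\<And>e H H1 y. 0 < e ==> e < e0 ==> profile (cutoff e) H H1 ==> y\<in>{0..pi} ==> \<bar>H y / G y - 1\<bar> \<le> k" by blast
 have "\<bar>U H x - U G x\<bar> \<le> \<kappa>" if e: "0 < e" "e < e0" and H: "profile (cutoff e) H H1" and x: "x \<in> {-pi..pi}" for e H H1 x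
 proof -
  define r where "r = H \<bar>x\<bar> / G \<bar>x\<bar>"
  define s where "s = H pi / G pi"
  define q where "q = G \<bar>x\<bar> / G pi"
  have xi: "\<bar>x\<bar> \<in> {0..pi}" using x by auto
  have g: "1 \<le> G \<bar>x\<bar>" "G \<bar>x\<bar> \<le> G pi" using profile_props(7)[OF G xi] profile_props(11)[OF G, of "\<bar>x\<bar>" pi] xi by auto
  have r: "\<bar>r - 1\<bar> \<le> k" "\<bar>s - 1\<bar> \<le> k" using e0(2)[OF e H] xi by (auto simp: r_def s_def)
  have sp: "s \<ge> 1/2" using r(2) k by (auto simp: abs_le_iff)
  have q: "0 \<le> q" "q \<le> 1" using g by (auto simp: q_def)
  have hp: "1 \<le> H pi" using profile_props(7)[OF H, of pi] by auto
  have "H \<bar>x\<bar> / H pi = q * (r / s)" using g hp by (simp add: q_def r_def s_def)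
  then have "\<bar>H \<bar>x\<bar> / H pi - q\<bar> = q * (\<bar>r - s\<bar> / s)"
  proof -
   assume eq: "H \<bar>x\<bar> / H pi = q * (r / s)"
   have "q * (r / s) - q = q * ((r - s) / s)" using sp by (simp add: field_simps)
   then show ?thesis unfolding eq using q sp by (simp add: abs_mult)
  qed
  also have "\<dots> \<le> 1 * ((2 * k) / (1/2))" using q sp r k by (intro mult_mono frac_le) (auto simp: abs_le_iff)
  also have "\<dots> \<le> \<kappa> * lam" using k by simp
  finally have "\<bar>H \<bar>x\<bar> / H pi - q\<bar> \<le> \<kappa> * lam" .
  moreover have "U H x - U G x = - (H \<bar>x\<bar> / H pi - q) / lam" by (simp add: U_def q_def diff_divide_distrib)
  ultimately show ?thesis using lam_pos by (simp add: abs_divide divide_le_eq)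
 qed
 then show ?thesis using e0(1) by blast
qed

text \<open>The residual of a cut profile is \<open>- (1 - cutoff) * H / H pi\<close>, hence
  nonpositive: switching off the zeroth order term always errs on the subsolution side.\<close>

lemma cut_profile_le_viscosity:
 assumes e: "0 < e" "e < pi" and H: "profile (cutoff e) H H1" and w: "viscosity_solution \<gamma> \<Omega> lam w"
  and x: "x \<in> {-pi..pi}"
 shows "U H x \<le> w x"
proof (rule C2_subsolution_le_viscosity[OF w U_continuous[OF H] U_pi(2)[OF H] U_pi(1)[OF H] _ _ _ x])
 fix y assume "y \<in> {-pi<..<pi}"
 then have y: "\<bar>y\<bar> < pi" by auto
 show "(U H has_real_derivative U1 H H1 y) (at y)" by (rule cut_profile(1)[OF e H y])
 show "(U1 H H1 has_real_derivative U2 (cutoff e) H H1 y) (at y)" by (rule cut_profile(2)[OF e H y])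
 have "1 \<le> H \<bar>y\<bar>" "1 \<le> H pi" using profile_props(7)[OF H] y by auto
 then show "pde y (U H y) (U1 H H1 y) (U2 (cutoff e) H H1 y) \<le> 0"
  unfolding cut_profile(3)[OF e H y] using cutoff_props(3)[OF e(1), of "\<bar>y\<bar>"]
  by (intro divide_nonpos_pos mult_nonpos_nonneg) auto
qed

lemma profile_cutoff_exists: "0 < e ==> \<exists>H H1. profile (cutoff e) H H1"
 by (rule profile_exists) (auto simp: cutoff_props)

lemma profile_one_exists: "\<exists>G G1. profile (%_. 1) G G1"
 by (rule profile_exists) auto

section \<open>The value profile is the only viscosity solution\<close>

context
 fixes G G1 assumes G: "profile (%_. 1) G G1"
begin

text \<open>Minus the right derivative of \<open>U G\<close> at 0, computed from
  \<open>G1 0 = lam / \<Omega>\<close>.\<close>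

definition kink :: real where "kink = 1 / (\<Omega> * G pi)"

lemma kink_pos: "kink > 0" using \<Omega>_pos Gpi_ge[OF G] by (simp add: kink_def)

text \<open>This is the equation read at 0, where the second order term and the sine drop out:
  \<open>\<Omega> * kink + lam * U G 0 - 1 = 0\<close>.\<close>

lemma lam_U_0: "lam * U G 0 - 1 = - \<Omega> * kink"
 using lam_pos \<Omega>_pos profile_props(3)[OF G] by (simp add: U_def kink_def)

lemma U_kink:
 assumes \<kappa>: "\<kappa> > 0"
 shows "\<exists>d>0. d \<le> pi \<and> (\<forall>y. \<bar>y\<bar> < d --> \<bar>U G y - U G 0 + kink * \<bar>y\<bar>\<bar> \<le> \<kappa> * \<bar>y\<bar>)"
proof -
 have g: "G pi > 0" using Gpi_ge[OF G] by auto
 have "(G has_real_derivative lam / \<Omega>) (at 0 within {0..<pi})"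
  using profile_props(5)[OF G, of 0] profile_props(4)[OF G] by simp
 then have "((%y. (G y - G 0) / (y - 0)) \<longlongrightarrow> lam / \<Omega>) (at 0 within {0..<pi})"
  by (simp add: has_field_derivative_iff)
 from tendstoD[OF this, of "\<kappa> * lam * G pi"] obtain d where d: "d > 0"
  "\<And>y. y \<in> {0..<pi} ==> y \<noteq> 0 ==> y < d ==> \<bar>(G y - G 0) / y - lam / \<Omega>\<bar> < \<kappa> * lam * G pi"
  using \<kappa> lam_pos g unfolding eventually_at dist_real_def by auto
 have "\<bar>U G y - U G 0 + kink * \<bar>y\<bar>\<bar> \<le> \<kappa> * \<bar>y\<bar>" if y: "\<bar>y\<bar> < min d pi" for y
 proof (cases "y = 0")
  case False
  define z where "z = \<bar>y\<bar>"
  have z: "z > 0" "z \<in> {0..<pi}" "z < d" using y False by (auto simp: z_def)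
  have "U G y - U G 0 + kink * \<bar>y\<bar> = - (z / (lam * G pi)) * ((G z - G 0) / z - lam / \<Omega>)"
   using z lam_pos g \<Omega>_pos unfolding U_def kink_def z_def[symmetric] by (simp add: field_simps)
  then have "\<bar>U G y - U G 0 + kink * \<bar>y\<bar>\<bar> = (z / (lam * G pi)) * \<bar>(G z - G 0) / z - lam / \<Omega>\<bar>"
   using z lam_pos g by (simp add: abs_mult)
  also have "\<dots> \<le> (z / (lam * G pi)) * (\<kappa> * lam * G pi)"
   using d(2)[OF z(2) _ z(3)] z lam_pos g by (intro mult_left_mono) auto
  also have "\<dots> = \<kappa> * \<bar>y\<bar>" using lam_pos g by (simp add: z_def)
  finally show ?thesis .
 qed simp
 then show ?thesis using d(1) by (intro exI[of _ "min d pi"]) auto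
qed

text \<open>Away from 0 a test function touches a classical solution, so slopes agree and curvatures
  are ordered. At 0 the second order coefficient vanishes and only the slope matters: touching the
  kink from above on both sides forces the slope of the test function to be at most
  \<open>kink\<close> in modulus, which by \<open>lam_U_0\<close> is exactly the subsolution
  inequality.\<close>

lemma U_viscosity: "viscosity_solution \<gamma> \<Omega> lam (U G)"
 unfolding viscosity_solution_pde
proof (intro conjI ballI allI impI)
 show "continuous_on {-pi..pi} (U G)" by (rule U_continuous[OF G])
 show "U G (-pi) = 0" "U G pi = 0" by (auto simp: U_pi[OF G])
next
 fix x \<phi> \<phi>1 \<phi>2 assume x: "x \<in> {-pi<..<pi}" and C2: "C2_with \<phi> \<phi>1 \<phi>2"
  and "\<exists>e>0. \<forall>y\<in>{-pi<..<pi} \<inter> ball x e. U G y - \<phi> y \<le> U G x - \<phi> x"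
 then obtain e where e: "e > 0" "\<And>y. y \<in> {-pi<..<pi} ==> \<bar>y - x\<bar> < e ==> U G y - \<phi> y \<le> U G x - \<phi> x"
  by (force simp: dist_real_def)
 have p1: "(\<phi> has_real_derivative \<phi>1 y) (at y)" and p2: "(\<phi>1 has_real_derivative \<phi>2 y) (at y)" for y
  using C2 by (auto simp: C2_with_def)
 show "pde x (U G x) (\<phi>1 x) (\<phi>2 x) \<le> 0"
 proof (cases "x = 0")
  case False
  define d where "d = min e (min \<bar>x\<bar> (pi - \<bar>x\<bar>))"
  have d: "d > 0" "\<And>y. \<bar>y - x\<bar> < d ==> \<bar>y - x\<bar> < e \<and> \<bar>y\<bar> < pi \<and> y \<noteq> 0"
   using False x e(1) by (auto simp: d_def abs_if split: if_splits)
  have x': "\<bar>x\<bar> < pi" using x by auto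
  have f1: "((%y. U G y - \<phi> y) has_real_derivative U1 G G1 y - \<phi>1 y) (at y)" if "\<bar>y - x\<bar> < d" for y
   using d(2)[OF that] by (intro DERIV_diff U_deriv[OF G] p1) auto
  have f2: "((%y. U1 G G1 y - \<phi>1 y) has_real_derivative U2 (%_. 1) G G1 x - \<phi>2 x) (at x)"
   by (intro DERIV_diff U1_deriv[OF G] p2 x' False)
  have mx: "U G y - \<phi> y \<le> U G x - \<phi> x" if "\<bar>y - x\<bar> < d" for y
   by (rule e(2)) (use d(2)[OF that] in auto)
  have "U1 G G1 x - \<phi>1 x = 0" "U2 (%_. 1) G G1 x - \<phi>2 x \<le> 0"
   using second_derivative_local_max[OF d(1) f1 f2 mx] by auto
  moreover from this have "(4 * \<gamma> * (sin x)\<^sup>2) * U2 (%_. 1) G G1 x \<le> (4 * \<gamma> * (sin x)\<^sup>2) * \<phi>2 x"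
   using \<gamma>_pos by (intro mult_left_mono) auto
  ultimately show ?thesis using U_pde[OF G x' False] by (simp add: pde_eq)
 next
  case True
  have "\<bar>\<phi>1 0\<bar> \<le> kink + \<kappa>" if k: "\<kappa> > 0" for \<kappa>
  proof -
   have k2: "\<kappa> / 2 > 0" using k by auto
   from U_kink[OF k2] obtain d where d: "d > 0" "d \<le> pi"
    "\<And>y. \<bar>y\<bar> < d ==> \<bar>U G y - U G 0 + kink * \<bar>y\<bar>\<bar> \<le> \<kappa> / 2 * \<bar>y\<bar>" by auto
   from tendstoD[OF p1[of 0, unfolded has_field_derivative_iff] k2] obtain d' where d': "d' > 0"
    "\<And>y. y \<noteq> 0 ==> \<bar>y\<bar> < d' ==> \<bar>(\<phi> y - \<phi> 0) / y - \<phi>1 0\<bar> < \<kappa> / 2"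
    unfolding eventually_at dist_real_def by auto
   have "s * \<phi>1 0 \<ge> - (kink + \<kappa>)" if s: "s = 1 \<or> s = -1" for s
   proof -
    define r where "r = min d (min d' e) / 2"
    have r: "r > 0" "r < d" "r < d'" "r < e" "r < pi" using d(1,2) d'(1) e(1) by (auto simp: r_def)
    define y where "y = s * r"
    have y: "\<bar>y\<bar> = r" "y \<noteq> 0" using s r by (auto simp: y_def)
    have 1: "U G y - \<phi> y \<le> U G 0 - \<phi> 0" using e(2)[of y] y r True by (auto simp: abs_if split: if_splits)
    have 2: "- (kink + \<kappa> / 2) * r \<le> U G y - U G 0"
    proof -
     have "\<bar>U G y - U G 0 + kink * r\<bar> \<le> \<kappa> / 2 * r" using d(3)[of y] y r by auto
     then have "- (kink * r) - \<kappa> / 2 * r \<le> U G y - U G 0" by linarith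
     then show ?thesis by (simp add: algebra_simps)
    qed
    have "\<bar>(\<phi> y - \<phi> 0) / y - \<phi>1 0\<bar> * r \<le> \<kappa> / 2 * r" using d'(2)[OF y(2)] y r by (intro mult_right_mono) auto
    also have "\<bar>(\<phi> y - \<phi> 0) / y - \<phi>1 0\<bar> * r = \<bar>((\<phi> y - \<phi> 0) / y - \<phi>1 0) * y\<bar>" using y by (simp add: abs_mult)
    also have "((\<phi> y - \<phi> 0) / y - \<phi>1 0) * y = \<phi> y - \<phi> 0 - \<phi>1 0 * y" using y by (subst left_diff_distrib) simp
    finally have "\<phi> y - \<phi> 0 \<le> \<phi>1 0 * y + \<kappa> / 2 * r" by linarith
    with 1 2 have "- (kink + \<kappa> / 2) * r \<le> \<phi>1 0 * y + \<kappa> / 2 * r" by linarith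
    then have "- (kink + \<kappa>) * r \<le> (s * \<phi>1 0) * r" by (simp add: y_def algebra_simps)
    then show ?thesis using r(1) by (simp only: mult_le_cancel_right_pos)
   qed
   from this[of 1] this[of "-1"] show ?thesis by (auto simp: abs_le_iff)
  qed
  then have "\<bar>\<phi>1 0\<bar> \<le> kink" by (rule field_le_epsilon)
  then have "\<Omega> * \<bar>\<phi>1 0\<bar> \<le> \<Omega> * kink" using \<Omega>_pos by (intro mult_left_mono) auto
  then show ?thesis using True lam_U_0 by (simp add: pde_eq)
 qed
next
 fix x \<phi> \<phi>1 \<phi>2 assume x: "x \<in> {-pi<..<pi}" and C2: "C2_with \<phi> \<phi>1 \<phi>2"
  and "\<exists>e>0. \<forall>y\<in>{-pi<..<pi} \<inter> ball x e. U G y - \<phi> y \<ge> U G x - \<phi> x"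
 then obtain e where e: "e > 0" "\<And>y. y \<in> {-pi<..<pi} ==> \<bar>y - x\<bar> < e ==> U G y - \<phi> y \<ge> U G x - \<phi> x"
  by (force simp: dist_real_def)
 have p1: "(\<phi> has_real_derivative \<phi>1 y) (at y)" and p2: "(\<phi>1 has_real_derivative \<phi>2 y) (at y)" for y
  using C2 by (auto simp: C2_with_def)
 show "pde x (U G x) (\<phi>1 x) (\<phi>2 x) \<ge> 0"
 proof (cases "x = 0")
  case False
  define d where "d = min e (min \<bar>x\<bar> (pi - \<bar>x\<bar>))"
  have d: "d > 0" "\<And>y. \<bar>y - x\<bar> < d ==> \<bar>y - x\<bar> < e \<and> \<bar>y\<bar> < pi \<and> y \<noteq> 0"
   using False x e(1) by (auto simp: d_def abs_if split: if_splits)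
  have x': "\<bar>x\<bar> < pi" using x by auto
  have f1: "((%y. \<phi> y - U G y) has_real_derivative \<phi>1 y - U1 G G1 y) (at y)" if "\<bar>y - x\<bar> < d" for y
   using d(2)[OF that] by (intro DERIV_diff U_deriv[OF G] p1) auto
  have f2: "((%y. \<phi>1 y - U1 G G1 y) has_real_derivative \<phi>2 x - U2 (%_. 1) G G1 x) (at x)"
   by (intro DERIV_diff U1_deriv[OF G] p2 x' False)
  have mx: "\<phi> y - U G y \<le> \<phi> x - U G x" if "\<bar>y - x\<bar> < d" for y
  proof -
   have "U G y - \<phi> y \<ge> U G x - \<phi> x" by (rule e(2)) (use d(2)[OF that] in auto)
   then show ?thesis by simp
  qed
  have "\<phi>1 x - U1 G G1 x = 0" "\<phi>2 x - U2 (%_. 1) G G1 x \<le> 0"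
   using second_derivative_local_max[OF d(1) f1 f2 mx] by auto
  moreover from this have "(4 * \<gamma> * (sin x)\<^sup>2) * \<phi>2 x \<le> (4 * \<gamma> * (sin x)\<^sup>2) * U2 (%_. 1) G G1 x"
   using \<gamma>_pos by (intro mult_left_mono) auto
  ultimately show ?thesis using U_pde[OF G x' False] by (simp add: pde_eq)
 next
  case True
  \<comment> \<open>A concave kink is touched from below by no smooth function.\<close>
  have k2: "kink / 4 > 0" using kink_pos by auto
  from U_kink[OF k2] obtain d where d: "d > 0" "d \<le> pi"
   "\<And>y. \<bar>y\<bar> < d ==> \<bar>U G y - U G 0 + kink * \<bar>y\<bar>\<bar> \<le> kink / 4 * \<bar>y\<bar>" by auto
  from tendstoD[OF p1[of 0, unfolded has_field_derivative_iff] k2] obtain d' where d': "d' > 0"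
   "\<And>y. y \<noteq> 0 ==> \<bar>y\<bar> < d' ==> \<bar>(\<phi> y - \<phi> 0) / y - \<phi>1 0\<bar> < kink / 4"
   unfolding eventually_at dist_real_def by auto
  have "s * \<phi>1 0 \<le> - (kink / 2)" if s: "s = 1 \<or> s = -1" for s
  proof -
   define r where "r = min d (min d' e) / 2"
   have r: "r > 0" "r < d" "r < d'" "r < e" "r < pi" using d(1,2) d'(1) e(1) by (auto simp: r_def)
   define y where "y = s * r"
   have y: "\<bar>y\<bar> = r" "y \<noteq> 0" using s r by (auto simp: y_def)
   have 1: "U G y - \<phi> y \<ge> U G 0 - \<phi> 0" using e(2)[of y] y r True by (auto simp: abs_if split: if_splits)
   have 2: "U G y - U G 0 \<le> - (kink - kink / 4) * r"
   proof -
    have "\<bar>U G y - U G 0 + kink * r\<bar> \<le> kink / 4 * r" using d(3)[of y] y r by auto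
    then have "U G y - U G 0 \<le> - (kink * r) + kink / 4 * r" by linarith
    then show ?thesis by (simp add: algebra_simps)
   qed
   have "\<bar>(\<phi> y - \<phi> 0) / y - \<phi>1 0\<bar> * r \<le> kink / 4 * r" using d'(2)[OF y(2)] y r by (intro mult_right_mono) auto
   also have "\<bar>(\<phi> y - \<phi> 0) / y - \<phi>1 0\<bar> * r = \<bar>((\<phi> y - \<phi> 0) / y - \<phi>1 0) * y\<bar>" using y by (simp add: abs_mult)
   also have "((\<phi> y - \<phi> 0) / y - \<phi>1 0) * y = \<phi> y - \<phi> 0 - \<phi>1 0 * y" using y by (subst left_diff_distrib) simp
   finally have "\<phi>1 0 * y \<le> \<phi> y - \<phi> 0 + kink / 4 * r" by linarith
   with 1 2 have "\<phi>1 0 * y \<le> - (kink - kink / 4) * r + kink / 4 * r" by linarith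
   then have "(s * \<phi>1 0) * r \<le> - (kink / 2) * r" by (simp add: y_def algebra_simps)
   then show ?thesis using r(1) by (simp only: mult_le_cancel_right_pos)
  qed
  from this[of 1] this[of "-1"] have False using kink_pos by auto
  then show ?thesis ..
 qed
qed

text \<open>At a maximum \<open>z\<close> of \<open>w - U G\<close> away from 0, \<open>U G\<close>
  is smooth and serves as test function. At \<open>z = 0\<close> it is replaced by a line: the kink
  pushes \<open>w\<close> below \<open>w 0 - (kink - k') * \<bar>y\<bar>\<close> near 0, hence below
  any line through \<open>w 0\<close> whose slope has modulus \<open>kink - k'\<close>.\<close>

lemma viscosity_le_U:
 assumes w: "viscosity_solution \<gamma> \<Omega> lam w" and x: "x \<in> {-pi..pi}"
 shows "w x \<le> U G x"
proof -
 have wc: "continuous_on {-pi..pi} w" and wb: "w (-pi) = 0" "w pi = 0"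
  using w by (auto simp: viscosity_solution_def)
 have "continuous_on {-pi..pi} (%y. w y - U G y)" by (intro continuous_intros wc U_continuous[OF G])
 from continuous_attains_sup[OF compact_Icc _ this] obtain z where z: "z \<in> {-pi..pi}"
  "\<And>y. y \<in> {-pi..pi} ==> w y - U G y \<le> w z - U G z" by auto
 have "w z - U G z \<le> 0"
 proof (cases "z \<in> {-pi<..<pi}")
  case False then show ?thesis using z(1) wb U_pi[OF G] by (cases "z = pi") auto
 next
  case True
  show ?thesis
  proof (cases "z = 0")
   case False
   have z': "\<bar>z\<bar> < pi" using True by auto
   define d where "d = min \<bar>z\<bar> (pi - \<bar>z\<bar>)"
   have d: "d > 0" "\<And>y. \<bar>y - z\<bar> < d ==> \<bar>y\<bar> < pi \<and> y \<noteq> 0"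
    using False True by (auto simp: d_def abs_if split: if_splits)
   have "pde z (w z) (U1 G G1 z) (U2 (%_. 1) G G1 z) \<le> 0"
   proof (rule viscosity_sub_C2_contact[OF w True d(1)])
    show "(U G has_real_derivative U1 G G1 y) (at y)" if "\<bar>y - z\<bar> < d" for y
     using d(2)[OF that] by (intro U_deriv[OF G]) auto
    show "(U1 G G1 has_real_derivative U2 (%_. 1) G G1 z) (at z)" by (rule U1_deriv[OF G z' False])
    show "w y - U G y \<le> w z - U G z" if "y \<in> {-pi<..<pi}" for y using z(2)[of y] that by simp
   qed
   then have "lam * w z \<le> lam * U G z" using U_pde[OF G z' False] by (simp add: pde_eq)
   then show ?thesis using lam_pos by simp
  next
   case z0: True
   have "lam * w 0 - 1 \<le> - \<Omega> * kink + \<kappa>" if k: "\<kappa> > 0" for \<kappa>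
   proof -
    define k' where "k' = min (kink / 2) (\<kappa> / \<Omega>)"
    have k': "k' > 0" "k' < kink" "\<Omega> * k' \<le> \<kappa>" using k kink_pos \<Omega>_pos
     by (auto simp: k'_def min_def field_simps)
    from U_kink[OF k'(1)] obtain d where d: "d > 0" "d \<le> pi"
     "\<And>y. \<bar>y\<bar> < d ==> \<bar>U G y - U G 0 + kink * \<bar>y\<bar>\<bar> \<le> k' * \<bar>y\<bar>" by auto
    \<comment> \<open>At 0 the operator only sees the modulus of the slope, so a line sloping to one
      side already yields \<open>\<Omega> * (kink - k') + lam * w 0 \<le> 1\<close>; letting
      \<open>k'\<close> vanish compares \<open>w 0\<close> with \<open>U G 0\<close> through
      \<open>lam_U_0\<close>.\<close>
    have "pde 0 (w 0) (- (kink - k')) 0 \<le> 0"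
    proof (rule viscosity_sub_quadratic[OF w _ d(1)])
     fix y :: real assume y: "y \<in> {-pi<..<pi}" "\<bar>y - 0\<bar> < d"
     have "w y - U G y \<le> w 0 - U G 0" using z(2)[of y] y z0 by auto
     moreover have "U G y - U G 0 \<le> - ((kink - k') * \<bar>y\<bar>)"
      using d(3)[of y] y by (auto simp: abs_le_iff algebra_simps)
     moreover have "(kink - k') * y \<le> (kink - k') * \<bar>y\<bar>" using k' by (intro mult_left_mono) auto
     ultimately have "w y \<le> w 0 + - ((kink - k') * y)" by linarith
     then show "w y \<le> w 0 + - (kink - k') * (y - 0) + 0 / 2 * (y - 0)\<^sup>2" by (simp add: algebra_simps)
    qed auto
    then have "\<Omega> * (kink - k') + lam * w 0 - 1 \<le> 0" using k' by (simp add: pde_eq)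
    then show ?thesis using k'(3) by (simp add: algebra_simps)
   qed
   then have "lam * w 0 - 1 \<le> - \<Omega> * kink" by (rule field_le_epsilon)
   then have "lam * w 0 \<le> lam * U G 0" using lam_U_0 by simp
   then show ?thesis using lam_pos z0 by simp
  qed
 qed
 then show ?thesis using z(2)[OF x] by auto
qed

text \<open>\<open>U G\<close> itself cannot be a test function from below at its kink; the smooth
  cut profiles lie below \<open>w\<close> and converge to it uniformly.\<close>

lemma U_le_viscosity:
 assumes w: "viscosity_solution \<gamma> \<Omega> lam w" and x: "x \<in> {-pi..pi}"
 shows "U G x \<le> w x"
proof (rule field_le_epsilon)
 fix \<kappa> :: real assume k: "\<kappa> > 0"
 from cut_U_tendsto[OF G k] obtain e0 where e0: "e0 > 0"
  "\<And>e H H1 x. 0 < e ==> e < e0 ==> profile (cutoff e) H H1 ==> x\<in>{-pi..pi} ==> \<bar>U H x - U G x\<bar> \<le> \<kappa>" by blast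
 define e where "e = min e0 pi / 2"
 have e: "0 < e" "e < e0" "e < pi" using e0(1) by (auto simp: e_def min_def)
 from profile_cutoff_exists[OF e(1)] obtain H H1 where H: "profile (cutoff e) H H1" by blast
 have "U H x \<le> w x" by (rule cut_profile_le_viscosity[OF e(1,3) H w x])
 moreover have "\<bar>U H x - U G x\<bar> \<le> \<kappa>" by (rule e0(2)[OF e(1,2) H x])
 ultimately show "U G x \<le> w x + \<kappa>" by linarith
qed

end

end

lemma viscosity_solution_cong:
 assumes "\<And>x. x \<in> {-pi..pi} ==> u x = w x"
 shows "viscosity_solution \<gamma> \<Omega> lam u = viscosity_solution \<gamma> \<Omega> lam w"
proof -
 have e: "u x = w x" if "x \<in> {-pi<..<pi}" for x using assms[of x] that by auto
 have "continuous_on {-pi..pi} u = continuous_on {-pi..pi} w" using assms by (intro continuous_on_cong) auto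
 moreover have "u pi = w pi" "u (-pi) = w (-pi)" using assms by auto
 ultimately show ?thesis unfolding viscosity_solution_def using e by simp
qed

section \<open>Ito integrals on grids\<close>

locale brownian_space = prob_space M for M :: "'a measure" +
 fixes F :: "real => 'a measure" and W :: "real => 'a => real"
 assumes filt: "time_filtration M F" and bm: "brownian_motion M F W"
begin

lemma subalg: "subalgebra M (F t)"
 using filt by (simp add: time_filtration_def)

lemma space_F [simp]: "space (F t) = space M"
 using subalg[of t] by (simp add: subalgebra_def)

lemma measurable_F_M: "f \<in> measurable (F t) N ==> f \<in> measurable M N"
 by (rule measurable_from_subalg[OF subalg])

lemma measurable_F_mono: "0 \<le> s ==> s \<le> t ==> f \<in> measurable (F s) N ==> f \<in> measurable (F t) N"
 by (rule measurable_from_subalg[of "F t" "F s"])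
  (use filt in \<open>auto simp: time_filtration_def subalgebra_def\<close>)

lemma W_measurable: "0 \<le> s ==> s \<le> t ==> W s \<in> borel_measurable (F t)"
 by (rule measurable_F_mono[of s]) (use bm in \<open>auto simp: brownian_motion_def\<close>)

lemma W_measurable_M [measurable]: "0 \<le> s ==> W s \<in> borel_measurable M"
 using measurable_F_M[OF W_measurable[of s s]] by simp

lemma W_continuous: "w \<in> space M ==> continuous_on {0..} (%t. W t w)"
 using bm by (simp add: brownian_motion_def)

lemma W_0: "w \<in> space M ==> W 0 w = 0"
 using bm by (simp add: brownian_motion_def)

lemma increment_distributed:
 "0 \<le> s ==> s < t ==> distributed M lborel (%w. W t w - W s w) (%x. ennreal (normal_density 0 (sqrt (t - s)) x))"
 using bm by (simp add: brownian_motion_def)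

text \<open>The definition of Brownian motion gives the product rule only on events of
  \<open>F s\<close> against preimages under the increment. Both families are stable under
  intersection, so the rule passes to the generated sigma algebras.\<close>

lemma increment_indep:
 fixes \<xi> :: "'a => real"
 assumes st: "0 \<le> s" "s < t" and \<xi>: "\<xi> \<in> borel_measurable (F s)"
 shows "indep_var borel \<xi> borel (%w. W t w - W s w)"
proof -
 let ?D = "%w. W t w - W s w"
 have D: "?D \<in> borel_measurable M" using st by (intro borel_measurable_diff W_measurable_M) auto
 have \<xi>M: "\<xi> \<in> borel_measurable M" by (rule measurable_F_M[OF \<xi>])
 let ?A = "{\<xi> -` A \<inter> space M |A. A \<in> sets borel}" and ?B = "{?D -` A \<inter> space M |A. A \<in> sets borel}"
 have "indep_set ?A ?B"
  unfolding indep_sets2_eq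
 proof (intro conjI ballI)
  show "?A \<subseteq> events" "?B \<subseteq> events" using \<xi>M D by (auto intro: measurable_sets)
  fix a b assume "a \<in> ?A" "b \<in> ?B"
  then obtain A B where A: "A \<in> sets borel" "a = \<xi> -` A \<inter> space M" and B: "B \<in> sets borel" "b = ?D -` B \<inter> space M" by auto
  have "a \<in> sets (F s)" using measurable_sets[OF \<xi> A(1)] A(2) by simp
  moreover have "b = {w\<in>space M. W t w - W s w \<in> B}" using B by auto
  ultimately show "prob (a \<inter> b) = prob a * prob b"
   using bm st B(1) unfolding brownian_motion_def by blast
 qed
 then have "indep_set (sigma_sets (space M) ?A) (sigma_sets (space M) ?B)"
 proof (rule indep_set_sigma_sets)
  show "Int_stable ?A"
  proof (rule Int_stableI)
   fix a b assume "a \<in> ?A" "b \<in> ?A"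
   then obtain A B where "A \<in> sets borel" "B \<in> sets borel" "a = \<xi> -` A \<inter> space M" "b = \<xi> -` B \<inter> space M" by auto
   then show "a \<inter> b \<in> ?A" by (auto intro!: exI[of _ "A \<inter> B"])
  qed
  show "Int_stable ?B"
  proof (rule Int_stableI)
   fix a b assume "a \<in> ?B" "b \<in> ?B"
   then obtain A B where "A \<in> sets borel" "B \<in> sets borel" "a = ?D -` A \<inter> space M" "b = ?D -` B \<inter> space M" by auto
   then show "a \<inter> b \<in> ?B" by (auto intro!: exI[of _ "A \<inter> B"])
  qed
 qed
 then show ?thesis unfolding indep_var_eq using \<xi>M D by simp
qed

lemma increment_mult:
 fixes \<xi> :: "'a => real" and g :: "real => real"
 assumes st: "0 \<le> s" "s < t" and \<xi>: "\<xi> \<in> borel_measurable (F s)" "integrable M \<xi>"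
  and g: "g \<in> borel_measurable borel" "integrable M (%w. g (W t w - W s w))"
 shows "integrable M (%w. \<xi> w * g (W t w - W s w))"
  "expectation (%w. \<xi> w * g (W t w - W s w)) = expectation \<xi> * expectation (%w. g (W t w - W s w))"
proof -
 have "indep_var borel (id \<circ> \<xi>) borel (g \<circ> (%w. W t w - W s w))"
  by (rule indep_var_compose[OF increment_indep[OF st \<xi>(1)]]) (use g in auto)
 then have i: "indep_var borel \<xi> borel (%w. g (W t w - W s w))" by (simp add: comp_def)
 show "integrable M (%w. \<xi> w * g (W t w - W s w))" by (rule indep_var_integrable[OF i \<xi>(2) g(2)])
 show "expectation (%w. \<xi> w * g (W t w - W s w)) = expectation \<xi> * expectation (%w. g (W t w - W s w))"
  by (rule indep_var_lebesgue_integral[OF i \<xi>(2) g(2)])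
qed

text \<open>An increment is \<open>sqrt (t - s)\<close> times a standard normal variable. Pulling
  the scale out of the density lets every moment bound be proved once, for the standard normal
  law.\<close>

lemma increment_scaling:
 fixes g :: "real => real"
 assumes st: "0 \<le> s" "s < t" and g: "g \<in> borel_measurable borel"
 shows "integrable M (%w. g (W t w - W s w)) \<longleftrightarrow> integrable lborel (%x. std_normal_density x * g (sqrt (t - s) * x))"
  "expectation (%w. g (W t w - W s w)) = (\<integral>x. std_normal_density x * g (sqrt (t - s) * x) \<partial>lborel)"
proof -
 define \<sigma> where "\<sigma> = sqrt (t - s)"
 have \<sigma>: "\<sigma> > 0" using st by (simp add: \<sigma>_def)
 have sc: "normal_density 0 \<sigma> (\<sigma> * x) = std_normal_density x / \<sigma>" for x
  using \<sigma> by (simp add: normal_density_def power_mult_distrib real_sqrt_mult field_simps)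
 note d = increment_distributed[OF st, folded \<sigma>_def]
 have "integrable M (%w. g (W t w - W s w)) \<longleftrightarrow> integrable lborel (%x. normal_density 0 \<sigma> x * g x)"
  by (rule distributed_integrable[OF d, symmetric]) (use g in auto)
 also have "\<dots> \<longleftrightarrow> integrable lborel (%x. normal_density 0 \<sigma> (0 + \<sigma> * x) * g (0 + \<sigma> * x))"
  using lborel_integrable_real_affine_iff[of \<sigma> "%x. normal_density 0 \<sigma> x * g x" 0] \<sigma> by simp
 also have "\<dots> \<longleftrightarrow> integrable lborel (%x. (std_normal_density x * g (\<sigma> * x)) / \<sigma>)" by (simp add: sc)
 also have "\<dots> \<longleftrightarrow> integrable lborel (%x. std_normal_density x * g (\<sigma> * x))"
 proof
  show "integrable lborel (%x. std_normal_density x * g (\<sigma> * x))"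
   if "integrable lborel (%x. (std_normal_density x * g (\<sigma> * x)) / \<sigma>)"
   using integrable_mult_right[OF that, of \<sigma>] \<sigma> by simp
 qed auto
 finally show "integrable M (%w. g (W t w - W s w)) \<longleftrightarrow> integrable lborel (%x. std_normal_density x * g (sqrt (t - s) * x))"
  by (simp add: \<sigma>_def)
 have "expectation (%w. g (W t w - W s w)) = (\<integral>x. normal_density 0 \<sigma> x * g x \<partial>lborel)"
  by (rule distributed_integral[OF d, symmetric]) (use g in auto)
 also have "\<dots> = \<bar>\<sigma>\<bar> *\<^sub>R (\<integral>x. normal_density 0 \<sigma> (0 + \<sigma> * x) * g (0 + \<sigma> * x) \<partial>lborel)"
  by (rule lborel_integral_real_affine) (use \<sigma> in auto)
 also have "\<dots> = (\<integral>x. std_normal_density x * g (\<sigma> * x) \<partial>lborel)"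
  using \<sigma> by (simp add: sc)
 finally show "expectation (%w. g (W t w - W s w)) = (\<integral>x. std_normal_density x * g (sqrt (t - s) * x) \<partial>lborel)"
  by (simp add: \<sigma>_def)
qed

lemma increment_power:
 assumes st: "0 \<le> s" "s < t"
 shows "integrable M (%w. (W t w - W s w) ^ k)"
  "expectation (%w. (W t w - W s w) ^ (2 * k)) = (t - s) ^ k * (fact (2 * k) / (2 ^ k * fact k))"
  "expectation (%w. W t w - W s w) = 0"
proof -
 have eq: "std_normal_density x * (sqrt (t - s) * x) ^ k = sqrt (t - s) ^ k * (std_normal_density x * x ^ k)" for x k
  by (simp add: power_mult_distrib)
 show "integrable M (%w. (W t w - W s w) ^ k)"
  by (subst increment_scaling(1)[OF st, of "%x. x ^ k"]) (auto simp: eq intro!: integrable_mult_right integrable_std_normal_moment)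
 show "expectation (%w. (W t w - W s w) ^ (2 * k)) = (t - s) ^ k * (fact (2 * k) / (2 ^ k * fact k))"
 proof -
  have "sqrt (t - s) ^ (2 * k) = (t - s) ^ k" using st by (simp add: power_mult)
  then show ?thesis
   by (subst increment_scaling(2)[OF st, of "%x. x ^ (2 * k)"]) (simp_all only: eq integral_mult_right_zero integral_std_normal_moment_even, simp_all)
 qed
 show "expectation (%w. W t w - W s w) = 0"
 proof -
  have "std_normal_density x * (sqrt (t - s) * x) = sqrt (t - s) * (std_normal_density x * x)" for x by simp
  moreover have "(\<integral>x. std_normal_density x * x \<partial>lborel) = 0"
   using has_bochner_integral_integral_eq[OF std_normal_moment_odd[of 0]] by simp
  ultimately show ?thesis
   by (subst increment_scaling(2)[OF st, of "%x. x"]) (simp_all only: integral_mult_right_zero, simp_all)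
 qed
qed

lemma increment_moments:
 assumes st: "0 \<le> s" "s < t"
 shows "expectation (%w. (W t w - W s w)\<^sup>2) = t - s" "expectation (%w. (W t w - W s w) ^ 4) = 3 * (t - s)\<^sup>2"
proof -
 show "expectation (%w. (W t w - W s w)\<^sup>2) = t - s"
  using increment_power(2)[OF st, of 1] by simp
 show "expectation (%w. (W t w - W s w) ^ 4) = 3 * (t - s)\<^sup>2"
  using increment_power(2)[OF st, of 2] by (simp add: fact_numeral)
qed

text \<open>Interpolation between the second and the fourth moment by the arithmetic-geometric mean
  inequality. The weight \<open>sqrt (t - s)\<close> makes both contributions of order 3/2, and
  their sum is \<open>(1 + 3) / 2 = 2\<close> times \<open>(t - s) * sqrt (t - s)\<close>.\<close>

lemma increment_abs_cube:
 assumes st: "0 \<le> s" "s < t"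
 shows "integrable M (%w. \<bar>W t w - W s w\<bar> ^ 3)"
  "expectation (%w. \<bar>W t w - W s w\<bar> ^ 3) \<le> 2 * (t - s) * sqrt (t - s)"
proof -
 let ?D = "%w. W t w - W s w" and ?q = "sqrt (t - s)"
 have q: "?q > 0" "?q * ?q = t - s" using st by auto
 have i: "integrable M (%w. ?D w ^ 2)" "integrable M (%w. ?D w ^ 4)" by (intro increment_power st)+
 have le: "\<bar>x\<bar> ^ 3 \<le> (?q * x ^ 2 + x ^ 4 / ?q) / 2" for x :: real
 proof -
  have "0 \<le> x\<^sup>2 * (?q - \<bar>x\<bar>)\<^sup>2 / ?q" using q by auto
  also have "\<dots> = ?q * x ^ 2 + x ^ 4 / ?q - 2 * \<bar>x\<bar> ^ 3"
   using q by (simp add: power2_eq_square power3_eq_cube power4_eq_xxxx field_simps abs_mult_self_eq)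
  finally show ?thesis by simp
 qed
 have j: "integrable M (%w. (?q * ?D w ^ 2 + ?D w ^ 4 / ?q) / 2)" using i by auto
 show k: "integrable M (%w. \<bar>?D w\<bar> ^ 3)"
 proof (rule Bochner_Integration.integrable_bound[OF j])
  show "AE w in M. norm (\<bar>?D w\<bar> ^ 3) \<le> norm ((?q * ?D w ^ 2 + ?D w ^ 4 / ?q) / 2)"
  proof (rule AE_I2)
   fix w
   show "norm (\<bar>?D w\<bar> ^ 3) \<le> norm ((?q * ?D w ^ 2 + ?D w ^ 4 / ?q) / 2)"
    unfolding real_norm_def using le[of "?D w"] by (intro order.trans[OF _ abs_ge_self]) simp
  qed
 qed (use st in \<open>auto intro!: borel_measurable_power borel_measurable_abs borel_measurable_diff W_measurable_M\<close>)
 have "expectation (%w. \<bar>?D w\<bar> ^ 3) \<le> expectation (%w. (?q * ?D w ^ 2 + ?D w ^ 4 / ?q) / 2)"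
  by (rule integral_mono[OF k j le])
 also have "\<dots> = (?q * (t - s) + 3 * (t - s)\<^sup>2 / ?q) / 2"
  using i increment_moments[OF st] by simp
 also have "\<dots> = 2 * (t - s) * ?q"
 proof -
  have "(t - s)\<^sup>2 / ?q = (t - s) * ?q" using q by (simp add: power2_eq_square field_simps)
  then have "3 * (t - s)\<^sup>2 / ?q = 3 * ((t - s) * ?q)" by simp
  then show ?thesis by simp
 qed
 finally show "expectation (%w. \<bar>?D w\<bar> ^ 3) \<le> 2 * (t - s) * ?q" .
qed

text \<open>A martingale difference argument on a grid: everything up to cell \<open>m\<close>,
  including the coefficient, is \<open>F (b m)\<close>-measurable and independent of the next
  increment, whose image under \<open>g m\<close> has mean zero, so cross terms vanish. It serves
  for \<open>g = id\<close> and for the compensated squares of increments. Cells of length zero are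
  allowed because grids will be clamped at a time. Measurability of a coefficient is asked on
  nondegenerate cells only, as a clamped cell may sit before the time at which its coefficient is
  known.\<close>

lemma orthogonal_sum:
 fixes b :: "nat => real" and \<zeta> :: "nat => 'a => real" and g :: "nat => real => real"
 defines "d \<equiv> %i w. g i (W (b (Suc i)) w - W (b i) w)"
 assumes b: "0 \<le> b 0" "\<And>i. i < n ==> b i \<le> b (Suc i)"
  and \<zeta>: "\<And>i. i < n ==> b i < b (Suc i) ==> \<zeta> i \<in> borel_measurable (F (b i))"
  and \<zeta>B: "\<And>i w. i < n ==> w \<in> space M ==> \<bar>\<zeta> i w\<bar> \<le> B"
  and g: "\<And>i. i < n ==> g i \<in> borel_measurable borel" and g0: "\<And>i. i < n ==> b i = b (Suc i) ==> g i 0 = 0"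
  and int: "\<And>i. i < n ==> b i < b (Suc i) ==> integrable M (%w. (d i w)\<^sup>2)"
  and mean: "\<And>i. i < n ==> b i < b (Suc i) ==> expectation (d i) = 0"
 shows "(%w. \<Sum>i<n. \<zeta> i w * d i w) \<in> borel_measurable (F (b n))"
  and "integrable M (%w. (\<Sum>i<n. \<zeta> i w * d i w)\<^sup>2)"
  and "expectation (%w. (\<Sum>i<n. \<zeta> i w * d i w)\<^sup>2) = (\<Sum>i<n. expectation (%w. (\<zeta> i w * d i w)\<^sup>2))"
  and "\<And>\<eta> C. \<eta> \<in> borel_measurable (F (b 0)) ==> (\<And>w. w \<in> space M ==> \<bar>\<eta> w\<bar> \<le> C) ==>
   expectation (%w. \<eta> w * (\<Sum>i<n. \<zeta> i w * d i w)) = 0"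
proof -
 have L1: "integrable M f" if "f \<in> borel_measurable M" "integrable M (%w. (f w)\<^sup>2)" for f :: "'a => real"
  by (rule square_integrable_imp_integrable[OF that(1)]) (use that in auto)
 have bn: "m \<le> n ==> 0 \<le> b m \<and> b 0 \<le> b m" for m
 proof (induction m)
  case (Suc m) then show ?case using b(2)[of m] by auto
 qed (use b in auto)
 let ?S = "%m w. \<Sum>i<m. \<zeta> i w * d i w"
 have "m \<le> n ==> ?S m \<in> borel_measurable (F (b m)) \<and> integrable M (%w. (?S m w)\<^sup>2) \<and>
   expectation (%w. (?S m w)\<^sup>2) = (\<Sum>i<m. expectation (%w. (\<zeta> i w * d i w)\<^sup>2)) \<and>
   (\<forall>\<eta> C. \<eta> \<in> borel_measurable (F (b 0)) --> (\<forall>w\<in>space M. \<bar>\<eta> w\<bar> \<le> C) --> expectation (%w. \<eta> w * ?S m w) = 0)" for m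
 proof (induction m)
  case 0 show ?case by simp
 next
  case (Suc m)
  then have m: "m < n" by auto
  note IH = Suc.IH[OF less_imp_le[OF m]]
  have Sm: "?S m \<in> borel_measurable (F (b m))" and Si: "integrable M (%w. (?S m w)\<^sup>2)" using IH by auto
  have bm0: "0 \<le> b m" "b 0 \<le> b m" using bn[of m] m by auto
  show ?case
  proof (cases "b m = b (Suc m)")
   case True
   have dz: "d m w = 0" for w unfolding d_def using g0[OF m True] True by simp
   show ?thesis using IH True by (simp add: dz)
  next
   case False
   then have lt: "b m < b (Suc m)" using b(2)[OF m] by auto
   let ?X = "%w. \<zeta> m w * d m w"
   have dF: "d m \<in> borel_measurable (F (b (Suc m)))"
    unfolding d_def using g[OF m] W_measurable[of "b m" "b (Suc m)"] W_measurable[of "b (Suc m)" "b (Suc m)"] bm0 lt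
    by (intro measurable_compose[OF _ g[OF m]] borel_measurable_diff) auto
   have \<zeta>F: "\<zeta> m \<in> borel_measurable (F (b m))" by (rule \<zeta>[OF m lt])
   have \<zeta>F': "\<zeta> m \<in> borel_measurable (F (b (Suc m)))" "?S m \<in> borel_measurable (F (b (Suc m)))"
    using measurable_F_mono[of "b m" "b (Suc m)"] bm0 lt \<zeta>F Sm by auto
   have meas: "?S (Suc m) \<in> borel_measurable (F (b (Suc m)))"
    using \<zeta>F' dF by simp
   have \<zeta>b: "\<bar>\<zeta> m w\<bar> \<le> B" if "w \<in> space M" for w using \<zeta>B[OF m that] .
   have dM: "d m \<in> borel_measurable M" "\<zeta> m \<in> borel_measurable M" "?S m \<in> borel_measurable M"
    using measurable_F_M[OF dF] measurable_F_M[OF \<zeta>F] measurable_F_M[OF Sm] by auto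
   have d2: "integrable M (%w. (d m w)\<^sup>2)" by (rule int[OF m lt])
   have di: "integrable M (d m)" by (rule L1[OF dM(1) d2])
   have mult0: "integrable M (%w. \<xi> w * d m w)" "expectation (%w. \<xi> w * d m w) = 0"
    if "\<xi> \<in> borel_measurable (F (b m))" "integrable M \<xi>" for \<xi>
    using increment_mult[OF bm0(1) lt that g[OF m]] di mean[OF m lt] unfolding d_def by auto
   have X2: "integrable M (%w. (?X w)\<^sup>2)"
   proof (rule Bochner_Integration.integrable_bound)
    show "integrable M (%w. B\<^sup>2 * (d m w)\<^sup>2)" using d2 by auto
    show "AE w in M. norm ((?X w)\<^sup>2) \<le> norm (B\<^sup>2 * (d m w)\<^sup>2)"
    proof (rule AE_I2)
     fix w assume w: "w \<in> space M"
     have "(\<zeta> m w)\<^sup>2 \<le> B\<^sup>2" using power_mono[OF \<zeta>b[OF w], of 2] by simp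
     then have "(\<zeta> m w)\<^sup>2 * (d m w)\<^sup>2 \<le> B\<^sup>2 * (d m w)\<^sup>2" by (rule mult_right_mono) simp
     then show "norm ((?X w)\<^sup>2) \<le> norm (B\<^sup>2 * (d m w)\<^sup>2)" by (simp add: power_mult_distrib)
    qed
   qed (use dM in measurable)
   have S\<zeta>: "integrable M (%w. ?S m w * \<zeta> m w)"
   proof (rule Bochner_Integration.integrable_bound)
    show "integrable M (%w. B * ?S m w)" using L1[OF dM(3) Si] by auto
    show "AE w in M. norm (?S m w * \<zeta> m w) \<le> norm (B * ?S m w)"
    proof (rule AE_I2)
     fix w assume w: "w \<in> space M"
     have "\<bar>\<zeta> m w\<bar> \<le> \<bar>B\<bar>" using \<zeta>b[OF w] by auto
     from mult_right_mono[OF this, of "\<bar>?S m w\<bar>"]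
     show "norm (?S m w * \<zeta> m w) \<le> norm (B * ?S m w)" by (simp add: abs_mult mult.commute)
    qed
   qed (use dM in measurable)
   have cross: "integrable M (%w. (?S m w * \<zeta> m w) * d m w)" "expectation (%w. (?S m w * \<zeta> m w) * d m w) = 0"
    by (intro mult0 S\<zeta> borel_measurable_times Sm \<zeta>F)+
   have sq: "(?S (Suc m) w)\<^sup>2 = (?S m w)\<^sup>2 + 2 * ((?S m w * \<zeta> m w) * d m w) + (?X w)\<^sup>2" for w
    by (simp add: power2_sum algebra_simps)
   have i2: "integrable M (%w. (?S (Suc m) w)\<^sup>2)"
    unfolding sq using Si cross X2 by auto
   have e2: "expectation (%w. (?S (Suc m) w)\<^sup>2) = (\<Sum>i<Suc m. expectation (%w. (\<zeta> i w * d i w)\<^sup>2))"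
    unfolding sq using Si cross X2 IH by simp
   have "expectation (%w. \<eta> w * ?S (Suc m) w) = 0" if \<eta>: "\<eta> \<in> borel_measurable (F (b 0))" "\<forall>w\<in>space M. \<bar>\<eta> w\<bar> \<le> C" for \<eta> C
   proof -
    have \<eta>F: "\<eta> \<in> borel_measurable (F (b m))" using measurable_F_mono[OF b(1) bm0(2) \<eta>(1)] .
    have \<eta>\<zeta>: "integrable M (%w. \<eta> w * \<zeta> m w)"
    proof (rule integrable_const_bound[of _ "\<bar>C\<bar> * \<bar>B\<bar>"])
     show "AE w in M. norm (\<eta> w * \<zeta> m w) \<le> \<bar>C\<bar> * \<bar>B\<bar>"
     proof (rule AE_I2)
      fix w assume w: "w \<in> space M"
      have "\<bar>\<eta> w\<bar> \<le> \<bar>C\<bar>" "\<bar>\<zeta> m w\<bar> \<le> \<bar>B\<bar>" using \<eta>(2) \<zeta>b[OF w] w by force+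
      then show "norm (\<eta> w * \<zeta> m w) \<le> \<bar>C\<bar> * \<bar>B\<bar>" unfolding real_norm_def abs_mult by (intro mult_mono) auto
     qed
    qed (use measurable_F_M[OF \<eta>F] dM in measurable)
    have 1: "integrable M (%w. (\<eta> w * \<zeta> m w) * d m w)" "expectation (%w. (\<eta> w * \<zeta> m w) * d m w) = 0"
     by (intro mult0 \<eta>\<zeta> borel_measurable_times \<eta>F \<zeta>F)+
    have 2: "integrable M (%w. \<eta> w * ?S m w)"
    proof (rule Bochner_Integration.integrable_bound)
     show "integrable M (%w. C * ?S m w)" using L1[OF dM(3) Si] by auto
     show "AE w in M. norm (\<eta> w * ?S m w) \<le> norm (C * ?S m w)"
     proof (rule AE_I2)
      fix w assume w: "w \<in> space M"
      have "\<bar>\<eta> w\<bar> \<le> \<bar>C\<bar>" using \<eta>(2) w by force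
      from mult_right_mono[OF this, of "\<bar>?S m w\<bar>"]
      show "norm (\<eta> w * ?S m w) \<le> norm (C * ?S m w)" by (simp add: abs_mult)
     qed
    qed (use measurable_F_M[OF \<eta>F] dM in measurable)
    have "\<eta> w * ?S (Suc m) w = \<eta> w * ?S m w + (\<eta> w * \<zeta> m w) * d m w" for w by (simp add: algebra_simps)
    then have "expectation (%w. \<eta> w * ?S (Suc m) w) = expectation (%w. \<eta> w * ?S m w) + 0"
     using 1 2 by simp
    then show ?thesis using IH \<eta> by simp
   qed
   then show ?thesis using meas i2 e2 by blast
  qed
 qed
 from this[of n] show "?S n \<in> borel_measurable (F (b n))" "integrable M (%w. (?S n w)\<^sup>2)"
  "expectation (%w. (?S n w)\<^sup>2) = (\<Sum>i<n. expectation (%w. (\<zeta> i w * d i w)\<^sup>2))"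
  "\<And>\<eta> C. \<eta> \<in> borel_measurable (F (b 0)) ==> (\<And>w. w \<in> space M ==> \<bar>\<eta> w\<bar> \<le> C) ==>
   expectation (%w. \<eta> w * ?S n w) = 0" by blast+
qed

end

lemma simple_proc_eq:
 assumes inc: "\<And>i. i < n ==> tt i < tt (Suc i)"
 shows "j < n ==> tt j < r ==> r \<le> tt (Suc j) ==> simple_proc n tt \<xi> r w = \<xi> j w"
  and "r \<le> tt 0 ==> simple_proc n tt \<xi> r w = 0"
  and "tt n < r ==> simple_proc n tt \<xi> r w = 0"
proof -
 have mono: "tt i \<le> tt k" if "i \<le> k" "k \<le> n" for i k
  using that
 proof (induction k)
  case (Suc k)
  show ?case
  proof (cases "i = Suc k")
   case False
   then have "tt i \<le> tt k" using Suc by auto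
   then show ?thesis using inc[of k] Suc.prems by auto
  qed simp
 qed simp
 show "simple_proc n tt \<xi> r w = \<xi> j w" if j: "j < n" "tt j < r" "r \<le> tt (Suc j)"
 proof -
  have "\<xi> i w * indicator {tt i<..tt (Suc i)} r = (if i = j then \<xi> j w else 0)" if "i < n" for i
  proof (cases "i = j")
   case False
   then consider "i < j" | "j < i" by linarith
   then show ?thesis
   proof cases
    case 1 then show ?thesis using mono[of "Suc i" j] j by (auto simp: indicator_def)
   next
    case 2 then show ?thesis using mono[of "Suc j" i] j that by (auto simp: indicator_def)
   qed
  qed (use j in auto)
  then show ?thesis unfolding simple_proc_def using j(1) by simp
 qed
 show "simple_proc n tt \<xi> r w = 0" if r: "r \<le> tt 0"
  unfolding simple_proc_def
 proof (rule sum.neutral, rule ballI)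
  fix i assume "i \<in> {..<n}"
  then have "tt 0 \<le> tt i" using mono[of 0 i] by auto
  then show "\<xi> i w * indicator {tt i<..tt (Suc i)} r = 0" using r by (auto simp: indicator_def)
 qed
 show "simple_proc n tt \<xi> r w = 0" if r: "tt n < r"
  unfolding simple_proc_def
 proof (rule sum.neutral, rule ballI)
  fix i assume "i \<in> {..<n}"
  then have "tt (Suc i) \<le> tt n" using mono[of "Suc i" n] by auto
  then show "\<xi> i w * indicator {tt i<..tt (Suc i)} r = 0" using r by (auto simp: indicator_def)
 qed
qed

lemma square_sum_le: "(x + y :: real)\<^sup>2 \<le> 2 * x\<^sup>2 + 2 * y\<^sup>2"
 using zero_le_power2[of "x - y"] by (simp add: power2_sum power2_diff)

section \<open>Increments of simple and Ito integrals over one time cell\<close>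

context brownian_space
begin

text \<open>Progressive measurability speaks about times restricted to \<open>[0, T]\<close>.
  Projecting time onto that interval gives a jointly measurable function on the whole line, so the
  product measure theorems for Lebesgue measure apply.\<close>

lemma progressive_clamp:
 assumes X: "progressive M F X" and T: "0 \<le> T" and N: "(%w. w) \<in> measurable N (F T)"
 shows "(%(w, r). X (max 0 (min T r)) w) \<in> borel_measurable (N \<Otimes>\<^sub>M borel)"
proof -
 have 1: "(%(w, r). (max 0 (min T r), w)) \<in> measurable (N \<Otimes>\<^sub>M (borel :: real measure)) (restrict_space borel {0..T} \<Otimes>\<^sub>M F T)"
  unfolding split_beta'
 proof (rule measurable_Pair)
  show "(%x. max 0 (min T (snd x))) \<in> measurable (N \<Otimes>\<^sub>M borel) (restrict_space borel {0..T})"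
   by (rule measurable_restrict_space2) (use T in \<open>auto intro!: borel_measurable_max borel_measurable_min\<close>)
  show "fst \<in> measurable (N \<Otimes>\<^sub>M borel) (F T)"
   using measurable_compose[OF measurable_fst[of N borel] N] by simp
 qed
 have 2: "(%(t, w). X t w) \<in> borel_measurable (restrict_space borel {0..T} \<Otimes>\<^sub>M F T)"
  using X T by (simp add: progressive_def)
 from measurable_compose[OF 1 2] show ?thesis by (simp add: split_beta')
qed

lemma ident_M_F: "(%w. w) \<in> measurable M (F T)"
 by (rule measurable_F_M[of _ T]) simp

lemma progressive_measurable:
 assumes X: "progressive M F X" and T: "0 \<le> T"
 shows "X T \<in> borel_measurable (F T)"
proof -
 have "(%w. (w, T)) \<in> measurable (F T) (F T \<Otimes>\<^sub>M borel)" by measurable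
 from measurable_compose[OF this progressive_clamp[OF X T, of "F T"]] T show ?thesis by simp
qed

lemma progressive_path:
 assumes X: "progressive M F X" and T: "0 \<le> T" and w: "w \<in> space M"
 shows "(%r. X (max 0 (min T r)) w) \<in> borel_measurable borel"
proof -
 have "(%r. (w, r)) \<in> measurable borel (M \<Otimes>\<^sub>M borel)" using w by measurable
 from measurable_compose[OF this progressive_clamp[OF X T ident_M_F]] show ?thesis by simp
qed

lemma expectation_sq_le:
 fixes X :: "'a => real"
 assumes X: "X \<in> borel_measurable M" "integrable M (%w. (X w)\<^sup>2)"
 shows "(expectation X)\<^sup>2 \<le> expectation (%w. (X w)\<^sup>2)"
proof -
 have i: "integrable M X" by (rule square_integrable_imp_integrable[OF X])
 have "0 \<le> variance X" by (rule variance_positive)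
 also have "variance X = expectation (%w. (X w)\<^sup>2) - (expectation X)\<^sup>2" by (rule variance_eq[OF i X(2)])
 finally show ?thesis by simp
qed

text \<open>Freezing the integrand at \<eta> on \<open>(s, t]\<close> leaves again a simple
  integral, over a partition of \<open>[s, t]\<close> and with coefficients reduced by \<eta>.
  Orthogonality then gives the Ito isometry with equality, and mean zero against anything bounded
  and known at time \<open>s\<close>.\<close>

lemma simple_int_increment:
 fixes \<eta> :: "'a => real"
 assumes ok: "simple_ok M F n tt \<xi>" and st: "0 \<le> s" "s < t"
  and \<eta>: "\<eta> \<in> borel_measurable (F s)" "\<And>w. w \<in> space M ==> \<bar>\<eta> w\<bar> \<le> K"
 defines "R \<equiv> %w. simple_int W n tt \<xi> t w - simple_int W n tt \<xi> s w - \<eta> w * (W t w - W s w)"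
 shows "R \<in> borel_measurable M" "integrable M (%w. (R w)\<^sup>2)"
  "\<And>f C. f \<in> borel_measurable (F s) ==> (\<And>w. w \<in> space M ==> \<bar>f w\<bar> \<le> C) ==> expectation (%w. f w * R w) = 0"
  "ennreal (expectation (%w. (R w)\<^sup>2)) =
   (\<integral>\<^sup>+w. (\<integral>\<^sup>+r\<in>{s<..t}. ennreal ((simple_proc n tt \<xi> r w - \<eta> w)\<^sup>2) \<partial>lborel) \<partial>M)"
proof -
 define a where "a x = max s (min t x)" for x
 \<comment> \<open>The partition points \<open>tt 0, ..., tt n\<close> projected to
   \<open>[s, t]\<close>, with \<open>s\<close> put in front and \<open>t\<close> at the end. This
   makes \<open>n + 2\<close> cells; on the first and the last one the simple process is 0, so there
   the coefficient is just \<open>- \<eta>\<close>.\<close>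
 define b where "b i = (if i = 0 then s else if i \<le> Suc n then a (tt (i - 1)) else t)" for i
 define \<zeta>' where "\<zeta>' i w = (if 1 \<le> i \<and> i \<le> n then \<xi> (i - 1) w else 0)" for i w
 define \<zeta> where "\<zeta> i w = \<zeta>' i w - \<eta> w" for i w
 from ok obtain B where tt0: "0 \<le> tt 0" and inc: "\<And>i. i < n ==> tt i < tt (Suc i)"
  and \<xi>: "\<And>i. i < n ==> \<xi> i \<in> borel_measurable (F (tt i))"
  and B: "\<And>i w. i < n ==> w \<in> space M ==> \<bar>\<xi> i w\<bar> \<le> B" unfolding simple_ok_def by blast
 have ttp: "i \<le> n ==> 0 \<le> tt i" for i
 proof (induction i)
  case (Suc i) then show ?case using inc[of i] by auto
 qed (use tt0 in auto)
 have am: "a x \<le> a y" if "x \<le> y" for x y using that by (auto simp: a_def)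
 have as: "s \<le> a x" "a x \<le> t" for x using st by (auto simp: a_def)
 have b0: "b 0 = s" and bS: "b (Suc i) = (if i \<le> n then a (tt i) else t)" for i by (auto simp: b_def)
 have bend: "b (Suc (Suc n)) = t" by (simp add: b_def)
 have bmono: "b i \<le> b (Suc i)" if i: "i < Suc (Suc n)" for i
 proof (cases i)
  case 0 then show ?thesis using as by (simp add: b0 bS)
 next
  case (Suc j)
  show ?thesis
  proof (cases "j < n")
   case True then show ?thesis using am[of "tt j" "tt (Suc j)"] inc[OF True] by (simp add: Suc bS)
  next
   case False then show ?thesis using as i by (simp add: Suc bS)
  qed
 qed
 have bge: "s \<le> b i" for i using as st by (auto simp: b_def)
 have val: "simple_proc n tt \<xi> r w - \<eta> w = \<zeta> i w" if i: "i < Suc (Suc n)" and r: "b i < r" "r \<le> b (Suc i)" for i r w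
 proof (cases i)
  case 0
  then have "r \<le> tt 0" using r by (auto simp: b0 bS a_def)
  then show ?thesis using simple_proc_eq(2)[of n tt, OF inc] 0 by (simp add: \<zeta>_def \<zeta>'_def)
 next
  case (Suc j)
  show ?thesis
  proof (cases "j < n")
   case True
   then have "tt j < r" "r \<le> tt (Suc j)" using r by (auto simp: Suc bS a_def split: if_splits)
   then show ?thesis using simple_proc_eq(1)[of n tt, OF inc True] True Suc by (simp add: \<zeta>_def \<zeta>'_def)
  next
   case False
   then have j: "j = n" using i Suc by auto
   then have "tt n < r" using r by (auto simp: Suc bS a_def split: if_splits)
   then show ?thesis using simple_proc_eq(3)[of n tt, OF inc] j Suc by (simp add: \<zeta>_def \<zeta>'_def)
  qed
 qed
 have \<zeta>F: "\<zeta> i \<in> borel_measurable (F (b i))" if i: "i < Suc (Suc n)" "b i < b (Suc i)" for i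
 proof -
  have e: "\<eta> \<in> borel_measurable (F (b i))" by (rule measurable_F_mono[OF st(1) bge \<eta>(1)])
  have "\<zeta>' i \<in> borel_measurable (F (b i))"
  proof (cases "1 \<le> i \<and> i \<le> n")
   case True
   then obtain j where j: "i = Suc j" "j < n" by (cases i) auto
   have "tt j \<le> b i" using i(2) j by (auto simp: bS a_def split: if_splits)
   then have "\<xi> j \<in> borel_measurable (F (b i))" using measurable_F_mono[OF ttp[of j] _ \<xi>[OF j(2)]] j by auto
   then show ?thesis using j by (simp add: \<zeta>'_def[abs_def])
  next
   case False then show ?thesis by (auto simp: \<zeta>'_def[abs_def])
  qed
  then show ?thesis unfolding \<zeta>_def[abs_def] using e by simp
 qed
 have \<zeta>B: "\<bar>\<zeta> i w\<bar> \<le> \<bar>B\<bar> + \<bar>K\<bar>" if "w \<in> space M" for i w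
 proof -
  have "\<bar>\<zeta>' i w\<bar> \<le> \<bar>B\<bar>"
  proof (cases "1 \<le> i \<and> i \<le> n")
   case True
   then have "i - 1 < n" by arith
   from B[OF this that] show ?thesis using True by (simp add: \<zeta>'_def)
  qed (auto simp: \<zeta>'_def)
  then show ?thesis using \<eta>(2)[OF that] unfolding \<zeta>_def by linarith
 qed
 have R_eq: "R w = (\<Sum>i<Suc (Suc n). \<zeta> i w * (W (b (Suc i)) w - W (b i) w))" for w
 proof -
  have step: "W (min t x) w - W (min s x) w = W (a x) w - W s w" for x
   using st by (auto simp: a_def min_def max_def)
  have "simple_int W n tt \<xi> t w - simple_int W n tt \<xi> s w =
   (\<Sum>i<n. \<xi> i w * ((W (min t (tt (Suc i))) w - W (min s (tt (Suc i))) w) - (W (min t (tt i)) w - W (min s (tt i)) w)))"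
   unfolding simple_int_def sum_subtractf[symmetric] by (rule sum.cong) (auto simp: algebra_simps)
  also have "\<dots> = (\<Sum>i<n. \<xi> i w * (W (a (tt (Suc i))) w - W (a (tt i)) w))" unfolding step by simp
  also have "\<dots> = (\<Sum>i<n. \<zeta>' (Suc i) w * (W (b (Suc (Suc i))) w - W (b (Suc i)) w))"
   by (rule sum.cong) (auto simp: \<zeta>'_def bS)
  also have "\<dots> = (\<Sum>i<Suc (Suc n). \<zeta>' i w * (W (b (Suc i)) w - W (b i) w))"
   unfolding sum.lessThan_Suc_shift[of _ "Suc n"] by (simp add: \<zeta>'_def)
  finally have 1: "simple_int W n tt \<xi> t w - simple_int W n tt \<xi> s w = (\<Sum>i<Suc (Suc n). \<zeta>' i w * (W (b (Suc i)) w - W (b i) w))" .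
  have 2: "W t w - W s w = (\<Sum>i<Suc (Suc n). W (b (Suc i)) w - W (b i) w)"
   using sum_lessThan_telescope[of "%i. W (b i) w" "Suc (Suc n)"] by (simp only: b0 bend)
  show ?thesis unfolding R_def 1 2 sum_distrib_left sum_subtractf[symmetric] \<zeta>_def
   by (rule sum.cong) (auto simp: algebra_simps)
 qed
 have bpos: "0 \<le> b i" for i using bge[of i] st by auto
 note orth = orthogonal_sum[where b = b and \<zeta> = \<zeta> and g = "%_ x. x" and n = "Suc (Suc n)" and B = "\<bar>B\<bar> + \<bar>K\<bar>",
   OF bpos bmono \<zeta>F \<zeta>B]
 have i2: "integrable M (%w. (W (b (Suc i)) w - W (b i) w)\<^sup>2)" if "b i < b (Suc i)" for i
  by (rule increment_power[OF bpos that])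
 have m0: "expectation (%w. W (b (Suc i)) w - W (b i) w) = 0" if "b i < b (Suc i)" for i
  by (rule increment_power(3)[OF bpos that])
 have "R \<in> borel_measurable (F (b (Suc (Suc n))))"
  unfolding R_eq by (rule orth(1)) (use i2 m0 in auto)
 then show "R \<in> borel_measurable M" by (rule measurable_F_M)
 show "integrable M (%w. (R w)\<^sup>2)"
  unfolding R_eq by (rule orth(2)) (use i2 m0 in auto)
 show "expectation (%w. f w * R w) = 0" if "f \<in> borel_measurable (F s)" "\<And>w. w \<in> space M ==> \<bar>f w\<bar> \<le> C" for f C
  unfolding R_eq by (rule orth(4)) (use i2 m0 that b0 in auto)
 have E: "expectation (%w. (R w)\<^sup>2) = (\<Sum>i<Suc (Suc n). expectation (%w. (\<zeta> i w * (W (b (Suc i)) w - W (b i) w))\<^sup>2))"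
  unfolding R_eq by (rule orth(3)) (use i2 m0 in auto)
 have \<zeta>M: "\<zeta> i \<in> borel_measurable M" if "i < Suc (Suc n)" for i
 proof -
  have "\<zeta>' i \<in> borel_measurable M"
  proof (cases "1 \<le> i \<and> i \<le> n")
   case True
   then have "\<xi> (i - 1) \<in> borel_measurable M" using measurable_F_M[OF \<xi>[of "i - 1"]] by auto
   then show ?thesis using True by (simp add: \<zeta>'_def[abs_def])
  next
   case False then show ?thesis by (auto simp: \<zeta>'_def[abs_def])
  qed
  then show ?thesis unfolding \<zeta>_def[abs_def] using measurable_F_M[OF \<eta>(1)] by simp
 qed
 have summand: "ennreal (expectation (%w. (\<zeta> i w * (W (b (Suc i)) w - W (b i) w))\<^sup>2)) =
   (\<integral>\<^sup>+w. (\<integral>\<^sup>+r\<in>{b i<..b (Suc i)}. ennreal ((simple_proc n tt \<xi> r w - \<eta> w)\<^sup>2) \<partial>lborel) \<partial>M)"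
  if i: "i < Suc (Suc n)" for i
 proof -
  have inner: "(\<integral>\<^sup>+r\<in>{b i<..b (Suc i)}. ennreal ((simple_proc n tt \<xi> r w - \<eta> w)\<^sup>2) \<partial>lborel) = ennreal ((\<zeta> i w)\<^sup>2 * (b (Suc i) - b i))" for w
  proof -
   have "(\<integral>\<^sup>+r\<in>{b i<..b (Suc i)}. ennreal ((simple_proc n tt \<xi> r w - \<eta> w)\<^sup>2) \<partial>lborel) = (\<integral>\<^sup>+r\<in>{b i<..b (Suc i)}. ennreal ((\<zeta> i w)\<^sup>2) \<partial>lborel)"
    by (rule nn_integral_cong) (use val[OF i] in \<open>auto simp: indicator_def\<close>)
   also have "\<dots> = ennreal ((\<zeta> i w)\<^sup>2) * emeasure lborel {b i<..b (Suc i)}" by (simp add: nn_integral_cmult_indicator)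
   also have "\<dots> = ennreal ((\<zeta> i w)\<^sup>2 * (b (Suc i) - b i))" using bmono[OF i] by (simp add: ennreal_mult)
   finally show ?thesis .
  qed
  have sqi: "integrable M (%w. (\<zeta> i w)\<^sup>2)"
  proof (rule integrable_const_bound[of _ "(\<bar>B\<bar> + \<bar>K\<bar>)\<^sup>2"])
   show "AE w in M. norm ((\<zeta> i w)\<^sup>2) \<le> (\<bar>B\<bar> + \<bar>K\<bar>)\<^sup>2"
   proof (rule AE_I2)
    fix w assume "w \<in> space M"
    from power_mono[OF \<zeta>B[OF this, of i], of 2] show "norm ((\<zeta> i w)\<^sup>2) \<le> (\<bar>B\<bar> + \<bar>K\<bar>)\<^sup>2" by simp
   qed
  qed (use \<zeta>M[OF i] in measurable)
  have "expectation (%w. (\<zeta> i w * (W (b (Suc i)) w - W (b i) w))\<^sup>2) = expectation (%w. (\<zeta> i w)\<^sup>2) * (b (Suc i) - b i)"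
  proof (cases "b i = b (Suc i)")
   case False
   then have lt: "b i < b (Suc i)" using bmono[OF i] by auto
   show ?thesis unfolding power_mult_distrib
    using increment_mult(2)[OF bpos lt _ sqi _ i2[OF lt]] \<zeta>F[OF i lt] increment_moments(1)[OF bpos lt] by simp
  qed simp
  also have "\<dots> = expectation (%w. (\<zeta> i w)\<^sup>2 * (b (Suc i) - b i))" by simp
  also have "ennreal \<dots> = (\<integral>\<^sup>+w. ennreal ((\<zeta> i w)\<^sup>2 * (b (Suc i) - b i)) \<partial>M)"
   using sqi bmono[OF i] by (intro nn_integral_eq_integral[symmetric]) auto
  finally show ?thesis unfolding inner .
 qed
 have spM: "(%(w, r). simple_proc n tt \<xi> r w) \<in> borel_measurable (M \<Otimes>\<^sub>M borel)"
  unfolding simple_proc_def split_beta'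
 proof (rule borel_measurable_sum)
  fix i assume "i \<in> {..<n}"
  then have [measurable]: "\<xi> i \<in> borel_measurable M" using measurable_F_M[OF \<xi>[of i]] by auto
  show "(%x. \<xi> i (fst x) * indicator {tt i<..tt (Suc i)} (snd x)) \<in> borel_measurable (M \<Otimes>\<^sub>M borel)"
   by measurable
 qed
 have \<eta>M [measurable]: "\<eta> \<in> borel_measurable M" by (rule measurable_F_M[OF \<eta>(1)])
 have jm: "(%(w, r). ennreal ((simple_proc n tt \<xi> r w - \<eta> w)\<^sup>2)) \<in> borel_measurable (M \<Otimes>\<^sub>M borel)"
  using spM unfolding split_beta' by measurable
 have im: "(%w. \<integral>\<^sup>+r\<in>A. ennreal ((simple_proc n tt \<xi> r w - \<eta> w)\<^sup>2) \<partial>lborel) \<in> borel_measurable M"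
  if [measurable]: "A \<in> sets borel" for A
  by (rule lborel.borel_measurable_nn_integral) (use jm in \<open>simp add: split_beta', measurable\<close>)
 have pm: "(%r. ennreal ((simple_proc n tt \<xi> r w - \<eta> w)\<^sup>2)) \<in> borel_measurable borel" if "w \<in> space M" for w
  unfolding simple_proc_def by measurable
 have path: "(\<Sum>i<m. \<integral>\<^sup>+r\<in>{b i<..b (Suc i)}. ennreal ((simple_proc n tt \<xi> r w - \<eta> w)\<^sup>2) \<partial>lborel)
   = (\<integral>\<^sup>+r\<in>{s<..b m}. ennreal ((simple_proc n tt \<xi> r w - \<eta> w)\<^sup>2) \<partial>lborel)"
  if "m \<le> Suc (Suc n)" and w: "w \<in> space M" for m w
  using that(1)
 proof (induction m)
  case 0 then show ?case by (simp add: b0)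
 next
  case (Suc m)
  have e: "{s<..b (Suc m)} = {s<..b m} \<union> {b m<..b (Suc m)}" using bge[of m] bmono[of m] Suc.prems by auto
  have "(\<integral>\<^sup>+r\<in>{s<..b (Suc m)}. ennreal ((simple_proc n tt \<xi> r w - \<eta> w)\<^sup>2) \<partial>lborel) =
    (\<integral>\<^sup>+r\<in>{s<..b m}. ennreal ((simple_proc n tt \<xi> r w - \<eta> w)\<^sup>2) \<partial>lborel) +
    (\<integral>\<^sup>+r\<in>{b m<..b (Suc m)}. ennreal ((simple_proc n tt \<xi> r w - \<eta> w)\<^sup>2) \<partial>lborel)"
   unfolding e by (rule nn_integral_disjoint_pair) (use pm[OF w] in auto)
  then show ?case using Suc by simp
 qed
 have "ennreal (expectation (%w. (R w)\<^sup>2)) = (\<Sum>i<Suc (Suc n). ennreal (expectation (%w. (\<zeta> i w * (W (b (Suc i)) w - W (b i) w))\<^sup>2)))"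
  unfolding E by (rule sum_ennreal[symmetric]) auto
 also have "\<dots> = (\<Sum>i<Suc (Suc n). \<integral>\<^sup>+w. (\<integral>\<^sup>+r\<in>{b i<..b (Suc i)}. ennreal ((simple_proc n tt \<xi> r w - \<eta> w)\<^sup>2) \<partial>lborel) \<partial>M)"
  by (rule sum.cong) (use summand in auto)
 also have "\<dots> = (\<integral>\<^sup>+w. (\<Sum>i<Suc (Suc n). \<integral>\<^sup>+r\<in>{b i<..b (Suc i)}. ennreal ((simple_proc n tt \<xi> r w - \<eta> w)\<^sup>2) \<partial>lborel) \<partial>M)"
  by (rule nn_integral_sum[symmetric]) (rule im, simp)
 also have "\<dots> = (\<integral>\<^sup>+w. (\<integral>\<^sup>+r\<in>{s<..t}. ennreal ((simple_proc n tt \<xi> r w - \<eta> w)\<^sup>2) \<partial>lborel) \<partial>M)"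
  by (rule nn_integral_cong) (simp only: path[OF order_refl] bend)
 finally show "ennreal (expectation (%w. (R w)\<^sup>2)) =
   (\<integral>\<^sup>+w. (\<integral>\<^sup>+r\<in>{s<..t}. ennreal ((simple_proc n tt \<xi> r w - \<eta> w)\<^sup>2) \<partial>lborel) \<partial>M)" .
qed

end

lemma ennreal_tendsto_zeroI:
 fixes f :: "nat => ennreal"
 assumes "\<And>e. e > 0 ==> \<forall>\<^sub>F n in sequentially. f n \<le> ennreal e"
 shows "f \<longlonglongrightarrow> 0"
proof (rule order_tendstoI)
 fix a :: ennreal assume "0 < a"
 then obtain b where b: "0 < b" "b < a" using dense by blast
 then obtain r where r: "b = ennreal r" "0 \<le> r" by (cases b) auto
 then have "0 < r" using b(1) by (simp add: ennreal_less_zero_iff)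
 from assms[OF this] show "\<forall>\<^sub>F n in sequentially. f n < a"
  by eventually_elim (use b r in auto)
qed auto

context brownian_space
begin

lemma simple_int_measurable:
 assumes ok: "simple_ok M F n tt \<xi>" and t: "0 \<le> t"
 shows "simple_int W n tt \<xi> t \<in> borel_measurable M"
proof -
 have inc: "\<And>i. i < n ==> tt i < tt (Suc i)" "0 \<le> tt 0" and \<xi>: "\<And>i. i < n ==> \<xi> i \<in> borel_measurable (F (tt i))"
  using ok by (auto simp: simple_ok_def)
 have ttp: "i \<le> n ==> 0 \<le> tt i" for i
 proof (induction i)
  case (Suc i) then show ?case using inc(1)[of i] by auto
 qed (use inc in auto)
 show ?thesis unfolding simple_int_def[abs_def]
 proof (rule borel_measurable_sum)
  fix i assume "i \<in> {..<n}"
  then have i: "i < n" by auto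
  have "0 \<le> tt i" "0 \<le> tt (Suc i)" using ttp[of i] ttp[of "Suc i"] i by auto
  then show "(%w. \<xi> i w * (W (min t (tt (Suc i))) w - W (min t (tt i)) w)) \<in> borel_measurable M"
   using t measurable_F_M[OF \<xi>[OF i]] by (intro borel_measurable_times borel_measurable_diff W_measurable_M) auto
 qed
qed

lemma ito_increment:
 assumes ito: "ito_integral M F W H Y" and HK: "\<And>t w. 0 \<le> t ==> w \<in> space M ==> \<bar>H t w\<bar> \<le> K"
  and st: "0 \<le> s" "s < t"
 defines "\<rho> \<equiv> %w. Y t w - Y s w - H s w * (W t w - W s w)"
 defines "J \<equiv> \<integral>\<^sup>+w. (\<integral>\<^sup>+r\<in>{s..t}. ennreal ((H r w - H s w)\<^sup>2) \<partial>lborel) \<partial>M"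
 shows "\<rho> \<in> borel_measurable M" "integrable M (%w. (\<rho> w)\<^sup>2)"
  "\<And>f C. f \<in> borel_measurable (F s) ==> (\<And>w. w \<in> space M ==> \<bar>f w\<bar> \<le> C) ==> expectation (%w. f w * \<rho> w) = 0"
  "ennreal (expectation (%w. (\<rho> w)\<^sup>2)) \<le> 4 * J"
proof -
 have t0: "0 \<le> t" using st by auto
 have prog: "progressive M F H" and Ym: "\<And>t. 0 \<le> t ==> Y t \<in> borel_measurable M"
  using ito by (auto simp: ito_integral_def)
 have "\<exists>n tt \<xi>. (\<forall>k. simple_ok M F (n k) (tt k) (\<xi> k)) \<and>
   ((%k. \<integral>\<^sup>+w. (\<integral>\<^sup>+r\<in>{0..t}. ennreal ((simple_proc (n k) (tt k) (\<xi> k) r w - H r w)\<^sup>2) \<partial>lborel) \<partial>M) \<longlongrightarrow> 0) sequentially \<and>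
   (\<forall>r\<in>{0..t}. ((%k. \<integral>\<^sup>+w. ennreal ((simple_int W (n k) (tt k) (\<xi> k) r w - Y r w)\<^sup>2) \<partial>M) \<longlongrightarrow> 0) sequentially)"
  using ito t0 unfolding ito_integral_def by blast
 then obtain n tt \<xi> where ok: "\<And>k. simple_ok M F (n k) (tt k) (\<xi> k)"
  and lim1: "((%k. \<integral>\<^sup>+w. (\<integral>\<^sup>+r\<in>{0..t}. ennreal ((simple_proc (n k) (tt k) (\<xi> k) r w - H r w)\<^sup>2) \<partial>lborel) \<partial>M) \<longlongrightarrow> 0) sequentially"
  and lim2: "\<And>r. r \<in> {0..t} ==> ((%k. \<integral>\<^sup>+w. ennreal ((simple_int W (n k) (tt k) (\<xi> k) r w - Y r w)\<^sup>2) \<partial>M) \<longlongrightarrow> 0) sequentially"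
  by blast
 have Hs: "H s \<in> borel_measurable (F s)" by (rule progressive_measurable[OF prog st(1)])
 have HsM [measurable]: "H s \<in> borel_measurable M" by (rule measurable_F_M[OF Hs])
 have Hsb: "\<And>w. w \<in> space M ==> \<bar>H s w\<bar> \<le> K" using HK st by auto
 show \<rho>M [measurable]: "\<rho> \<in> borel_measurable M"
  unfolding \<rho>_def using st t0 by (intro borel_measurable_diff borel_measurable_times HsM Ym W_measurable_M) auto
 define R where "R k w = simple_int W (n k) (tt k) (\<xi> k) t w - simple_int W (n k) (tt k) (\<xi> k) s w - H s w * (W t w - W s w)" for k w
 note R = simple_int_increment[OF ok st Hs Hsb, folded R_def]
 have RM [measurable]: "R k \<in> borel_measurable M" for k
  using R(1)[of k] by (simp add: R_def[abs_def])
 have R2: "integrable M (%w. (R k w)\<^sup>2)" for k using R(2)[of k] .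
 have R0: "expectation (%w. f w * R k w) = 0" if "f \<in> borel_measurable (F s)" "\<And>w. w \<in> space M ==> \<bar>f w\<bar> \<le> C" for f C k
  using R(3)[of f C k] that by simp
 have Rn: "(\<integral>\<^sup>+w. ennreal ((R k w)\<^sup>2) \<partial>M) =
   (\<integral>\<^sup>+w. (\<integral>\<^sup>+r\<in>{s<..t}. ennreal ((simple_proc (n k) (tt k) (\<xi> k) r w - H s w)\<^sup>2) \<partial>lborel) \<partial>M)" for k
  using R(4)[of k] R2[of k] by (subst nn_integral_eq_integral) auto
 define Hc where "Hc r w = H (max 0 (min t r)) w" for r w
 have Hcm [measurable]: "(%(w, r). Hc r w) \<in> borel_measurable (M \<Otimes>\<^sub>M borel)"
  unfolding Hc_def by (rule progressive_clamp[OF prog t0 ident_M_F])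
 have Hc: "Hc r w = H r w" if "0 \<le> r" "r \<le> t" for r w using that by (simp add: Hc_def)
 have spM [measurable]: "(%(w, r). simple_proc (n k) (tt k) (\<xi> k) r w) \<in> borel_measurable (M \<Otimes>\<^sub>M borel)" for k
  unfolding simple_proc_def split_beta'
 proof (rule borel_measurable_sum)
  fix i assume "i \<in> {..<n k}"
  then have "\<xi> k i \<in> borel_measurable (F (tt k i))" using ok[of k] by (auto simp: simple_ok_def)
  then have [measurable]: "\<xi> k i \<in> borel_measurable M" by (rule measurable_F_M)
  show "(%x. \<xi> k i (fst x) * indicator {tt k i<..tt k (Suc i)} (snd x)) \<in> borel_measurable (M \<Otimes>\<^sub>M borel)"
   by measurable
 qed
 define a where "a k = (\<integral>\<^sup>+w. (\<integral>\<^sup>+r\<in>{0..t}. ennreal ((simple_proc (n k) (tt k) (\<xi> k) r w - H r w)\<^sup>2) \<partial>lborel) \<partial>M)" for k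
 have a_eq: "a k = (\<integral>\<^sup>+w. (\<integral>\<^sup>+r\<in>{0..t}. ennreal ((simple_proc (n k) (tt k) (\<xi> k) r w - Hc r w)\<^sup>2) \<partial>lborel) \<partial>M)" for k
  unfolding a_def by (intro nn_integral_cong) (auto simp: indicator_def Hc)
 have J_eq: "J = (\<integral>\<^sup>+w. (\<integral>\<^sup>+r\<in>{s..t}. ennreal ((Hc r w - H s w)\<^sup>2) \<partial>lborel) \<partial>M)"
  unfolding J_def using st by (intro nn_integral_cong) (auto simp: indicator_def Hc)
 have Rle: "(\<integral>\<^sup>+w. ennreal ((R k w)\<^sup>2) \<partial>M) \<le> 2 * a k + 2 * J" for k
 proof -
  let ?P = "simple_proc (n k) (tt k) (\<xi> k)"
  have "(\<integral>\<^sup>+w. (\<integral>\<^sup>+r\<in>{s<..t}. ennreal ((?P r w - H s w)\<^sup>2) \<partial>lborel) \<partial>M) \<le>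
   (\<integral>\<^sup>+w. 2 * (\<integral>\<^sup>+r\<in>{0..t}. ennreal ((?P r w - Hc r w)\<^sup>2) \<partial>lborel) + 2 * (\<integral>\<^sup>+r\<in>{s..t}. ennreal ((Hc r w - H s w)\<^sup>2) \<partial>lborel) \<partial>M)"
  proof (rule nn_integral_mono)
   fix w assume w: "w \<in> space M"
   have [measurable]: "(%r. Hc r w) \<in> borel_measurable borel"
    unfolding Hc_def by (rule progressive_path[OF prog t0 w])
   have [measurable]: "(%r. ?P r w) \<in> borel_measurable borel" unfolding simple_proc_def by measurable
   have "(\<integral>\<^sup>+r\<in>{s<..t}. ennreal ((?P r w - H s w)\<^sup>2) \<partial>lborel) \<le>
    (\<integral>\<^sup>+r. 2 * (ennreal ((?P r w - Hc r w)\<^sup>2) * indicator {0..t} r) + 2 * (ennreal ((Hc r w - H s w)\<^sup>2) * indicator {s..t} r) \<partial>lborel)"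
   proof (rule nn_integral_mono)
    fix r
    show "ennreal ((?P r w - H s w)\<^sup>2) * indicator {s<..t} r \<le>
     2 * (ennreal ((?P r w - Hc r w)\<^sup>2) * indicator {0..t} r) + 2 * (ennreal ((Hc r w - H s w)\<^sup>2) * indicator {s..t} r)"
    proof (cases "r \<in> {s<..t}")
     case True
     have "(?P r w - H s w)\<^sup>2 \<le> 2 * (?P r w - Hc r w)\<^sup>2 + 2 * (Hc r w - H s w)\<^sup>2"
      using square_sum_le[of "?P r w - Hc r w" "Hc r w - H s w"] by simp
     then have "ennreal ((?P r w - H s w)\<^sup>2) \<le> ennreal (2 * (?P r w - Hc r w)\<^sup>2 + 2 * (Hc r w - H s w)\<^sup>2)"
      by (rule ennreal_leI)
     then show ?thesis using True st by (simp add: ennreal_mult)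
    qed simp
   qed
   also have "\<dots> = 2 * (\<integral>\<^sup>+r\<in>{0..t}. ennreal ((?P r w - Hc r w)\<^sup>2) \<partial>lborel) + 2 * (\<integral>\<^sup>+r\<in>{s..t}. ennreal ((Hc r w - H s w)\<^sup>2) \<partial>lborel)"
    by (subst nn_integral_add) (simp_all add: nn_integral_cmult)
   finally show "(\<integral>\<^sup>+r\<in>{s<..t}. ennreal ((?P r w - H s w)\<^sup>2) \<partial>lborel) \<le> \<dots>" .
  qed
  also have "\<dots> = 2 * a k + 2 * J"
  proof -
   have 1: "(%w. \<integral>\<^sup>+r\<in>{0..t}. ennreal ((?P r w - Hc r w)\<^sup>2) \<partial>lborel) \<in> borel_measurable M"
    by (rule lborel.borel_measurable_nn_integral) (use spM Hcm in \<open>simp add: split_beta', measurable\<close>)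
   have 2: "(%w. \<integral>\<^sup>+r\<in>{s..t}. ennreal ((Hc r w - H s w)\<^sup>2) \<partial>lborel) \<in> borel_measurable M"
    by (rule lborel.borel_measurable_nn_integral) (use Hcm in \<open>simp add: split_beta', measurable\<close>)
   show ?thesis unfolding a_eq J_eq using 1 2 by (subst nn_integral_add) (simp_all add: nn_integral_cmult)
  qed
  finally show ?thesis unfolding Rn .
 qed
 define y where "y r k = (\<integral>\<^sup>+w. ennreal ((simple_int W (n k) (tt k) (\<xi> k) r w - Y r w)\<^sup>2) \<partial>M)" for r k
 have ele: "(\<integral>\<^sup>+w. ennreal ((\<rho> w - R k w)\<^sup>2) \<partial>M) \<le> 2 * y t k + 2 * y s k" for k
 proof -
  let ?S = "simple_int W (n k) (tt k) (\<xi> k)"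
  have [measurable]: "?S t \<in> borel_measurable M" "?S s \<in> borel_measurable M" "Y t \<in> borel_measurable M" "Y s \<in> borel_measurable M"
   using simple_int_measurable[OF ok t0] simple_int_measurable[OF ok st(1)] Ym t0 st by auto
  have "(\<integral>\<^sup>+w. ennreal ((\<rho> w - R k w)\<^sup>2) \<partial>M) \<le> (\<integral>\<^sup>+w. 2 * ennreal ((?S t w - Y t w)\<^sup>2) + 2 * ennreal ((?S s w - Y s w)\<^sup>2) \<partial>M)"
  proof (rule nn_integral_mono)
   fix w
   have "\<rho> w - R k w = - (?S t w - Y t w) + (?S s w - Y s w)" by (simp add: \<rho>_def R_def)
   then have "(\<rho> w - R k w)\<^sup>2 \<le> 2 * (?S t w - Y t w)\<^sup>2 + 2 * (?S s w - Y s w)\<^sup>2"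
    using square_sum_le[of "- (?S t w - Y t w)" "?S s w - Y s w"] by (simp add: power2_commute)
   then have "ennreal ((\<rho> w - R k w)\<^sup>2) \<le> ennreal (2 * (?S t w - Y t w)\<^sup>2 + 2 * (?S s w - Y s w)\<^sup>2)" by (rule ennreal_leI)
   then show "ennreal ((\<rho> w - R k w)\<^sup>2) \<le> 2 * ennreal ((?S t w - Y t w)\<^sup>2) + 2 * ennreal ((?S s w - Y s w)\<^sup>2)"
    by (simp add: ennreal_mult)
  qed
  also have "\<dots> = 2 * y t k + 2 * y s k"
   unfolding y_def by (subst nn_integral_add) (simp_all add: nn_integral_cmult)
  finally show ?thesis .
 qed
 \<comment> \<open>One index serves both approximations, that of the integrand and that of the
   integral at the two times \<open>s\<close> and \<open>t\<close>. The factor 4 comes from the two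
   applications of the doubling inequality to the errors at \<open>s\<close> and
   \<open>t\<close>.\<close>
 have approx: "\<exists>k. a k \<le> ennreal e \<and> (\<integral>\<^sup>+w. ennreal ((\<rho> w - R k w)\<^sup>2) \<partial>M) \<le> ennreal (4 * e)" if e: "e > 0" for e
 proof -
  have e': "0 < ennreal e" using e by simp
  have "\<forall>\<^sub>F k in sequentially. a k < ennreal e \<and> y t k < ennreal e \<and> y s k < ennreal e"
   using order_tendstoD(2)[OF lim1 e'] order_tendstoD(2)[OF lim2[of t] e'] order_tendstoD(2)[OF lim2[of s] e'] st
   unfolding a_def y_def by (auto intro: eventually_conj)
  then obtain k where k: "a k < ennreal e" "y t k < ennreal e" "y s k < ennreal e"
   using eventually_happens' [OF sequentially_bot] by blast
  have "(\<integral>\<^sup>+w. ennreal ((\<rho> w - R k w)\<^sup>2) \<partial>M) \<le> 2 * ennreal e + 2 * ennreal e"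
   using k by (intro order.trans[OF ele] add_mono mult_left_mono) auto
  also have "\<dots> = ennreal (4 * e)" using e by (simp add: ennreal_mult distrib_right[symmetric] flip: ennreal_plus)
  finally show ?thesis using k by (auto intro: less_imp_le)
 qed
 have split: "(\<integral>\<^sup>+w. ennreal ((\<rho> w)\<^sup>2) \<partial>M) \<le> 2 * (\<integral>\<^sup>+w. ennreal ((\<rho> w - R k w)\<^sup>2) \<partial>M) + 2 * (\<integral>\<^sup>+w. ennreal ((R k w)\<^sup>2) \<partial>M)" for k
 proof -
  have "(\<integral>\<^sup>+w. ennreal ((\<rho> w)\<^sup>2) \<partial>M) \<le> (\<integral>\<^sup>+w. 2 * ennreal ((\<rho> w - R k w)\<^sup>2) + 2 * ennreal ((R k w)\<^sup>2) \<partial>M)"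
  proof (rule nn_integral_mono)
   fix w
   have "ennreal ((\<rho> w)\<^sup>2) \<le> ennreal (2 * (\<rho> w - R k w)\<^sup>2 + 2 * (R k w)\<^sup>2)"
    using square_sum_le[of "\<rho> w - R k w" "R k w"] by (intro ennreal_leI) simp
   then show "ennreal ((\<rho> w)\<^sup>2) \<le> 2 * ennreal ((\<rho> w - R k w)\<^sup>2) + 2 * ennreal ((R k w)\<^sup>2)" by (simp add: ennreal_mult)
  qed
  also have "\<dots> = 2 * (\<integral>\<^sup>+w. ennreal ((\<rho> w - R k w)\<^sup>2) \<partial>M) + 2 * (\<integral>\<^sup>+w. ennreal ((R k w)\<^sup>2) \<partial>M)"
   by (subst nn_integral_add) (simp_all add: nn_integral_cmult)
  finally show ?thesis .
 qed
 show \<rho>2: "integrable M (%w. (\<rho> w)\<^sup>2)"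
 proof (rule integrableI_bounded)
  from approx[of 1] obtain k where k: "(\<integral>\<^sup>+w. ennreal ((\<rho> w - R k w)\<^sup>2) \<partial>M) \<le> ennreal (4 * 1)" by auto
  have "(\<integral>\<^sup>+w. ennreal ((\<rho> w - R k w)\<^sup>2) \<partial>M) < \<infinity>" by (rule le_less_trans[OF k]) simp
  moreover have "(\<integral>\<^sup>+w. ennreal ((R k w)\<^sup>2) \<partial>M) < \<infinity>" using R2[of k] by (subst nn_integral_eq_integral) auto
  ultimately have "(\<integral>\<^sup>+w. ennreal ((\<rho> w)\<^sup>2) \<partial>M) < \<infinity>"
   by (intro le_less_trans[OF split[of k]]) (auto simp: ennreal_mult_less_top)
  then show "(\<integral>\<^sup>+w. ennreal (norm ((\<rho> w)\<^sup>2)) \<partial>M) < \<infinity>" by simp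
 qed measurable
 show "ennreal (expectation (%w. (\<rho> w)\<^sup>2)) \<le> 4 * J"
 proof (rule ennreal_le_epsilon)
  fix d :: real assume d: "d > 0"
  \<comment> \<open>The errors add up to \<open>2 * (4 * e) + 4 * e = 12 * e\<close>.\<close>
  define e where "e = d / 12"
  have e: "e > 0" using d by (simp add: e_def)
  from approx[OF e] obtain k where k: "a k \<le> ennreal e" "(\<integral>\<^sup>+w. ennreal ((\<rho> w - R k w)\<^sup>2) \<partial>M) \<le> ennreal (4 * e)" by auto
  have "ennreal (expectation (%w. (\<rho> w)\<^sup>2)) = (\<integral>\<^sup>+w. ennreal ((\<rho> w)\<^sup>2) \<partial>M)"
   using \<rho>2 by (subst nn_integral_eq_integral) auto
  also have "\<dots> \<le> 2 * ennreal (4 * e) + 2 * (2 * ennreal e + 2 * J)"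
   by (intro order.trans[OF split[of k]] add_mono mult_left_mono order.trans[OF Rle[of k]] k) auto
  also have "\<dots> = 4 * J + ennreal (12 * e)"
  proof -
   have "2 * ennreal (4 * e) + 2 * (2 * ennreal e + 2 * J) = (2 * ennreal (4 * e) + 4 * ennreal e) + 4 * J"
    by (simp add: distrib_left mult.assoc[symmetric] add.assoc)
   also have "2 * ennreal (4 * e) + 4 * ennreal e = ennreal (2 * (4 * e) + 4 * e)"
    using e by (subst ennreal_plus) (auto simp: ennreal_mult)
   finally show ?thesis by (simp add: add.commute)
  qed
  finally show "ennreal (expectation (%w. (\<rho> w)\<^sup>2)) \<le> 4 * J + ennreal d" by (simp add: e_def)
 qed
 show "expectation (%w. f w * \<rho> w) = 0" if f: "f \<in> borel_measurable (F s)" "\<And>w. w \<in> space M ==> \<bar>f w\<bar> \<le> C" for f C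
 proof -
  have fM [measurable]: "f \<in> borel_measurable M" by (rule measurable_F_M[OF f(1)])
  have f2: "(f w)\<^sup>2 \<le> C\<^sup>2" if "w \<in> space M" for w using power_mono[OF f(2)[OF that], of 2] by simp
  have f3: "norm ((f w * x)\<^sup>2) \<le> norm (C\<^sup>2 * x\<^sup>2)" if "w \<in> space M" for w x
   using mult_right_mono[OF f2[OF that], of "x\<^sup>2"] by (simp add: power_mult_distrib)
  have "(expectation (%w. f w * \<rho> w))\<^sup>2 \<le> 0 + d" if d: "d > 0" for d
  proof -
   define e where "e = d / (4 * (C\<^sup>2 + 1))"
   have C1: "C\<^sup>2 + 1 > 0" by (intro add_nonneg_pos) auto
   have e: "e > 0" using d C1 by (simp add: e_def)
   from approx[OF e] obtain k where k: "(\<integral>\<^sup>+w. ennreal ((\<rho> w - R k w)\<^sup>2) \<partial>M) \<le> ennreal (4 * e)" by auto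
   have di: "integrable M (%w. (\<rho> w - R k w)\<^sup>2)"
    by (rule integrableI_bounded) (use k in \<open>auto intro: le_less_trans\<close>)
   have de: "expectation (%w. (\<rho> w - R k w)\<^sup>2) \<le> 4 * e"
    using k di e by (subst (asm) nn_integral_eq_integral) (auto simp: ennreal_le_iff)
   have i1: "integrable M (%w. (f w * (\<rho> w - R k w))\<^sup>2)"
    by (rule Bochner_Integration.integrable_bound[of _ "%w. C\<^sup>2 * (\<rho> w - R k w)\<^sup>2"])
     (use di f3 in \<open>auto intro!: AE_I2\<close>)
   have i2: "integrable M (%w. (f w * R k w)\<^sup>2)"
    by (rule Bochner_Integration.integrable_bound[of _ "%w. C\<^sup>2 * (R k w)\<^sup>2"])
     (use R2[of k] f3 in \<open>auto intro!: AE_I2\<close>)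
   have j1: "integrable M (%w. f w * (\<rho> w - R k w))" by (rule square_integrable_imp_integrable[OF _ i1]) measurable
   have j2: "integrable M (%w. f w * R k w)" by (rule square_integrable_imp_integrable[OF _ i2]) measurable
   have "expectation (%w. f w * \<rho> w) = expectation (%w. f w * (\<rho> w - R k w) + f w * R k w)"
    by (rule Bochner_Integration.integral_cong) (auto simp: algebra_simps)
   also have "\<dots> = expectation (%w. f w * (\<rho> w - R k w))"
    using j1 j2 R0[OF f] by simp
   finally have "(expectation (%w. f w * \<rho> w))\<^sup>2 \<le> expectation (%w. (f w * (\<rho> w - R k w))\<^sup>2)"
    using expectation_sq_le[OF _ i1] by simp
   also have "\<dots> \<le> expectation (%w. C\<^sup>2 * (\<rho> w - R k w)\<^sup>2)"
    by (rule integral_mono[OF i1]) (use di f3 in auto)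
   also have "\<dots> \<le> C\<^sup>2 * (4 * e)" using de by (simp add: mult_left_mono)
   also have "\<dots> \<le> (C\<^sup>2 + 1) * (4 * e)" using e by (intro mult_right_mono) auto
   also have "\<dots> = d" using C1 by (simp add: e_def field_simps)
   finally show ?thesis by simp
  qed
  then have "(expectation (%w. f w * \<rho> w))\<^sup>2 \<le> 0" by (rule field_le_epsilon)
  then show ?thesis by simp
 qed
qed

text \<open>Along each path, uniform continuity on \<open>[0, T]\<close> makes the sum of cell
  oscillations tend to 0. Truncation at 1 bounds that sum by \<open>T\<close>, so dominated
  convergence applies without any moment assumption on \<open>X\<close>.\<close>

lemma grid_modulus:
 assumes X: "progressive M F X" and Xc: "\<And>w. w \<in> space M ==> continuous_on {0..} (%t. X t w)" and T: "0 < T"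
 shows "((%N. \<Sum>k<N. \<integral>\<^sup>+w. (\<integral>\<^sup>+r\<in>{T * real k / real N..T * real (Suc k) / real N}.
   ennreal (min 1 \<bar>X r w - X (T * real k / real N) w\<bar>) \<partial>lborel) \<partial>M) \<longlongrightarrow> 0) sequentially"
proof -
 define g where "g N k = T * real k / real N" for N k
 define Xc' where "Xc' r w = X (max 0 (min T r)) w" for r w
 have Xm [measurable]: "(%(w, r). Xc' r w) \<in> borel_measurable (M \<Otimes>\<^sub>M borel)"
  unfolding Xc'_def using T by (intro progressive_clamp[OF X _ ident_M_F]) auto
 have gr: "0 \<le> g N k" "g N k \<le> g N (Suc k)" "g N (Suc k) \<le> T" if "k < N" for N k
 proof -
  have "T * real (Suc k) \<le> T * real N" using that T by (intro mult_left_mono) auto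
  then show "g N (Suc k) \<le> T" using that by (simp add: g_def divide_le_eq)
 qed (use that T in \<open>auto simp: g_def intro!: divide_right_mono\<close>)
 have gd: "g N (Suc k) - g N k = T / real N" for N k
  by (simp add: g_def diff_divide_distrib[symmetric] algebra_simps)
 define u where "u N w = (\<Sum>k<N. \<integral>\<^sup>+r\<in>{g N k..g N (Suc k)}. ennreal (min 1 \<bar>X r w - X (g N k) w\<bar>) \<partial>lborel)" for N w
 have cm: "(%w. \<integral>\<^sup>+r\<in>{g N k..g N (Suc k)}. ennreal (min 1 \<bar>X r w - X (g N k) w\<bar>) \<partial>lborel) \<in> borel_measurable M"
  if k: "k < N" for N k
 proof -
  have [measurable]: "X (g N k) \<in> borel_measurable M"
   by (rule measurable_F_M[OF progressive_measurable[OF X gr(1)[OF k]]])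
  have "(%w. \<integral>\<^sup>+r\<in>{g N k..g N (Suc k)}. ennreal (min 1 \<bar>Xc' r w - X (g N k) w\<bar>) \<partial>lborel) \<in> borel_measurable M"
   by (rule lborel.borel_measurable_nn_integral) (use Xm in \<open>simp add: split_beta', measurable\<close>)
  also have "(%w. \<integral>\<^sup>+r\<in>{g N k..g N (Suc k)}. ennreal (min 1 \<bar>Xc' r w - X (g N k) w\<bar>) \<partial>lborel) =
   (%w. \<integral>\<^sup>+r\<in>{g N k..g N (Suc k)}. ennreal (min 1 \<bar>X r w - X (g N k) w\<bar>) \<partial>lborel)"
   by (intro ext nn_integral_cong) (use gr[OF k] in \<open>auto simp: indicator_def Xc'_def\<close>)
  finally show ?thesis .
 qed
 have um: "u N \<in> borel_measurable M" for N
  unfolding u_def by (rule borel_measurable_sum) (use cm in auto)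
 have ub: "u N w \<le> ennreal (T * c)" if c: "0 \<le> c" and le: "\<And>k r. k < N ==> r \<in> {g N k..g N (Suc k)} ==> min 1 \<bar>X r w - X (g N k) w\<bar> \<le> c" for N w c
 proof (cases "N = 0")
  case True then show ?thesis by (simp add: u_def)
 next
  case False
  have "u N w \<le> (\<Sum>k<N. ennreal (T / real N * c))"
   unfolding u_def
  proof (rule sum_mono)
   fix k assume "k \<in> {..<N}"
   then have k: "k < N" by auto
   have "(\<integral>\<^sup>+r\<in>{g N k..g N (Suc k)}. ennreal (min 1 \<bar>X r w - X (g N k) w\<bar>) \<partial>lborel) \<le> (\<integral>\<^sup>+r\<in>{g N k..g N (Suc k)}. ennreal c \<partial>lborel)"
    by (rule nn_integral_mono) (use le[OF k] in \<open>auto simp: indicator_def intro!: ennreal_leI\<close>)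
   also have "\<dots> = ennreal c * ennreal (T / real N)" using gr[OF k] by (simp add: nn_integral_cmult_indicator gd)
   also have "\<dots> = ennreal (T / real N * c)" using c T by (subst ennreal_mult[symmetric]) (auto simp: mult.commute)
   finally show "(\<integral>\<^sup>+r\<in>{g N k..g N (Suc k)}. ennreal (min 1 \<bar>X r w - X (g N k) w\<bar>) \<partial>lborel) \<le> ennreal (T / real N * c)" .
  qed
  also have "\<dots> = ennreal (\<Sum>k<N. T / real N * c)" using c T by (intro sum_ennreal) auto
  also have "(\<Sum>k<N. T / real N * c) = T * c" using False by simp
  finally show ?thesis .
 qed
 have lim: "(%N. u N w) \<longlonglongrightarrow> 0" if w: "w \<in> space M" for w
 proof (rule ennreal_tendsto_zeroI)
  fix e :: real assume e: "e > 0"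
  have eT: "e / T > 0" using e T by simp
  have "uniformly_continuous_on {0..T} (%t. X t w)"
   by (intro compact_uniformly_continuous continuous_on_subset[OF Xc[OF w]]) auto
  then obtain d where d: "d > 0" "\<And>x y. x \<in> {0..T} ==> y \<in> {0..T} ==> dist y x < d ==> dist (X y w) (X x w) < e / T"
   using eT unfolding uniformly_continuous_on_def by metis
  obtain N0 :: nat where N0: "real N0 > T / d" using reals_Archimedean2 by blast
  show "\<forall>\<^sub>F n in sequentially. u n w \<le> ennreal e"
   unfolding eventually_sequentially
  proof (intro exI[of _ N0] allI impI)
   fix N assume N: "N0 \<le> N"
   have "u N w \<le> ennreal (T * (e / T))"
   proof (rule ub)
    show "0 \<le> e / T" using eT by simp
    fix k r assume k: "k < N" and r: "r \<in> {g N k..g N (Suc k)}"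
    have N': "real N > T / d" using N N0 by auto
    then have "T / real N < d" using d(1) k by (simp add: field_simps)
    then have "dist r (g N k) < d" using r gd[of N k] by (auto simp: dist_real_def)
    then have "dist (X r w) (X (g N k) w) < e / T"
     using r gr[OF k] by (intro d(2)) auto
    then show "min 1 \<bar>X r w - X (g N k) w\<bar> \<le> e / T" by (simp add: dist_real_def)
   qed
   then show "u N w \<le> ennreal e" using T by simp
  qed
 qed
 have "(%N. \<integral>\<^sup>+w. u N w \<partial>M) \<longlonglongrightarrow> (\<integral>\<^sup>+w. 0 \<partial>M)"
 proof (rule nn_integral_dominated_convergence[of _ _ _ "%_. ennreal T"])
  show "AE x in M. u j x \<le> ennreal T" for j using ub[of 1 j] by (auto intro!: AE_I2)
  show "AE x in M. (%i. u i x) \<longlonglongrightarrow> 0" using lim by (auto intro!: AE_I2)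
  show "(\<integral>\<^sup>+ x. ennreal T \<partial>M) < \<infinity>" by (simp add: emeasure_space_1)
 qed (use um in auto)
 moreover have "(\<integral>\<^sup>+w. u N w \<partial>M) = (\<Sum>k<N. \<integral>\<^sup>+w. (\<integral>\<^sup>+r\<in>{g N k..g N (Suc k)}. ennreal (min 1 \<bar>X r w - X (g N k) w\<bar>) \<partial>lborel) \<partial>M)" for N
  unfolding u_def by (rule nn_integral_sum) (use cm in auto)
 ultimately show ?thesis by (simp add: g_def)
qed

end

text \<open>Two bounds on the Taylor remainder are played against each other, because only second
  moments of \<rho> are available while \<open>D\<close> and \<open>Hw\<close> have third moments.
  Where \<rho> dominates, the quadratic bound is used and costs
  \<open>9 * C * \<rho>\<^sup>2\<close>; otherwise the increment is at most three times the larger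
  of \<open>\<bar>D\<bar>\<close> and \<open>\<bar>Hw\<bar>\<close>, and the cubic term can be
  afforded.\<close>

lemma taylor_remainder_split:
 fixes R d D Hw \<rho> :: real
 assumes d: "d = D + Hw + \<rho>" and 1: "\<bar>R\<bar> \<le> C * d\<^sup>2" and 2: "\<bar>R\<bar> \<le> \<kappa> * d\<^sup>2 + K * \<bar>d\<bar> ^ 3"
  and nn: "C \<ge> 0" "\<kappa> \<ge> 0" "K \<ge> 0"
 shows "\<bar>R\<bar> \<le> 3 * \<kappa> * (D\<^sup>2 + Hw\<^sup>2 + \<rho>\<^sup>2) + 27 * K * (\<bar>D\<bar> ^ 3 + \<bar>Hw\<bar> ^ 3) + 9 * C * \<rho>\<^sup>2"
proof (cases "\<bar>D\<bar> \<le> \<bar>\<rho>\<bar> \<and> \<bar>Hw\<bar> \<le> \<bar>\<rho>\<bar>")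
 case True
 then have "\<bar>d\<bar> \<le> 3 * \<bar>\<rho>\<bar>" unfolding d by linarith
 from power_mono[OF this, of 2] have "d\<^sup>2 \<le> 9 * \<rho>\<^sup>2" by (simp add: power_mult_distrib)
 from mult_left_mono[OF this nn(1)] have "\<bar>R\<bar> \<le> 9 * C * \<rho>\<^sup>2" using 1 by simp
 moreover have "0 \<le> 3 * \<kappa> * (D\<^sup>2 + Hw\<^sup>2 + \<rho>\<^sup>2) + 27 * K * (\<bar>D\<bar> ^ 3 + \<bar>Hw\<bar> ^ 3)" using nn by (intro add_nonneg_nonneg mult_nonneg_nonneg) auto
 ultimately show ?thesis by linarith
next
 case False
 then have "\<bar>d\<bar> \<le> 3 * max \<bar>D\<bar> \<bar>Hw\<bar>" unfolding d by (auto simp: max_def abs_if split: if_splits)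
 from power_mono[OF this, of 3] have "\<bar>d\<bar> ^ 3 \<le> 27 * (max \<bar>D\<bar> \<bar>Hw\<bar>) ^ 3" by (simp add: power_mult_distrib)
 also have "\<dots> \<le> 27 * (\<bar>D\<bar> ^ 3 + \<bar>Hw\<bar> ^ 3)" by (auto simp: max_def)
 finally have "\<bar>d\<bar> ^ 3 \<le> 27 * (\<bar>D\<bar> ^ 3 + \<bar>Hw\<bar> ^ 3)" .
 from mult_left_mono[OF this nn(3)] have a: "K * \<bar>d\<bar> ^ 3 \<le> 27 * K * (\<bar>D\<bar> ^ 3 + \<bar>Hw\<bar> ^ 3)" by (simp only: mult_ac)
 have "d\<^sup>2 \<le> 3 * (D\<^sup>2 + Hw\<^sup>2 + \<rho>\<^sup>2)"
 proof -
  have "0 \<le> (D - Hw)\<^sup>2 + (D - \<rho>)\<^sup>2 + (Hw - \<rho>)\<^sup>2" by (intro add_nonneg_nonneg) auto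
  then show ?thesis unfolding d by (simp add: power2_eq_square algebra_simps)
 qed
 from mult_left_mono[OF this nn(2)] have "\<kappa> * d\<^sup>2 \<le> 3 * \<kappa> * (D\<^sup>2 + Hw\<^sup>2 + \<rho>\<^sup>2)" by (simp only: mult_ac)
 moreover have "0 \<le> 9 * C * \<rho>\<^sup>2" using nn by auto
 ultimately show ?thesis using 2 a by linarith
qed

text \<open>The pathwise one-step estimate behind the discretised Dynkin inequality: \<open>D\<close> is the drift increment, \<open>h0 * w\<close> the frozen
 noise increment, \<open>\<rho>\<close> the rest of the noise increment, and \<open>m\<close> measures the oscillation of the path.\<close>

lemma dynkin_step_path:
 fixes fx fy f1 f2 \<psi> D h0 w \<rho> h lam E0 E1 A m :: real
 assumes h: "0 < h" "h \<le> 1" "0 < lam" "lam * h \<le> 1" and E: "E0 = E1 * exp (lam * h)" "0 < E1" "E0 \<le> 1"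
  and B: "\<bar>fx\<bar> \<le> B" "\<bar>f1\<bar> \<le> B" "\<bar>f2\<bar> \<le> B" "\<bar>\<psi>\<bar> \<le> B" and D: "\<bar>D\<bar> \<le> Bd * h" "0 \<le> Bd" and h0: "\<bar>h0\<bar> \<le> c"
  and R1: "\<bar>fy - fx - f1 * d - f2 / 2 * d\<^sup>2\<bar> \<le> C * d\<^sup>2"
  and R2: "\<bar>fy - fx - f1 * d - f2 / 2 * d\<^sup>2\<bar> \<le> \<kappa> * d\<^sup>2 + K * \<bar>d\<bar> ^ 3"
  and d: "d = D + h0 * w + \<rho>" and nn: "0 \<le> C" "0 < \<kappa>" "0 \<le> K" "0 \<le> Cm * m"
  and gen: "f1 * D + h / 2 * h0\<^sup>2 * f2 \<ge> h * (lam * fx - \<psi>) - Cm * m"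
  and K1: "K1 = B * (lam\<^sup>2 + lam) + B * c * Bd + B * c\<^sup>2 / \<kappa> + B * Bd\<^sup>2 + B + 3 * \<kappa> * Bd\<^sup>2 + 3 * \<kappa> + 27 * K * Bd ^ 3 + 27 * K * c ^ 3 + 9 * C"
 shows "E1 * fy - E0 * fx \<ge> - (h * E0 * \<psi>) + (E1 * f1 * h0 * w + E1 * f1 * \<rho> + E1 * (f2 / 2 * h0\<^sup>2) * (w\<^sup>2 - h))
  - (Cm * m + \<kappa> * (B + 3 * c\<^sup>2) * w\<^sup>2 + K1 * (h\<^sup>2 + h * \<bar>w\<bar> + \<bar>w\<bar> ^ 3 + \<rho>\<^sup>2))"
proof -
 define R where "R = fy - fx - f1 * d - f2 / 2 * d\<^sup>2"
 define S where "S = h\<^sup>2 + h * \<bar>w\<bar> + \<bar>w\<bar> ^ 3 + \<rho>\<^sup>2"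
 have B0: "0 \<le> B" and c0: "0 \<le> c" using B h0 by linarith+
 have S: "0 \<le> S" "h\<^sup>2 \<le> S" "h * \<bar>w\<bar> \<le> S" "\<bar>w\<bar> ^ 3 \<le> S" "\<rho>\<^sup>2 \<le> S" using h by (auto simp: S_def)
 have E1: "E1 \<le> 1"
 proof -
  have "E1 * 1 \<le> E1 * exp (lam * h)" using E h by (intro mult_left_mono) auto
  then show ?thesis using E(1,3) by linarith
 qed
 have D2: "D\<^sup>2 \<le> Bd\<^sup>2 * h\<^sup>2" using power_mono[OF D(1), of 2] by (simp add: power_mult_distrib)
 have D3: "\<bar>D\<bar> ^ 3 \<le> Bd ^ 3 * h\<^sup>2"
 proof -
  have "\<bar>D\<bar> ^ 3 \<le> Bd ^ 3 * h ^ 3" using power_mono[OF D(1), of 3] by (simp add: power_mult_distrib)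
  also have "\<dots> \<le> Bd ^ 3 * h\<^sup>2" using h D by (intro mult_left_mono power_decreasing) auto
  finally show ?thesis .
 qed
 have hw: "(h0 * w)\<^sup>2 \<le> c\<^sup>2 * w\<^sup>2" "\<bar>h0 * w\<bar> ^ 3 \<le> c ^ 3 * \<bar>w\<bar> ^ 3" "\<bar>h0 * w\<bar> \<le> c * \<bar>w\<bar>"
  using power_mono[OF h0, of 2] power_mono[OF h0, of 3] h0
  by (auto simp: power_mult_distrib abs_mult intro!: mult_right_mono)
 have "\<bar>R\<bar> \<le> 3 * \<kappa> * (D\<^sup>2 + (h0 * w)\<^sup>2 + \<rho>\<^sup>2) + 27 * K * (\<bar>D\<bar> ^ 3 + \<bar>h0 * w\<bar> ^ 3) + 9 * C * \<rho>\<^sup>2"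
  by (rule taylor_remainder_split[OF d]) (use R1 R2 nn in \<open>auto simp: R_def\<close>)
 also have "\<dots> \<le> 3 * \<kappa> * (Bd\<^sup>2 * h\<^sup>2 + c\<^sup>2 * w\<^sup>2 + \<rho>\<^sup>2) + 27 * K * (Bd ^ 3 * h\<^sup>2 + c ^ 3 * \<bar>w\<bar> ^ 3) + 9 * C * \<rho>\<^sup>2"
  using D2 D3 hw nn by (intro add_mono mult_left_mono) auto
 also have "\<dots> = 3 * \<kappa> * c\<^sup>2 * w\<^sup>2 + (3 * \<kappa> * Bd\<^sup>2) * h\<^sup>2 + (3 * \<kappa>) * \<rho>\<^sup>2 + (27 * K * Bd ^ 3) * h\<^sup>2 + (27 * K * c ^ 3) * \<bar>w\<bar> ^ 3 + (9 * C) * \<rho>\<^sup>2"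
  by (simp add: algebra_simps)
 also have "\<dots> \<le> 3 * \<kappa> * c\<^sup>2 * w\<^sup>2 + (3 * \<kappa> * Bd\<^sup>2) * S + (3 * \<kappa>) * S + (27 * K * Bd ^ 3) * S + (27 * K * c ^ 3) * S + (9 * C) * S"
  using S nn D c0 by (intro add_mono mult_left_mono order_refl) auto
 finally have Rb: "\<bar>R\<bar> \<le> 3 * \<kappa> * c\<^sup>2 * w\<^sup>2 + (3 * \<kappa> * Bd\<^sup>2) * S + (3 * \<kappa>) * S + (27 * K * Bd ^ 3) * S + (27 * K * c ^ 3) * S + (9 * C) * S" .
 have cr1: "\<bar>f2 * (h0 * w) * D\<bar> \<le> (B * c * Bd) * S"
 proof -
  have "\<bar>f2 * (h0 * w) * D\<bar> \<le> B * (c * \<bar>w\<bar>) * (Bd * h)"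
   unfolding abs_mult[of _ D] abs_mult[of f2] using B D hw B0 c0 by (intro mult_mono) auto
  also have "\<dots> = (B * c * Bd) * (h * \<bar>w\<bar>)" by simp
  also have "\<dots> \<le> (B * c * Bd) * S" using S B0 c0 D by (intro mult_left_mono) auto
  finally show ?thesis .
 qed
 \<comment> \<open>Young's inequality with the small weight \<kappa> on \<open>w\<^sup>2\<close> and
   \<open>1 / \<kappa>\<close> on \<open>\<rho>\<^sup>2\<close>: the expectations of
   \<open>w\<^sup>2\<close> add up to the time horizon over a grid, those of
   \<open>\<rho>\<^sup>2\<close> tend to 0.\<close>
 have cr2: "\<bar>f2 * (h0 * w) * \<rho>\<bar> \<le> \<kappa> * B * w\<^sup>2 + (B * c\<^sup>2 / \<kappa>) * S"
 proof -
  have y: "c * \<bar>w\<bar> * \<bar>\<rho>\<bar> \<le> \<kappa> * w\<^sup>2 + c\<^sup>2 / \<kappa> * \<rho>\<^sup>2"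
  proof -
   have "0 \<le> (\<kappa> * \<bar>w\<bar> - c * \<bar>\<rho>\<bar> / 2)\<^sup>2 / \<kappa> + 3 / 4 * (c\<^sup>2 / \<kappa> * \<rho>\<^sup>2)" using nn by (intro add_nonneg_nonneg) auto
   also have "\<dots> = \<kappa> * w\<^sup>2 + c\<^sup>2 / \<kappa> * \<rho>\<^sup>2 - c * \<bar>w\<bar> * \<bar>\<rho>\<bar>" using nn by (simp add: power2_eq_square field_simps)
   finally show ?thesis by simp
  qed
  have "\<bar>f2 * (h0 * w) * \<rho>\<bar> \<le> B * (c * \<bar>w\<bar>) * \<bar>\<rho>\<bar>"
   unfolding abs_mult[of _ \<rho>] abs_mult[of f2] using B hw B0 c0 by (intro mult_mono) auto
  also have "\<dots> \<le> B * (\<kappa> * w\<^sup>2 + c\<^sup>2 / \<kappa> * \<rho>\<^sup>2)" using mult_left_mono[OF y B0] by (simp add: mult_ac)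
  also have "\<dots> = \<kappa> * B * w\<^sup>2 + (B * c\<^sup>2 / \<kappa>) * \<rho>\<^sup>2" by (simp add: algebra_simps)
  also have "\<dots> \<le> \<kappa> * B * w\<^sup>2 + (B * c\<^sup>2 / \<kappa>) * S" using S B0 nn by (intro add_left_mono mult_left_mono) auto
  finally show ?thesis .
 qed
 have sq: "\<bar>f2 / 2 * (D + \<rho>)\<^sup>2\<bar> \<le> (B * Bd\<^sup>2) * S + B * S"
 proof -
  have "\<bar>f2 / 2 * (D + \<rho>)\<^sup>2\<bar> = \<bar>f2\<bar> * ((D + \<rho>)\<^sup>2 / 2)" by (simp add: abs_mult)
  also have "\<dots> \<le> B * (D\<^sup>2 + \<rho>\<^sup>2)" using B B0 square_sum_le[of D \<rho>] by (intro mult_mono) auto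
  also have "\<dots> \<le> B * (Bd\<^sup>2 * S + S)"
   using B0 D2 S(5) mult_left_mono[OF S(2), of "Bd\<^sup>2"] by (intro mult_left_mono add_mono) auto
  finally show ?thesis by (simp add: algebra_simps)
 qed
 have d2: "f2 / 2 * d\<^sup>2 = f2 / 2 * h0\<^sup>2 * w\<^sup>2 + f2 * (h0 * w) * D + f2 * (h0 * w) * \<rho> + f2 / 2 * (D + \<rho>)\<^sup>2"
  unfolding d by (simp add: power2_eq_square algebra_simps)
 define Q where "Q = f1 * h0 * w + f1 * \<rho> + (f2 / 2 * h0\<^sup>2) * (w\<^sup>2 - h)"
 define Er where "Er = Cm * m + \<kappa> * (B + 3 * c\<^sup>2) * w\<^sup>2 + (B * c * Bd + B * c\<^sup>2 / \<kappa> + B * Bd\<^sup>2 + B + 3 * \<kappa> * Bd\<^sup>2 + 3 * \<kappa> + 27 * K * Bd ^ 3 + 27 * K * c ^ 3 + 9 * C) * S"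
 have Er0: "0 \<le> Er" unfolding Er_def using nn(1-3) B0 c0 D S by (intro add_nonneg_nonneg nn(4) mult_nonneg_nonneg) auto
 have main: "fy - fx \<ge> h * (lam * fx - \<psi>) + Q - Er"
 proof -
  have "fy - fx = f1 * d + f2 / 2 * d\<^sup>2 + R" by (simp add: R_def)
  also have "\<dots> = (f1 * D + h / 2 * h0\<^sup>2 * f2) + Q + (f2 * (h0 * w) * D + f2 * (h0 * w) * \<rho> + f2 / 2 * (D + \<rho>)\<^sup>2 + R)"
   unfolding d2 unfolding d Q_def by (simp add: algebra_simps add_divide_distrib diff_divide_distrib)
  finally have eq: "fy - fx = (f1 * D + h / 2 * h0\<^sup>2 * f2) + Q + (f2 * (h0 * w) * D + f2 * (h0 * w) * \<rho> + f2 / 2 * (D + \<rho>)\<^sup>2 + R)" .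
  have Er_eq: "Er = Cm * m + (3 * \<kappa> * c\<^sup>2 * w\<^sup>2 + (3 * \<kappa> * Bd\<^sup>2) * S + (3 * \<kappa>) * S + (27 * K * Bd ^ 3) * S + (27 * K * c ^ 3) * S + (9 * C) * S)
   + (B * c * Bd) * S + (\<kappa> * B * w\<^sup>2 + (B * c\<^sup>2 / \<kappa>) * S) + ((B * Bd\<^sup>2) * S + B * S)"
   unfolding Er_def by (simp add: algebra_simps)
  show ?thesis using eq Er_eq gen Rb cr1 cr2 sq by linarith
 qed
 \<comment> \<open>To first order the change of the discount cancels the term
   \<open>lam * fx\<close> of the generator; what remains is quadratic in \<open>h\<close> and goes
   into \<open>S\<close>.\<close>
 have ex: "exp (lam * h) - 1 - lam * h \<le> (lam * h)\<^sup>2" using exp_bound[of "lam * h"] h by simp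
 have ex0: "0 \<le> exp (lam * h) - 1 - lam * h" using exp_ge_add_one_self[of "lam * h"] by linarith
 have "E1 * fy - E0 * fx = E1 * (fy - fx) - E1 * (exp (lam * h) - 1) * fx" unfolding E by (simp add: algebra_simps)
 also have "\<dots> \<ge> E1 * (h * (lam * fx - \<psi>) + Q - Er) - E1 * (exp (lam * h) - 1) * fx"
  using main E by (intro diff_right_mono mult_left_mono) auto
 also have "E1 * (h * (lam * fx - \<psi>) + Q - Er) - E1 * (exp (lam * h) - 1) * fx
  = E1 * Q - E1 * Er - E1 * (exp (lam * h) - 1 - lam * h) * fx - h * E0 * \<psi> + h * (E0 - E1) * \<psi>"
  by (simp add: algebra_simps)
 finally have fin: "E1 * fy - E0 * fx \<ge> E1 * Q - E1 * Er - E1 * (exp (lam * h) - 1 - lam * h) * fx - h * E0 * \<psi> + h * (E0 - E1) * \<psi>" .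
 have e1: "E1 * Er \<le> Er" using E1 Er0 E mult_right_mono[of E1 1 Er] by simp
 have e2: "E1 * (exp (lam * h) - 1 - lam * h) * fx \<le> (B * lam\<^sup>2) * S"
 proof -
  have "E1 * (exp (lam * h) - 1 - lam * h) * fx \<le> E1 * (exp (lam * h) - 1 - lam * h) * B"
   using E(2) ex0 B(1) by (intro mult_left_mono mult_nonneg_nonneg) auto
  also have "\<dots> \<le> 1 * (lam * h)\<^sup>2 * B"
   using E(2) E1 ex ex0 B0 by (intro mult_mono) auto
  also have "\<dots> = B * lam\<^sup>2 * h\<^sup>2" by (simp add: power_mult_distrib)
  also have "\<dots> \<le> B * lam\<^sup>2 * S" using S B0 by (intro mult_left_mono) auto
  finally show ?thesis .
 qed
 have e3: "- (h * (E0 - E1) * \<psi>) \<le> (B * lam) * S"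
 proof -
  have "E0 * (1 - lam * h) \<le> E0 * exp (- (lam * h))" using exp_ge_add_one_self[of "- (lam * h)"] E by (intro mult_left_mono) auto
  also have "\<dots> = E1" unfolding E by (simp add: exp_minus)
  finally have "E0 - E1 \<le> E0 * (lam * h)" by (simp add: algebra_simps)
  also have "\<dots> \<le> 1 * (lam * h)" using E h by (intro mult_right_mono) auto
  finally have a: "E0 - E1 \<le> lam * h" by simp
  have b: "0 \<le> E0 - E1"
  proof -
   have "E1 * 1 \<le> E1 * exp (lam * h)" using E h by (intro mult_left_mono) auto
   then show ?thesis using E(1) by linarith
  qed
  have "- (h * (E0 - E1) * \<psi>) = h * (E0 - E1) * (- \<psi>)" by simp
  also have "\<dots> \<le> h * (E0 - E1) * B" using b h B by (intro mult_left_mono mult_nonneg_nonneg) auto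
  also have "\<dots> \<le> h * (lam * h) * B" using a b h B0 by (intro mult_mono) auto
  also have "\<dots> = B * lam * h\<^sup>2" by (simp add: power2_eq_square)
  also have "\<dots> \<le> B * lam * S" using S B0 h by (intro mult_left_mono) auto
  finally show ?thesis .
 qed
 have "Cm * m + \<kappa> * (B + 3 * c\<^sup>2) * w\<^sup>2 + K1 * S = Er + (B * lam\<^sup>2) * S + (B * lam) * S"
  unfolding Er_def K1 by (simp add: algebra_simps)
 moreover have "E1 * Q = E1 * f1 * h0 * w + E1 * f1 * \<rho> + E1 * (f2 / 2 * h0\<^sup>2) * (w\<^sup>2 - h)"
  unfolding Q_def by (simp add: algebra_simps)
 ultimately show ?thesis using fin e1 e2 e3 unfolding S_def[symmetric] by linarith
qed

section \<open>A discretised Dynkin inequality\<close>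

locale controlled_qubit = brownian_space M F W + qubit_control \<gamma> \<Omega> lam
 for M :: "'a measure" and F W \<gamma> \<Omega> lam
begin

text \<open>The indicator that the path has stayed in \<open>[a, b]\<close> up to time
  \<open>t\<close>, as a real number so that it multiplies integrands. It is nonincreasing in
  \<open>t\<close> and known at time \<open>t\<close>, and takes over the role of a stopping
  time.\<close>

definition alive :: "(real => 'a => real) => real => real => real => 'a => real" where
 "alive X a b t w = (if \<forall>r\<in>{0..t}. X r w \<in> {a..b} then 1 else 0)"

lemma alive_bound: "\<bar>alive X a b t w\<bar> \<le> 1" "0 \<le> alive X a b t w"
 by (auto simp: alive_def)

text \<open>By continuity it is enough to inspect countably many times. A time \<open>r > 0\<close>
  at which the path is outside the closed interval has, just before it, a whole stretch of such
  times.\<close>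

lemma alive_measurable:
 assumes X: "progressive M F X" and Xc: "\<And>w. w \<in> space M ==> continuous_on {0..} (%t. X t w)" and t: "0 \<le> t"
 shows "alive X a b t \<in> borel_measurable (F t)"
proof -
 \<comment> \<open>Fractions of \<open>t\<close> rather than rational times: \<open>q * t\<close>
   then ranges over a dense subset of \<open>[0, t]\<close> that contains both endpoints.\<close>
 define Q where "Q = \<rat> \<inter> {0..1::real}"
 have Q: "countable Q" "0 \<in> Q" by (auto simp: Q_def intro: countable_subset[OF _ countable_rat])
 have "(\<forall>r\<in>{0..t}. X r w \<in> {a..b}) \<longleftrightarrow> (\<forall>q\<in>Q. X (q * t) w \<in> {a..b})" if w: "w \<in> space M" for w
 proof
  assume *: "\<forall>r\<in>{0..t}. X r w \<in> {a..b}"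
  show "\<forall>q\<in>Q. X (q * t) w \<in> {a..b}"
  proof
   fix q assume "q \<in> Q"
   then have "q * t \<in> {0..t}" using t by (auto simp: Q_def intro: mult_left_le_one_le)
   then show "X (q * t) w \<in> {a..b}" using * by blast
  qed
 next
  assume *: "\<forall>q\<in>Q. X (q * t) w \<in> {a..b}"
  show "\<forall>r\<in>{0..t}. X r w \<in> {a..b}"
  proof (rule ballI, rule ccontr)
   fix r assume r: "r \<in> {0..t}" "X r w \<notin> {a..b}"
   show False
   proof (cases "r = 0")
    case True then show False using * Q(2) r by force
   next
    case False
    then have r0: "0 < r" "0 < t" using r by auto
    have "continuous (at r within {0..}) (%t. X t w)"
     using Xc[OF w] r0 by (auto simp: continuous_on_eq_continuous_within)
    then have "((%t. X t w) \<longlongrightarrow> X r w) (at r within {0..})" by (simp add: continuous_within)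
    moreover have "open (- {a..b})" by (simp add: open_Compl)
    ultimately have "\<forall>\<^sub>F s in at r within {0..}. X s w \<in> - {a..b}"
     using r(2) by (intro topological_tendstoD) auto
    then obtain d where d: "d > 0" "\<And>s. 0 \<le> s ==> s \<noteq> r ==> dist s r < d ==> X s w \<notin> {a..b}"
     unfolding eventually_at by auto
    have "max 0 (r - d) / t < r / t" using r0 d(1) by (intro divide_strict_right_mono) auto
    from Rats_dense_in_real[OF this] obtain q where q: "q \<in> \<rat>" "max 0 (r - d) / t < q" "q < r / t" by blast
    have qt: "max 0 (r - d) < q * t" "q * t < r" using q r0 by (auto simp: divide_less_eq less_divide_eq)
    have "0 \<le> q" using qt(1) r0 by (auto simp: zero_less_mult_iff)
    moreover have "q \<le> 1"
    proof (rule ccontr)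
     assume "\<not> q \<le> 1"
     then have "1 * t \<le> q * t" using r0 by (intro mult_right_mono) auto
     then show False using qt r by auto
    qed
    ultimately have "q \<in> Q" using q by (auto simp: Q_def)
    moreover have "X (q * t) w \<notin> {a..b}" using qt by (intro d(2)) (auto simp: dist_real_def)
    ultimately show False using * by blast
   qed
  qed
 qed
 then have "{w \<in> space M. \<forall>r\<in>{0..t}. X r w \<in> {a..b}} = (\<Inter>q\<in>Q. {w \<in> space (F t). X (q * t) w \<in> {a..b}})"
  using Q(2) by auto
 also have "\<dots> \<in> sets (F t)"
 proof (rule sets.countable_INT'[OF Q(1)], use Q(2) in blast, rule image_subsetI)
  fix q assume "q \<in> Q"
  then have q: "0 \<le> q * t" "q * t \<le> t" using t by (auto simp: Q_def intro: mult_left_le_one_le)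
  have "X (q * t) \<in> borel_measurable (F t)"
   by (rule measurable_F_mono[OF q progressive_measurable[OF X q(1)]])
  from measurable_sets[OF this, of "{a..b}"]
  show "{w \<in> space (F t). X (q * t) w \<in> {a..b}} \<in> sets (F t)"
   by (simp add: vimage_def Int_def conj_commute)
 qed
 finally have s: "{w \<in> space M. \<forall>r\<in>{0..t}. X r w \<in> {a..b}} \<in> sets (F t)" .
 have "(%w. indicator {w \<in> space M. \<forall>r\<in>{0..t}. X r w \<in> {a..b}} w :: real) \<in> borel_measurable (F t)"
  using s by measurable
 also have "?this \<longleftrightarrow> ?thesis"
  by (rule measurable_cong) (auto simp: alive_def indicator_def)
 finally show ?thesis .
qed

lemma min_integral:
 fixes X :: "real => real"
 assumes Xc: "continuous_on {0..} X" and st: "0 \<le> s" "s \<le> t"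
 shows "(%r. min 1 \<bar>X r - X s\<bar>) integrable_on {s..t}"
  "(\<integral>\<^sup>+r\<in>{s..t}. ennreal (min 1 \<bar>X r - X s\<bar>) \<partial>lborel) = ennreal (integral {s..t} (%r. min 1 \<bar>X r - X s\<bar>))"
proof -
 have c: "continuous_on {s..t} (%r. min 1 \<bar>X r - X s\<bar>)"
  using st by (intro continuous_intros continuous_on_subset[OF Xc]) auto
 show i: "(%r. min 1 \<bar>X r - X s\<bar>) integrable_on {s..t}" by (rule integrable_continuous_real[OF c])
 define g where "g r = indicator {s..t} r * min 1 \<bar>X r - X s\<bar>" for r
 have gm: "g \<in> borel_measurable borel"
  unfolding g_def using borel_measurable_continuous_on_indicator[OF _ c] by (simp add: scaleR_conv_of_real)
 have "((%r. if r \<in> {s..t} then min 1 \<bar>X r - X s\<bar> else 0) has_integral integral {s..t} (%r. min 1 \<bar>X r - X s\<bar>)) UNIV"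
  unfolding has_integral_restrict_UNIV by (rule integrable_integral[OF i])
 also have "(%r. if r \<in> {s..t} then min 1 \<bar>X r - X s\<bar> else 0) = g" by (auto simp: g_def)
 finally have "(\<integral>\<^sup>+x. ennreal (g x) \<partial>lborel) = ennreal (integral {s..t} (%r. min 1 \<bar>X r - X s\<bar>))"
  by (intro nn_integral_has_integral_lborel gm) (auto simp: g_def)
 moreover have "(\<integral>\<^sup>+r\<in>{s..t}. ennreal (min 1 \<bar>X r - X s\<bar>) \<partial>lborel) = (\<integral>\<^sup>+x. ennreal (g x) \<partial>lborel)"
  by (rule nn_integral_cong) (auto simp: g_def indicator_def)
 ultimately show "(\<integral>\<^sup>+r\<in>{s..t}. ennreal (min 1 \<bar>X r - X s\<bar>) \<partial>lborel) = ennreal (integral {s..t} (%r. min 1 \<bar>X r - X s\<bar>))"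
  by simp
qed

lemma abs_sin_diff_le: "\<bar>sin x - sin y\<bar> \<le> \<bar>x - y :: real\<bar>"
proof -
 have "norm (sin x - sin y) \<le> 1 * norm (x - y)"
  by (rule field_differentiable_bound[of UNIV sin cos]) (auto intro!: derivative_eq_intros)
 then show ?thesis by simp
qed

text \<open>The truncated distance is used throughout as measure of oscillation: it is bounded, it
  needs no moments of the path, and its square is at most itself, so it also controls squared
  differences of sines.\<close>

lemma sin_diff_min: "\<bar>sin x - sin y\<bar> \<le> 2 * min 1 \<bar>x - y :: real\<bar>"
proof -
 have "\<bar>sin x - sin y\<bar> \<le> \<bar>sin x\<bar> + \<bar>sin y\<bar>" by linarith
 also have "\<dots> \<le> 2" using abs_sin_le_one[of x] abs_sin_le_one[of y] by linarith
 finally have le: "\<bar>sin x - sin y\<bar> \<le> 2" .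
 have "min 1 \<bar>x - y\<bar> = 1 \<or> min 1 \<bar>x - y\<bar> = \<bar>x - y\<bar>" by (auto simp: min_def)
 then show ?thesis
 proof
  assume e: "min 1 \<bar>x - y\<bar> = 1"
  show ?thesis unfolding e using le by simp
 next
  assume e: "min 1 \<bar>x - y\<bar> = \<bar>x - y\<bar>"
  have "\<bar>x - y\<bar> \<le> 2 * \<bar>x - y\<bar>" by simp
  then show ?thesis unfolding e by (rule order.trans[OF abs_sin_diff_le])
 qed
qed

lemma sin2_diff_min: "\<bar>sin (2 * x) - sin (2 * y)\<bar> \<le> 2 * min 1 \<bar>x - y :: real\<bar>"
proof -
 have "\<bar>sin (2 * x) - sin (2 * y)\<bar> \<le> \<bar>sin (2 * x)\<bar> + \<bar>sin (2 * y)\<bar>" by linarith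
 also have "\<dots> \<le> 2" using abs_sin_le_one[of "2 * x"] abs_sin_le_one[of "2 * y"] by linarith
 finally have le: "\<bar>sin (2 * x) - sin (2 * y)\<bar> \<le> 2" .
 have "min 1 \<bar>x - y\<bar> = 1 \<or> min 1 \<bar>x - y\<bar> = \<bar>x - y\<bar>" by (auto simp: min_def)
 then show ?thesis
 proof
  assume e: "min 1 \<bar>x - y\<bar> = 1"
  show ?thesis unfolding e using le by simp
 next
  assume e: "min 1 \<bar>x - y\<bar> = \<bar>x - y\<bar>"
  have "\<bar>2 * x - 2 * y\<bar> = 2 * \<bar>x - y\<bar>" by (auto simp: abs_if)
  then show ?thesis unfolding e using abs_sin_diff_le[of "2 * x" "2 * y"] by simp
 qed
qed

text \<open>Measurability of each path of the control comes from progressive measurability, and the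
  bound \<Omega> makes it integrable on compact intervals.\<close>

lemma control_integrable:
 assumes adm: "admissible M F \<Omega> v" and w: "w \<in> space M" and st: "0 \<le> s" "s \<le> t"
 shows "(%r. v r w) integrable_on {s..t}"
proof -
 have t: "0 \<le> t" using st by auto
 have m: "(%r. v (max 0 (min t r)) w) \<in> borel_measurable borel"
  using adm by (intro progressive_path[OF _ t w]) (simp add: admissible_def)
 have "set_integrable lborel {s..t} (%r. v (max 0 (min t r)) w)"
  unfolding set_integrable_def
 proof (rule integrableI_bounded_set_indicator[where B = \<Omega>])
  show "AE x in lborel. x \<in> {s..t} --> norm (v (max 0 (min t x)) w) \<le> \<Omega>"
  proof (intro AE_I2 impI)
   fix x
   have "v (max 0 (min t x)) w \<in> {-\<Omega>..\<Omega>}" using adm w by (simp add: admissible_def)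
   then show "norm (v (max 0 (min t x)) w) \<le> \<Omega>" by auto
  qed
 qed (use m st in auto)
 then have "(%r. v (max 0 (min t r)) w) integrable_on {s..t}" by (rule set_borel_integral_eq_integral(1))
 then show ?thesis by (rule integrable_eq) (use st in auto)
qed

text \<open>The generator inequality is pointwise with the state frozen at \<open>X s\<close>,
  whereas the drift sees \<open>X r\<close>. Replacing one by the other inside the sine costs the
  oscillation integral; the control stays inside the integral and may vary arbitrarily over the
  cell.\<close>

lemma drift_generator_path:
 fixes X :: "real => real"
 assumes v: "u integrable_on {s..t}" and Xc: "continuous_on {0..} X" and st: "0 \<le> s" "s < t"
  and B: "\<bar>f1\<bar> \<le> B" and gen: "\<And>r. r \<in> {s..t} ==> (u r - 2 * \<gamma> * sin (2 * X s)) * f1 \<ge> L"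
  and ub: "\<And>r. r \<in> {s..t} ==> \<bar>u r\<bar> \<le> \<Omega>"
 defines "D \<equiv> integral {s..t} (%r. u r - 2 * \<gamma> * sin (2 * X r))"
 shows "f1 * D \<ge> (t - s) * L - 4 * \<gamma> * B * integral {s..t} (%r. min 1 \<bar>X r - X s\<bar>)"
  "\<bar>D\<bar> \<le> (\<Omega> + 2 * \<gamma>) * (t - s)"
proof -
 have st': "s \<le> t" using st by auto
 have si: "(%r. 2 * \<gamma> * sin (2 * X r)) integrable_on {s..t}"
  using st by (intro integrable_continuous_real continuous_intros continuous_on_subset[OF Xc]) auto
 have di: "(%r. u r - 2 * \<gamma> * sin (2 * X r)) integrable_on {s..t}" by (rule integrable_diff[OF v si])
 note mi = min_integral(1)[OF Xc st(1) st']
 have "integral {s..t} (%r. L - 4 * \<gamma> * B * min 1 \<bar>X r - X s\<bar>) \<le> integral {s..t} (%r. f1 * (u r - 2 * \<gamma> * sin (2 * X r)))"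
 proof (rule integral_le)
  show "(%r. L - 4 * \<gamma> * B * min 1 \<bar>X r - X s\<bar>) integrable_on {s..t}"
   by (intro integrable_diff integrable_const_ivl integrable_on_mult_right mi)
  show "(%r. f1 * (u r - 2 * \<gamma> * sin (2 * X r))) integrable_on {s..t}" by (intro integrable_on_mult_right di)
  fix r assume r: "r \<in> {s..t}"
  have "\<bar>2 * \<gamma> * f1 * (sin (2 * X r) - sin (2 * X s))\<bar> \<le> 2 * \<gamma> * B * (2 * min 1 \<bar>X r - X s\<bar>)"
   unfolding abs_mult using \<gamma>_pos B sin2_diff_min[of "X r" "X s"] by (intro mult_mono) auto
  moreover have "f1 * (u r - 2 * \<gamma> * sin (2 * X r)) = (u r - 2 * \<gamma> * sin (2 * X s)) * f1 - 2 * \<gamma> * f1 * (sin (2 * X r) - sin (2 * X s))"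
   by (simp add: algebra_simps)
  ultimately show "L - 4 * \<gamma> * B * min 1 \<bar>X r - X s\<bar> \<le> f1 * (u r - 2 * \<gamma> * sin (2 * X r))"
   using gen[OF r] by linarith
 qed
 also have "integral {s..t} (%r. f1 * (u r - 2 * \<gamma> * sin (2 * X r))) = f1 * D" unfolding D_def by simp
 also have "integral {s..t} (%r. L - 4 * \<gamma> * B * min 1 \<bar>X r - X s\<bar>) = (t - s) * L - 4 * \<gamma> * B * integral {s..t} (%r. min 1 \<bar>X r - X s\<bar>)"
 proof -
  have ig: "(%r. (4 * \<gamma> * B) * min 1 \<bar>X r - X s\<bar>) integrable_on {s..t}" by (rule integrable_on_mult_right[OF mi])
  show ?thesis using st integral_diff[OF integrable_const_ivl[of L s t] ig] by simp
 qed
 finally show "f1 * D \<ge> (t - s) * L - 4 * \<gamma> * B * integral {s..t} (%r. min 1 \<bar>X r - X s\<bar>)" .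
 have "norm D \<le> integral {s..t} (%r. \<Omega> + 2 * \<gamma>)"
  unfolding D_def
 proof (rule integral_norm_bound_integral[OF di])
  fix r assume r: "r \<in> {s..t}"
  have "\<bar>2 * \<gamma> * sin (2 * X r)\<bar> \<le> 2 * \<gamma> * 1" unfolding abs_mult using \<gamma>_pos by (intro mult_mono) auto
  then show "norm (u r - 2 * \<gamma> * sin (2 * X r)) \<le> \<Omega> + 2 * \<gamma>" using ub[OF r] unfolding real_norm_def by linarith
 qed (rule integrable_const_ivl)
 then show "\<bar>D\<bar> \<le> (\<Omega> + 2 * \<gamma>) * (t - s)" using st by (simp add: mult.commute)
qed

text \<open>The pathwise estimate is multiplied by \<open>alive\<close> and integrated. All terms
  linear in the noise have coefficients known at time \<open>s\<close>, so their expectations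
  vanish; what is left is the running cost and an error governed by the expected oscillation
  \<open>mu\<close>, by \<open>\<kappa> * h\<close>, and by terms of higher order in
  \<open>h\<close>.\<close>

lemma dynkin_step:
 assumes adm: "admissible M F \<Omega> v" and sol: "sde_solution M F W \<gamma> v x0 X"
  and s: "0 \<le> s" and h: "0 < h" "h \<le> 1" "lam * h \<le> 1"
  and fm [measurable]: "f \<in> borel_measurable borel" "f1 \<in> borel_measurable borel" "f2 \<in> borel_measurable borel" "\<psi> \<in> borel_measurable borel"
  and B: "\<And>x. \<bar>f x\<bar> \<le> B" "\<And>x. \<bar>f1 x\<bar> \<le> B" "\<And>x. \<bar>f2 x\<bar> \<le> B" "\<And>x. \<bar>\<psi> x\<bar> \<le> B"
  and R1: "\<And>x y. x \<in> {a..b} ==> \<bar>f y - f x - f1 x * (y - x) - f2 x / 2 * (y - x)\<^sup>2\<bar> \<le> C * (y - x)\<^sup>2"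
  and R2: "\<And>x y. x \<in> {a..b} ==> \<bar>f y - f x - f1 x * (y - x) - f2 x / 2 * (y - x)\<^sup>2\<bar> \<le> \<kappa> * (y - x)\<^sup>2 + K * \<bar>y - x\<bar> ^ 3"
  and nn: "0 \<le> C" "0 < \<kappa>" "0 \<le> K"
  and gen: "\<And>t \<omega> x. 0 \<le> t ==> \<omega> \<in> space M ==> x \<in> {a..b} ==>
   (v t \<omega> - 2 * \<gamma> * sin (2 * x)) * f1 x + 4 * \<gamma> * (sin x)\<^sup>2 * f2 x - lam * f x \<ge> - \<psi> x"
 defines "c \<equiv> 2 * sqrt (2 * \<gamma>)" and "Bd \<equiv> \<Omega> + 2 * \<gamma>"
 defines "K1 \<equiv> B * (lam\<^sup>2 + lam) + B * c * Bd + B * c\<^sup>2 / \<kappa> + B * Bd\<^sup>2 + B + 3 * \<kappa> * Bd\<^sup>2 + 3 * \<kappa> + 27 * K * Bd ^ 3 + 27 * K * c ^ 3 + 9 * C"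
 defines "mu \<equiv> \<integral>\<^sup>+\<omega>. (\<integral>\<^sup>+r\<in>{s..s + h}. ennreal (min 1 \<bar>X r \<omega> - X s \<omega>\<bar>) \<partial>lborel) \<partial>M"
 shows "mu < \<infinity>"
  "expectation (%\<omega>. alive X a b s \<omega> * (exp (- lam * (s + h)) * f (X (s + h) \<omega>) - exp (- lam * s) * f (X s \<omega>)))
   \<ge> - expectation (%\<omega>. alive X a b s \<omega> * (h * exp (- lam * s) * \<psi> (X s \<omega>)))
    - ((4 * \<gamma> * B + 16 * c\<^sup>2 * K1) * enn2real mu + \<kappa> * (B + 3 * c\<^sup>2) * h + K1 * (h\<^sup>2 + 3 * h * sqrt h))"
proof -
 define t where "t = s + h"
 have st: "s < t" "0 \<le> t" "t - s = h" using s h by (auto simp: t_def)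
 have prog: "progressive M F X" and Xc: "\<And>\<omega>. \<omega> \<in> space M ==> continuous_on {0..} (%t. X t \<omega>)"
  and X0: "\<And>\<omega>. \<omega> \<in> space M ==> X 0 \<omega> = x0"
  using sol by (auto simp: sde_solution_def)
 obtain Y where ito: "ito_integral M F W (%t \<omega>. - 2 * sqrt (2 * \<gamma>) * sin (X t \<omega>)) Y"
  and eq: "\<And>t. 0 \<le> t ==> AE \<omega> in M. X t \<omega> = x0 + integral {0..t} (%s. v s \<omega> - 2 * \<gamma> * sin (2 * X s \<omega>)) + Y t \<omega>"
  using sol unfolding sde_solution_def by blast
 define H where "H t \<omega> = - 2 * sqrt (2 * \<gamma>) * sin (X t \<omega>)" for t \<omega>
 have c0: "0 < c" and c2: "c\<^sup>2 = 8 * \<gamma>" using \<gamma>_pos by (auto simp: c_def power_mult_distrib)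
 have HK: "\<bar>H t \<omega>\<bar> \<le> c" for t \<omega>
 proof -
  have "\<bar>H t \<omega>\<bar> = c * \<bar>sin (X t \<omega>)\<bar>" using c0 \<gamma>_pos by (simp add: H_def c_def abs_mult)
  also have "\<dots> \<le> c * 1" using c0 by (intro mult_left_mono) auto
  finally show ?thesis by simp
 qed
 have H2: "(H t \<omega>)\<^sup>2 = 8 * \<gamma> * (sin (X t \<omega>))\<^sup>2" for t \<omega> using c2 by (simp add: H_def c_def power_mult_distrib)
 have B0: "0 \<le> B" using B(1)[of 0] by linarith
 have Bd0: "0 \<le> Bd" using \<Omega>_pos \<gamma>_pos by (simp add: Bd_def)
 have K10: "0 \<le> K1" unfolding K1_def using B0 c0 Bd0 nn lam_pos by (intro add_nonneg_nonneg mult_nonneg_nonneg divide_nonneg_nonneg) auto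
 define \<rho> where "\<rho> \<omega> = Y t \<omega> - Y s \<omega> - H s \<omega> * (W t \<omega> - W s \<omega>)" for \<omega>
 note it = ito_increment[OF ito[folded H_def] HK s st(1), folded \<rho>_def]
 have \<rho>M [measurable]: "\<rho> \<in> borel_measurable M" using it(1) by (simp add: \<rho>_def[abs_def])
 have \<rho>2: "integrable M (%\<omega>. (\<rho> \<omega>)\<^sup>2)" using it(2) .
 define m where "m \<omega> = integral {s..t} (%r. min 1 \<bar>X r \<omega> - X s \<omega>\<bar>)" for \<omega>
 have inner: "(\<integral>\<^sup>+r\<in>{s..t}. ennreal (min 1 \<bar>X r \<omega> - X s \<omega>\<bar>) \<partial>lborel) = ennreal (m \<omega>)" if "\<omega> \<in> space M" for \<omega>
  unfolding m_def by (rule min_integral(2)[OF Xc[OF that] s]) (use st in auto)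
 have m0: "0 \<le> m \<omega>" if "\<omega> \<in> space M" for \<omega>
  unfolding m_def by (rule integral_nonneg[OF min_integral(1)[OF Xc[OF that] s]]) (use st in auto)
 have mh: "m \<omega> \<le> h" if "\<omega> \<in> space M" for \<omega>
 proof -
  have "m \<omega> \<le> integral {s..t} (%_. 1)"
   unfolding m_def by (rule integral_le[OF min_integral(1)[OF Xc[OF that] s]]) (use st in auto)
  then show ?thesis using st by simp
 qed
 have XsF: "X s \<in> borel_measurable (F s)" by (rule progressive_measurable[OF prog s])
 have XM [measurable]: "X s \<in> borel_measurable M" "X t \<in> borel_measurable M"
  using measurable_F_M[OF XsF] measurable_F_M[OF progressive_measurable[OF prog st(2)]] by auto
 have mM [measurable]: "m \<in> borel_measurable M"
 proof -
  have Xm: "(%(\<omega>, r). X (max 0 (min t r)) \<omega>) \<in> borel_measurable (M \<Otimes>\<^sub>M borel)"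
   by (rule progressive_clamp[OF prog st(2) ident_M_F])
  have "(%\<omega>. \<integral>\<^sup>+r\<in>{s..t}. ennreal (min 1 \<bar>X (max 0 (min t r)) \<omega> - X s \<omega>\<bar>) \<partial>lborel) \<in> borel_measurable M"
   by (rule lborel.borel_measurable_nn_integral) (use Xm in \<open>simp add: split_beta', measurable\<close>)
  then have "(%\<omega>. enn2real (\<integral>\<^sup>+r\<in>{s..t}. ennreal (min 1 \<bar>X (max 0 (min t r)) \<omega> - X s \<omega>\<bar>) \<partial>lborel)) \<in> borel_measurable M" by measurable
  moreover have "m \<omega> = enn2real (\<integral>\<^sup>+r\<in>{s..t}. ennreal (min 1 \<bar>X (max 0 (min t r)) \<omega> - X s \<omega>\<bar>) \<partial>lborel)" if w: "\<omega> \<in> space M" for \<omega>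
  proof -
   have "(\<integral>\<^sup>+r\<in>{s..t}. ennreal (min 1 \<bar>X (max 0 (min t r)) \<omega> - X s \<omega>\<bar>) \<partial>lborel) = (\<integral>\<^sup>+r\<in>{s..t}. ennreal (min 1 \<bar>X r \<omega> - X s \<omega>\<bar>) \<partial>lborel)"
    by (rule nn_integral_cong) (use s in \<open>auto simp: indicator_def\<close>)
   then show ?thesis using inner[OF w] m0[OF w] by simp
  qed
  ultimately show ?thesis by (subst measurable_cong) auto
 qed
 have mi: "integrable M m" by (rule integrable_const_bound[of _ h]) (use m0 mh in \<open>auto intro!: AE_I2\<close>)
 have mu: "mu = ennreal (expectation m)"
 proof -
  have "mu = (\<integral>\<^sup>+\<omega>. ennreal (m \<omega>) \<partial>M)" unfolding mu_def t_def[symmetric] by (rule nn_integral_cong) (rule inner)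
  also have "\<dots> = ennreal (expectation m)" by (rule nn_integral_eq_integral[OF mi]) (use m0 in auto)
  finally show ?thesis .
 qed
 show "mu < \<infinity>" by (simp add: mu)
 have Em0: "0 \<le> expectation m" by (rule integral_nonneg_AE) (use m0 in auto)
 \<comment> \<open>With \<open>z\<close> the truncated oscillation, \<open>(H r - H s)\<^sup>2 \<le>
   c\<^sup>2 * (2 * z)\<^sup>2 \<le> 4 * c\<^sup>2 * z\<close>; the remaining factor 4 is that of
   \<open>ito_increment\<close>.\<close>
 have E\<rho>: "expectation (%\<omega>. (\<rho> \<omega>)\<^sup>2) \<le> 16 * c\<^sup>2 * expectation m"
 proof -
  have "(\<integral>\<^sup>+\<omega>. (\<integral>\<^sup>+r\<in>{s..t}. ennreal ((H r \<omega> - H s \<omega>)\<^sup>2) \<partial>lborel) \<partial>M) \<le> (\<integral>\<^sup>+\<omega>. ennreal (4 * c\<^sup>2) * ennreal (m \<omega>) \<partial>M)"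
  proof (rule nn_integral_mono)
   fix \<omega> assume w: "\<omega> \<in> space M"
   have Xb [measurable]: "(%r. X (max 0 (min t r)) \<omega>) \<in> borel_measurable borel" by (rule progressive_path[OF prog st(2) w])
   have le: "(H r \<omega> - H s \<omega>)\<^sup>2 \<le> 4 * c\<^sup>2 * min 1 \<bar>X r \<omega> - X s \<omega>\<bar>" for r
   proof -
    define z where "z = min 1 \<bar>X r \<omega> - X s \<omega>\<bar>"
    have z: "0 \<le> z" "z \<le> 1" by (auto simp: z_def)
    have "(H r \<omega> - H s \<omega>)\<^sup>2 = c\<^sup>2 * \<bar>sin (X r \<omega>) - sin (X s \<omega>)\<bar>\<^sup>2"
     by (simp add: H_def c_def power_mult_distrib power2_eq_square algebra_simps)
    also have "\<dots> \<le> c\<^sup>2 * (2 * z)\<^sup>2" unfolding z_def by (intro mult_left_mono power_mono sin_diff_min) auto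
    also have "\<dots> \<le> c\<^sup>2 * (4 * z)" using z by (intro mult_left_mono) (auto simp: power2_eq_square intro: mult_left_le)
    finally show ?thesis by (simp add: z_def mult_ac)
   qed
   have "(\<integral>\<^sup>+r\<in>{s..t}. ennreal ((H r \<omega> - H s \<omega>)\<^sup>2) \<partial>lborel) \<le> (\<integral>\<^sup>+r. ennreal (4 * c\<^sup>2) * (ennreal (min 1 \<bar>X (max 0 (min t r)) \<omega> - X s \<omega>\<bar>) * indicator {s..t} r) \<partial>lborel)"
   proof (rule nn_integral_mono)
    fix r
    show "ennreal ((H r \<omega> - H s \<omega>)\<^sup>2) * indicator {s..t} r \<le> ennreal (4 * c\<^sup>2) * (ennreal (min 1 \<bar>X (max 0 (min t r)) \<omega> - X s \<omega>\<bar>) * indicator {s..t} r)"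
     using ennreal_leI[OF le[of r]] s by (auto simp: indicator_def ennreal_mult)
   qed
   also have "\<dots> = ennreal (4 * c\<^sup>2) * (\<integral>\<^sup>+r\<in>{s..t}. ennreal (min 1 \<bar>X (max 0 (min t r)) \<omega> - X s \<omega>\<bar>) \<partial>lborel)"
    by (rule nn_integral_cmult) measurable
   also have "(\<integral>\<^sup>+r\<in>{s..t}. ennreal (min 1 \<bar>X (max 0 (min t r)) \<omega> - X s \<omega>\<bar>) \<partial>lborel) = ennreal (m \<omega>)"
    unfolding inner[OF w, symmetric] by (rule nn_integral_cong) (use s in \<open>auto simp: indicator_def\<close>)
   finally show "(\<integral>\<^sup>+r\<in>{s..t}. ennreal ((H r \<omega> - H s \<omega>)\<^sup>2) \<partial>lborel) \<le> ennreal (4 * c\<^sup>2) * ennreal (m \<omega>)" .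
  qed
  also have "\<dots> = ennreal (4 * c\<^sup>2) * ennreal (expectation m)"
   using m0 by (simp add: nn_integral_cmult nn_integral_eq_integral[OF mi])
  also have "\<dots> = ennreal (4 * c\<^sup>2 * expectation m)" using Em0 by (simp add: ennreal_mult)
  finally have "4 * (\<integral>\<^sup>+\<omega>. (\<integral>\<^sup>+r\<in>{s..t}. ennreal ((H r \<omega> - H s \<omega>)\<^sup>2) \<partial>lborel) \<partial>M) \<le> 4 * ennreal (4 * c\<^sup>2 * expectation m)"
   by (rule mult_left_mono) simp
  also have "\<dots> = ennreal (16 * c\<^sup>2 * expectation m)"
  proof -
   have "4 * ennreal (4 * c\<^sup>2 * expectation m) = ennreal 4 * ennreal (4 * c\<^sup>2 * expectation m)" by simp
   also have "\<dots> = ennreal (4 * (4 * c\<^sup>2 * expectation m))" using Em0 by (intro ennreal_mult[symmetric]) auto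
   finally show ?thesis by (simp add: mult_ac)
  qed
  finally have "ennreal (expectation (%\<omega>. (\<rho> \<omega>)\<^sup>2)) \<le> ennreal (16 * c\<^sup>2 * expectation m)" using it(4) by (rule order.trans[rotated])
  then show ?thesis using Em0 by (simp add: ennreal_le_iff)
 qed
 let ?al = "alive X a b s" and ?w = "%\<omega>. W t \<omega> - W s \<omega>"
 define E0 where "E0 = exp (- lam * s)"
 define E1 where "E1 = exp (- lam * t)"
 have E: "E0 = E1 * exp (lam * h)" "0 < E1" "E0 \<le> 1" "0 \<le> E0"
  using s lam_pos by (auto simp: E0_def E1_def t_def mult_exp_exp algebra_simps)
 have E1: "E1 \<le> 1" using st lam_pos by (simp add: E1_def)
 have alF [measurable]: "?al \<in> borel_measurable (F s)" by (rule alive_measurable[OF prog Xc s])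
 have alM [measurable]: "?al \<in> borel_measurable M" by (rule measurable_F_M[OF alF])
 define Err where "Err \<omega> = 4 * \<gamma> * B * m \<omega> + \<kappa> * (B + 3 * c\<^sup>2) * (?w \<omega>)\<^sup>2 + K1 * (h\<^sup>2 + h * \<bar>?w \<omega>\<bar> + \<bar>?w \<omega>\<bar> ^ 3 + (\<rho> \<omega>)\<^sup>2)" for \<omega>
 \<comment> \<open>The coefficients of the three mean-zero noise terms: the Brownian increment, the
   unfrozen rest \<rho>, and the compensated square of the increment. The indicator is included,
   which keeps them bounded and \<open>F s\<close>-measurable.\<close>
 define q1 where "q1 \<omega> = ?al \<omega> * (E1 * f1 (X s \<omega>) * H s \<omega>)" for \<omega>
 define q2 where "q2 \<omega> = ?al \<omega> * (E1 * f1 (X s \<omega>))" for \<omega>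
 define q3 where "q3 \<omega> = ?al \<omega> * (E1 * (f2 (X s \<omega>) / 2 * (H s \<omega>)\<^sup>2))" for \<omega>
 have path: "AE \<omega> in M. - (?al \<omega> * (h * E0 * \<psi> (X s \<omega>))) + (q1 \<omega> * ?w \<omega> + q2 \<omega> * \<rho> \<omega> + q3 \<omega> * ((?w \<omega>)\<^sup>2 - h)) - Err \<omega>
   \<le> ?al \<omega> * (E1 * f (X t \<omega>) - E0 * f (X s \<omega>))"
  using eq[OF s] eq[OF st(2)] AE_space
 proof eventually_elim
  case (elim \<omega>)
  then have w: "\<omega> \<in> space M" by simp
  have Err0: "0 \<le> Err \<omega>" unfolding Err_def using \<gamma>_pos B0 m0[OF w] nn K10 h
   by (intro add_nonneg_nonneg mult_nonneg_nonneg) auto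
  show ?case
  proof (cases "?al \<omega> = 0")
   case True then show ?thesis using Err0 by (simp add: q1_def q2_def q3_def)
  next
   case False
   then have al1: "?al \<omega> = 1" and inI: "X s \<omega> \<in> {a..b}" using s by (auto simp: alive_def split: if_splits)
   define D where "D = integral {s..t} (%r. v r \<omega> - 2 * \<gamma> * sin (2 * X r \<omega>))"
   have vi: "(%r. v r \<omega> - 2 * \<gamma> * sin (2 * X r \<omega>)) integrable_on {0..t}"
    using st by (intro integrable_diff control_integrable[OF adm w] integrable_continuous_real continuous_intros
      continuous_on_subset[OF Xc[OF w]]) auto
   have "integral {0..s} (%r. v r \<omega> - 2 * \<gamma> * sin (2 * X r \<omega>)) + D = integral {0..t} (%r. v r \<omega> - 2 * \<gamma> * sin (2 * X r \<omega>))"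
    unfolding D_def by (rule Henstock_Kurzweil_Integration.integral_combine[OF _ _ vi]) (use s st in auto)
   then have dX: "X t \<omega> - X s \<omega> = D + H s \<omega> * ?w \<omega> + \<rho> \<omega>" using elim by (simp add: \<rho>_def)
   define L where "L = lam * f (X s \<omega>) - \<psi> (X s \<omega>) - 4 * \<gamma> * (sin (X s \<omega>))\<^sup>2 * f2 (X s \<omega>)"
   have vb: "\<bar>v r \<omega>\<bar> \<le> \<Omega>" if "r \<in> {s..t}" for r
   proof -
    have "v r \<omega> \<in> {-\<Omega>..\<Omega>}" using adm w that s by (auto simp: admissible_def)
    then show ?thesis by auto
   qed
   have genr: "(v r \<omega> - 2 * \<gamma> * sin (2 * X s \<omega>)) * f1 (X s \<omega>) \<ge> L" if "r \<in> {s..t}" for r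
    using gen[of r \<omega> "X s \<omega>"] that s w inI by (simp add: L_def)
   have vi': "(%r. v r \<omega>) integrable_on {s..t}" by (rule control_integrable[OF adm w s]) (use st in auto)
   note dg = drift_generator_path[OF vi' Xc[OF w] s st(1) B(2) genr vb, folded D_def m_def Bd_def]
   have g2: "f1 (X s \<omega>) * D + h / 2 * (H s \<omega>)\<^sup>2 * f2 (X s \<omega>) \<ge> h * (lam * f (X s \<omega>) - \<psi> (X s \<omega>)) - 4 * \<gamma> * B * m \<omega>"
    using dg(1) unfolding st(3) H2 L_def by (simp add: algebra_simps)
   have "- (h * E0 * \<psi> (X s \<omega>)) + (E1 * f1 (X s \<omega>) * H s \<omega> * ?w \<omega> + E1 * f1 (X s \<omega>) * \<rho> \<omega> + E1 * (f2 (X s \<omega>) / 2 * (H s \<omega>)\<^sup>2) * ((?w \<omega>)\<^sup>2 - h))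
    - (4 * \<gamma> * B * m \<omega> + \<kappa> * (B + 3 * c\<^sup>2) * (?w \<omega>)\<^sup>2 + K1 * (h\<^sup>2 + h * \<bar>?w \<omega>\<bar> + \<bar>?w \<omega>\<bar> ^ 3 + (\<rho> \<omega>)\<^sup>2))
    \<le> E1 * f (X t \<omega>) - E0 * f (X s \<omega>)"
    by (rule dynkin_step_path[OF h(1,2) lam_pos h(3) E(1-3) B(1) B(2) B(3) B(4) dg(2)[unfolded st(3)] Bd0 HK
      R1[OF inI] R2[OF inI] dX nn _ g2 K1_def[THEN meta_eq_to_obj_eq]])
     (use \<gamma>_pos B0 m0[OF w] in auto)
   then show ?thesis by (simp add: al1 q1_def q2_def q3_def Err_def)
  qed
 qed
 have HF [measurable]: "H s \<in> borel_measurable (F s)" unfolding H_def[abs_def] using XsF by measurable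
 have qF: "q1 \<in> borel_measurable (F s)" "q2 \<in> borel_measurable (F s)" "q3 \<in> borel_measurable (F s)"
  unfolding q1_def[abs_def] q2_def[abs_def] q3_def[abs_def] using XsF alF HF by measurable
 have qM [measurable]: "q1 \<in> borel_measurable M" "q2 \<in> borel_measurable M" "q3 \<in> borel_measurable M"
  using qF by (auto intro: measurable_F_M)
 have qb: "\<bar>q1 \<omega>\<bar> \<le> B * c" "\<bar>q2 \<omega>\<bar> \<le> B" "\<bar>q3 \<omega>\<bar> \<le> B * c\<^sup>2" for \<omega>
 proof -
  have e: "\<bar>E1\<bar> \<le> 1" using E E1 by auto
  have hh: "\<bar>(H s \<omega>)\<^sup>2\<bar> \<le> c\<^sup>2" using power_mono[OF HK[of s \<omega>], of 2] by simp
  have "\<bar>q1 \<omega>\<bar> \<le> 1 * (1 * B * c)"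
   unfolding q1_def abs_mult using alive_bound e B HK B0 by (intro mult_mono) auto
  then show "\<bar>q1 \<omega>\<bar> \<le> B * c" by simp
  have "\<bar>q2 \<omega>\<bar> \<le> 1 * (1 * B)"
   unfolding q2_def abs_mult using alive_bound e B B0 by (intro mult_mono) auto
  then show "\<bar>q2 \<omega>\<bar> \<le> B" by simp
  have "\<bar>f2 (X s \<omega>) / 2\<bar> \<le> B" using B(3)[of "X s \<omega>"] by auto
  then have "\<bar>q3 \<omega>\<bar> \<le> 1 * (1 * (B * c\<^sup>2))"
   unfolding q3_def abs_mult[of "alive X a b s \<omega>"] abs_mult[of E1] abs_mult[of "f2 (X s \<omega>) / 2"]
   using alive_bound e hh B0 by (intro mult_mono) auto
  then show "\<bar>q3 \<omega>\<bar> \<le> B * c\<^sup>2" by simp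
 qed
 have qi: "integrable M q1" "integrable M q2" "integrable M q3"
  using qb by (auto intro!: integrable_const_bound AE_I2)
 have wi: "integrable M ?w" "integrable M (%\<omega>. (?w \<omega>)\<^sup>2)"
  using increment_power(1)[OF s st(1), of 1] increment_power(1)[OF s st(1), of 2] by auto
 have wE: "expectation ?w = 0" "expectation (%\<omega>. (?w \<omega>)\<^sup>2) = h"
  using increment_power(3)[OF s st(1)] increment_moments(1)[OF s st(1)] st by auto
 have Q1: "integrable M (%\<omega>. q1 \<omega> * ?w \<omega>)" "expectation (%\<omega>. q1 \<omega> * ?w \<omega>) = 0"
  using increment_mult[OF s st(1) qF(1) qi(1), of "%x. x"] wi wE by auto
 have w2i: "integrable M (%\<omega>. (?w \<omega>)\<^sup>2 - h)" using wi by auto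
 have "expectation (%\<omega>. (?w \<omega>)\<^sup>2 - h) = 0" using wi wE by (simp add: prob_space)
 then have Q3: "integrable M (%\<omega>. q3 \<omega> * ((?w \<omega>)\<^sup>2 - h))" "expectation (%\<omega>. q3 \<omega> * ((?w \<omega>)\<^sup>2 - h)) = 0"
  using increment_mult[OF s st(1) qF(3) qi(3), of "%x. x\<^sup>2 - h"] w2i by auto
 have \<rho>i: "integrable M \<rho>" by (rule square_integrable_imp_integrable[OF \<rho>M \<rho>2])
 have Q2: "integrable M (%\<omega>. q2 \<omega> * \<rho> \<omega>)" "expectation (%\<omega>. q2 \<omega> * \<rho> \<omega>) = 0"
 proof -
  show "integrable M (%\<omega>. q2 \<omega> * \<rho> \<omega>)"
  proof (rule Bochner_Integration.integrable_bound[of _ "%\<omega>. B * \<rho> \<omega>"])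
   show "integrable M (%\<omega>. B * \<rho> \<omega>)" using \<rho>i by auto
   show "AE \<omega> in M. norm (q2 \<omega> * \<rho> \<omega>) \<le> norm (B * \<rho> \<omega>)"
   proof (rule AE_I2)
    fix \<omega>
    have "\<bar>q2 \<omega>\<bar> * \<bar>\<rho> \<omega>\<bar> \<le> \<bar>B\<bar> * \<bar>\<rho> \<omega>\<bar>" using qb(2)[of \<omega>] by (intro mult_right_mono) auto
    then show "norm (q2 \<omega> * \<rho> \<omega>) \<le> norm (B * \<rho> \<omega>)" by (simp add: abs_mult)
   qed
  qed measurable
  show "expectation (%\<omega>. q2 \<omega> * \<rho> \<omega>) = 0" by (rule it(3)[OF qF(2)]) (use qb in auto)
 qed
 have w3: "integrable M (%\<omega>. \<bar>?w \<omega>\<bar> ^ 3)" "expectation (%\<omega>. \<bar>?w \<omega>\<bar> ^ 3) \<le> 2 * h * sqrt h"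
  using increment_abs_cube[OF s st(1)] st by auto
 have WM: "?w \<in> borel_measurable M" using s st by (intro borel_measurable_diff W_measurable_M) auto
 have w1: "integrable M (%\<omega>. \<bar>?w \<omega>\<bar>)" "expectation (%\<omega>. \<bar>?w \<omega>\<bar>) \<le> sqrt h"
 proof -
  show "integrable M (%\<omega>. \<bar>?w \<omega>\<bar>)" using wi by auto
  have "(expectation (%\<omega>. \<bar>?w \<omega>\<bar>))\<^sup>2 \<le> expectation (%\<omega>. \<bar>?w \<omega>\<bar>\<^sup>2)"
   by (rule expectation_sq_le) (use wi WM in auto)
  then show "expectation (%\<omega>. \<bar>?w \<omega>\<bar>) \<le> sqrt h" using wE by (intro real_le_rsqrt) simp
 qed
 have Ei: "integrable M Err"
  unfolding Err_def[abs_def] using mi wi w1 w3 \<rho>2 by (intro Bochner_Integration.integrable_add integrable_mult_right) auto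
 have EErr: "expectation Err \<le> (4 * \<gamma> * B + 16 * c\<^sup>2 * K1) * expectation m + \<kappa> * (B + 3 * c\<^sup>2) * h + K1 * (h\<^sup>2 + 3 * h * sqrt h)"
 proof -
  have "expectation Err = 4 * \<gamma> * B * expectation m + \<kappa> * (B + 3 * c\<^sup>2) * h + K1 * (h\<^sup>2 + h * expectation (%\<omega>. \<bar>?w \<omega>\<bar>) + expectation (%\<omega>. \<bar>?w \<omega>\<bar> ^ 3) + expectation (%\<omega>. (\<rho> \<omega>)\<^sup>2))"
   unfolding Err_def using mi wi w1 w3 \<rho>2 wE
   by (subst Bochner_Integration.integral_add | simp add: prob_space)+
  also have "\<dots> \<le> 4 * \<gamma> * B * expectation m + \<kappa> * (B + 3 * c\<^sup>2) * h + K1 * (h\<^sup>2 + h * sqrt h + 2 * h * sqrt h + 16 * c\<^sup>2 * expectation m)"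
   using w1 w3 E\<rho> K10 h by (intro add_mono mult_left_mono order_refl) auto
  finally show ?thesis by (simp add: algebra_simps)
 qed
 have psi_i: "integrable M (%\<omega>. ?al \<omega> * (h * E0 * \<psi> (X s \<omega>)))"
 proof (rule integrable_const_bound[of _ "1 * (h * 1 * B)"])
  show "AE \<omega> in M. norm (?al \<omega> * (h * E0 * \<psi> (X s \<omega>))) \<le> 1 * (h * 1 * B)"
   unfolding real_norm_def abs_mult using alive_bound E h B B0 by (intro AE_I2 mult_mono) auto
 qed measurable
 have f_i: "integrable M (%\<omega>. ?al \<omega> * (E1 * f (X t \<omega>) - E0 * f (X s \<omega>)))"
 proof (rule integrable_const_bound[of _ "1 * (1 * B + 1 * B)"])
  show "AE \<omega> in M. norm (?al \<omega> * (E1 * f (X t \<omega>) - E0 * f (X s \<omega>))) \<le> 1 * (1 * B + 1 * B)"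
  proof (rule AE_I2)
   fix \<omega>
   have "\<bar>E1 * f (X t \<omega>)\<bar> \<le> 1 * B" "\<bar>E0 * f (X s \<omega>)\<bar> \<le> 1 * B" unfolding abs_mult using E E1 B B0 by (intro mult_mono; auto)+
   then have "\<bar>E1 * f (X t \<omega>) - E0 * f (X s \<omega>)\<bar> \<le> 1 * B + 1 * B" by linarith
   then show "norm (?al \<omega> * (E1 * f (X t \<omega>) - E0 * f (X s \<omega>))) \<le> 1 * (1 * B + 1 * B)"
    unfolding real_norm_def abs_mult using alive_bound B0 by (intro mult_mono) auto
  qed
 qed measurable
 have "expectation (%\<omega>. - (?al \<omega> * (h * E0 * \<psi> (X s \<omega>))) + (q1 \<omega> * ?w \<omega> + q2 \<omega> * \<rho> \<omega> + q3 \<omega> * ((?w \<omega>)\<^sup>2 - h)) - Err \<omega>)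
  \<le> expectation (%\<omega>. ?al \<omega> * (E1 * f (X t \<omega>) - E0 * f (X s \<omega>)))"
  by (rule integral_mono_AE[OF _ f_i path])
   (intro Bochner_Integration.integrable_add Bochner_Integration.integrable_diff Bochner_Integration.integrable_minus psi_i Q1 Q2 Q3 Ei)
 also have "expectation (%\<omega>. - (?al \<omega> * (h * E0 * \<psi> (X s \<omega>))) + (q1 \<omega> * ?w \<omega> + q2 \<omega> * \<rho> \<omega> + q3 \<omega> * ((?w \<omega>)\<^sup>2 - h)) - Err \<omega>)
  = - expectation (%\<omega>. ?al \<omega> * (h * E0 * \<psi> (X s \<omega>))) - expectation Err"
  using psi_i Q1 Q2 Q3 Ei by (simp del: right_diff_distrib_numeral)
 finally show "expectation (%\<omega>. alive X a b s \<omega> * (exp (- lam * (s + h)) * f (X (s + h) \<omega>) - exp (- lam * s) * f (X s \<omega>)))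
   \<ge> - expectation (%\<omega>. alive X a b s \<omega> * (h * exp (- lam * s) * \<psi> (X s \<omega>)))
    - ((4 * \<gamma> * B + 16 * c\<^sup>2 * K1) * enn2real mu + \<kappa> * (B + 3 * c\<^sup>2) * h + K1 * (h\<^sup>2 + 3 * h * sqrt h))"
  using EErr Em0 unfolding mu E0_def E1_def t_def by simp
qed

end

text \<open>Discrete optional stopping for a sequence that is 1 up to some index and 0 from there
  on: the weighted sum of differences stops at the first index with weight 0, or at
  \<open>N\<close>.\<close>

lemma telescope_until:
 fixes a m :: "nat => real"
 assumes a: "\<And>k. a k = 0 \<or> a k = 1" "a 0 = 1" and dec: "\<And>k. a k = 0 ==> a (Suc k) = 0"
 shows "\<exists>j\<le>N. (\<Sum>k<N. a k * (m (Suc k) - m k)) = m j - m 0 \<and> (\<forall>i<j. a i = 1) \<and> (j = N \<or> a j = 0)"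
proof (induction N)
 case 0 show ?case by auto
next
 case (Suc N)
 then obtain j where j: "j \<le> N" "(\<Sum>k<N. a k * (m (Suc k) - m k)) = m j - m 0" "\<forall>i<j. a i = 1" "j = N \<or> a j = 0" by blast
 show ?case
 proof (cases "a j = 0")
  case True
  have "a (j + i) = 0" for i by (induction i) (use True dec in auto)
  from this[of "N - j"] have "a N = 0" using j(1) by simp
  then show ?thesis using j True by (intro exI[of _ j]) auto
 next
  case False
  then have "j = N" "a N = 1" using j(4) a(1)[of N] by auto
  then show ?thesis using j by (intro exI[of _ "Suc N"]) (auto simp: less_Suc_eq)
 qed
qed

text \<open>The remainder is measured by the oscillation of the second derivative along the segment,
  via two mean value inequalities. Uniform continuity of that derivative then gives estimates
  uniform in the base point, beyond what the Peano form offers.\<close>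

lemma taylor_segment:
 fixes g g1 g2 :: "real => real"
 assumes g: "\<And>z. z \<in> closed_segment x y ==> (g has_real_derivative g1 z) (at z)"
  and g1: "\<And>z. z \<in> closed_segment x y ==> (g1 has_real_derivative g2 z) (at z)"
  and m: "\<And>z. z \<in> closed_segment x y ==> \<bar>g2 z - g2 x\<bar> \<le> m"
 shows "\<bar>g y - g x - g1 x * (y - x) - g2 x / 2 * (y - x)\<^sup>2\<bar> \<le> m * (y - x)\<^sup>2"
proof -
 have seg: "\<bar>z - x\<bar> \<le> \<bar>y - x\<bar>" "closed_segment x z \<subseteq> closed_segment x y" if "z \<in> closed_segment x y" for z
  using that by (auto simp: closed_segment_eq_real_ivl split: if_splits)
 have m0: "0 \<le> m" using m[of x] by auto
 have d1: "\<bar>g1 z - g1 x - g2 x * (z - x)\<bar> \<le> m * \<bar>z - x\<bar>" if z: "z \<in> closed_segment x y" for z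
 proof -
  have "norm ((g1 z - g2 x * z) - (g1 x - g2 x * x)) \<le> m * norm (z - x)"
  proof (rule field_differentiable_bound[of "closed_segment x z" "%z. g1 z - g2 x * z" "%z. g2 z - g2 x"])
   fix u assume "u \<in> closed_segment x z"
   then have u: "u \<in> closed_segment x y" using seg(2)[OF z] by auto
   have "((%z. g1 z - g2 x * z) has_real_derivative g2 u - g2 x * 1) (at u)"
    by (intro DERIV_diff g1[OF u] DERIV_cmult DERIV_ident)
   then show "((%z. g1 z - g2 x * z) has_real_derivative g2 u - g2 x) (at u within closed_segment x z)"
    unfolding mult_1_right by (rule has_field_derivative_at_within)
   show "norm (g2 u - g2 x) \<le> m" using m[OF u] by simp
  qed auto
  then show ?thesis by (simp add: algebra_simps)
 qed
 define r where "r z = g z - (g1 x * (z - x) + g2 x / 2 * (z - x)\<^sup>2)" for z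
 have "norm (r y - r x) \<le> (m * \<bar>y - x\<bar>) * norm (y - x)"
 proof (rule field_differentiable_bound[of "closed_segment x y" r "%z. g1 z - g1 x - g2 x * (z - x)"])
  fix z assume z: "z \<in> closed_segment x y"
  have "((%z. g1 x * (z - x) + g2 x / 2 * (z - x)\<^sup>2) has_real_derivative g1 x + g2 x * (z - x)) (at z)"
   by (auto intro!: derivative_eq_intros)
  from DERIV_diff[OF g[OF z] this] have "(r has_real_derivative g1 z - g1 x - g2 x * (z - x)) (at z)"
   unfolding r_def[abs_def] diff_diff_eq .
  then show "(r has_field_derivative g1 z - g1 x - g2 x * (z - x)) (at z within closed_segment x y)"
   by (rule has_field_derivative_at_within)
  show "norm (g1 z - g1 x - g2 x * (z - x)) \<le> m * \<bar>y - x\<bar>"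
   using d1[OF z] mult_left_mono[OF seg(1)[OF z] m0] by simp
 qed auto
 then show ?thesis by (simp add: r_def power2_eq_square algebra_simps abs_mult_self_eq)
qed

definition clamp_sym :: "real => real => real" where "clamp_sym p y = max (- p) (min p y)"

lemma clamp_sym_props:
 assumes "0 \<le> p"
 shows "\<bar>y\<bar> \<le> p ==> clamp_sym p y = y" "\<bar>clamp_sym p y\<bar> \<le> p" "continuous_on A (clamp_sym p)"
  "p \<le> \<bar>y\<bar> ==> \<bar>clamp_sym p y\<bar> = p"
proof -
 show "continuous_on A (clamp_sym p)" unfolding clamp_sym_def[abs_def] by (intro continuous_intros)
qed (use assms in \<open>auto simp: clamp_sym_def\<close>)

text \<open>A function that is C2 only on \<open>[-q, q]\<close> is frozen outside. For base points
  in \<open>[-p, p]\<close> the Taylor estimates nevertheless hold for all \<open>y\<close> on the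
  line: a \<open>y\<close> beyond \<open>q\<close> is at distance at least \<open>q - p\<close>,
  where \<open>(y - x)\<^sup>2\<close> dominates every bounded or linear term.\<close>

lemma taylor_clamp:
 fixes g g1 g2 :: "real => real"
 assumes p: "0 < p" "p < q"
  and g: "\<And>z. \<bar>z\<bar> \<le> q ==> (g has_real_derivative g1 z) (at z)"
  and g1: "\<And>z. \<bar>z\<bar> \<le> q ==> (g1 has_real_derivative g2 z) (at z)"
  and g2: "continuous_on {-q..q} g2"
 obtains C where "0 \<le> C"
  "\<And>x y. \<bar>x\<bar> \<le> p ==> \<bar>g (clamp_sym q y) - g x - g1 x * (y - x) - g2 x / 2 * (y - x)\<^sup>2\<bar> \<le> C * (y - x)\<^sup>2"
  "\<And>\<kappa>. \<kappa> > 0 ==> \<exists>K\<ge>0. \<forall>x y. \<bar>x\<bar> \<le> p -->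
   \<bar>g (clamp_sym q y) - g x - g1 x * (y - x) - g2 x / 2 * (y - x)\<^sup>2\<bar> \<le> \<kappa> * (y - x)\<^sup>2 + K * \<bar>y - x\<bar> ^ 3"
proof -
 have gd: "continuous_on {-q..q} g"
 proof (rule DERIV_continuous_on)
  fix x assume "x \<in> {-q..q}"
  then show "(g has_real_derivative g1 x) (at x within {-q..q})" by (intro has_field_derivative_at_within[OF g]) auto
 qed
 have g1d: "continuous_on {-q..q} g1"
 proof (rule DERIV_continuous_on)
  fix x assume "x \<in> {-q..q}"
  then show "(g1 has_real_derivative g2 x) (at x within {-q..q})" by (intro has_field_derivative_at_within[OF g1]) auto
 qed
 have bd: "\<exists>b\<ge>0. \<forall>x. \<bar>x\<bar> \<le> q --> \<bar>u x\<bar> \<le> b" if "continuous_on {-q..q} u" for u :: "real => real"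
 proof -
  have "bounded (u ` {-q..q})" by (intro compact_imp_bounded compact_continuous_image that) auto
  then obtain b where b: "\<forall>y\<in>u ` {-q..q}. norm y \<le> b" unfolding bounded_iff by blast
  show ?thesis
  proof (intro exI[of _ "\<bar>b\<bar>"] conjI allI impI)
   fix x assume "\<bar>x\<bar> \<le> q"
   then have "u x \<in> u ` {-q..q}" by (intro imageI) auto
   with b have "norm (u x) \<le> b" by blast
   then show "\<bar>u x\<bar> \<le> \<bar>b\<bar>" by simp
  qed simp
 qed
 obtain Bg where Bg: "0 \<le> Bg" "\<And>x. \<bar>x\<bar> \<le> q ==> \<bar>g x\<bar> \<le> Bg" using bd[OF gd] by blast
 obtain B1 where B1: "0 \<le> B1" "\<And>x. \<bar>x\<bar> \<le> q ==> \<bar>g1 x\<bar> \<le> B1" using bd[OF g1d] by blast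
 obtain B2 where B2: "0 \<le> B2" "\<And>x. \<bar>x\<bar> \<le> q ==> \<bar>g2 x\<bar> \<le> B2" using bd[OF g2] by blast
 let ?R = "%x y. \<bar>g (clamp_sym q y) - g x - g1 x * (y - x) - g2 x / 2 * (y - x)\<^sup>2\<bar>"
 have q0: "0 \<le> q" using p by auto
 have segq: "\<bar>z\<bar> \<le> q" if "z \<in> closed_segment x y" "\<bar>x\<bar> \<le> q" "\<bar>y\<bar> \<le> q" for x y z
  using that by (auto simp: closed_segment_eq_real_ivl abs_le_iff split: if_splits)
 have near: "?R x y \<le> m * (y - x)\<^sup>2" if x: "\<bar>x\<bar> \<le> q" and y: "\<bar>y\<bar> \<le> q" and m: "\<And>z. z \<in> closed_segment x y ==> \<bar>g2 z - g2 x\<bar> \<le> m" for x y m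
  unfolding clamp_sym_props(1)[OF q0 y]
  by (rule taylor_segment[OF g g1 m]) (use segq[OF _ x y] in auto)
 define \<delta> where "\<delta> = q - p"
 have \<delta>: "\<delta> > 0" using p by (simp add: \<delta>_def)
 \<comment> \<open>The three summands pay, in this order, for the second derivative, for the values
   at points at distance at least \<delta>, and for the linear term there.\<close>
 define C where "C = 2 * B2 + 2 * Bg / \<delta>\<^sup>2 + B1 / \<delta>"
 have C0: "0 \<le> C" using B2 Bg B1 \<delta> by (auto simp: C_def)
 have c1: "?R x y \<le> C * (y - x)\<^sup>2" if x: "\<bar>x\<bar> \<le> p" for x y
 proof -
  have xq: "\<bar>x\<bar> \<le> q" using x p by auto
  show ?thesis
  proof (cases "\<bar>y\<bar> \<le> q")
   case True
   have "?R x y \<le> (2 * B2) * (y - x)\<^sup>2"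
   proof (rule near[OF xq True])
    fix z assume "z \<in> closed_segment x y"
    then have "\<bar>g2 z\<bar> \<le> B2" using B2(2)[OF segq[OF _ xq True]] by auto
    then show "\<bar>g2 z - g2 x\<bar> \<le> 2 * B2" using B2(2)[OF xq] by linarith
   qed
   also have "\<dots> \<le> C * (y - x)\<^sup>2" using Bg B1 \<delta> unfolding C_def by (intro mult_right_mono) auto
   finally show ?thesis .
  next
   case False
   then have far: "\<delta> \<le> \<bar>y - x\<bar>" using x by (auto simp: \<delta>_def)
   have e1: "2 * Bg \<le> 2 * Bg / \<delta>\<^sup>2 * (y - x)\<^sup>2"
   proof -
    have "\<delta>\<^sup>2 \<le> (y - x)\<^sup>2" using power_mono[OF far, of 2] \<delta> by simp
    from mult_left_mono[OF this, of "2 * Bg / \<delta>\<^sup>2"] show ?thesis using Bg \<delta> by simp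
   qed
   have e2: "B1 * \<bar>y - x\<bar> \<le> B1 / \<delta> * (y - x)\<^sup>2"
   proof -
    have "\<delta> * \<bar>y - x\<bar> \<le> \<bar>y - x\<bar> * \<bar>y - x\<bar>" using far by (intro mult_right_mono) auto
    from mult_left_mono[OF this, of "B1 / \<delta>"] show ?thesis using B1 \<delta> by (simp add: power2_eq_square)
   qed
   have "\<bar>g (clamp_sym q y)\<bar> \<le> Bg" using Bg clamp_sym_props(2)[OF q0] by auto
   moreover have "\<bar>g x\<bar> \<le> Bg" using Bg xq by auto
   moreover have "\<bar>g1 x * (y - x)\<bar> \<le> B1 * \<bar>y - x\<bar>" unfolding abs_mult using B1 xq by (intro mult_right_mono) auto
   moreover have "\<bar>g2 x / 2 * (y - x)\<^sup>2\<bar> \<le> 2 * B2 * (y - x)\<^sup>2"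
   proof -
    have "\<bar>g2 x / 2\<bar> \<le> 2 * B2" using B2(1) B2(2)[OF xq] by auto
    then show ?thesis unfolding abs_mult by (intro mult_mono) auto
   qed
   ultimately have "?R x y \<le> 2 * Bg + B1 * \<bar>y - x\<bar> + 2 * B2 * (y - x)\<^sup>2" by linarith
   also have "\<dots> \<le> C * (y - x)\<^sup>2" using e1 e2 unfolding C_def by (simp add: algebra_simps)
   finally show ?thesis .
  qed
 qed
 have c2: "\<exists>K\<ge>0. \<forall>x y. \<bar>x\<bar> \<le> p --> ?R x y \<le> \<kappa> * (y - x)\<^sup>2 + K * \<bar>y - x\<bar> ^ 3" if k: "\<kappa> > 0" for \<kappa>
 proof -
  have "uniformly_continuous_on {-q..q} g2" by (rule compact_uniformly_continuous[OF g2]) auto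
  then obtain d where d: "d > 0" "\<And>x z. x \<in> {-q..q} ==> z \<in> {-q..q} ==> dist z x < d ==> dist (g2 z) (g2 x) < \<kappa>"
   using k unfolding uniformly_continuous_on_def by metis
  define d' where "d' = min d \<delta>"
  have d': "d' > 0" "d' \<le> d" "d' \<le> \<delta>" using d \<delta> by (auto simp: d'_def)
  show ?thesis
  proof (intro exI[of _ "C / d'"] conjI allI impI)
   show "0 \<le> C / d'" using C0 d' by auto
   fix x y assume x: "\<bar>x\<bar> \<le> p"
   have xq: "\<bar>x\<bar> \<le> q" using x p by auto
   have K0: "0 \<le> C / d' * \<bar>y - x\<bar> ^ 3" using C0 d' by auto
   show "?R x y \<le> \<kappa> * (y - x)\<^sup>2 + C / d' * \<bar>y - x\<bar> ^ 3"
   proof (cases "\<bar>y - x\<bar> < d'")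
    case True
    then have y: "\<bar>y\<bar> \<le> q" using x d' by (auto simp: \<delta>_def)
    have "?R x y \<le> \<kappa> * (y - x)\<^sup>2"
    proof (rule near[OF xq y])
     fix z assume z: "z \<in> closed_segment x y"
     have "\<bar>z - x\<bar> \<le> \<bar>y - x\<bar>" using z by (auto simp: closed_segment_eq_real_ivl split: if_splits)
     then have "dist (g2 z) (g2 x) < \<kappa>" using segq[OF z xq y] xq True d' by (intro d(2)) (auto simp: dist_real_def abs_le_iff)
     then show "\<bar>g2 z - g2 x\<bar> \<le> \<kappa>" by (simp add: dist_real_def)
    qed
    then show ?thesis using K0 by linarith
   next
    case False
    then have "d' * (y - x)\<^sup>2 \<le> \<bar>y - x\<bar> * (y - x)\<^sup>2" by (intro mult_right_mono) auto
    from mult_left_mono[OF this, of "C / d'"] have "C * (y - x)\<^sup>2 \<le> C / d' * \<bar>y - x\<bar> ^ 3"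
     using C0 d' by (simp add: power2_eq_square power3_eq_cube abs_mult_self_eq)
    then show ?thesis using c1[OF x, of y] k by (smt (verit, ccfv_SIG) mult_nonneg_nonneg zero_le_power2)
   qed
  qed
 qed
 show ?thesis by (rule that[OF C0 c1 c2])
qed

section \<open>Dynkin's inequality over a fine grid\<close>

context controlled_qubit
begin

text \<open>Summed over \<open>N\<close> cells, the oscillation error is killed by
  \<open>grid_modulus\<close>, the higher order terms vanish because \<open>N * h = T\<close>, and
  the term with \<kappa> stays at a fixed multiple of \<open>T * \<kappa>\<close>. Only a lower
  bound on the generator is assumed, for every control value that occurs and on
  \<open>[a, b]\<close> only.\<close>

lemma dynkin_sum:
 assumes adm: "admissible M F \<Omega> v" and sol: "sde_solution M F W \<gamma> v x0 X" and T: "0 < T" and \<epsilon>: "0 < \<epsilon>"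
  and fm: "f \<in> borel_measurable borel" "f1 \<in> borel_measurable borel" "f2 \<in> borel_measurable borel" "\<psi> \<in> borel_measurable borel"
  and B: "\<And>x. \<bar>f x\<bar> \<le> B" "\<And>x. \<bar>f1 x\<bar> \<le> B" "\<And>x. \<bar>f2 x\<bar> \<le> B" "\<And>x. \<bar>\<psi> x\<bar> \<le> B"
  and C: "0 \<le> C" and R1: "\<And>x y. x \<in> {a..b} ==> \<bar>f y - f x - f1 x * (y - x) - f2 x / 2 * (y - x)\<^sup>2\<bar> \<le> C * (y - x)\<^sup>2"
  and R2: "\<And>\<kappa>. \<kappa> > 0 ==> \<exists>K\<ge>0. \<forall>x y. x \<in> {a..b} -->
   \<bar>f y - f x - f1 x * (y - x) - f2 x / 2 * (y - x)\<^sup>2\<bar> \<le> \<kappa> * (y - x)\<^sup>2 + K * \<bar>y - x\<bar> ^ 3"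
  and gen: "\<And>t w x. 0 \<le> t ==> w \<in> space M ==> x \<in> {a..b} ==>
   (v t w - 2 * \<gamma> * sin (2 * x)) * f1 x + 4 * \<gamma> * (sin x)\<^sup>2 * f2 x - lam * f x \<ge> - \<psi> x"
 shows "\<exists>N0. \<forall>N\<ge>N0. 0 < N -->
  (\<Sum>k<N. expectation (%w. alive X a b (T * real k / real N) w *
    (exp (- lam * (T * real (Suc k) / real N)) * f (X (T * real (Suc k) / real N) w)
     - exp (- lam * (T * real k / real N)) * f (X (T * real k / real N) w))))
   \<ge> - (\<Sum>k<N. expectation (%w. alive X a b (T * real k / real N) w *
      (T / real N * exp (- lam * (T * real k / real N)) * \<psi> (X (T * real k / real N) w)))) - \<epsilon>"
proof -
 define c where "c = 2 * sqrt (2 * \<gamma>)"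
 define Bd where "Bd = \<Omega> + 2 * \<gamma>"
 have B0: "0 \<le> B" using B(1)[of 0] by linarith
 \<comment> \<open>Fixed before the mesh, because \<open>K\<close> and \<open>K1\<close> depend on
   it. It makes \<open>T * \<kappa> * (B + 3 * c\<^sup>2)\<close> at most a third of
   \<epsilon>.\<close>
 define \<kappa> where "\<kappa> = \<epsilon> / (3 * T * (B + 3 * c\<^sup>2 + 1))"
 have den: "0 < B + 3 * c\<^sup>2 + 1" using B0 by (intro add_nonneg_pos) auto
 have \<kappa>: "\<kappa> > 0" using \<epsilon> T den by (simp add: \<kappa>_def)
 from R2[OF \<kappa>] obtain K where K: "0 \<le> K" "\<And>x y. x \<in> {a..b} ==> \<bar>f y - f x - f1 x * (y - x) - f2 x / 2 * (y - x)\<^sup>2\<bar> \<le> \<kappa> * (y - x)\<^sup>2 + K * \<bar>y - x\<bar> ^ 3"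
  by blast
 define K1 where "K1 = B * (lam\<^sup>2 + lam) + B * c * Bd + B * c\<^sup>2 / \<kappa> + B * Bd\<^sup>2 + B + 3 * \<kappa> * Bd\<^sup>2 + 3 * \<kappa> + 27 * K * Bd ^ 3 + 27 * K * c ^ 3 + 9 * C"
 have c0: "0 \<le> c" using \<gamma>_pos by (simp add: c_def)
 have Bd0: "0 \<le> Bd" using \<Omega>_pos \<gamma>_pos by (simp add: Bd_def)
 have K10: "0 \<le> K1" unfolding K1_def using B0 c0 Bd0 \<kappa> K C lam_pos by (intro add_nonneg_nonneg mult_nonneg_nonneg divide_nonneg_nonneg) auto
 define Cm where "Cm = 4 * \<gamma> * B + 16 * c\<^sup>2 * K1"
 have Cm0: "0 \<le> Cm" unfolding Cm_def using \<gamma>_pos B0 K10 by auto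
 have prog: "progressive M F X" and Xc: "\<And>w. w \<in> space M ==> continuous_on {0..} (%t. X t w)"
  using sol by (auto simp: sde_solution_def)
 define mu where "mu N k = (\<integral>\<^sup>+w. (\<integral>\<^sup>+r\<in>{T * real k / real N..T * real (Suc k) / real N}. ennreal (min 1 \<bar>X r w - X (T * real k / real N) w\<bar>) \<partial>lborel) \<partial>M)" for N k
 have "0 < ennreal (\<epsilon> / (3 * (Cm + 1)))" using \<epsilon> Cm0 by simp
 from order_tendstoD(2)[OF grid_modulus[OF prog Xc T] this]
 have ev1: "\<forall>\<^sub>F N in sequentially. (\<Sum>k<N. mu N k) < ennreal (\<epsilon> / (3 * (Cm + 1)))" unfolding mu_def by simp
 have hl: "(%N. T / real N) \<longlonglongrightarrow> 0" by (rule lim_const_over_n)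
 have "(%N. K1 * (T * (T / real N) + 3 * T * sqrt (T / real N))) \<longlonglongrightarrow> K1 * (T * 0 + 3 * T * sqrt 0)"
  by (intro tendsto_intros hl)
 then have "(%N. K1 * (T * (T / real N) + 3 * T * sqrt (T / real N))) \<longlonglongrightarrow> 0" by simp
 from order_tendstoD(2)[OF this, of "\<epsilon> / 3"] \<epsilon>
 have ev2: "\<forall>\<^sub>F N in sequentially. K1 * (T * (T / real N) + 3 * T * sqrt (T / real N)) < \<epsilon> / 3" by simp
 have ev3: "\<forall>\<^sub>F N in sequentially. T / real N < min 1 (1 / lam)"
  using order_tendstoD(2)[OF hl, of "min 1 (1 / lam)"] lam_pos by simp
 from ev1 ev2 ev3 have "\<forall>\<^sub>F N in sequentially. (\<Sum>k<N. mu N k) < ennreal (\<epsilon> / (3 * (Cm + 1))) \<and> K1 * (T * (T / real N) + 3 * T * sqrt (T / real N)) < \<epsilon> / 3 \<and> T / real N < min 1 (1 / lam)"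
  by eventually_elim auto
 then obtain N0 where N0: "\<And>N. N \<ge> N0 ==> (\<Sum>k<N. mu N k) < ennreal (\<epsilon> / (3 * (Cm + 1)))"
  "\<And>N. N \<ge> N0 ==> K1 * (T * (T / real N) + 3 * T * sqrt (T / real N)) < \<epsilon> / 3" "\<And>N. N \<ge> N0 ==> T / real N < min 1 (1 / lam)"
  unfolding eventually_sequentially by blast
 show ?thesis
 proof (intro exI[of _ N0] allI impI)
  fix N assume N: "N0 \<le> N" "0 < N"
  define h where "h = T / real N"
  have h: "0 < h" "h \<le> 1" "lam * h \<le> 1" using N0(3)[OF N(1)] T N lam_pos by (auto simp: h_def field_simps)
  define g where "g k = T * real k / real N" for k
  have g: "0 \<le> g k" "g k + h = g (Suc k)" for k using T by (auto simp: g_def h_def add_divide_distrib[symmetric] algebra_simps)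
  let ?L = "%k. expectation (%w. alive X a b (g k) w * (exp (- lam * g (Suc k)) * f (X (g (Suc k)) w) - exp (- lam * g k) * f (X (g k) w)))"
  let ?P = "%k. expectation (%w. alive X a b (g k) w * (h * exp (- lam * g k) * \<psi> (X (g k) w)))"
  have step: "mu N k < \<infinity> \<and> ?L k \<ge> - ?P k - (Cm * enn2real (mu N k) + \<kappa> * (B + 3 * c\<^sup>2) * h + K1 * (h\<^sup>2 + 3 * h * sqrt h))" for k
  proof -
   have mk: "mu N k = (\<integral>\<^sup>+w. (\<integral>\<^sup>+r\<in>{g k..g k + h}. ennreal (min 1 \<bar>X r w - X (g k) w\<bar>) \<partial>lborel) \<partial>M)"
    unfolding mu_def g(2) by (simp add: g_def)
   note dk = dynkin_step[OF adm sol g(1)[of k] h fm B R1 K(2) C \<kappa> K(1) gen, folded c_def Bd_def, folded K1_def, folded Cm_def]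
   show ?thesis using dk(1) dk(2) unfolding mk g(2) by simp
  qed
  have fin: "(\<Sum>k<N. mu N k) = ennreal (\<Sum>k<N. enn2real (mu N k))"
   using step by (subst sum_ennreal[symmetric]) (auto intro!: sum.cong simp: less_top)
  have Sm: "(\<Sum>k<N. enn2real (mu N k)) < \<epsilon> / (3 * (Cm + 1))"
   using N0(1)[OF N(1)] unfolding fin by (subst (asm) ennreal_less_iff) (auto intro: sum_nonneg)
  have "(\<Sum>k<N. ?L k) \<ge> (\<Sum>k<N. - ?P k - (Cm * enn2real (mu N k) + \<kappa> * (B + 3 * c\<^sup>2) * h + K1 * (h\<^sup>2 + 3 * h * sqrt h)))"
   by (rule sum_mono) (use step in auto)
  also have "(\<Sum>k<N. - ?P k - (Cm * enn2real (mu N k) + \<kappa> * (B + 3 * c\<^sup>2) * h + K1 * (h\<^sup>2 + 3 * h * sqrt h)))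
   = - (\<Sum>k<N. ?P k) - (Cm * (\<Sum>k<N. enn2real (mu N k)) + real N * (\<kappa> * (B + 3 * c\<^sup>2) * h) + real N * (K1 * (h\<^sup>2 + 3 * h * sqrt h)))"
   by (simp add: sum_subtractf sum.distrib sum_negf sum_distrib_left)
  finally have main: "(\<Sum>k<N. ?L k) \<ge> - (\<Sum>k<N. ?P k) - (Cm * (\<Sum>k<N. enn2real (mu N k)) + real N * (\<kappa> * (B + 3 * c\<^sup>2) * h) + real N * (K1 * (h\<^sup>2 + 3 * h * sqrt h)))" .
  have Nh: "real N * h = T" using N by (simp add: h_def)
  have e1: "Cm * (\<Sum>k<N. enn2real (mu N k)) \<le> \<epsilon> / 3"
  proof -
   have "Cm * (\<Sum>k<N. enn2real (mu N k)) \<le> (Cm + 1) * (\<epsilon> / (3 * (Cm + 1)))"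
    using Sm Cm0 by (intro mult_mono) (auto intro: sum_nonneg)
   also have "\<dots> = \<epsilon> / 3" using Cm0 by (simp add: field_simps)
   finally show ?thesis .
  qed
  have e2: "real N * (\<kappa> * (B + 3 * c\<^sup>2) * h) \<le> \<epsilon> / 3"
  proof -
   have "real N * (\<kappa> * (B + 3 * c\<^sup>2) * h) = (real N * h) * (\<kappa> * (B + 3 * c\<^sup>2))" by simp
   also have "\<dots> \<le> T * (\<kappa> * (B + 3 * c\<^sup>2 + 1))" unfolding Nh using T \<kappa> by (intro mult_left_mono) auto
   also have "\<dots> = \<epsilon> / 3"
   proof -
    have "T * (\<epsilon> / (3 * T * d) * d) = \<epsilon> / 3" if "d > 0" for d using T that by (simp add: field_simps)
    from this[OF den] show ?thesis unfolding \<kappa>_def .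
   qed
   finally show ?thesis .
  qed
  have e3: "real N * (K1 * (h\<^sup>2 + 3 * h * sqrt h)) \<le> \<epsilon> / 3"
  proof -
   have "real N * (K1 * (h\<^sup>2 + 3 * h * sqrt h)) = K1 * ((real N * h) * h + 3 * (real N * h) * sqrt h)"
    by (simp add: power2_eq_square algebra_simps)
   also have "\<dots> = K1 * (T * h + 3 * T * sqrt h)" unfolding Nh ..
   also have "\<dots> \<le> \<epsilon> / 3" using N0(2)[OF N(1)] unfolding h_def by (rule less_imp_le)
   finally show ?thesis .
  qed
  have "(\<Sum>k<N. ?L k) \<ge> - (\<Sum>k<N. ?P k) - \<epsilon>" using main e1 e2 e3 by linarith
  then show "(\<Sum>k<N. expectation (%w. alive X a b (T * real k / real N) w *
    (exp (- lam * (T * real (Suc k) / real N)) * f (X (T * real (Suc k) / real N) w)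
     - exp (- lam * (T * real k / real N)) * f (X (T * real k / real N) w))))
   \<ge> - (\<Sum>k<N. expectation (%w. alive X a b (T * real k / real N) w *
      (T / real N * exp (- lam * (T * real k / real N)) * \<psi> (X (T * real k / real N) w)))) - \<epsilon>"
   by (simp only: g_def h_def)
 qed
qed

end

lemma has_real_derivative_bound_diff:
 fixes f :: "real => real"
 assumes "\<And>z. (f has_real_derivative f' z) (at z)" "\<And>z. \<bar>f' z\<bar> \<le> L"
 shows "\<bar>f x - f y\<bar> \<le> L * \<bar>x - y\<bar>"
proof -
 have "norm (f x - f y) \<le> L * norm (x - y)"
  by (rule field_differentiable_bound[of UNIV f f'])
   (use assms in \<open>auto intro: has_field_derivative_at_within\<close>)
 then show ?thesis by simp
qed

section \<open>The explicit flow of the noise field\<close>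

context qubit_control
begin

definition vol :: real where "vol = 2 * sqrt (2 * \<gamma>)"

lemma vol_pos: "vol > 0" and vol_sq: "vol\<^sup>2 = 8 * \<gamma>"
 using \<gamma>_pos by (auto simp: vol_def power_mult_distrib)

text \<open>The flow of the vector field \<open>- vol * sin\<close>: it multiplies \<open>tan (z / 2)\<close> by \<open>exp (- vol * w)\<close>, written so that it is smooth on the whole line.\<close>

definition flow :: "real => real => real" where
 "flow w z = z + 2 * arctan (sin z * (exp (- vol * w) - 1) / (1 + cos z + exp (- vol * w) * (1 - cos z)))"

text \<open>The reciprocal of the derivative of \<open>flow w\<close> at \<open>z\<close>. It is
  also the ratio of \<open>sin z\<close> to \<open>sin (flow w z)\<close>, as the flow of an
  autonomous field carries the field to itself.\<close>

definition flow_den :: "real => real => real" where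
 "flow_den w z = (exp (vol * w) * (1 + cos z) + exp (- vol * w) * (1 - cos z)) / 2"

lemma cos_factors: "0 \<le> 1 + cos z" "0 \<le> 1 - cos (z::real)"
 using cos_ge_minus_one[of z] cos_le_one[of z] by linarith+

lemma convex_pos: "0 < (1 + cos (z::real)) * x + (1 - cos z) * y" if "0 < x" "0 < y"
proof (cases "1 + cos z = 0")
 case True then show ?thesis using that by simp
next
 case False
 then have "0 < (1 + cos z) * x" using cos_factors(1)[of z] that by (intro mult_pos_pos) auto
 moreover have "0 \<le> (1 - cos z) * y" using cos_factors(2)[of z] that by (intro mult_nonneg_nonneg) auto
 ultimately show ?thesis by linarith
qed

lemma flow_den_pos: "flow_den w z > 0"
 using convex_pos[of "exp (vol * w)" "exp (- vol * w)" z] by (simp add: flow_den_def mult.commute)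

text \<open>The argument \<open>q\<close> of the arctangent is the tangent of half the displacement
  \<open>flow w z - z\<close>. The quantity \<open>A\<close> stays positive even where
  \<open>tan (z / 2)\<close> is infinite, which is the point of this form. The identities clear
  denominators in the half-angle formulas for sine and cosine.\<close>

lemma flow_aux:
 fixes z w :: real
 defines "e \<equiv> exp (- vol * w)" and "k \<equiv> cos z" and "s \<equiv> sin z"
 defines "A \<equiv> 1 + k + e * (1 - k)"
 defines "q \<equiv> s * (e - 1) / A"
 shows "e > 0 \<and> A > 0 \<and> 1 + q\<^sup>2 = 4 * e * flow_den w z / A\<^sup>2 \<and> A\<^sup>2 - s\<^sup>2 * (e - 1)\<^sup>2 + 2 * k * (e - 1) * A = 4 * e \<and>
  A\<^sup>2 + s\<^sup>2 * (e - 1)\<^sup>2 = 4 * e * flow_den w z"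
proof (intro conjI)
 show e: "e > 0" by (simp add: e_def)
 show A: "A > 0" using convex_pos[of 1 e z] e by (simp add: A_def k_def mult.commute)
 have sk: "s\<^sup>2 = 1 - k\<^sup>2" by (simp add: s_def k_def sin_squared_eq)
 have ee: "e * exp (vol * w) = 1" by (simp add: e_def exp_minus)
 have "4 * e * flow_den w z = 2 * (e * exp (vol * w)) * (1 + k) + 2 * e\<^sup>2 * (1 - k)"
  unfolding flow_den_def e_def[symmetric] k_def[symmetric] by (simp add: power2_eq_square field_simps)
 also have "\<dots> = A\<^sup>2 + s\<^sup>2 * (e - 1)\<^sup>2" unfolding ee sk A_def by (simp add: power2_eq_square algebra_simps)
 finally show eq: "A\<^sup>2 + s\<^sup>2 * (e - 1)\<^sup>2 = 4 * e * flow_den w z" by simp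
 have "1 + q\<^sup>2 = (A\<^sup>2 + s\<^sup>2 * (e - 1)\<^sup>2) / A\<^sup>2" using A by (simp add: q_def power_divide power_mult_distrib add_divide_distrib)
 then show "1 + q\<^sup>2 = 4 * e * flow_den w z / A\<^sup>2" unfolding eq .
 show "A\<^sup>2 - s\<^sup>2 * (e - 1)\<^sup>2 + 2 * k * (e - 1) * A = 4 * e"
  unfolding sk A_def by (simp add: power2_eq_square algebra_simps)
qed

lemma sin_flow: "sin (flow w z) = sin z / flow_den w z"
proof -
 define e where "e = exp (- vol * w)"
 define k where "k = cos z"
 define s where "s = sin z"
 define A where "A = 1 + k + e * (1 - k)"
 define q where "q = s * (e - 1) / A"
 define n where "n = flow_den w z"
 note aux0 = flow_aux[where w = w and z = z, folded e_def k_def s_def, folded A_def, folded q_def n_def]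
 note aux = aux0[THEN conjunct1] aux0[THEN conjunct2, THEN conjunct1] aux0[THEN conjunct2, THEN conjunct2, THEN conjunct1]
  aux0[THEN conjunct2, THEN conjunct2, THEN conjunct2, THEN conjunct1] aux0[THEN conjunct2, THEN conjunct2, THEN conjunct2, THEN conjunct2]
 have n: "n > 0" by (simp add: n_def flow_den_pos)
 have c2: "cos (2 * arctan q) = (1 - q\<^sup>2) / (1 + q\<^sup>2)"
  using cos_tan_half[of "arctan q"] by (simp add: tan_arctan cos_arctan_not_zero)
 have s2: "sin (2 * arctan q) = 2 * q / (1 + q\<^sup>2)"
  using sin_tan_half[of "arctan q"] by (simp add: tan_arctan cos_arctan_not_zero)
 have "sin (flow w z) = sin (z + 2 * arctan q)" by (simp add: flow_def q_def A_def e_def k_def s_def)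
 also have "\<dots> = s * ((1 - q\<^sup>2) / (1 + q\<^sup>2)) + k * (2 * q / (1 + q\<^sup>2))"
  unfolding sin_add c2 s2 by (simp add: s_def k_def)
 also have "\<dots> = (s * (1 - q\<^sup>2) + 2 * k * q) / (1 + q\<^sup>2)" by (simp add: add_divide_distrib)
 also have "\<dots> = (A\<^sup>2 * (s * (1 - q\<^sup>2) + 2 * k * q)) / (4 * e * n)"
  unfolding aux(3) using aux(2) by simp
 also have "A\<^sup>2 * (s * (1 - q\<^sup>2) + 2 * k * q) = s * (A\<^sup>2 - s\<^sup>2 * (e - 1)\<^sup>2 + 2 * k * (e - 1) * A)"
  using aux(2) unfolding q_def by (simp add: power2_eq_square field_simps)
 also have "\<dots> = s * (4 * e)" unfolding aux(4) ..
 also have "s * (4 * e) / (4 * e * n) = s / n" using aux(1) by simp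
 finally show ?thesis by (simp add: s_def n_def)
qed

lemma flow_deriv_w: "((%w. flow w z) has_real_derivative - vol * sin (flow w z)) (at w)"
proof -
 define e where "e w = exp (- vol * w)" for w
 define k where "k = cos z"
 define s where "s = sin z"
 define A where "A w = 1 + k + e w * (1 - k)" for w
 define q where "q w = s * (e w - 1) / A w" for w
 define n where "n = flow_den w z"
 note aux0 = flow_aux[where w = w and z = z, folded e_def k_def s_def, folded A_def, folded q_def n_def]
 note aux = aux0[THEN conjunct1] aux0[THEN conjunct2, THEN conjunct1] aux0[THEN conjunct2, THEN conjunct2, THEN conjunct1]
  aux0[THEN conjunct2, THEN conjunct2, THEN conjunct2, THEN conjunct1] aux0[THEN conjunct2, THEN conjunct2, THEN conjunct2, THEN conjunct2]
 have n: "n > 0" by (simp add: n_def flow_den_pos)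
 have ed: "(e has_real_derivative - vol * e w) (at w)"
  unfolding e_def[abs_def] by (auto intro!: derivative_eq_intros)
 have Ad: "(A has_real_derivative 0 + - vol * e w * (1 - k)) (at w)"
  unfolding A_def[abs_def] by (intro DERIV_add DERIV_const DERIV_cmult_right ed)
 have qd: "(q has_real_derivative (s * (- vol * e w - 0) * A w - s * (e w - 1) * (0 + - vol * e w * (1 - k))) / (A w * A w)) (at w)"
  unfolding q_def[abs_def] by (intro DERIV_divide DERIV_cmult DERIV_diff DERIV_const ed Ad) (use aux(2) in auto)
 also have "(s * (- vol * e w - 0) * A w - s * (e w - 1) * (0 + - vol * e w * (1 - k))) / (A w * A w) = - vol * s * e w * (A w - (e w - 1) * (1 - k)) / (A w)\<^sup>2"
  by (simp add: power2_eq_square algebra_simps)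
 also have "A w - (e w - 1) * (1 - k) = 2" by (simp add: A_def algebra_simps)
 finally have qd': "(q has_real_derivative - vol * s * e w * 2 / (A w)\<^sup>2) (at w)" .
 have "((%w. z + 2 * arctan (q w)) has_real_derivative 0 + 2 * (inverse (1 + (q w)\<^sup>2) * (- vol * s * e w * 2 / (A w)\<^sup>2))) (at w)"
  by (intro DERIV_add DERIV_const DERIV_cmult DERIV_chain2[OF DERIV_arctan qd'])
 also have "0 + 2 * (inverse (1 + (q w)\<^sup>2) * (- vol * s * e w * 2 / (A w)\<^sup>2)) = - vol * (s / n)"
  unfolding aux(3) using aux(1,2) n by (simp add: field_simps)
 also have "s / n = sin (flow w z)" by (simp add: sin_flow s_def n_def)
 finally show ?thesis by (simp add: flow_def[abs_def] q_def A_def e_def k_def s_def)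
qed

lemma flow_deriv_z: "(flow w has_real_derivative 1 / flow_den w z) (at z)"
proof -
 define e where "e = exp (- vol * w)"
 define A where "A z = 1 + cos z + e * (1 - cos z)" for z
 define q where "q z = sin z * (e - 1) / A z" for z
 define n where "n = flow_den w z"
 note aux0 = flow_aux[where w = w and z = z, folded e_def, folded A_def, folded q_def n_def]
 note aux = aux0[THEN conjunct1] aux0[THEN conjunct2, THEN conjunct1] aux0[THEN conjunct2, THEN conjunct2, THEN conjunct1]
  aux0[THEN conjunct2, THEN conjunct2, THEN conjunct2, THEN conjunct1] aux0[THEN conjunct2, THEN conjunct2, THEN conjunct2, THEN conjunct2]
 have n: "n > 0" by (simp add: n_def flow_den_pos)
 have Ad: "(A has_real_derivative 0 + - sin z + e * (0 - - sin z)) (at z)"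
  unfolding A_def[abs_def] by (intro DERIV_add DERIV_const DERIV_cmult DERIV_diff DERIV_cos)
 have "(q has_real_derivative (cos z * (e - 1) * A z - sin z * (e - 1) * (0 + - sin z + e * (0 - - sin z))) / (A z * A z)) (at z)"
  unfolding q_def[abs_def] by (intro DERIV_divide DERIV_cmult_right DERIV_sin Ad) (use aux(2) in auto)
 also have "(cos z * (e - 1) * A z - sin z * (e - 1) * (0 + - sin z + e * (0 - - sin z))) / (A z * A z) = (e - 1) * (cos z * A z - (e - 1) * (sin z)\<^sup>2) / (A z)\<^sup>2"
  by (simp add: power2_eq_square algebra_simps)
 finally have qd: "(q has_real_derivative (e - 1) * (cos z * A z - (e - 1) * (sin z)\<^sup>2) / (A z)\<^sup>2) (at z)" .
 have "((%z. z + 2 * arctan (q z)) has_real_derivative 1 + 2 * (inverse (1 + (q z)\<^sup>2) * ((e - 1) * (cos z * A z - (e - 1) * (sin z)\<^sup>2) / (A z)\<^sup>2))) (at z)"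
  by (intro DERIV_add DERIV_ident DERIV_cmult DERIV_chain2[OF DERIV_arctan qd])
 also have "1 + 2 * (inverse (1 + (q z)\<^sup>2) * ((e - 1) * (cos z * A z - (e - 1) * (sin z)\<^sup>2) / (A z)\<^sup>2))
   = (4 * e * n + 2 * (e - 1) * (cos z * A z - (e - 1) * (sin z)\<^sup>2)) / (4 * e * n)"
  unfolding aux(3) using aux(1,2) n by (simp add: field_simps)
 also have "4 * e * n + 2 * (e - 1) * (cos z * A z - (e - 1) * (sin z)\<^sup>2) = (A z)\<^sup>2 - (sin z)\<^sup>2 * (e - 1)\<^sup>2 + 2 * cos z * (e - 1) * A z"
  unfolding aux(5)[symmetric] by (simp add: power2_eq_square algebra_simps)
 also have "\<dots> = 4 * e" by (rule aux(4))
 also have "4 * e / (4 * e * n) = 1 / n" using aux(1) by simp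
 finally show ?thesis by (simp add: flow_def[abs_def] q_def A_def e_def n_def)
qed

lemma flow_0 [simp]: "flow 0 z = z" by (simp add: flow_def)

lemma flow_zero [simp]: "flow w 0 = 0" by (simp add: flow_def)

lemma flow_strict_mono: "x < y ==> flow w x < flow w y"
proof (rule DERIV_pos_imp_increasing[of x y])
 fix z
 show "\<exists>l. (flow w has_real_derivative l) (at z) \<and> 0 < l"
  using flow_deriv_z[of w z] flow_den_pos[of w z] by (intro exI[of _ "1 / flow_den w z"]) auto
qed

lemma continuous_on_flow: "continuous_on UNIV (%(w, z). flow w z)"
proof -
 have "1 + cos z + exp (- vol * w) * (1 - cos z) \<noteq> 0" for w z
  using convex_pos[of 1 "exp (- vol * w)" z] by (simp add: mult.commute)
 then show ?thesis unfolding flow_def split_beta' by (intro continuous_intros) auto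
qed

lemma flow_lipschitz_w: "\<bar>flow w z - flow w' z\<bar> \<le> vol * \<bar>w - w'\<bar>"
proof (rule has_real_derivative_bound_diff[OF flow_deriv_w])
 fix u
 have "\<bar>vol * sin (flow u z)\<bar> \<le> vol * 1" unfolding abs_mult using vol_pos by (intro mult_mono) auto
 then show "\<bar>- vol * sin (flow u z)\<bar> \<le> vol" by simp
qed

text \<open>Differentiating the flow equation again gives the second derivative
  \<open>4 * \<gamma> * sin (2 * flow w z)\<close> in \<open>w\<close>, from
  \<open>vol\<^sup>2 = 8 * \<gamma>\<close>. Its half is the coefficient of the quadratic term, and
  its Lipschitz constant in \<open>w\<close> is \<open>vol ^ 3\<close>.\<close>

lemma flow_taylor:
 "\<bar>flow w' z - flow w z + vol * sin (flow w z) * (w' - w) - 2 * \<gamma> * sin (2 * flow w z) * (w' - w)\<^sup>2\<bar> \<le> vol ^ 3 * \<bar>w' - w\<bar> ^ 3"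
proof -
 have g1: "((%w. - vol * sin (flow w z)) has_real_derivative 4 * \<gamma> * sin (2 * flow u z)) (at u)" for u
 proof -
  have "((%w. - vol * sin (flow w z)) has_real_derivative - vol * (cos (flow u z) * (- vol * sin (flow u z)))) (at u)"
   by (intro DERIV_cmult DERIV_chain2[OF DERIV_sin flow_deriv_w])
  also have "- vol * (cos (flow u z) * (- vol * sin (flow u z))) = vol\<^sup>2 * (sin (flow u z) * cos (flow u z))"
   by (simp add: power2_eq_square)
  also have "\<dots> = 4 * \<gamma> * sin (2 * flow u z)" unfolding vol_sq sin_double by simp
  finally show ?thesis .
 qed
 have "\<bar>flow w' z - flow w z - - vol * sin (flow w z) * (w' - w) - 4 * \<gamma> * sin (2 * flow w z) / 2 * (w' - w)\<^sup>2\<bar> \<le> (vol ^ 3 * \<bar>w' - w\<bar>) * (w' - w)\<^sup>2"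
 proof (rule taylor_segment[OF flow_deriv_w g1])
  fix u assume u: "u \<in> closed_segment w w'"
  have "\<bar>sin (2 * flow u z) - sin (2 * flow w z)\<bar> \<le> \<bar>2 * flow u z - 2 * flow w z\<bar>"
  proof -
   have "\<bar>sin (2 * flow u z) - sin (2 * flow w z)\<bar> \<le> 1 * \<bar>2 * flow u z - 2 * flow w z\<bar>"
    by (rule has_real_derivative_bound_diff[OF DERIV_sin]) simp
   then show ?thesis by simp
  qed
  also have "\<dots> = 2 * \<bar>flow u z - flow w z\<bar>" by (auto simp: abs_if)
  also have "\<dots> \<le> 2 * (vol * \<bar>u - w\<bar>)" using flow_lipschitz_w[of u z w] by simp
  also have "\<dots> \<le> 2 * (vol * \<bar>w' - w\<bar>)"
   using u vol_pos by (auto simp: closed_segment_eq_real_ivl split: if_splits)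
  finally have *: "\<bar>sin (2 * flow u z) - sin (2 * flow w z)\<bar> \<le> 2 * (vol * \<bar>w' - w\<bar>)" .
  have "\<bar>4 * \<gamma> * sin (2 * flow u z) - 4 * \<gamma> * sin (2 * flow w z)\<bar> = 4 * \<gamma> * \<bar>sin (2 * flow u z) - sin (2 * flow w z)\<bar>"
   unfolding right_diff_distrib[symmetric] abs_mult using \<gamma>_pos by simp
  also have "\<dots> \<le> 4 * \<gamma> * (2 * (vol * \<bar>w' - w\<bar>))" using * \<gamma>_pos by (intro mult_left_mono) auto
  also have "\<dots> = vol\<^sup>2 * (vol * \<bar>w' - w\<bar>)" unfolding vol_sq by simp
  finally show "\<bar>4 * \<gamma> * sin (2 * flow u z) - 4 * \<gamma> * sin (2 * flow w z)\<bar> \<le> vol ^ 3 * \<bar>w' - w\<bar>"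
   by (simp add: power2_eq_square power3_eq_cube)
 qed
 then show ?thesis by (simp add: power2_eq_square power3_eq_cube abs_mult_self_eq)
qed

text \<open>Both exponentials in \<open>flow_den\<close> change by a factor at most
  \<open>exp (vol * \<bar>w' - w\<bar>)\<close> in either direction, and their coefficients are
  nonnegative.\<close>

lemma flow_den_ratio: "\<bar>flow_den w' z / flow_den w z - 1\<bar> \<le> exp (vol * \<bar>w' - w\<bar>) - 1"
proof -
 define r where "r = exp (vol * \<bar>w' - w\<bar>)"
 have r1: "1 \<le> r" using vol_pos by (simp add: r_def)
 have dd: "vol * (w' - w) \<le> vol * \<bar>w' - w\<bar>" "- (vol * \<bar>w' - w\<bar>) \<le> vol * (w' - w)"
  using vol_pos mult_left_mono[of "w' - w" "\<bar>w' - w\<bar>" vol] mult_left_mono[of "- (w' - w)" "\<bar>w' - w\<bar>" vol] by (auto simp: algebra_simps)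
 have up1: "exp (vol * w') \<le> r * exp (vol * w)" "exp (- vol * w') \<le> r * exp (- vol * w)"
  unfolding r_def using dd by (auto simp: mult_exp_exp algebra_simps)
 have lo1: "exp (vol * w) \<le> r * exp (vol * w')" "exp (- vol * w) \<le> r * exp (- vol * w')"
  unfolding r_def using dd by (auto simp: mult_exp_exp algebra_simps)
 have mono: "flow_den a z \<le> r * flow_den b z" if "exp (vol * a) \<le> r * exp (vol * b)" "exp (- vol * a) \<le> r * exp (- vol * b)" for a b
 proof -
  have "exp (vol * a) * (1 + cos z) + exp (- vol * a) * (1 - cos z) \<le> (r * exp (vol * b)) * (1 + cos z) + (r * exp (- vol * b)) * (1 - cos z)"
   using that cos_factors[of z] by (intro add_mono mult_right_mono) auto
  also have "\<dots> = r * (exp (vol * b) * (1 + cos z) + exp (- vol * b) * (1 - cos z))" by (simp only: distrib_left mult.assoc)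
  finally show ?thesis by (simp add: flow_den_def)
 qed
 have u: "flow_den w' z \<le> r * flow_den w z" by (rule mono[OF up1])
 have l: "flow_den w z \<le> r * flow_den w' z" by (rule mono[OF lo1])
 define x where "x = flow_den w' z / flow_den w z"
 have x: "x > 0" "x \<le> r" "1 \<le> r * x"
  using u l flow_den_pos[of w z] flow_den_pos[of w' z] by (auto simp: x_def divide_le_eq le_divide_eq)
 have "1 - x \<le> (r - 1) * x" using x by (simp add: algebra_simps)
 moreover have "1 - x \<le> r - 1"
 proof (cases "x \<le> 1")
  case True
  have "(r - 1) * x \<le> (r - 1) * 1" using r1 True by (intro mult_left_mono) auto
  then show ?thesis using \<open>1 - x \<le> (r - 1) * x\<close> by simp
 qed (use r1 in auto)
 ultimately show ?thesis using x unfolding x_def[symmetric] r_def[symmetric] by (simp add: abs_le_iff)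
qed

text \<open>The velocity of the Doss-Sussmann coordinate. Writing the equation in Stratonovich form
  subtracts half of sigma times its derivative, \<open>2 * \<gamma> * sin (2 * x)\<close>, from the
  drift, which doubles the sine term to \<open>4 * \<gamma>\<close>. Multiplication by
  \<open>flow_den\<close> inverts the spatial derivative of the flow.\<close>

definition vfield :: "real => real => real" where
 "vfield w z = (\<Omega> - 4 * \<gamma> * sin (2 * flow w z)) * flow_den w z"

lemma vfield_factor: "\<bar>\<Omega> - 4 * \<gamma> * sin y\<bar> \<le> \<Omega> + 4 * \<gamma>"
proof -
 have "\<bar>4 * \<gamma> * sin y\<bar> \<le> 4 * \<gamma> * 1" unfolding abs_mult using \<gamma>_pos by (intro mult_mono) auto
 then show ?thesis using \<Omega>_pos by linarith
qed

lemma flow_den_deriv: "(flow_den w has_real_derivative - sin z * ((exp (vol * w) - exp (- vol * w)) / 2)) (at z)"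
proof -
 have "(flow_den w has_real_derivative (exp (vol * w) * (0 + - sin z) + exp (- vol * w) * (0 - - sin z)) / 2) (at z)"
  unfolding flow_den_def[abs_def] by (intro DERIV_cdivide DERIV_add DERIV_cmult DERIV_diff DERIV_const DERIV_cos)
 also have "(exp (vol * w) * (0 + - sin z) + exp (- vol * w) * (0 - - sin z)) / 2 = - sin z * ((exp (vol * w) - exp (- vol * w)) / 2)"
  by (simp add: algebra_simps diff_divide_distrib)
 finally show ?thesis .
qed

text \<open>In the derivative with respect to \<open>z\<close> the factor \<open>flow_den\<close>
  cancels the derivative of the flow, which leaves bounded trigonometric terms and a hyperbolic
  sine. The constant depends on \<open>w\<close> alone and so is bounded along a Brownian path on
  each compact time interval.\<close>

lemma vfield_lipschitz: "\<bar>vfield w z - vfield w z'\<bar> \<le> (8 * \<gamma> + (\<Omega> + 4 * \<gamma>) * exp (vol * \<bar>w\<bar>)) * \<bar>z - z'\<bar>"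
proof (rule has_real_derivative_bound_diff)
 fix z
 let ?sh = "(exp (vol * w) - exp (- vol * w)) / 2"
 have "((%z. 2 * flow w z) has_real_derivative 2 * (1 / flow_den w z)) (at z)" by (intro DERIV_cmult flow_deriv_z)
 from DERIV_chain2[OF DERIV_sin this]
 have "((%z. \<Omega> - 4 * \<gamma> * sin (2 * flow w z)) has_real_derivative 0 - 4 * \<gamma> * (cos (2 * flow w z) * (2 * (1 / flow_den w z)))) (at z)"
  by (intro DERIV_diff DERIV_const DERIV_cmult)
 from DERIV_mult[OF this flow_den_deriv]
 have "(vfield w has_real_derivative (0 - 4 * \<gamma> * (cos (2 * flow w z) * (2 * (1 / flow_den w z)))) * flow_den w z + (- sin z * ?sh) * (\<Omega> - 4 * \<gamma> * sin (2 * flow w z))) (at z)"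
  unfolding vfield_def[abs_def] .
 also have "(0 - 4 * \<gamma> * (cos (2 * flow w z) * (2 * (1 / flow_den w z)))) * flow_den w z + (- sin z * ?sh) * (\<Omega> - 4 * \<gamma> * sin (2 * flow w z))
  = - 8 * \<gamma> * cos (2 * flow w z) - sin z * ?sh * (\<Omega> - 4 * \<gamma> * sin (2 * flow w z))"
  using flow_den_pos[of w z] by simp
 finally show "(vfield w has_real_derivative - 8 * \<gamma> * cos (2 * flow w z) - sin z * ?sh * (\<Omega> - 4 * \<gamma> * sin (2 * flow w z))) (at z)" .
 have sh: "\<bar>?sh\<bar> \<le> exp (vol * \<bar>w\<bar>)"
 proof -
  have "exp (vol * w) \<le> exp (vol * \<bar>w\<bar>)" "exp (- vol * w) \<le> exp (vol * \<bar>w\<bar>)"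
   using vol_pos mult_left_mono[of w "\<bar>w\<bar>" vol] mult_left_mono[of "- w" "\<bar>w\<bar>" vol] by auto
  moreover have "\<bar>(a - b) / 2\<bar> \<le> m" if "a \<le> m" "b \<le> m" "0 < a" "0 < b" for a b m :: real
  proof (rule abs_leI)
   have "a - b \<le> 2 * m" "b - a \<le> 2 * m" using that by linarith+
   then show "(a - b) / 2 \<le> m" "- ((a - b) / 2) \<le> m" by (auto simp: field_simps)
  qed
  ultimately show ?thesis by simp
 qed
 have "\<bar>- 8 * \<gamma> * cos (2 * flow w z)\<bar> \<le> 8 * \<gamma> * 1" unfolding abs_mult using \<gamma>_pos by (intro mult_mono) auto
 moreover have "\<bar>sin z * ?sh * (\<Omega> - 4 * \<gamma> * sin (2 * flow w z))\<bar> \<le> 1 * exp (vol * \<bar>w\<bar>) * (\<Omega> + 4 * \<gamma>)"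
  unfolding abs_mult[of _ "\<Omega> - 4 * \<gamma> * sin (2 * flow w z)"] abs_mult[of "sin z"] using sh vfield_factor by (intro mult_mono) auto
 ultimately show "\<bar>- 8 * \<gamma> * cos (2 * flow w z) - sin z * ?sh * (\<Omega> - 4 * \<gamma> * sin (2 * flow w z))\<bar> \<le> 8 * \<gamma> + (\<Omega> + 4 * \<gamma>) * exp (vol * \<bar>w\<bar>)"
 proof -
  assume 1: "\<bar>- 8 * \<gamma> * cos (2 * flow w z)\<bar> \<le> 8 * \<gamma> * 1"
   and 2: "\<bar>sin z * ?sh * (\<Omega> - 4 * \<gamma> * sin (2 * flow w z))\<bar> \<le> 1 * exp (vol * \<bar>w\<bar>) * (\<Omega> + 4 * \<gamma>)"
  have "\<bar>x - y\<bar> \<le> a + b" if "\<bar>x\<bar> \<le> a" "\<bar>y\<bar> \<le> b" for x y a b :: real using that by linarith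
  from this[OF 1 2] show ?thesis by (simp only: mult_1 mult_1_right mult.commute[of "exp (vol * \<bar>w\<bar>)"])
 qed
qed

lemma continuous_on_vfield: "continuous_on UNIV (%(w, z). vfield w z)"
proof -
 have "continuous_on UNIV (%p. flow (fst p) (snd p))" using continuous_on_flow by (simp add: split_beta')
 then show ?thesis unfolding vfield_def split_beta' flow_den_def by (intro continuous_intros) auto
qed

end

lemma integral_deriv_atLeast:
 fixes g :: "real => real"
 assumes g: "continuous_on {0..} g" and t: "0 \<le> t"
 shows "((%t. integral {0..t} g) has_real_derivative g t) (at t within {0..})"
proof -
 have "((%t. integral {0..t} g) has_real_derivative g t) (at t within {0..t + 1})"
  by (rule integral_has_real_derivative[OF continuous_on_subset[OF g]]) (use t in auto)
 moreover have "at t within {0..t + 1} = at t within {0..}"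
  by (rule at_within_nhd[of _ "{..<t + 1}"]) auto
 ultimately show ?thesis by simp
qed

context brownian_space
begin

section \<open>The bang-bang diffusion\<close>

text \<open>Time is rounded up to a grid of mesh \<open>1 / Suc n\<close> and then projected to
  \<open>[0, T]\<close>. The rounded process takes countably many times, all at most
  \<open>T\<close>, so it is jointly measurable with respect to \<open>F T\<close>; continuity of
  paths gives the limit.\<close>

lemma adapted_continuous_progressive:
 assumes ad: "\<And>t. 0 \<le> t ==> X t \<in> borel_measurable (F t)"
  and Xc: "\<And>w. w \<in> space M ==> continuous_on {0..} (%t. X t w)"
 shows "progressive M F X"
 unfolding progressive_def
proof (intro allI impI)
 fix T :: real assume T: "0 \<le> T"
 let ?N = "restrict_space borel {0..T} \<Otimes>\<^sub>M F T"
 define r where "r n t = min T (max 0 (real_of_int \<lceil>t * real (Suc n)\<rceil> / real (Suc n)))" for n and t :: real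
 have fstm: "fst \<in> borel_measurable ?N"
  using measurable_compose[OF measurable_fst[of "restrict_space borel {0..T}" "F T"] measurable_restrict_space1[OF measurable_ident]] by simp
 have m: "(%p. X (r n (fst p)) (snd p)) \<in> borel_measurable ?N" for n
 proof -
  have "(%p. X (min T (max 0 (real_of_int (\<lceil>fst p * real (Suc n)\<rceil>) / real (Suc n)))) (snd p)) \<in> borel_measurable ?N"
  proof (rule measurable_compose_countable[where f = "%i p. X (min T (max 0 (real_of_int i / real (Suc n)))) (snd p)"])
   fix i :: int
   have "X (min T (max 0 (real_of_int i / real (Suc n)))) \<in> borel_measurable (F T)"
    by (rule measurable_F_mono[OF _ _ ad]) (use T in auto)
   then show "(%p. X (min T (max 0 (real_of_int i / real (Suc n)))) (snd p)) \<in> borel_measurable ?N"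
    by (rule measurable_compose[OF measurable_snd])
   have "(%p. fst p * real (Suc n)) \<in> borel_measurable ?N" using fstm by measurable
   from measurable_compose[OF this measurable_real_ceiling]
   show "(%p. \<lceil>fst p * real (Suc n)\<rceil>) \<in> measurable ?N (count_space UNIV)" .
  qed
  then show ?thesis by (simp add: r_def)
 qed
 have "(%p. X (fst p) (snd p)) \<in> borel_measurable ?N"
 proof (rule borel_measurable_LIMSEQ_real[OF _ m])
  fix p assume "p \<in> space ?N"
  then have t: "0 \<le> fst p" "fst p \<le> T" and w: "snd p \<in> space M" by (auto simp: space_pair_measure space_restrict_space)
  let ?t = "fst p"
  have "(%n. real_of_int \<lceil>?t * real (Suc n)\<rceil> / real (Suc n)) \<longlonglongrightarrow> ?t"
  proof (rule tendsto_sandwich[of "%_. ?t" _ _ "%n. ?t + 1 / real (Suc n)"])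
   show "\<forall>\<^sub>F n in sequentially. ?t \<le> real_of_int \<lceil>?t * real (Suc n)\<rceil> / real (Suc n)"
    by (intro always_eventually allI) (simp add: le_divide_eq del: of_nat_Suc)
   show "\<forall>\<^sub>F n in sequentially. real_of_int \<lceil>?t * real (Suc n)\<rceil> / real (Suc n) \<le> ?t + 1 / real (Suc n)"
   proof (intro always_eventually allI)
    fix n
    have "real_of_int \<lceil>?t * real (Suc n)\<rceil> \<le> ?t * real (Suc n) + 1" by linarith
    then have "real_of_int \<lceil>?t * real (Suc n)\<rceil> / real (Suc n) \<le> (?t * real (Suc n) + 1) / real (Suc n)" by (intro divide_right_mono) auto
    then show "real_of_int \<lceil>?t * real (Suc n)\<rceil> / real (Suc n) \<le> ?t + 1 / real (Suc n)" by (simp add: add_divide_distrib del: of_nat_Suc)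
   qed
   have "(%n. ?t + 1 / real (Suc n)) \<longlonglongrightarrow> ?t + 0"
    by (intro tendsto_intros LIMSEQ_Suc[OF lim_1_over_n])
   then show "(%n. ?t + 1 / real (Suc n)) \<longlonglongrightarrow> ?t" by simp
  qed simp
  then have "(%n. r n ?t) \<longlonglongrightarrow> min T (max 0 ?t)" unfolding r_def by (intro tendsto_intros)
  then have "(%n. r n ?t) \<longlonglongrightarrow> ?t" using t by simp
  then show "(%n. X (r n ?t) (snd p)) \<longlonglongrightarrow> X ?t (snd p)"
   by (rule continuous_on_tendsto_compose[OF Xc[OF w]]) (use t T in \<open>auto simp: r_def\<close>)
 qed
 then show "(%(t, w). X t w) \<in> borel_measurable ?N" by (simp add: split_beta')
qed

lemma integral_adapted:
 fixes u :: "real => 'a => real"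
 assumes ad: "\<And>t. 0 \<le> t ==> u t \<in> borel_measurable (F t)"
  and uc: "\<And>w. w \<in> space M ==> continuous_on {0..} (%t. u t w)" and t: "0 \<le> t"
 shows "(%w. integral {0..t} (%r. u r w)) \<in> borel_measurable (F t)"
proof -
 have "(%(w, r). u (max 0 (min t r)) w) \<in> borel_measurable (F t \<Otimes>\<^sub>M borel)"
  by (rule progressive_clamp[OF adapted_continuous_progressive[OF ad uc] t]) auto
 then have "(%w. \<integral>r. indicator {0..t} r *\<^sub>R u (max 0 (min t r)) w \<partial>lborel) \<in> borel_measurable (F t)"
  by (intro lborel.borel_measurable_lebesgue_integral) (simp add: split_beta', measurable)
 also have "?this \<longleftrightarrow> ?thesis"
 proof (rule measurable_cong)
  fix w assume "w \<in> space (F t)"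
  then have w: "w \<in> space M" by simp
  have si: "set_integrable lborel {0..t} (%r. u r w)"
   by (rule borel_integrable_atLeastAtMost') (rule continuous_on_subset[OF uc[OF w]], auto)
  have "(\<integral>r. indicator {0..t} r *\<^sub>R u (max 0 (min t r)) w \<partial>lborel) = (LINT r:{0..t}|lborel. u r w)"
   unfolding set_lebesgue_integral_def by (rule Bochner_Integration.integral_cong) (auto simp: indicator_def)
  also have "\<dots> = integral {0..t} (%r. u r w)" by (rule set_borel_integral_eq_integral(2)[OF si])
  finally show "(\<integral>r. indicator {0..t} r *\<^sub>R u (max 0 (min t r)) w \<partial>lborel) = integral {0..t} (%r. u r w)" .
 qed
 finally show ?thesis .
qed

end

section \<open>Pathwise solution under the constant control\<close>

context controlled_qubit
begin

definition picard :: "real => 'a => (real => real) => real => real" where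
 "picard z0 w u t = z0 + integral {0..t} (%r. vfield (W r w) (u r))"

text \<open>Given as the limit of the Picard iterates rather than by choice of a solution for each
  path, so that adaptedness passes from the iterates to the limit.\<close>

definition Zp :: "real => real => 'a => real" where
 "Zp z0 t w = lim (%n. (picard z0 w ^^ n) (%_. z0) t)"

lemma vfield_path_continuous:
 assumes w: "w \<in> space M" and u: "continuous_on {0..} u"
 shows "continuous_on {0..} (%r. vfield (W r w) (u r))"
proof -
 have "continuous_on {0..} (%r. (W r w, u r))" by (intro continuous_intros W_continuous[OF w] u)
 from continuous_on_compose2[OF continuous_on_vfield this] show ?thesis by simp
qed

lemma picard_deriv:
 assumes w: "w \<in> space M" and u: "continuous_on {0..} u" and t: "0 \<le> t"
 shows "(picard z0 w u has_real_derivative vfield (W t w) (u t)) (at t within {0..})"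
proof -
 have "((%t. z0 + integral {0..t} (%r. vfield (W r w) (u r))) has_real_derivative 0 + vfield (W t w) (u t)) (at t within {0..})"
  by (intro DERIV_add DERIV_const integral_deriv_atLeast[OF vfield_path_continuous[OF w u] t])
 then show ?thesis by (simp add: picard_def[abs_def])
qed

lemma picard_continuous:
 assumes w: "w \<in> space M" and u: "continuous_on {0..} u"
 shows "continuous_on {0..} (picard z0 w u)"
 by (rule DERIV_continuous_on[where D = "%t. vfield (W t w) (u t)"]) (use picard_deriv[OF w u] in auto)

lemma Zp_props:
 assumes w: "w \<in> space M"
 shows "continuous_on {0..} (%t. Zp z0 t w)" "\<And>t. 0 \<le> t ==> picard z0 w (%r. Zp z0 r w) t = Zp z0 t w"
  "\<And>t. 0 \<le> t ==> (%n. (picard z0 w ^^ n) (%_. z0) t) \<longlonglongrightarrow> Zp z0 t w"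
proof -
 obtain g where g: "continuous_on {0..} g" "\<And>t. t \<in> {0..} ==> picard z0 w g t = g t"
  "\<And>t. t \<in> {0..} ==> (%n. (picard z0 w ^^ n) (%_. z0) t) \<longlonglongrightarrow> g t"
 proof (rule volterra_fixed_point[of "{0..}" "picard z0 w" "%_. z0"])
  show "\<exists>T\<in>{0..}. t < T" if "t \<in> {0..}" for t :: real using that by (intro bexI[of _ "t + 1"]) auto
  show "continuous_on {0..} (picard z0 w u)" if "continuous_on {0..} u" for u by (rule picard_continuous[OF w that])
  fix T :: real assume "T \<in> {0..}"
  then have T: "0 \<le> T" by simp
  have "bounded ((%t. W t w) ` {0..T})"
   by (intro compact_imp_bounded compact_continuous_image continuous_on_subset[OF W_continuous[OF w]]) auto
  then obtain b where b: "\<And>r. r \<in> {0..T} ==> \<bar>W r w\<bar> \<le> b" unfolding bounded_iff by fastforce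
  define L where "L = 8 * \<gamma> + (\<Omega> + 4 * \<gamma>) * exp (vol * b)"
  have L0: "0 \<le> L" using \<gamma>_pos \<Omega>_pos by (simp add: L_def)
  have "\<bar>picard z0 w u s - picard z0 w v s\<bar> \<le> L * B * s ^ Suc n / real (Suc n)"
   if u: "continuous_on {0..} u" and v: "continuous_on {0..} v" and B: "0 \<le> B"
    and le: "\<forall>s\<in>{0..T}. \<bar>u s - v s\<bar> \<le> B * s ^ n" and s: "s \<in> {0..T}" for u v B s and n :: nat
  proof -
   have iu: "(%r. vfield (W r w) (u r)) integrable_on {0..s}" "(%r. vfield (W r w) (v r)) integrable_on {0..s}"
    by (intro integrable_continuous_real continuous_on_subset[OF vfield_path_continuous[OF w u]] continuous_on_subset[OF vfield_path_continuous[OF w v]]; auto)+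
   have hi: "((%r. L * B * r ^ n) has_integral L * B * s ^ Suc n / real (Suc n) - L * B * 0 ^ Suc n / real (Suc n)) {0..s}"
   proof (rule fundamental_theorem_of_calculus)
    show "((%r. L * B * r ^ Suc n / real (Suc n)) has_vector_derivative L * B * x ^ n) (at x within {0..s})" for x
     unfolding has_real_derivative_iff_has_vector_derivative[symmetric]
     by (rule derivative_eq_intros refl | simp)+
   qed (use s in auto)
   have "picard z0 w u s - picard z0 w v s = integral {0..s} (%r. vfield (W r w) (u r) - vfield (W r w) (v r))"
    unfolding picard_def using integral_diff[OF iu] by simp
   also have "norm \<dots> \<le> integral {0..s} (%r. L * B * r ^ n)"
   proof (rule integral_norm_bound_integral[OF integrable_diff[OF iu] has_integral_integrable[OF hi]])
    fix r assume r: "r \<in> {0..s}"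
    then have rT: "r \<in> {0..T}" using s by auto
    have Lr: "8 * \<gamma> + (\<Omega> + 4 * \<gamma>) * exp (vol * \<bar>W r w\<bar>) \<le> L"
     unfolding L_def using b[OF rT] vol_pos \<gamma>_pos \<Omega>_pos by (intro add_left_mono mult_left_mono) auto
    have "\<bar>vfield (W r w) (u r) - vfield (W r w) (v r)\<bar> \<le> (8 * \<gamma> + (\<Omega> + 4 * \<gamma>) * exp (vol * \<bar>W r w\<bar>)) * \<bar>u r - v r\<bar>"
     by (rule vfield_lipschitz)
    also have "\<dots> \<le> L * (B * r ^ n)" using Lr le rT L0 by (intro mult_mono) auto
    finally show "norm (vfield (W r w) (u r) - vfield (W r w) (v r)) \<le> L * B * r ^ n" by simp
   qed
   also have "\<dots> = L * B * s ^ Suc n / real (Suc n)" using integral_unique[OF hi] by simp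
   finally show ?thesis by simp
  qed
  then show "\<exists>L\<ge>0. \<forall>u v B n. continuous_on {0..} u --> continuous_on {0..} v --> 0 \<le> B -->
    (\<forall>s\<in>{0..T}. \<bar>u s - v s\<bar> \<le> B * s ^ n) -->
    (\<forall>s\<in>{0..T}. \<bar>picard z0 w u s - picard z0 w v s\<bar> \<le> L * B * s ^ Suc n / real (Suc n))"
   using L0 by (intro exI[of _ L]) blast
 qed auto
 have eq: "Zp z0 t w = g t" if "0 \<le> t" for t unfolding Zp_def using limI[OF g(3)[of t]] that by simp
 show c: "continuous_on {0..} (%t. Zp z0 t w)" using g(1) by (rule continuous_on_eq) (simp add: eq)
 show "(%n. (picard z0 w ^^ n) (%_. z0) t) \<longlonglongrightarrow> Zp z0 t w" if "0 \<le> t" for t using g(3)[of t] eq that by simp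
 show "picard z0 w (%r. Zp z0 r w) t = Zp z0 t w" if t: "0 \<le> t" for t
 proof -
  have "integral {0..t} (%r. vfield (W r w) (Zp z0 r w)) = integral {0..t} (%r. vfield (W r w) (g r))"
   by (rule integral_cong) (simp add: eq)
  then have "picard z0 w (%r. Zp z0 r w) t = picard z0 w g t" by (simp add: picard_def)
  then show ?thesis using g(2)[of t] eq[OF t] t by simp
 qed
qed

lemma Zp_adapted:
 assumes t: "0 \<le> t"
 shows "Zp z0 t \<in> borel_measurable (F t)"
proof -
 have vm: "(%p. vfield (fst p) (snd p)) \<in> borel_measurable borel"
  using borel_measurable_continuous_onI[OF continuous_on_vfield] by (simp add: split_beta')
 have it: "(\<forall>w\<in>space M. continuous_on {0..} ((picard z0 w ^^ n) (%_. z0))) \<and> (\<forall>t\<ge>0. (%w. (picard z0 w ^^ n) (%_. z0) t) \<in> borel_measurable (F t))" for n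
 proof (induction n)
  case (Suc n)
  define u where "u t w = (picard z0 w ^^ n) (%_. z0) t" for t w
  have uc: "\<And>w. w \<in> space M ==> continuous_on {0..} (%t. u t w)" and um: "\<And>t. 0 \<le> t ==> u t \<in> borel_measurable (F t)"
   using Suc by (auto simp: u_def[abs_def])
  have 1: "continuous_on {0..} (picard z0 w (%t. u t w))" if "w \<in> space M" for w
   by (rule picard_continuous[OF that uc[OF that]])
  have 2: "(%w. picard z0 w (%t. u t w) t) \<in> borel_measurable (F t)" if t: "0 \<le> t" for t
  proof -
   have "(%w. integral {0..t} (%r. vfield (W r w) (u r w))) \<in> borel_measurable (F t)"
   proof (rule integral_adapted[OF _ _ t, of "%r w. vfield (W r w) (u r w)"])
    fix r :: real assume r: "0 \<le> r"
    have "(%w. (W r w, u r w)) \<in> measurable (F r) (borel \<Otimes>\<^sub>M borel)"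
     by (intro measurable_Pair W_measurable[OF r order_refl] um r)
    then have "(%w. (W r w, u r w)) \<in> borel_measurable (F r)" by (simp add: borel_prod)
    from measurable_compose[OF this vm] show "(%w. vfield (W r w) (u r w)) \<in> borel_measurable (F r)" by simp
   next
    fix w assume "w \<in> space M"
    then show "continuous_on {0..} (%r. vfield (W r w) (u r w))" by (intro vfield_path_continuous uc)
   qed
   then show ?thesis unfolding picard_def by simp
  qed
  show ?case using 1 2 unfolding u_def by simp
 qed auto
 show ?thesis
  by (rule borel_measurable_LIMSEQ_real[where u = "%n w. (picard z0 w ^^ n) (%_. z0) t"])
   (use Zp_props(3)[OF _ t] it t in auto)
qed

lemma Zp_deriv:
 assumes w: "w \<in> space M" and t: "0 \<le> t"
 shows "((%t. Zp z0 t w) has_real_derivative vfield (W t w) (Zp z0 t w)) (at t within {0..})"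
 by (rule has_field_derivative_transform_within[OF picard_deriv[OF w Zp_props(1)[OF w] t], where d = 1])
  (use t Zp_props(2)[OF w] in auto)

lemma Zp_0: "w \<in> space M ==> Zp z0 0 w = z0"
 using Zp_props(2)[of w 0 z0] by (simp add: picard_def)

lemma vfield_zero_pos: "vfield w 0 > 0"
 using \<Omega>_pos flow_den_pos[of w 0] by (simp add: vfield_def)

text \<open>At the state 0 the velocity is strictly positive whatever the Brownian value, since the
  sine vanishes there and \<Omega> > 0. So the path leaves 0 to the right at once, and it cannot
  come back: at a first return it would have to be increasing while arriving from above.\<close>

lemma Zp_positive:
 assumes w: "w \<in> space M" and z0: "0 \<le> z0" and t: "0 < t"
 shows "Zp z0 t w > 0"
proof (rule ccontr)
 let ?Z = "%t. Zp z0 t w"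
 assume "\<not> ?Z t > 0"
 then have neg: "?Z t \<le> 0" by simp
 obtain t0 where t0: "0 \<le> t0" "t0 < t" "?Z t0 > 0"
 proof (cases "z0 = 0")
  case False
  show ?thesis by (rule that[of 0]) (use False z0 t Zp_0[OF w, of z0] in auto)
 next
  case True
  have "(?Z has_real_derivative vfield (W 0 w) (?Z 0)) (at 0 within {0..})" by (rule Zp_deriv[OF w]) simp
  moreover have "0 < vfield (W 0 w) (?Z 0)" using Zp_0[OF w, of z0] True vfield_zero_pos by simp
  ultimately obtain d where d: "d > 0" "\<And>h. h > 0 ==> 0 + h \<in> {0..} ==> h < d ==> ?Z 0 < ?Z (0 + h)"
   using has_real_derivative_pos_inc_right by blast
  define h where "h = min d t / 2"
  have "h > 0" "h < d" "h < t" using d(1) t by (auto simp: h_def)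
  then show ?thesis using d(2)[of h] Zp_0[OF w, of z0] True by (intro that[of h]) auto
 qed
 define A where "A = {t0..t} \<inter> ?Z -` {..0}"
 have cA: "continuous_on {t0..t} ?Z" by (rule continuous_on_subset[OF Zp_props(1)[OF w]]) (use t0 in auto)
 have "closed A" unfolding A_def by (rule continuous_closed_preimage[OF cA]) auto
 moreover have "bdd_below A" by (auto simp: A_def)
 moreover have "A \<noteq> {}"
 proof -
  have "t \<in> A" unfolding A_def using neg t0 by simp
  then show ?thesis by blast
 qed
 ultimately have sA: "Inf A \<in> A" by (intro closed_contains_Inf)
 \<comment> \<open>The first time after \<open>t0\<close> with a nonpositive value. Continuity makes
   that value 0, and the positive derivative there contradicts positivity just before.\<close>
 define s where "s = Inf A"
 have s: "t0 \<le> s" "s \<le> t" "?Z s \<le> 0" using sA by (auto simp: s_def A_def)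
 have s0: "t0 < s" using s t0 by (cases "s = t0") auto
 have before: "?Z r > 0" if "t0 \<le> r" "r < s" for r
 proof (rule ccontr)
  assume "\<not> ?Z r > 0"
  then have "r \<in> A" using that s by (auto simp: A_def)
  then have "s \<le> r" unfolding s_def using \<open>bdd_below A\<close> by (rule cInf_lower)
  then show False using that by simp
 qed
 have "?Z s = 0"
 proof (rule ccontr)
  assume "?Z s \<noteq> 0"
  then have "?Z s < 0" using s by auto
  have "continuous_on {t0..s} ?Z" by (rule continuous_on_subset[OF cA]) (use s in auto)
  from IVT2'[OF _ _ _ this, of 0] obtain r where "t0 \<le> r" "r \<le> s" "?Z r = 0" using t0 s by auto
  then show False using before[of r] \<open>?Z s < 0\<close> by (cases "r = s") auto
 qed
 then have "(?Z has_real_derivative vfield (W s w) 0) (at s within {0..})" using Zp_deriv[OF w, of s z0] s t0 by simp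
 then obtain d where d: "d > 0" "\<And>h. h > 0 ==> s - h \<in> {0..} ==> h < d ==> ?Z (s - h) < ?Z s"
  using has_real_derivative_pos_inc_left vfield_zero_pos by blast
 define h where "h = min d (s - t0) / 2"
 have h: "h > 0" "h < d" "h < s - t0" using d(1) s0 by (auto simp: h_def)
 have "?Z (s - h) < ?Z s" by (rule d(2)) (use h t0 in auto)
 moreover have "?Z (s - h) > 0" by (rule before) (use h in auto)
 ultimately show False using \<open>?Z s = 0\<close> by simp
qed

text \<open>The Doss-Sussmann representation: the flow of the noise field, run for the Brownian
  value, applied to a path that is differentiable in time. Positivity passes from \<open>Zp\<close>
  to \<open>Xp\<close> because the flow is increasing and fixes 0.\<close>

definition Xp :: "real => real => 'a => real" where "Xp z0 t w = flow (W t w) (Zp z0 t w)"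

lemma Xp_continuous:
 assumes w: "w \<in> space M"
 shows "continuous_on {0..} (%t. Xp z0 t w)"
proof -
 have "continuous_on {0..} (%r. (W r w, Zp z0 r w))" by (intro continuous_intros W_continuous[OF w] Zp_props(1)[OF w])
 from continuous_on_compose2[OF continuous_on_flow this] show ?thesis by (simp add: Xp_def)
qed

lemma Xp_adapted:
 assumes t: "0 \<le> t"
 shows "Xp z0 t \<in> borel_measurable (F t)"
proof -
 have vm: "(%p. flow (fst p) (snd p)) \<in> borel_measurable borel"
  using borel_measurable_continuous_onI[OF continuous_on_flow] by (simp add: split_beta')
 have "(%w. (W t w, Zp z0 t w)) \<in> measurable (F t) (borel \<Otimes>\<^sub>M borel)"
  by (intro measurable_Pair W_measurable[OF t order_refl] Zp_adapted t)
 then have "(%w. (W t w, Zp z0 t w)) \<in> borel_measurable (F t)" by (simp add: borel_prod)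
 from measurable_compose[OF this vm] show ?thesis by (simp add: Xp_def[abs_def])
qed

lemma Xp_progressive: "progressive M F (Xp z0)"
 by (rule adapted_continuous_progressive[OF Xp_adapted Xp_continuous])

lemma Xp_0: "w \<in> space M ==> Xp z0 0 w = z0"
 by (simp add: Xp_def Zp_0 W_0)

lemma Xp_positive: "w \<in> space M ==> 0 \<le> z0 ==> 0 < t ==> Xp z0 t w > 0"
 using flow_strict_mono[OF Zp_positive[of w z0 t], of "W t w"] by (simp add: Xp_def)

end

lemma integral_square_le:
 fixes e :: "real => real"
 assumes e: "continuous_on {s..t} e" and st: "s < t"
 shows "(integral {s..t} e)\<^sup>2 \<le> (t - s) * integral {s..t} (%r. (e r)\<^sup>2)"
proof -
 define m where "m = integral {s..t} e / (t - s)"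
 have i1: "e integrable_on {s..t}" and i2: "(%r. (e r)\<^sup>2) integrable_on {s..t}"
  by (intro integrable_continuous_real continuous_intros e)+
 have i3: "(%r. 2 * m * e r) integrable_on {s..t}" by (rule integrable_on_mult_right[OF i1])
 have "0 \<le> integral {s..t} (%r. (e r - m)\<^sup>2)"
  by (rule integral_nonneg) (auto intro!: integrable_continuous_real continuous_intros e)
 also have "(%r. (e r - m)\<^sup>2) = (%r. ((e r)\<^sup>2 - 2 * m * e r) + m\<^sup>2)" by (auto simp: power2_diff algebra_simps)
 also have "integral {s..t} (%r. ((e r)\<^sup>2 - 2 * m * e r) + m\<^sup>2) = integral {s..t} (%r. (e r)\<^sup>2) - 2 * m * integral {s..t} e + m\<^sup>2 * (t - s)"
  using st i1 i2 i3 by (subst integral_add) (auto intro!: integrable_diff simp: integral_diff)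
 also have "\<dots> = integral {s..t} (%r. (e r)\<^sup>2) - (integral {s..t} e)\<^sup>2 / (t - s)"
 proof -
  have "- 2 * (z / D) * z + (z / D)\<^sup>2 * D = - (z\<^sup>2 / D)" if "D > 0" for z D :: real
   using that by (simp add: power2_eq_square field_simps)
  from this[of "t - s" "integral {s..t} e"] show ?thesis using st by (simp add: m_def)
 qed
 finally show ?thesis using st by (simp add: field_simps)
qed

text \<open>The square is split by repeated doubling, and the mixed products
  \<open>u\<^sup>2 * I\<^sup>2\<close> and \<open>u ^ 4 * I\<^sup>2\<close> by Young's inequality.
  The seven terms on the right are arranged so that, for increments of exponential type, each has
  expectation of order at most \<open>d ^ 3\<close>.\<close>

lemma remainder_square_bound:
 fixes R I u d J2 J4 Bb c :: real
 assumes nn: "0 \<le> I" "0 \<le> u" "0 < d" "d \<le> 1" "0 \<le> Bb" "0 \<le> c" "0 \<le> J2" "0 \<le> J4"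
  and R: "\<bar>R\<bar> \<le> Bb * I + c * (I + d * (Bb * (d + I))) + (u + u\<^sup>2) * (Bb * (d + I)) + u ^ 3"
  and J2: "I\<^sup>2 \<le> d * J2" and J4: "I ^ 4 \<le> d ^ 3 * J4"
 shows "R\<^sup>2 \<le> (1024 * (Bb + c + c * Bb + 1)\<^sup>2) * (d * J2 + d ^ 4 + d\<^sup>2 * u\<^sup>2 + d * u ^ 4 + d\<^sup>2 * J4 + u ^ 8 + u ^ 6)"
proof -
 define K where "K = Bb + c + c * Bb + 1"
 have K: "0 \<le> K" "Bb + c \<le> K" "c * Bb \<le> K" "Bb \<le> K" "1 \<le> K" using nn by (auto simp: K_def)
 have d2: "d * I \<le> 1 * I" using nn by (intro mult_right_mono) auto
 have "\<bar>R\<bar> \<le> (Bb + c) * I + (c * Bb) * (d\<^sup>2 + d * I) + Bb * ((u + u\<^sup>2) * (d + I)) + 1 * u ^ 3"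
  using R by (simp add: algebra_simps power2_eq_square)
 also have "\<dots> \<le> K * I + K * (d\<^sup>2 + I) + K * ((u + u\<^sup>2) * (d + I)) + K * u ^ 3"
  using K nn d2 by (intro add_mono mult_mono) auto
 also have "\<dots> = K * ((2 * I + (d\<^sup>2 + (u * d + u * I))) + (u\<^sup>2 * d + (u\<^sup>2 * I + u ^ 3)))" by (simp add: algebra_simps)
 finally have "\<bar>R\<bar>\<^sup>2 \<le> (K * ((2 * I + (d\<^sup>2 + (u * d + u * I))) + (u\<^sup>2 * d + (u\<^sup>2 * I + u ^ 3))))\<^sup>2"
  by (rule power_mono) auto
 then have "R\<^sup>2 \<le> K\<^sup>2 * ((2 * I + (d\<^sup>2 + (u * d + u * I))) + (u\<^sup>2 * d + (u\<^sup>2 * I + u ^ 3)))\<^sup>2" by (simp add: power_mult_distrib)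
 also have "\<dots> \<le> K\<^sup>2 * (2 * (2 * (2 * I)\<^sup>2 + 2 * (2 * (d\<^sup>2)\<^sup>2 + 2 * (2 * (u * d)\<^sup>2 + 2 * (u * I)\<^sup>2)))
   + 2 * (2 * (u\<^sup>2 * d)\<^sup>2 + 2 * (2 * (u\<^sup>2 * I)\<^sup>2 + 2 * (u ^ 3)\<^sup>2)))"
  by (intro mult_left_mono order.trans[OF square_sum_le] add_mono) (auto intro!: square_sum_le)
 also have "\<dots> = K\<^sup>2 * (16 * I\<^sup>2 + 8 * d ^ 4 + 16 * (u\<^sup>2 * d\<^sup>2) + 16 * (u\<^sup>2 * I\<^sup>2) + 4 * (u ^ 4 * d\<^sup>2) + 8 * (u ^ 4 * I\<^sup>2) + 8 * u ^ 6)"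
  by (simp add: power_mult_distrib power_mult[symmetric])
 also have "\<dots> \<le> K\<^sup>2 * (1024 * (d * J2 + d ^ 4 + d\<^sup>2 * u\<^sup>2 + d * u ^ 4 + d\<^sup>2 * J4 + u ^ 8 + u ^ 6))"
 proof (rule mult_left_mono)
  have a1: "u\<^sup>2 * I\<^sup>2 \<le> d * u ^ 4 + d\<^sup>2 * J4"
  proof -
   have "0 \<le> (d * u\<^sup>2 - I\<^sup>2)\<^sup>2 / d" using nn by auto
   also have "\<dots> = d * u ^ 4 + I ^ 4 / d - 2 * (u\<^sup>2 * I\<^sup>2)" using nn by (simp add: power2_eq_square power4_eq_xxxx field_simps)
   finally have "2 * (u\<^sup>2 * I\<^sup>2) \<le> d * u ^ 4 + I ^ 4 / d" by simp
   moreover have "I ^ 4 / d \<le> d\<^sup>2 * J4"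
   proof -
    have "I ^ 4 / d \<le> (d ^ 3 * J4) / d" using J4 nn by (intro divide_right_mono) auto
    also have "\<dots> = d\<^sup>2 * J4" using nn by (simp add: power2_eq_square power3_eq_cube)
    finally show ?thesis .
   qed
   moreover have "0 \<le> u\<^sup>2 * I\<^sup>2" by auto
   ultimately show ?thesis by linarith
  qed
  have a2: "u ^ 4 * I\<^sup>2 \<le> u ^ 8 + d\<^sup>2 * J4"
  proof -
   have "0 \<le> (u ^ 4 - I\<^sup>2)\<^sup>2" by auto
   also have "\<dots> = u ^ 8 + I ^ 4 - 2 * (u ^ 4 * I\<^sup>2)" by (simp add: power2_diff power_mult[symmetric])
   finally have "2 * (u ^ 4 * I\<^sup>2) \<le> u ^ 8 + I ^ 4" by simp
   moreover have "I ^ 4 \<le> d\<^sup>2 * J4"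
   proof -
    have "d ^ 3 * J4 \<le> d ^ 2 * J4" using nn by (intro mult_right_mono power_decreasing) auto
    then show ?thesis using J4 by simp
   qed
   moreover have "0 \<le> u ^ 4 * I\<^sup>2" using nn by auto
   ultimately show ?thesis by linarith
  qed
  have a3: "u ^ 4 * d\<^sup>2 \<le> d * u ^ 4"
  proof -
   have "u ^ 4 * (d * d) \<le> u ^ 4 * (d * 1)" using nn by (intro mult_left_mono) auto
   then show ?thesis by (simp add: power2_eq_square mult_ac)
  qed
  have pos: "0 \<le> d * J2" "0 \<le> d ^ 4" "0 \<le> d\<^sup>2 * u\<^sup>2" "0 \<le> d * u ^ 4" "0 \<le> d\<^sup>2 * J4" "0 \<le> u ^ 8" "0 \<le> u ^ 6" using nn by auto
  have a4: "u\<^sup>2 * d\<^sup>2 = d\<^sup>2 * u\<^sup>2" by simp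
  show "16 * I\<^sup>2 + 8 * d ^ 4 + 16 * (u\<^sup>2 * d\<^sup>2) + 16 * (u\<^sup>2 * I\<^sup>2) + 4 * (u ^ 4 * d\<^sup>2) + 8 * (u ^ 4 * I\<^sup>2) + 8 * u ^ 6
   \<le> 1024 * (d * J2 + d ^ 4 + d\<^sup>2 * u\<^sup>2 + d * u ^ 4 + d\<^sup>2 * J4 + u ^ 8 + u ^ 6)"
   using J2 a1 a2 a3 a4 pos unfolding distrib_left by linarith
 qed simp
 finally show ?thesis unfolding K_def[symmetric] by (simp only: mult_ac)
qed

section \<open>Local expansion of the constructed path and moments of its error\<close>

context controlled_qubit
begin

text \<open>The move from \<open>s\<close> to \<open>t\<close> is made in two stages: along
  \<open>Zp\<close> with the Brownian argument frozen at \<open>W s w\<close>, which is the path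
  \<open>xt\<close>, and then along the flow in the Brownian variable. The first stage follows the
  Stratonovich drift up to the density ratio, the second is Taylor expanded. The gap between
  Stratonovich and Ito drift, integrated over the cell, is what turns \<open>q\<^sup>2\<close> into
  \<open>q\<^sup>2 - d\<close>. The function \<open>e\<close> dominates both the displacement
  \<open>vol * \<bar>W r w - W s w\<bar>\<close> and the deviation of the density ratio from
  1.\<close>

lemma path_expansion:
 fixes z0 :: real
 assumes w: "w \<in> space M" and st: "0 \<le> s" "s < t"
 defines "q \<equiv> W t w - W s w" and "e \<equiv> %r. exp (vol * \<bar>W r w - W s w\<bar>) - 1" and "d \<equiv> t - s" and "Bb \<equiv> \<Omega> + 4 * \<gamma>"
 defines "I \<equiv> integral {s..t} e" and "u \<equiv> exp (vol * \<bar>q\<bar>) - 1" and "x \<equiv> Xp z0 s w"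
 shows "\<bar>Xp z0 t w - x - integral {s..t} (%r. \<Omega> - 2 * \<gamma> * sin (2 * Xp z0 r w)) + vol * sin x * q - 2 * \<gamma> * sin (2 * x) * (q\<^sup>2 - d)\<bar>
  \<le> Bb * I + 4 * \<gamma> * (I + d * (Bb * (d + I))) + (u + u\<^sup>2) * (Bb * (d + I)) + u ^ 3"
proof -
 let ?X = "%r. Xp z0 r w" and ?Z = "%r. Zp z0 r w"
 define xt where "xt r = flow (W s w) (?Z r)" for r
 define bt where "bt r = \<Omega> - 4 * \<gamma> * sin (2 * ?X r)" for r
 define f where "f r = bt r * (flow_den (W r w) (?Z r) / flow_den (W s w) (?Z r))" for r
 have d0: "0 < d" using st by (simp add: d_def)
 have Bb0: "0 \<le> Bb" using \<Omega>_pos \<gamma>_pos by (simp add: Bb_def)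
 have Wc: "continuous_on {s..t} (%r. W r w)" by (rule continuous_on_subset[OF W_continuous[OF w]]) (use st in auto)
 have Xc: "continuous_on {s..t} ?X" by (rule continuous_on_subset[OF Xp_continuous[OF w]]) (use st in auto)
 have ec: "continuous_on {s..t} e" unfolding e_def by (intro continuous_intros Wc)
 have e0: "0 \<le> e r" for r using vol_pos by (simp add: e_def)
 have ei: "e integrable_on {s..t}" by (rule integrable_continuous_real[OF ec])
 have I0: "0 \<le> I" unfolding I_def by (rule integral_nonneg[OF ei]) (use e0 in auto)
 have btb: "\<bar>bt r\<bar> \<le> Bb" for r unfolding bt_def Bb_def by (rule vfield_factor)
 have btc: "continuous_on {s..t} bt" unfolding bt_def by (intro continuous_intros Xc)
 have bti: "bt integrable_on {s..t}" by (rule integrable_continuous_real[OF btc])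
 have xs: "xt s = x" by (simp add: xt_def x_def Xp_def)
 have hi: "(f has_integral (xt r - x)) {s..r}" if r: "s \<le> r" "r \<le> t" for r
  unfolding xs[symmetric]
 proof (rule fundamental_theorem_of_calculus[OF r(1)])
  fix y assume y: "y \<in> {s..r}"
  have "((%t. Zp z0 t w) has_real_derivative vfield (W y w) (?Z y)) (at y within {s..r})"
   by (rule has_field_derivative_subset[OF Zp_deriv[OF w]]) (use y st in auto)
  from DERIV_chain'[OF this flow_deriv_z[of "W s w"]]
  have "(xt has_real_derivative 1 / flow_den (W s w) (?Z y) * vfield (W y w) (?Z y)) (at y within {s..r})"
   unfolding xt_def[abs_def] .
  also have "1 / flow_den (W s w) (?Z y) * vfield (W y w) (?Z y) = f y"
   by (simp add: f_def bt_def vfield_def Xp_def)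
  finally show "(xt has_vector_derivative f y) (at y within {s..r})"
   by (simp add: has_real_derivative_iff_has_vector_derivative)
 qed
 have fi: "f integrable_on {s..t}" using hi[of t] st by auto
 have fb: "\<bar>f r - bt r\<bar> \<le> Bb * e r" for r
 proof -
  have "f r - bt r = bt r * (flow_den (W r w) (?Z r) / flow_den (W s w) (?Z r) - 1)" by (simp add: f_def right_diff_distrib)
  then have "\<bar>f r - bt r\<bar> = \<bar>bt r\<bar> * \<bar>flow_den (W r w) (?Z r) / flow_den (W s w) (?Z r) - 1\<bar>" by (simp only: abs_mult)
  also have "\<dots> \<le> Bb * e r" unfolding e_def using btb flow_den_ratio Bb0 by (intro mult_mono) auto
  finally show ?thesis .
 qed
 have A1: "\<bar>xt t - x - integral {s..t} bt\<bar> \<le> Bb * I"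
 proof -
  have "xt t - x - integral {s..t} bt = integral {s..t} (%r. f r - bt r)"
   using integral_unique[OF hi[of t]] st integral_diff[OF fi bti] by simp
  also have "norm \<dots> \<le> integral {s..t} (%r. Bb * e r)"
   by (rule integral_norm_bound_integral[OF integrable_diff[OF fi bti] integrable_on_mult_right[OF ei]]) (use fb in auto)
  finally show ?thesis by (simp add: I_def)
 qed
 have A2: "\<bar>xt r - x\<bar> \<le> Bb * (d + I)" if r: "s \<le> r" "r \<le> t" for r
 proof -
  have sub: "continuous_on {s..r} e" by (rule continuous_on_subset[OF ec]) (use r in auto)
  have g1: "(%r. Bb * (1 + e r)) integrable_on {s..r}" by (intro integrable_continuous_real continuous_intros sub)
  have g2: "(%r. Bb * (1 + e r)) integrable_on {s..t}" by (intro integrable_continuous_real continuous_intros ec)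
  have "norm (integral {s..r} f) \<le> integral {s..r} (%r. Bb * (1 + e r))"
  proof (rule integral_norm_bound_integral[OF has_integral_integrable[OF hi[OF r]] g1])
   fix y
   have "Bb * (1 + e y) = Bb + Bb * e y" by (simp add: algebra_simps)
   then show "norm (f y) \<le> Bb * (1 + e y)" using fb[of y] btb[of y] unfolding real_norm_def by linarith
  qed
  also have "\<dots> \<le> integral {s..t} (%r. Bb * (1 + e r))"
   by (rule integral_subset_le[OF _ g1 g2]) (use r e0 Bb0 in auto)
  also have "\<dots> = Bb * (d + I)"
   using st ei integral_add[OF integrable_const_ivl[of 1 s t] ei] by (simp add: d_def I_def)
  finally show ?thesis using integral_unique[OF hi[OF r]] by simp
 qed
 have qe: "vol * y \<le> exp (vol * y) - 1" for y using exp_ge_add_one_self[of "vol * y"] by linarith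
 have A3: "\<bar>integral {s..t} (%r. 2 * \<gamma> * sin (2 * ?X r)) - 2 * \<gamma> * sin (2 * x) * d\<bar> \<le> 4 * \<gamma> * (I + d * (Bb * (d + I)))"
 proof -
  have i1: "(%r. 2 * \<gamma> * sin (2 * ?X r)) integrable_on {s..t}" by (intro integrable_continuous_real continuous_intros Xc)
  have "integral {s..t} (%r. 2 * \<gamma> * sin (2 * ?X r) - 2 * \<gamma> * sin (2 * x)) = integral {s..t} (%r. 2 * \<gamma> * sin (2 * ?X r)) - 2 * \<gamma> * sin (2 * x) * d"
   using st integral_diff[OF i1 integrable_const_ivl[of "2 * \<gamma> * sin (2 * x)" s t]] by (simp add: d_def)
  then have "\<bar>integral {s..t} (%r. 2 * \<gamma> * sin (2 * ?X r)) - 2 * \<gamma> * sin (2 * x) * d\<bar> = norm (integral {s..t} (%r. 2 * \<gamma> * sin (2 * ?X r) - 2 * \<gamma> * sin (2 * x)))" by simp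
  also have "\<dots> \<le> integral {s..t} (%r. 4 * \<gamma> * (e r + Bb * (d + I)))"
  proof (rule integral_norm_bound_integral)
   show "(%r. 2 * \<gamma> * sin (2 * ?X r) - 2 * \<gamma> * sin (2 * x)) integrable_on {s..t}" by (intro integrable_diff i1 integrable_const_ivl)
   show "(%r. 4 * \<gamma> * (e r + Bb * (d + I))) integrable_on {s..t}" by (intro integrable_continuous_real continuous_intros ec)
   fix r assume r: "r \<in> {s..t}"
   have "\<bar>?X r - xt r\<bar> \<le> vol * \<bar>W r w - W s w\<bar>" unfolding Xp_def xt_def by (rule flow_lipschitz_w)
   also have "\<dots> \<le> e r" unfolding e_def by (rule qe)
   finally have "\<bar>?X r - x\<bar> \<le> e r + Bb * (d + I)" using A2[of r] r by auto
   then have "2 * \<gamma> * \<bar>sin (2 * ?X r) - sin (2 * x)\<bar> \<le> 2 * \<gamma> * (2 * (e r + Bb * (d + I)))"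
    using \<gamma>_pos by (intro mult_left_mono order.trans[OF sin2_diff_min]) (auto simp: min_le_iff_disj)
   moreover have "norm (2 * \<gamma> * sin (2 * ?X r) - 2 * \<gamma> * sin (2 * x)) = 2 * \<gamma> * \<bar>sin (2 * ?X r) - sin (2 * x)\<bar>"
    unfolding right_diff_distrib[symmetric] real_norm_def abs_mult using \<gamma>_pos by simp
   moreover have "2 * \<gamma> * (2 * (e r + Bb * (d + I))) = 4 * \<gamma> * (e r + Bb * (d + I))" by (simp only: mult.assoc[symmetric])
   ultimately show "norm (2 * \<gamma> * sin (2 * ?X r) - 2 * \<gamma> * sin (2 * x)) \<le> 4 * \<gamma> * (e r + Bb * (d + I))" by linarith
  qed
  also have "\<dots> = 4 * \<gamma> * (I + d * (Bb * (d + I)))"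
   using st integral_add[OF ei integrable_const_ivl[of "Bb * (d + I)" s t]] by (simp add: d_def I_def)
  finally show ?thesis .
 qed
 have u0: "0 \<le> u" using vol_pos by (simp add: u_def)
 have vq: "vol * \<bar>q\<bar> \<le> u" unfolding u_def by (rule qe)
 have A4: "\<bar>?X t - xt t + vol * sin (xt t) * q - 2 * \<gamma> * sin (2 * xt t) * q\<^sup>2\<bar> \<le> u ^ 3"
 proof -
  have "\<bar>?X t - xt t + vol * sin (xt t) * q - 2 * \<gamma> * sin (2 * xt t) * q\<^sup>2\<bar> \<le> vol ^ 3 * \<bar>q\<bar> ^ 3"
   unfolding Xp_def xt_def q_def by (rule flow_taylor)
  also have "\<dots> = (vol * \<bar>q\<bar>) ^ 3" by (simp add: power_mult_distrib)
  also have "\<dots> \<le> u ^ 3" using vq vol_pos by (intro power_mono) auto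
  finally show ?thesis .
 qed
 have xb: "\<bar>xt t - x\<bar> \<le> Bb * (d + I)" using A2[of t] st by auto
 have A5: "\<bar>vol * q * (sin x - sin (xt t))\<bar> \<le> u * (Bb * (d + I))"
 proof -
  have "\<bar>sin x - sin (xt t)\<bar> \<le> Bb * (d + I)" using abs_sin_diff_le[of x "xt t"] xb by (simp add: abs_minus_commute)
  then have "(vol * \<bar>q\<bar>) * \<bar>sin x - sin (xt t)\<bar> \<le> u * (Bb * (d + I))" using vq u0 by (intro mult_mono) auto
  then show ?thesis using vol_pos by (simp add: abs_mult)
 qed
 have A6: "\<bar>2 * \<gamma> * q\<^sup>2 * (sin (2 * xt t) - sin (2 * x))\<bar> \<le> u\<^sup>2 * (Bb * (d + I))"
 proof -
  have "\<bar>sin (2 * xt t) - sin (2 * x)\<bar> \<le> 2 * (Bb * (d + I))"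
   by (rule order.trans[OF sin2_diff_min]) (use xb in auto)
  then have s2: "\<bar>sin (2 * xt t) - sin (2 * x)\<bar> / 2 \<le> Bb * (d + I)" by simp
  have "(vol * \<bar>q\<bar>)\<^sup>2 \<le> u\<^sup>2" using vq vol_pos by (intro power_mono) auto
  then have "(vol * \<bar>q\<bar>)\<^sup>2 * (\<bar>sin (2 * xt t) - sin (2 * x)\<bar> / 2) \<le> u\<^sup>2 * (Bb * (d + I))"
   using s2 by (intro mult_mono) auto
  moreover have "(vol * \<bar>q\<bar>)\<^sup>2 * (\<bar>sin (2 * xt t) - sin (2 * x)\<bar> / 2) = 4 * \<gamma> * q\<^sup>2 * \<bar>sin (2 * xt t) - sin (2 * x)\<bar>"
   by (simp add: power_mult_distrib vol_sq)
  moreover have "0 \<le> 2 * \<gamma> * q\<^sup>2 * \<bar>sin (2 * xt t) - sin (2 * x)\<bar>" using \<gamma>_pos by auto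
  moreover have "\<bar>2 * \<gamma> * q\<^sup>2 * (sin (2 * xt t) - sin (2 * x))\<bar> = 2 * \<gamma> * q\<^sup>2 * \<bar>sin (2 * xt t) - sin (2 * x)\<bar>"
   using \<gamma>_pos by (simp add: abs_mult)
  ultimately show ?thesis by linarith
 qed
 have bt_split: "integral {s..t} bt = integral {s..t} (%r. \<Omega> - 2 * \<gamma> * sin (2 * ?X r)) - integral {s..t} (%r. 2 * \<gamma> * sin (2 * ?X r))"
 proof -
  have "integral {s..t} (%r. (\<Omega> - 2 * \<gamma> * sin (2 * ?X r)) - 2 * \<gamma> * sin (2 * ?X r)) = integral {s..t} (%r. \<Omega> - 2 * \<gamma> * sin (2 * ?X r)) - integral {s..t} (%r. 2 * \<gamma> * sin (2 * ?X r))"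
   by (rule integral_diff) (intro integrable_continuous_real continuous_intros Xc)+
  moreover have "(%r. (\<Omega> - 2 * \<gamma> * sin (2 * ?X r)) - 2 * \<gamma> * sin (2 * ?X r)) = bt" by (auto simp: bt_def)
  ultimately show ?thesis by (simp only:)
 qed
 \<comment> \<open>In this order: the second stage expanded at \<open>xt t\<close>; the first stage
   against the Stratonovich drift; the drift correction with the state frozen at \<open>x\<close>;
   and the two replacements of \<open>xt t\<close> by \<open>x\<close> in the coefficients.\<close>
 have eq: "?X t - x - integral {s..t} (%r. \<Omega> - 2 * \<gamma> * sin (2 * ?X r)) + vol * sin x * q - 2 * \<gamma> * sin (2 * x) * (q\<^sup>2 - d)
  = (?X t - xt t + vol * sin (xt t) * q - 2 * \<gamma> * sin (2 * xt t) * q\<^sup>2) + (xt t - x - integral {s..t} bt)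
   - (integral {s..t} (%r. 2 * \<gamma> * sin (2 * ?X r)) - 2 * \<gamma> * sin (2 * x) * d)
   + vol * q * (sin x - sin (xt t)) + 2 * \<gamma> * q\<^sup>2 * (sin (2 * xt t) - sin (2 * x))"
  unfolding bt_split by (simp add: algebra_simps)
 have tri: "\<bar>a + b - c + d1 + e1\<bar> \<le> \<bar>a\<bar> + \<bar>b\<bar> + \<bar>c\<bar> + \<bar>d1\<bar> + \<bar>e1\<bar>" for a b c d1 e1 :: real by linarith
 show ?thesis unfolding eq
  by (rule order.trans[OF tri]) (use A1 A3 A4 A5 A6 in \<open>simp add: algebra_simps\<close>)
qed

lemma exp_scale_le:
 fixes y \<sigma> :: real assumes "0 \<le> \<sigma>" "\<sigma> \<le> 1"
 shows "exp (\<sigma> * y) - 1 \<le> \<sigma> * (exp y - 1)"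
proof -
 have "exp ((1 - \<sigma>) *\<^sub>R 0 + \<sigma> *\<^sub>R y) \<le> (1 - \<sigma>) * exp 0 + \<sigma> * exp y"
  by (rule convex_onD[OF exp_convex]) (use assms in auto)
 then show ?thesis by (simp add: algebra_simps)
qed

text \<open>By convexity, \<open>exp (\<sigma> * y) - 1 \<le> \<sigma> * (exp y - 1)\<close> for
  \<sigma> in \<open>[0, 1]\<close>. With \<sigma> = \<open>sqrt (t - s)\<close> the scale of the
  increment comes out as the power \<open>(t - s) ^ k\<close>, and the constant is a finite
  exponential moment of the standard normal law. The restriction to cells of length at most 1 is
  what puts \<sigma> into that range.\<close>

lemma exp_moment:
 "\<exists>C\<ge>0. \<forall>s t. 0 \<le> s --> s < t --> t \<le> s + 1 -->
  integrable M (%w. (exp (vol * \<bar>W t w - W s w\<bar>) - 1) ^ (2 * k)) \<and>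
  expectation (%w. (exp (vol * \<bar>W t w - W s w\<bar>) - 1) ^ (2 * k)) \<le> C * (t - s) ^ k"
proof -
 define f where "f x = (exp (vol * \<bar>x\<bar>) - 1) ^ (2 * k)" for x :: real
 have f0: "0 \<le> f x" for x unfolding f_def by (intro zero_le_power) (use vol_pos in auto)
 have fm: "f \<in> borel_measurable borel" unfolding f_def by measurable
 define a where "a = vol * real (2 * k)"
 have shift: "std_normal_density x * exp (b * x) = exp (b\<^sup>2 / 2) * normal_density b 1 x" for b x
  by (simp add: normal_density_def exp_add[symmetric] mult_exp_exp power2_eq_square algebra_simps add_divide_distrib diff_divide_distrib)
 have dom: "integrable lborel (%x. exp (a\<^sup>2 / 2) * normal_density a 1 x + exp ((- a)\<^sup>2 / 2) * normal_density (- a) 1 x)"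
  by (intro Bochner_Integration.integrable_add integrable_mult_right integrable_normal_density) auto
 have fi: "integrable lborel (%x. std_normal_density x * f x)"
 proof (rule Bochner_Integration.integrable_bound[OF dom])
  show "AE x in lborel. norm (std_normal_density x * f x) \<le> norm (exp (a\<^sup>2 / 2) * normal_density a 1 x + exp ((- a)\<^sup>2 / 2) * normal_density (- a) 1 x)"
  proof (rule AE_I2)
   fix x :: real
   have "f x \<le> exp (vol * \<bar>x\<bar>) ^ (2 * k)" unfolding f_def by (rule power_mono) (use vol_pos in auto)
   also have "\<dots> = exp (a * \<bar>x\<bar>)" by (simp add: a_def exp_of_nat_mult[symmetric] mult_ac)
   also have "\<dots> \<le> exp (a * x) + exp (- a * x)" by (auto simp: abs_if)
   finally have "f x \<le> exp (a * x) + exp (- a * x)" .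
   then have "std_normal_density x * f x \<le> std_normal_density x * (exp (a * x) + exp (- a * x))" by (intro mult_left_mono) auto
   also have "\<dots> = exp (a\<^sup>2 / 2) * normal_density a 1 x + exp ((- a)\<^sup>2 / 2) * normal_density (- a) 1 x"
    unfolding distrib_left shift ..
   finally show "norm (std_normal_density x * f x) \<le> norm (exp (a\<^sup>2 / 2) * normal_density a 1 x + exp ((- a)\<^sup>2 / 2) * normal_density (- a) 1 x)"
    using f0[of x] by (simp add: abs_mult)
  qed
 qed (use fm in measurable)
 define C where "C = (\<integral>x. std_normal_density x * f x \<partial>lborel)"
 have C0: "0 \<le> C" unfolding C_def using f0 by (intro integral_nonneg_AE) auto
 have "integrable M (%w. f (W t w - W s w)) \<and> expectation (%w. f (W t w - W s w)) \<le> C * (t - s) ^ k"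
  if st: "0 \<le> s" "s < t" "t \<le> s + 1" for s t
 proof -
  define \<sigma> where "\<sigma> = sqrt (t - s)"
  have \<sigma>: "0 < \<sigma>" "\<sigma> \<le> 1" "\<sigma>\<^sup>2 = t - s" using st by (auto simp: \<sigma>_def)
  have le: "f (\<sigma> * x) \<le> \<sigma> ^ (2 * k) * f x" for x
  proof -
   have "exp (vol * \<bar>\<sigma> * x\<bar>) - 1 \<le> \<sigma> * (exp (vol * \<bar>x\<bar>) - 1)"
    using exp_scale_le[of \<sigma> "vol * \<bar>x\<bar>"] \<sigma> by (simp add: abs_mult mult_ac)
   then have "(exp (vol * \<bar>\<sigma> * x\<bar>) - 1) ^ (2 * k) \<le> (\<sigma> * (exp (vol * \<bar>x\<bar>) - 1)) ^ (2 * k)"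
    by (rule power_mono) (use vol_pos in auto)
   then show ?thesis by (simp add: f_def power_mult_distrib)
  qed
  have i2: "integrable lborel (%x. \<sigma> ^ (2 * k) * (std_normal_density x * f x))" using fi by auto
  have pt: "std_normal_density x * f (\<sigma> * x) \<le> \<sigma> ^ (2 * k) * (std_normal_density x * f x)" for x
   using mult_left_mono[OF le[of x], of "std_normal_density x"] by (simp add: mult_ac)
  have i1: "integrable lborel (%x. std_normal_density x * f (\<sigma> * x))"
   by (rule Bochner_Integration.integrable_bound[OF i2])
    (use fm f0 pt in \<open>auto intro!: AE_I2 order.trans[OF _ abs_ge_self] simp: abs_mult\<close>)
  have "integrable M (%w. f (W t w - W s w))"
   using increment_scaling(1)[OF st(1,2) fm] i1 by (simp add: \<sigma>_def)
  moreover have "expectation (%w. f (W t w - W s w)) \<le> C * (t - s) ^ k"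
  proof -
   have "expectation (%w. f (W t w - W s w)) = (\<integral>x. std_normal_density x * f (\<sigma> * x) \<partial>lborel)"
    using increment_scaling(2)[OF st(1,2) fm] by (simp add: \<sigma>_def)
   also have "\<dots> \<le> (\<integral>x. \<sigma> ^ (2 * k) * (std_normal_density x * f x) \<partial>lborel)" by (rule integral_mono[OF i1 i2 pt])
   also have "\<dots> = C * (t - s) ^ k" by (simp add: C_def power_mult \<sigma>(3))
   finally show ?thesis .
  qed
  ultimately show ?thesis by blast
 qed
 then show ?thesis using C0 unfolding f_def by blast
qed

lemma W_progressive: "progressive M F W"
 by (rule adapted_continuous_progressive) (auto intro: W_measurable W_continuous)

text \<open>Tonelli moves the expectation inside the time integral, where the moment bound at each
  time \<open>r\<close> is at most its value at \<open>t\<close>; integration over the cell adds one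
  power of its length.\<close>

lemma osc_moment:
 "\<exists>C\<ge>0. \<forall>s t. 0 \<le> s --> s < t --> t \<le> s + 1 -->
  integrable M (%w. integral {s..t} (%r. (exp (vol * \<bar>W r w - W s w\<bar>) - 1) ^ (2 * k))) \<and>
  expectation (%w. integral {s..t} (%r. (exp (vol * \<bar>W r w - W s w\<bar>) - 1) ^ (2 * k))) \<le> C * (t - s) ^ Suc k"
proof -
 from exp_moment[of k] obtain C where C: "0 \<le> C" and
  mom: "\<And>s t. 0 \<le> s ==> s < t ==> t \<le> s + 1 ==> integrable M (%w. (exp (vol * \<bar>W t w - W s w\<bar>) - 1) ^ (2 * k))"
  "\<And>s t. 0 \<le> s ==> s < t ==> t \<le> s + 1 ==> expectation (%w. (exp (vol * \<bar>W t w - W s w\<bar>) - 1) ^ (2 * k)) \<le> C * (t - s) ^ k"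
  by blast
 have "integrable M (%w. integral {s..t} (%r. (exp (vol * \<bar>W r w - W s w\<bar>) - 1) ^ (2 * k))) \<and>
  expectation (%w. integral {s..t} (%r. (exp (vol * \<bar>W r w - W s w\<bar>) - 1) ^ (2 * k))) \<le> C * (t - s) ^ Suc k"
  if st: "0 \<le> s" "s < t" "t \<le> s + 1" for s t
 proof -
  define h where "h r w = (exp (vol * \<bar>W r w - W s w\<bar>) - 1) ^ (2 * k)" for r w
  define hc where "hc r w = (exp (vol * \<bar>W (max 0 (min t r)) w - W s w\<bar>) - 1) ^ (2 * k)" for r w
  have h0: "0 \<le> h r w" for r w unfolding h_def by (intro zero_le_power) (use vol_pos in auto)
  have hc: "hc r w = h r w" if "r \<in> {s..t}" for r w using that st by (simp add: h_def hc_def)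
  have Wm: "(%(w, r). W (max 0 (min t r)) w) \<in> borel_measurable (M \<Otimes>\<^sub>M borel)"
   by (rule progressive_clamp[OF W_progressive _ ident_M_F]) (use st in auto)
  have [measurable]: "W s \<in> borel_measurable M" using st by (intro W_measurable_M)
  have jm: "(%(w, r). ennreal (hc r w) * indicator {s..t} r) \<in> borel_measurable (M \<Otimes>\<^sub>M lborel)"
   unfolding hc_def using Wm by (simp add: split_beta', measurable)
  have hcont: "continuous_on {s..t} (%r. h r w)" if "w \<in> space M" for w
   unfolding h_def by (intro continuous_intros continuous_on_subset[OF W_continuous[OF that]]) (use st in auto)
  have inner: "(\<integral>\<^sup>+r. ennreal (hc r w) * indicator {s..t} r \<partial>lborel) = ennreal (integral {s..t} (%r. h r w))" if w: "w \<in> space M" for w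
  proof -
   define g where "g r = indicator {s..t} r * h r w" for r
   have gm: "g \<in> borel_measurable borel"
    unfolding g_def using borel_measurable_continuous_on_indicator[OF _ hcont[OF w]] by (simp add: scaleR_conv_of_real)
   have "((%r. if r \<in> {s..t} then h r w else 0) has_integral integral {s..t} (%r. h r w)) UNIV"
    unfolding has_integral_restrict_UNIV by (rule integrable_integral[OF integrable_continuous_real[OF hcont[OF w]]])
   also have "(%r. if r \<in> {s..t} then h r w else 0) = g" by (auto simp: g_def)
   finally have "(\<integral>\<^sup>+x. ennreal (g x) \<partial>lborel) = ennreal (integral {s..t} (%r. h r w))"
    by (intro nn_integral_has_integral_lborel gm) (auto simp: g_def h0)
   moreover have "(\<integral>\<^sup>+r. ennreal (hc r w) * indicator {s..t} r \<partial>lborel) = (\<integral>\<^sup>+x. ennreal (g x) \<partial>lborel)"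
    by (rule nn_integral_cong) (use hc in \<open>auto simp: g_def indicator_def\<close>)
   ultimately show ?thesis by simp
  qed
  have I0: "0 \<le> integral {s..t} (%r. h r w)" if "w \<in> space M" for w
   by (rule integral_nonneg[OF integrable_continuous_real[OF hcont[OF that]]]) (use h0 in auto)
  have Im: "(%w. integral {s..t} (%r. h r w)) \<in> borel_measurable M"
  proof -
   have "(%w. enn2real (\<integral>\<^sup>+r. ennreal (hc r w) * indicator {s..t} r \<partial>lborel)) \<in> borel_measurable M"
    using lborel.borel_measurable_nn_integral[OF jm] by measurable
   also have "?this \<longleftrightarrow> ?thesis" by (rule measurable_cong) (use inner I0 in auto)
   finally show ?thesis .
  qed
  interpret P: pair_sigma_finite M lborel by unfold_locales
  have "(\<integral>\<^sup>+w. ennreal (integral {s..t} (%r. h r w)) \<partial>M) = (\<integral>\<^sup>+w. (\<integral>\<^sup>+r. ennreal (hc r w) * indicator {s..t} r \<partial>lborel) \<partial>M)"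
   by (rule nn_integral_cong) (use inner in auto)
  also have "\<dots> = (\<integral>\<^sup>+r. (\<integral>\<^sup>+w. ennreal (hc r w) * indicator {s..t} r \<partial>M) \<partial>lborel)"
   by (rule P.Fubini'[OF jm, symmetric])
  also have "\<dots> \<le> (\<integral>\<^sup>+r. ennreal (C * (t - s) ^ k) * indicator {s..t} r \<partial>lborel)"
  proof (rule nn_integral_mono)
   fix r
   show "(\<integral>\<^sup>+w. ennreal (hc r w) * indicator {s..t} r \<partial>M) \<le> ennreal (C * (t - s) ^ k) * indicator {s..t} r"
   proof (cases "r \<in> {s..t}")
    case True
    have "(\<integral>\<^sup>+w. ennreal (h r w) \<partial>M) \<le> ennreal (C * (t - s) ^ k)"
    proof (cases "r = s")
     \<comment> \<open>At \<open>r = s\<close> the integrand is \<open>0 ^ (2 * k)\<close>, which is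
       1 if \<open>k = 0\<close>. In that case the constant must be at least 1, and this follows
       from the moment bound applied to the constant 1.\<close>
     case rs: True
     show ?thesis
     proof (cases "k = 0")
      case True
      have "C * (t - s) ^ k \<ge> 1" using mom(2)[OF st] True by (simp add: prob_space)
      then show ?thesis using True rs by (simp add: h_def emeasure_space_1)
     next
      case False then show ?thesis using rs by (simp add: h_def power_0_left)
     qed
    next
     case False
     then have r: "s < r" "r \<le> s + 1" using True st by auto
     have "(\<integral>\<^sup>+w. ennreal (h r w) \<partial>M) = ennreal (expectation (h r))"
      using mom(1)[OF st(1) r] h0 unfolding h_def[abs_def] by (intro nn_integral_eq_integral) auto
     also have "\<dots> \<le> ennreal (C * (t - s) ^ k)"
     proof (rule ennreal_leI)
      have "expectation (h r) \<le> C * (r - s) ^ k" using mom(2)[OF st(1) r] unfolding h_def[abs_def] .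
      also have "\<dots> \<le> C * (t - s) ^ k" using C True by (intro mult_left_mono power_mono) auto
      finally show "expectation (h r) \<le> C * (t - s) ^ k" .
     qed
     finally show ?thesis .
    qed
    then show ?thesis using True hc by simp
   qed simp
  qed
  also have "\<dots> = ennreal (C * (t - s) ^ k) * ennreal (t - s)" using st by (simp add: nn_integral_cmult_indicator)
  also have "\<dots> = ennreal (C * (t - s) ^ Suc k)" using C st by (simp add: ennreal_mult[symmetric] mult_ac)
  finally have bound: "(\<integral>\<^sup>+w. ennreal (integral {s..t} (%r. h r w)) \<partial>M) \<le> ennreal (C * (t - s) ^ Suc k)" .
  have "(\<integral>\<^sup>+w. ennreal (norm (integral {s..t} (%r. h r w))) \<partial>M) = (\<integral>\<^sup>+w. ennreal (integral {s..t} (%r. h r w)) \<partial>M)"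
   by (rule nn_integral_cong) (use I0 in auto)
  also have "\<dots> < \<infinity>" by (rule le_less_trans[OF bound]) simp
  finally have int: "integrable M (%w. integral {s..t} (%r. h r w))" by (intro integrableI_bounded Im)
  have "ennreal (expectation (%w. integral {s..t} (%r. h r w))) \<le> ennreal (C * (t - s) ^ Suc k)"
   using bound I0 by (subst nn_integral_eq_integral[symmetric, OF int]) auto
  then have "expectation (%w. integral {s..t} (%r. h r w)) \<le> C * (t - s) ^ Suc k" using C st by (subst (asm) ennreal_le_iff) auto
  with int show ?thesis by (simp add: h_def)
 qed
 then show ?thesis using C by blast
qed

end

lemma grid_locate:
 fixes g :: "nat => real"
 assumes "g 0 < r" "r \<le> g N"
 shows "\<exists>i<N. g i < r \<and> r \<le> g (Suc i)"
 using assms(2)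
proof (induction N)
 case 0 then show ?case using assms(1) by simp
next
 case (Suc N)
 show ?case
 proof (cases "r \<le> g N")
  case True then show ?thesis using Suc.IH by (auto intro: less_SucI)
 next
  case False then show ?thesis using Suc.prems by (intro exI[of _ N]) auto
 qed
qed

section \<open>The constructed path solves the stochastic equation\<close>

context controlled_qubit
begin

text \<open>The martingale part is defined as whatever the equation requires it to be. The equation
  then holds identically, and the content lies in showing that this process is an L2 limit of simple
  integrals.\<close>

definition Yp :: "real => real => 'a => real" where
 "Yp z0 t w = Xp z0 t w - z0 - integral {0..t} (%r. \<Omega> - 2 * \<gamma> * sin (2 * Xp z0 r w))"

text \<open>What remains of an increment of \<open>Yp\<close> after its Milstein expansion. The term
  \<open>- vol * sin x\<close> times the increment is the Euler term, and
  \<open>2 * \<gamma> * sin (2 * x)\<close> is half of the noise coefficient times its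
  derivative.\<close>

definition Rem :: "real => real => real => 'a => real" where
 "Rem z0 s t w = (Yp z0 t w - Yp z0 s w) + vol * sin (Xp z0 s w) * (W t w - W s w)
  - 2 * \<gamma> * sin (2 * Xp z0 s w) * ((W t w - W s w)\<^sup>2 - (t - s))"

lemma Xp_measurable_M: "0 \<le> t ==> Xp z0 t \<in> borel_measurable M"
 by (rule measurable_F_M[OF Xp_adapted])

lemma Yp_measurable:
 assumes t: "0 \<le> t"
 shows "Yp z0 t \<in> borel_measurable M"
proof -
 have "(%w. integral {0..t} (%r. \<Omega> - 2 * \<gamma> * sin (2 * Xp z0 r w))) \<in> borel_measurable (F t)"
 proof (rule integral_adapted[OF _ _ t, of "%r w. \<Omega> - 2 * \<gamma> * sin (2 * Xp z0 r w)"])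
  fix r :: real assume "0 \<le> r"
  from Xp_adapted[OF this] show "(%w. \<Omega> - 2 * \<gamma> * sin (2 * Xp z0 r w)) \<in> borel_measurable (F r)" by measurable
 next
  fix w assume "w \<in> space M"
  then show "continuous_on {0..} (%r. \<Omega> - 2 * \<gamma> * sin (2 * Xp z0 r w))" by (intro continuous_intros Xp_continuous)
 qed
 from measurable_F_M[OF this] show ?thesis
  unfolding Yp_def[abs_def] using Xp_measurable_M[OF t, of z0] by (intro borel_measurable_diff borel_measurable_const)
qed

lemma Yp_diff:
 assumes w: "w \<in> space M" and st: "0 \<le> s" "s \<le> t"
 shows "Yp z0 t w - Yp z0 s w = Xp z0 t w - Xp z0 s w - integral {s..t} (%r. \<Omega> - 2 * \<gamma> * sin (2 * Xp z0 r w))"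
proof -
 have "(%r. \<Omega> - 2 * \<gamma> * sin (2 * Xp z0 r w)) integrable_on {0..t}"
  by (intro integrable_continuous_real continuous_intros continuous_on_subset[OF Xp_continuous[OF w]]) auto
 from Henstock_Kurzweil_Integration.integral_combine[OF st this] show ?thesis by (simp add: Yp_def)
qed

lemma Yp_0: "w \<in> space M ==> Yp z0 0 w = 0"
 by (simp add: Yp_def Xp_0)

lemma Rem_measurable: "0 \<le> s ==> 0 \<le> t ==> Rem z0 s t \<in> borel_measurable M"
proof -
 assume "0 \<le> s" "0 \<le> t"
 then have [measurable]: "Yp z0 t \<in> borel_measurable M" "Yp z0 s \<in> borel_measurable M" "Xp z0 s \<in> borel_measurable M"
  "W t \<in> borel_measurable M" "W s \<in> borel_measurable M"
  by (auto intro: Yp_measurable Xp_measurable_M)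
 show ?thesis unfolding Rem_def[abs_def] by measurable
qed

text \<open>Each of the seven terms of \<open>remainder_square_bound\<close> has expectation of
  order at least 3 in the cell length. Order 3 is just what is needed: \<open>N\<close> remainders
  of L2 size \<open>(T / N) powr (3/2)\<close> add up, without any orthogonality, to order
  \<open>N powr (- 1/2)\<close>.\<close>

lemma rem_moment:
 "\<exists>C\<ge>0. \<forall>s t. 0 \<le> s --> s < t --> t \<le> s + 1 -->
  integrable M (%w. (Rem z0 s t w)\<^sup>2) \<and> expectation (%w. (Rem z0 s t w)\<^sup>2) \<le> C * (t - s) ^ 3"
proof -
 define u where "u s t w = exp (vol * \<bar>W t w - W s w\<bar>) - 1" for s t w
 have um: "\<exists>C\<ge>0. \<forall>s t. 0 \<le> s --> s < t --> t \<le> s + 1 --> integrable M (%w. u s t w ^ (2 * k)) \<and> expectation (%w. u s t w ^ (2 * k)) \<le> C * (t - s) ^ k" for k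
  using exp_moment[of k] unfolding u_def .
 define J where "J k s t w = integral {s..t} (%r. u s r w ^ (2 * k))" for k s t w
 have jm: "\<exists>C\<ge>0. \<forall>s t. 0 \<le> s --> s < t --> t \<le> s + 1 --> integrable M (J k s t) \<and> expectation (J k s t) \<le> C * (t - s) ^ Suc k" for k
  using osc_moment[of k] unfolding J_def[abs_def] u_def .
 obtain U1 where U1: "0 \<le> U1" "\<And>s t. 0 \<le> s ==> s < t ==> t \<le> s + 1 ==> integrable M (%w. u s t w ^ (2 * 1)) \<and> expectation (%w. u s t w ^ (2 * 1)) \<le> U1 * (t - s) ^ 1" using um[of 1] by blast
 obtain U2 where U2: "0 \<le> U2" "\<And>s t. 0 \<le> s ==> s < t ==> t \<le> s + 1 ==> integrable M (%w. u s t w ^ (2 * 2)) \<and> expectation (%w. u s t w ^ (2 * 2)) \<le> U2 * (t - s) ^ 2" using um[of 2] by blast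
 obtain U3 where U3: "0 \<le> U3" "\<And>s t. 0 \<le> s ==> s < t ==> t \<le> s + 1 ==> integrable M (%w. u s t w ^ (2 * 3)) \<and> expectation (%w. u s t w ^ (2 * 3)) \<le> U3 * (t - s) ^ 3" using um[of 3] by blast
 obtain U4 where U4: "0 \<le> U4" "\<And>s t. 0 \<le> s ==> s < t ==> t \<le> s + 1 ==> integrable M (%w. u s t w ^ (2 * 4)) \<and> expectation (%w. u s t w ^ (2 * 4)) \<le> U4 * (t - s) ^ 4" using um[of 4] by blast
 obtain C1 where C1: "0 \<le> C1" "\<And>s t. 0 \<le> s ==> s < t ==> t \<le> s + 1 ==> integrable M (J 1 s t) \<and> expectation (J 1 s t) \<le> C1 * (t - s) ^ Suc 1" using jm[of 1] by blast
 obtain C2 where C2: "0 \<le> C2" "\<And>s t. 0 \<le> s ==> s < t ==> t \<le> s + 1 ==> integrable M (J 2 s t) \<and> expectation (J 2 s t) \<le> C2 * (t - s) ^ Suc 2" using jm[of 2] by blast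
 define K where "K = 1024 * ((\<Omega> + 4 * \<gamma>) + 4 * \<gamma> + 4 * \<gamma> * (\<Omega> + 4 * \<gamma>) + 1)\<^sup>2"
 define Q where "Q = C1 + 1 + U1 + U2 + C2 + U4 + U3"
 have K0: "0 \<le> K" by (simp add: K_def)
 have "integrable M (%w. (Rem z0 s t w)\<^sup>2) \<and> expectation (%w. (Rem z0 s t w)\<^sup>2) \<le> K * Q * (t - s) ^ 3"
  if st: "0 \<le> s" "s < t" "t \<le> s + 1" for s t
 proof -
  define d where "d = t - s"
  have d: "0 < d" "d \<le> 1" using st by (auto simp: d_def)
  define V where "V w = d * J 1 s t w + d ^ 4 + d\<^sup>2 * u s t w ^ (2 * 1) + d * u s t w ^ (2 * 2) + d\<^sup>2 * J 2 s t w + u s t w ^ (2 * 4) + u s t w ^ (2 * 3)" for w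
  have ii: "integrable M (J 1 s t)" "integrable M (J 2 s t)" "integrable M (%w. u s t w ^ (2 * 1))" "integrable M (%w. u s t w ^ (2 * 2))"
   "integrable M (%w. u s t w ^ (2 * 3))" "integrable M (%w. u s t w ^ (2 * 4))"
   using U1(2)[OF st] U2(2)[OF st] U3(2)[OF st] U4(2)[OF st] C1(2)[OF st] C2(2)[OF st] by auto
  have Vi: "integrable M V" unfolding V_def[abs_def]
   by (intro Bochner_Integration.integrable_add integrable_mult_right ii) auto
  have pt: "(Rem z0 s t w)\<^sup>2 \<le> K * V w" if w: "w \<in> space M" for w
  proof -
   let ?e = "%r. exp (vol * \<bar>W r w - W s w\<bar>) - 1"
   have ec: "continuous_on {s..t} ?e" by (intro continuous_intros continuous_on_subset[OF W_continuous[OF w]]) (use st in auto)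
   have e0: "0 \<le> ?e r" for r using vol_pos by auto
   have u0: "0 \<le> u s r w" for r using e0 by (simp add: u_def)
   have I0: "0 \<le> integral {s..t} ?e" by (rule integral_nonneg[OF integrable_continuous_real[OF ec]]) (use e0 in auto)
   have Jnn: "0 \<le> J k s t w" for k unfolding J_def u_def
    by (rule integral_nonneg) (auto intro!: integrable_continuous_real continuous_intros ec zero_le_power e0)
   have s1: "(integral {s..t} ?e)\<^sup>2 \<le> d * J 1 s t w"
    using integral_square_le[OF ec st(2)] by (simp add: J_def u_def d_def)
   have "(integral {s..t} (%r. (?e r)\<^sup>2))\<^sup>2 \<le> d * J 2 s t w"
    using integral_square_le[of s t "%r. (?e r)\<^sup>2"] st ec
    by (simp add: J_def u_def d_def continuous_intros power_mult[symmetric])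
   then have s2': "(J 1 s t w)\<^sup>2 \<le> d * J 2 s t w" by (simp add: J_def u_def)
   have s2: "(integral {s..t} ?e) ^ 4 \<le> d ^ 3 * J 2 s t w"
   proof -
    have "((integral {s..t} ?e)\<^sup>2)\<^sup>2 \<le> (d * J 1 s t w)\<^sup>2" using s1 by (intro power_mono) auto
    also have "\<dots> = d\<^sup>2 * (J 1 s t w)\<^sup>2" by (simp add: power_mult_distrib)
    also have "\<dots> \<le> d\<^sup>2 * (d * J 2 s t w)" using s2' by (intro mult_left_mono) auto
    finally show ?thesis by (simp add: power4_eq_xxxx power2_eq_square power3_eq_cube mult_ac)
   qed
   have "(Rem z0 s t w)\<^sup>2 \<le> (1024 * ((\<Omega> + 4 * \<gamma>) + 4 * \<gamma> + 4 * \<gamma> * (\<Omega> + 4 * \<gamma>) + 1)\<^sup>2) *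
    (d * J 1 s t w + d ^ 4 + d\<^sup>2 * (u s t w)\<^sup>2 + d * u s t w ^ 4 + d\<^sup>2 * J 2 s t w + u s t w ^ 8 + u s t w ^ 6)"
   proof (rule remainder_square_bound[OF I0 u0 d])
    show "\<bar>Rem z0 s t w\<bar> \<le> (\<Omega> + 4 * \<gamma>) * integral {s..t} ?e + 4 * \<gamma> * (integral {s..t} ?e + d * ((\<Omega> + 4 * \<gamma>) * (d + integral {s..t} ?e)))
      + (u s t w + (u s t w)\<^sup>2) * ((\<Omega> + 4 * \<gamma>) * (d + integral {s..t} ?e)) + u s t w ^ 3"
     using path_expansion[OF w st(1,2), of z0] unfolding Rem_def Yp_diff[OF w st(1) less_imp_le[OF st(2)]] u_def d_def by simp
   qed (use s1 s2 Jnn \<Omega>_pos \<gamma>_pos in auto)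
   then show ?thesis by (simp add: K_def V_def)
  qed
  have Ri: "integrable M (%w. (Rem z0 s t w)\<^sup>2)"
  proof (rule Bochner_Integration.integrable_bound[of _ "%w. K * V w"])
   show "integrable M (%w. K * V w)" using Vi by auto
   have "Rem z0 s t \<in> borel_measurable M" by (rule Rem_measurable) (use st in auto)
   then show "(%w. (Rem z0 s t w)\<^sup>2) \<in> borel_measurable M" by (rule borel_measurable_power)
   show "AE w in M. norm ((Rem z0 s t w)\<^sup>2) \<le> norm (K * V w)"
   proof (rule AE_I2)
    fix w assume "w \<in> space M"
    from pt[OF this] show "norm ((Rem z0 s t w)\<^sup>2) \<le> norm (K * V w)" unfolding real_norm_def by (intro order.trans[OF _ abs_ge_self]) simp
   qed
  qed
  have dd: "d ^ 4 \<le> d ^ 3" "d ^ 5 \<le> d ^ 3" using d by (auto intro!: power_decreasing)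
  have "expectation V = d * expectation (J 1 s t) + d ^ 4 + d\<^sup>2 * expectation (%w. u s t w ^ (2 * 1)) + d * expectation (%w. u s t w ^ (2 * 2))
    + d\<^sup>2 * expectation (J 2 s t) + expectation (%w. u s t w ^ (2 * 4)) + expectation (%w. u s t w ^ (2 * 3))"
   unfolding V_def using ii
   by (subst Bochner_Integration.integral_add | (intro Bochner_Integration.integrable_add integrable_mult_right; simp; fail) | simp add: prob_space del: mult_numeral_1_right numeral_times_numeral)+
  also have "\<dots> \<le> d * (C1 * d ^ Suc 1) + d ^ 4 + d\<^sup>2 * (U1 * d ^ 1) + d * (U2 * d ^ 2) + d\<^sup>2 * (C2 * d ^ Suc 2) + U4 * d ^ 4 + U3 * d ^ 3"
   using U1(2)[OF st] U2(2)[OF st] U3(2)[OF st] U4(2)[OF st] C1(2)[OF st] C2(2)[OF st] d unfolding d_def[symmetric]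
   by (intro add_mono mult_left_mono order_refl) auto
  also have "\<dots> = C1 * d ^ 3 + d ^ 4 + U1 * d ^ 3 + U2 * d ^ 3 + C2 * d ^ 5 + U4 * d ^ 4 + U3 * d ^ 3"
   by (simp add: power_numeral_reduce power2_eq_square mult_ac)
  also have "\<dots> \<le> C1 * d ^ 3 + d ^ 3 + U1 * d ^ 3 + U2 * d ^ 3 + C2 * d ^ 3 + U4 * d ^ 3 + U3 * d ^ 3"
   using dd U4(1) C2(1) by (intro add_mono mult_left_mono order_refl) auto
  also have "\<dots> = Q * d ^ 3" by (simp add: Q_def algebra_simps)
  finally have EV: "expectation V \<le> Q * d ^ 3" .
  have "expectation (%w. (Rem z0 s t w)\<^sup>2) \<le> expectation (%w. K * V w)"
   by (rule integral_mono[OF Ri]) (use Vi pt in auto)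
  also have "\<dots> \<le> K * (Q * d ^ 3)" using EV K0 by (simp add: mult_left_mono)
  finally show ?thesis using Ri by (simp add: d_def mult_ac)
 qed
 moreover have "0 \<le> K * Q" using K0 U1(1) U2(1) U3(1) U4(1) C1(1) C2(1) by (simp add: Q_def)
 ultimately show ?thesis by blast
qed

lemma osc_measurable:
 assumes X: "progressive M F X" and st: "0 \<le> s" "s \<le> t"
 shows "(%w. \<integral>\<^sup>+r\<in>{s..t}. ennreal (min 1 \<bar>X r w - X s w\<bar>) \<partial>lborel) \<in> borel_measurable M"
proof -
 have t: "0 \<le> t" using st by auto
 have Xm: "(%(w, r). X (max 0 (min t r)) w) \<in> borel_measurable (M \<Otimes>\<^sub>M borel)"
  by (rule progressive_clamp[OF X t ident_M_F])
 have [measurable]: "X s \<in> borel_measurable M" by (rule measurable_F_M[OF progressive_measurable[OF X st(1)]])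
 have "(%w. \<integral>\<^sup>+r\<in>{s..t}. ennreal (min 1 \<bar>X (max 0 (min t r)) w - X s w\<bar>) \<partial>lborel) \<in> borel_measurable M"
  by (rule lborel.borel_measurable_nn_integral) (use Xm in \<open>simp add: split_beta', measurable\<close>)
 also have "(%w. \<integral>\<^sup>+r\<in>{s..t}. ennreal (min 1 \<bar>X (max 0 (min t r)) w - X s w\<bar>) \<partial>lborel) = (%w. \<integral>\<^sup>+r\<in>{s..t}. ennreal (min 1 \<bar>X r w - X s w\<bar>) \<partial>lborel)"
  by (intro ext nn_integral_cong) (use st in \<open>auto simp: indicator_def\<close>)
 finally show ?thesis .
qed

text \<open>The error of the Riemann sum splits into the compensated squares \<open>P\<close>, which
  are orthogonal, and the remainders, which are summed by Cauchy-Schwarz. The former contribute at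
  most \<open>N * (2 * \<gamma>)\<^sup>2 * 2 * h\<^sup>2 = 8 * \<gamma>\<^sup>2 * T * h\<close>, the
  latter \<open>N\<^sup>2 * C * h ^ 3 = C * T\<^sup>2 * h\<close>; doubling both gives the
  constant.\<close>

lemma ito_l2_bound:
 fixes z0 T :: real and N :: nat
 assumes T: "0 < T" and N: "0 < N" "T \<le> real N" and t: "0 \<le> t" "t \<le> T"
  and C: "0 \<le> C" "\<And>s t. 0 \<le> s ==> s < t ==> t \<le> s + 1 ==>
   integrable M (%w. (Rem z0 s t w)\<^sup>2) \<and> expectation (%w. (Rem z0 s t w)\<^sup>2) \<le> C * (t - s) ^ 3"
 defines "g \<equiv> %i. T * real i / real N"
 shows "(\<integral>\<^sup>+w. ennreal ((simple_int W N g (%i w. - vol * sin (Xp z0 (g i) w)) t w - Yp z0 t w)\<^sup>2) \<partial>M)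
  \<le> ennreal ((16 * \<gamma>\<^sup>2 * T + 2 * C * T\<^sup>2) * (T / real N))"
proof -
 define h where "h = T / real N"
 have h: "0 < h" "h \<le> 1" "real N * h = T" using T N by (auto simp: h_def)
 \<comment> \<open>The grid stopped at \<open>t\<close>, as in \<open>simple_int\<close>: cells
   beyond \<open>t\<close> degenerate and the one containing \<open>t\<close> is shortened. A
   nondegenerate cell still starts at a true grid point, where the simple process takes its
   value.\<close>
 define a where "a i = min t (g i)" for i
 have g0: "g 0 = 0" and gN: "g N = T" and gS: "g (Suc i) = g i + h" for i using N by (auto simp: g_def h_def add_divide_distrib algebra_simps)
 have gnn: "0 \<le> g i" for i using T by (simp add: g_def)
 have a0: "a 0 = 0" and aN: "a N = t" using t by (auto simp: a_def g0 gN)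
 have ann: "0 \<le> a i" for i using t gnn by (simp add: a_def)
 have am: "a i \<le> a (Suc i)" for i using h by (simp add: a_def gS)
 have ad: "a (Suc i) - a i \<le> h" for i using h by (auto simp: a_def gS)
 have ag: "a i = g i" if "a i < a (Suc i)" for i using that by (auto simp: a_def)
 define \<zeta> where "\<zeta> i w = 2 * \<gamma> * sin (2 * Xp z0 (a i) w)" for i w
 define gg where "gg i x = x\<^sup>2 - (a (Suc i) - a i)" for i and x :: real
 define P where "P w = (\<Sum>i<N. \<zeta> i w * gg i (W (a (Suc i)) w - W (a i) w))" for w
 define R where "R i w = Rem z0 (a i) (a (Suc i)) w" for i w
 have \<zeta>b: "\<bar>\<zeta> i w\<bar> \<le> 2 * \<gamma>" for i w
 proof -
  have "\<bar>\<zeta> i w\<bar> \<le> 2 * \<gamma> * 1" unfolding \<zeta>_def abs_mult using \<gamma>_pos by (intro mult_mono) auto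
  then show ?thesis by simp
 qed
 have \<zeta>F: "\<zeta> i \<in> borel_measurable (F (a i))" for i
  unfolding \<zeta>_def[abs_def] using Xp_adapted[OF ann] by measurable
 have q4: "integrable M (%w. (gg i (W (a (Suc i)) w - W (a i) w))\<^sup>2) \<and> expectation (%w. (gg i (W (a (Suc i)) w - W (a i) w))\<^sup>2) = 2 * (a (Suc i) - a i)\<^sup>2
   \<and> expectation (%w. gg i (W (a (Suc i)) w - W (a i) w)) = 0" if lt: "a i < a (Suc i)" for i
 proof -
  let ?D = "%w. W (a (Suc i)) w - W (a i) w" and ?d = "a (Suc i) - a i"
  have ii: "integrable M (%w. ?D w ^ 4)" "integrable M (%w. ?D w ^ 2)" by (intro increment_power ann lt)+
  note m = increment_moments[OF ann lt]
  have eq: "(gg i y)\<^sup>2 = y ^ 4 - 2 * ?d * y\<^sup>2 + ?d\<^sup>2" for y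
   unfolding gg_def by algebra
  show ?thesis
  proof (intro conjI)
   show "integrable M (%w. (gg i (?D w))\<^sup>2)" unfolding eq
    by (intro Bochner_Integration.integrable_add Bochner_Integration.integrable_diff integrable_mult_right ii) simp
   have "expectation (%w. ?D w ^ 4 - 2 * ?d * (?D w)\<^sup>2 + ?d\<^sup>2) = expectation (%w. ?D w ^ 4) - 2 * ?d * expectation (%w. (?D w)\<^sup>2) + ?d\<^sup>2"
    using ii by (subst Bochner_Integration.integral_add, simp, simp, subst Bochner_Integration.integral_diff) (simp_all add: prob_space)
   also have "\<dots> = 3 * ?d\<^sup>2 - 2 * ?d * ?d + ?d\<^sup>2" using m by simp
   finally show "expectation (%w. (gg i (?D w))\<^sup>2) = 2 * ?d\<^sup>2" unfolding eq by (simp add: power2_eq_square)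
   have "expectation (%w. gg i (?D w)) = expectation (%w. (?D w)\<^sup>2) - ?d"
    unfolding gg_def using ii by (subst Bochner_Integration.integral_diff) (simp_all add: prob_space)
   then show "expectation (%w. gg i (?D w)) = 0" using m by simp
  qed
 qed
 note orth = orthogonal_sum[where b = a and \<zeta> = \<zeta> and g = gg and n = N and B = "2 * \<gamma>", OF ann am \<zeta>F \<zeta>b, folded P_def]
 have ggm: "gg i \<in> borel_measurable borel" for i unfolding gg_def[abs_def] by measurable
 have gg0: "gg i 0 = 0" if "a i = a (Suc i)" for i using that by (simp add: gg_def)
 have PM: "P \<in> borel_measurable M"
  using measurable_F_M[OF orth(1)] ggm gg0 q4 unfolding P_def[abs_def] by blast
 have P2: "integrable M (%w. (P w)\<^sup>2)" using orth(2) ggm gg0 q4 by blast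
 have EP: "expectation (%w. (P w)\<^sup>2) \<le> 8 * \<gamma>\<^sup>2 * T * h"
 proof -
  have tb: "expectation (%w. (\<zeta> i w * gg i (W (a (Suc i)) w - W (a i) w))\<^sup>2) \<le> 8 * \<gamma>\<^sup>2 * h\<^sup>2" if "i < N" for i
  proof (cases "a i = a (Suc i)")
   case True
   then show ?thesis using gg0[OF True] by simp
  next
   case False
   then have lt: "a i < a (Suc i)" using am[of i] by auto
   note q = q4[OF lt]
   have "expectation (%w. (\<zeta> i w * gg i (W (a (Suc i)) w - W (a i) w))\<^sup>2) \<le> expectation (%w. (2 * \<gamma>)\<^sup>2 * (gg i (W (a (Suc i)) w - W (a i) w))\<^sup>2)"
   proof (rule integral_mono')
    show "integrable M (%w. (2 * \<gamma>)\<^sup>2 * (gg i (W (a (Suc i)) w - W (a i) w))\<^sup>2)" using q by auto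
    fix w
    have "(\<zeta> i w)\<^sup>2 \<le> (2 * \<gamma>)\<^sup>2" using power_mono[OF \<zeta>b[of i w], of 2] by simp
    then show "(\<zeta> i w * gg i (W (a (Suc i)) w - W (a i) w))\<^sup>2 \<le> (2 * \<gamma>)\<^sup>2 * (gg i (W (a (Suc i)) w - W (a i) w))\<^sup>2"
     unfolding power_mult_distrib[of "\<zeta> i w"] by (intro mult_right_mono) auto
   qed auto
   also have "\<dots> = (2 * \<gamma>)\<^sup>2 * (2 * (a (Suc i) - a i)\<^sup>2)" using q by simp
   also have "\<dots> \<le> (2 * \<gamma>)\<^sup>2 * (2 * h\<^sup>2)" using ad[of i] am[of i] by (intro mult_left_mono power_mono) auto
   finally show ?thesis by (simp add: power_mult_distrib)
  qed
  have "expectation (%w. (P w)\<^sup>2) = (\<Sum>i<N. expectation (%w. (\<zeta> i w * gg i (W (a (Suc i)) w - W (a i) w))\<^sup>2))"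
   using orth(3) ggm gg0 q4 by blast
  also have "\<dots> \<le> (\<Sum>i<N. 8 * \<gamma>\<^sup>2 * h\<^sup>2)" by (rule sum_mono) (use tb in auto)
  also have "\<dots> = 8 * \<gamma>\<^sup>2 * (real N * h) * h" by (simp add: power2_eq_square)
  finally show ?thesis unfolding h(3) .
 qed
 have Rz: "R i w = 0" if "a i = a (Suc i)" for i w using that by (simp add: R_def Rem_def)
 have RM: "R i \<in> borel_measurable M" for i unfolding R_def[abs_def] by (rule Rem_measurable[OF ann ann])
 have R2: "integrable M (%w. (R i w)\<^sup>2) \<and> expectation (%w. (R i w)\<^sup>2) \<le> C * h ^ 3" for i
 proof (cases "a i = a (Suc i)")
  case True
  then show ?thesis using Rz[OF True] C h by simp
 next
  case False
  then have lt: "a i < a (Suc i)" using am[of i] by auto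
  have le: "a (Suc i) \<le> a i + 1" using ad[of i] h by auto
  have "C * (a (Suc i) - a i) ^ 3 \<le> C * h ^ 3" using C ad[of i] am[of i] by (intro mult_left_mono power_mono) auto
  then show ?thesis using C(2)[OF ann lt le] unfolding R_def by auto
 qed
 have diff: "simple_int W N g (%i w. - vol * sin (Xp z0 (g i) w)) t w - Yp z0 t w = - (P w + (\<Sum>i<N. R i w))" if w: "w \<in> space M" for w
 proof -
  have "Yp z0 t w = (\<Sum>i<N. Yp z0 (a (Suc i)) w - Yp z0 (a i) w)"
   using sum_lessThan_telescope[of "%i. Yp z0 (a i) w" N] Yp_0[OF w] by (simp add: a0 aN)
  then have "simple_int W N g (%i w. - vol * sin (Xp z0 (g i) w)) t w - Yp z0 t w =
   (\<Sum>i<N. - vol * sin (Xp z0 (g i) w) * (W (a (Suc i)) w - W (a i) w) - (Yp z0 (a (Suc i)) w - Yp z0 (a i) w))"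
   by (simp add: simple_int_def a_def sum_subtractf)
  also have "\<dots> = (\<Sum>i<N. - (\<zeta> i w * gg i (W (a (Suc i)) w - W (a i) w) + R i w))"
  proof (rule sum.cong[OF refl])
   fix i
   show "- vol * sin (Xp z0 (g i) w) * (W (a (Suc i)) w - W (a i) w) - (Yp z0 (a (Suc i)) w - Yp z0 (a i) w) = - (\<zeta> i w * gg i (W (a (Suc i)) w - W (a i) w) + R i w)"
   proof (cases "a i = a (Suc i)")
    case True then show ?thesis using gg0[OF True] Rz[OF True] by simp
   next
    case False
    then have "a i < a (Suc i)" using am[of i] by auto
    from ag[OF this] show ?thesis unfolding R_def Rem_def \<zeta>_def gg_def by (simp add: algebra_simps)
   qed
  qed
  also have "\<dots> = - (P w + (\<Sum>i<N. R i w))" by (simp add: sum_subtractf sum_negf P_def sum.distrib)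
  finally show ?thesis .
 qed
 have bi: "integrable M (%w. 2 * (P w)\<^sup>2 + 2 * (real N * (\<Sum>i<N. (R i w)\<^sup>2)))" using P2 R2 by auto
 have "(\<integral>\<^sup>+w. ennreal ((simple_int W N g (%i w. - vol * sin (Xp z0 (g i) w)) t w - Yp z0 t w)\<^sup>2) \<partial>M)
  \<le> (\<integral>\<^sup>+w. ennreal (2 * (P w)\<^sup>2 + 2 * (real N * (\<Sum>i<N. (R i w)\<^sup>2))) \<partial>M)"
 proof (rule nn_integral_mono, rule ennreal_leI)
  fix w assume w: "w \<in> space M"
  have "(\<Sum>i<N. R i w)\<^sup>2 \<le> real N * (\<Sum>i<N. (R i w)\<^sup>2)"
   using sum_squared_le_sum_of_squares[of "%i. R i w" "{..<N}"] by (simp add: mult.commute)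
  then have "2 * (P w)\<^sup>2 + 2 * (\<Sum>i<N. R i w)\<^sup>2 \<le> 2 * (P w)\<^sup>2 + 2 * (real N * (\<Sum>i<N. (R i w)\<^sup>2))" by simp
  moreover have "(- (P w + (\<Sum>i<N. R i w)))\<^sup>2 \<le> 2 * (P w)\<^sup>2 + 2 * (\<Sum>i<N. R i w)\<^sup>2" unfolding power2_minus by (rule square_sum_le)
  ultimately show "(simple_int W N g (%i w. - vol * sin (Xp z0 (g i) w)) t w - Yp z0 t w)\<^sup>2 \<le> 2 * (P w)\<^sup>2 + 2 * (real N * (\<Sum>i<N. (R i w)\<^sup>2))"
   unfolding diff[OF w] by linarith
 qed
 also have "\<dots> = ennreal (expectation (%w. 2 * (P w)\<^sup>2 + 2 * (real N * (\<Sum>i<N. (R i w)\<^sup>2))))"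
  by (rule nn_integral_eq_integral[OF bi]) (auto intro!: AE_I2 add_nonneg_nonneg mult_nonneg_nonneg sum_nonneg)
 also have "\<dots> \<le> ennreal ((16 * \<gamma>\<^sup>2 * T + 2 * C * T\<^sup>2) * (T / real N))"
 proof (rule ennreal_leI)
  have "expectation (%w. 2 * (P w)\<^sup>2 + 2 * (real N * (\<Sum>i<N. (R i w)\<^sup>2))) = 2 * expectation (%w. (P w)\<^sup>2) + 2 * (real N * (\<Sum>i<N. expectation (%w. (R i w)\<^sup>2)))"
   using P2 R2 by simp
  also have "\<dots> \<le> 2 * (8 * \<gamma>\<^sup>2 * T * h) + 2 * (real N * (\<Sum>i<N. C * h ^ 3))"
   using EP R2 by (intro add_mono mult_left_mono sum_mono) auto
  also have "\<dots> = 16 * \<gamma>\<^sup>2 * T * h + 2 * C * ((real N * h) * (real N * h)) * h" by (simp add: power3_eq_cube)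
  also have "\<dots> = (16 * \<gamma>\<^sup>2 * T + 2 * C * T\<^sup>2) * (T / real N)" unfolding h(3) by (simp add: h_def power2_eq_square algebra_simps)
  finally show "expectation (%w. 2 * (P w)\<^sup>2 + 2 * (real N * (\<Sum>i<N. (R i w)\<^sup>2))) \<le> (16 * \<gamma>\<^sup>2 * T + 2 * C * T\<^sup>2) * (T / real N)" .
 qed
 finally show ?thesis .
qed

lemma Xp_noise_progressive: "progressive M F (%t w. - vol * sin (Xp z0 t w))"
proof (rule adapted_continuous_progressive)
 fix t :: real assume "0 \<le> t"
 from Xp_adapted[OF this] show "(%w. - vol * sin (Xp z0 t w)) \<in> borel_measurable (F t)" by measurable
next
 fix w assume "w \<in> space M"
 then show "continuous_on {0..} (%t. - vol * sin (Xp z0 t w))" by (intro continuous_intros Xp_continuous)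
qed

text \<open>On each cell the simple process is the integrand at the left end, so the squared error
  is at most \<open>4 * vol\<^sup>2\<close> times the truncated oscillation of the path, which is
  the quantity handled by \<open>grid_modulus\<close>.\<close>

lemma ito_integrand_bound:
 fixes z0 T S :: real and N :: nat
 assumes T: "0 < T" and N: "0 < N" and S: "S \<le> T"
 defines "g \<equiv> %i. T * real i / real N"
 shows "(\<integral>\<^sup>+w. (\<integral>\<^sup>+r\<in>{0..S}. ennreal ((simple_proc N g (%i w. - vol * sin (Xp z0 (g i) w)) r w - - vol * sin (Xp z0 r w))\<^sup>2) \<partial>lborel) \<partial>M)
  \<le> ennreal (4 * vol\<^sup>2) * (\<Sum>i<N. \<integral>\<^sup>+w. (\<integral>\<^sup>+r\<in>{g i..g (Suc i)}. ennreal (min 1 \<bar>Xp z0 r w - Xp z0 (g i) w\<bar>) \<partial>lborel) \<partial>M)"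
proof -
 let ?X = "Xp z0"
 let ?P = "simple_proc N g (%i w. - vol * sin (Xp z0 (g i) w))"
 have g0: "g 0 = 0" and gN: "g N = T" using N by (auto simp: g_def)
 have gs: "g i < g (Suc i)" for i using T N by (auto simp: g_def intro!: divide_strict_right_mono)
 have gnn: "0 \<le> g i" for i using T by (simp add: g_def)
 have path: "(\<integral>\<^sup>+r\<in>{0..S}. ennreal ((?P r w - - vol * sin (?X r w))\<^sup>2) \<partial>lborel) \<le>
  (\<Sum>i<N. ennreal (4 * vol\<^sup>2) * (\<integral>\<^sup>+r\<in>{g i..g (Suc i)}. ennreal (min 1 \<bar>?X r w - ?X (g i) w\<bar>) \<partial>lborel))" if w: "w \<in> space M" for w
 proof -
  define k where "k i r = ennreal (min 1 \<bar>?X r w - ?X (g i) w\<bar>) * indicator {g i..g (Suc i)} r" for i r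
  have km: "k i \<in> borel_measurable lborel" for i
  proof -
   have "continuous_on {g i..g (Suc i)} (%r. min 1 \<bar>?X r w - ?X (g i) w\<bar>)"
    using gnn[of i] by (intro continuous_intros continuous_on_subset[OF Xp_continuous[OF w]]) auto
   from borel_measurable_continuous_on_indicator[OF _ this]
   have "(%r. ennreal (indicator {g i..g (Suc i)} r *\<^sub>R min 1 \<bar>?X r w - ?X (g i) w\<bar>)) \<in> borel_measurable borel" by measurable
   also have "(%r. ennreal (indicator {g i..g (Suc i)} r *\<^sub>R min 1 \<bar>?X r w - ?X (g i) w\<bar>)) = k i" by (auto simp: k_def indicator_def)
   finally show ?thesis by simp
  qed
  have "(\<integral>\<^sup>+r\<in>{0..S}. ennreal ((?P r w - - vol * sin (?X r w))\<^sup>2) \<partial>lborel) \<le> (\<integral>\<^sup>+r. (\<Sum>i<N. ennreal (4 * vol\<^sup>2) * k i r) \<partial>lborel)"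
  proof (rule nn_integral_mono_AE)
   \<comment> \<open>The cells of a simple process are open on the left, so time 0 belongs to none
     of them and has to be discarded as a null set.\<close>
   have "AE r in lborel. r \<noteq> (0::real)" by (rule AE_lborel_singleton)
   then show "AE r in lborel. ennreal ((?P r w - - vol * sin (?X r w))\<^sup>2) * indicator {0..S} r \<le> (\<Sum>i<N. ennreal (4 * vol\<^sup>2) * k i r)"
   proof eventually_elim
    case (elim r)
    show ?case
    proof (cases "r \<in> {0..S}")
     case True
     then have "g 0 < r" "r \<le> g N" using elim S by (auto simp: g0 gN)
     from grid_locate[OF this] obtain i where i: "i < N" "g i < r" "r \<le> g (Suc i)" by blast
     have P: "?P r w = - vol * sin (?X (g i) w)" using simple_proc_eq(1)[of N g, OF gs i] .
     define z where "z = min 1 \<bar>?X r w - ?X (g i) w\<bar>"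
     have z: "0 \<le> z" "z \<le> 1" by (auto simp: z_def)
     have "(?P r w - - vol * sin (?X r w))\<^sup>2 = vol\<^sup>2 * \<bar>sin (?X r w) - sin (?X (g i) w)\<bar>\<^sup>2"
      unfolding P by (simp add: power2_eq_square algebra_simps)
     also have "\<dots> \<le> vol\<^sup>2 * (2 * z)\<^sup>2" unfolding z_def by (intro mult_left_mono power_mono sin_diff_min) auto
     also have "\<dots> \<le> vol\<^sup>2 * (4 * z)" using z by (intro mult_left_mono) (auto simp: power2_eq_square intro: mult_left_le)
     finally have "(?P r w - - vol * sin (?X r w))\<^sup>2 \<le> 4 * vol\<^sup>2 * z" by (simp add: mult_ac)
     then have "ennreal ((?P r w - - vol * sin (?X r w))\<^sup>2) \<le> ennreal (4 * vol\<^sup>2) * ennreal z"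
      using z by (subst ennreal_mult[symmetric]) (auto intro: ennreal_leI)
     also have "\<dots> = ennreal (4 * vol\<^sup>2) * k i r" using i by (simp add: k_def z_def)
     also have "\<dots> \<le> (\<Sum>i<N. ennreal (4 * vol\<^sup>2) * k i r)" by (rule member_le_sum) (use i in auto)
     finally show ?thesis using True by simp
    qed simp
   qed
  qed
  also have "\<dots> = (\<Sum>i<N. ennreal (4 * vol\<^sup>2) * (\<integral>\<^sup>+r. k i r \<partial>lborel))"
   using km by (subst nn_integral_sum) (auto simp: nn_integral_cmult)
  finally show ?thesis by (simp add: k_def)
 qed
 have om: "(%w. \<integral>\<^sup>+r\<in>{g i..g (Suc i)}. ennreal (min 1 \<bar>?X r w - ?X (g i) w\<bar>) \<partial>lborel) \<in> borel_measurable M" for i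
  by (rule osc_measurable[OF Xp_progressive gnn less_imp_le[OF gs]])
 have "(\<integral>\<^sup>+w. (\<integral>\<^sup>+r\<in>{0..S}. ennreal ((?P r w - - vol * sin (?X r w))\<^sup>2) \<partial>lborel) \<partial>M) \<le>
  (\<integral>\<^sup>+w. (\<Sum>i<N. ennreal (4 * vol\<^sup>2) * (\<integral>\<^sup>+r\<in>{g i..g (Suc i)}. ennreal (min 1 \<bar>?X r w - ?X (g i) w\<bar>) \<partial>lborel)) \<partial>M)"
  by (rule nn_integral_mono) (rule path)
 also have "\<dots> = (\<Sum>i<N. ennreal (4 * vol\<^sup>2) * (\<integral>\<^sup>+w. (\<integral>\<^sup>+r\<in>{g i..g (Suc i)}. ennreal (min 1 \<bar>?X r w - ?X (g i) w\<bar>) \<partial>lborel) \<partial>M))"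
  using om by (subst nn_integral_sum) (auto simp: nn_integral_cmult)
 finally show ?thesis by (simp add: sum_distrib_left)
qed

text \<open>The same left-endpoint Riemann sums approximate both the integrand and
  \<open>Yp\<close>, as the defining relation of the integral requires: the former because the path
  is continuous, the latter by the Milstein estimate.\<close>

lemma Xp_ito: "ito_integral M F W (%t w. - 2 * sqrt (2 * \<gamma>) * sin (Xp z0 t w)) (Yp z0)"
proof -
 have ve: "- 2 * sqrt (2 * \<gamma>) = - vol" by (simp add: vol_def)
 obtain C where C: "0 \<le> C" "\<And>s t. 0 \<le> s ==> s < t ==> t \<le> s + 1 ==>
   integrable M (%w. (Rem z0 s t w)\<^sup>2) \<and> expectation (%w. (Rem z0 s t w)\<^sup>2) \<le> C * (t - s) ^ 3"
  using rem_moment[of z0] by blast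
 have fin: "(\<integral>\<^sup>+w. (\<integral>\<^sup>+t\<in>{0..T}. ennreal ((- vol * sin (Xp z0 t w))\<^sup>2) \<partial>lborel) \<partial>M) < \<infinity>" if T: "0 \<le> T" for T
 proof -
  have "(\<integral>\<^sup>+w. (\<integral>\<^sup>+t\<in>{0..T}. ennreal ((- vol * sin (Xp z0 t w))\<^sup>2) \<partial>lborel) \<partial>M) \<le> (\<integral>\<^sup>+w. (\<integral>\<^sup>+t\<in>{0..T}. ennreal (vol\<^sup>2) \<partial>lborel) \<partial>M)"
  proof (intro nn_integral_mono mult_right_mono ennreal_leI)
   fix t w
   have "vol\<^sup>2 * (sin (Xp z0 t w))\<^sup>2 \<le> vol\<^sup>2 * 1" by (intro mult_left_mono) (auto simp: abs_square_le_1)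
   then show "(- vol * sin (Xp z0 t w))\<^sup>2 \<le> vol\<^sup>2" by (simp add: power_mult_distrib)
  qed auto
  also have "\<dots> < \<infinity>" using T by (simp add: nn_integral_cmult_indicator emeasure_space_1 ennreal_mult_less_top)
  finally show ?thesis .
 qed
 have approx: "\<exists>n tt \<xi>. (\<forall>k. simple_ok M F (n k) (tt k) (\<xi> k)) \<and>
   ((%k. \<integral>\<^sup>+w. (\<integral>\<^sup>+t\<in>{0..T}. ennreal ((simple_proc (n k) (tt k) (\<xi> k) t w - - vol * sin (Xp z0 t w))\<^sup>2) \<partial>lborel) \<partial>M) \<longlongrightarrow> 0) sequentially \<and>
   (\<forall>t\<in>{0..T}. ((%k. \<integral>\<^sup>+w. ennreal ((simple_int W (n k) (tt k) (\<xi> k) t w - Yp z0 t w)\<^sup>2) \<partial>M) \<longlongrightarrow> 0) sequentially)" if T: "0 \<le> T" for T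
 proof -
  \<comment> \<open>A horizon of positive length, since \<open>T\<close> may be 0 and the grid needs
    increasing points; the statements on \<open>[0, T]\<close> follow from those on
    \<open>[0, S]\<close>.\<close>
  define S where "S = max T 1"
  have S: "0 < S" "T \<le> S" by (auto simp: S_def)
  define g where "g k i = S * real i / real (Suc k)" for k i
  define \<xi> where "\<xi> k i w = - vol * sin (Xp z0 (g k i) w)" for k i w
  have gnn: "0 \<le> g k i" for k i using S by (simp add: g_def)
  have ok: "simple_ok M F (Suc k) (g k) (\<xi> k)" for k
   unfolding simple_ok_def
  proof (intro conjI allI impI)
   show "g k i < g k (Suc i)" for i using S by (auto simp: g_def intro!: divide_strict_right_mono)
   show "\<xi> k i \<in> borel_measurable (F (g k i))" for i unfolding \<xi>_def[abs_def] using Xp_adapted[OF gnn] by measurable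
   show "\<exists>B. \<forall>i<Suc k. \<forall>w\<in>space M. \<bar>\<xi> k i w\<bar> \<le> B"
   proof (intro exI[of _ vol] allI impI ballI)
    fix i w
    have "vol * \<bar>sin (Xp z0 (g k i) w)\<bar> \<le> vol * 1" using vol_pos by (intro mult_left_mono) auto
    then show "\<bar>\<xi> k i w\<bar> \<le> vol" using vol_pos by (simp add: \<xi>_def abs_mult)
   qed
  qed (use gnn in auto)
  have l1: "((%k. \<integral>\<^sup>+w. (\<integral>\<^sup>+t\<in>{0..T}. ennreal ((simple_proc (Suc k) (g k) (\<xi> k) t w - - vol * sin (Xp z0 t w))\<^sup>2) \<partial>lborel) \<partial>M) \<longlongrightarrow> 0) sequentially"
  proof (rule ennreal_tendsto_zeroI)
   fix e :: real assume e: "e > 0"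
   define m where "m N = (\<Sum>i<N. \<integral>\<^sup>+w. (\<integral>\<^sup>+r\<in>{S * real i / real N..S * real (Suc i) / real N}. ennreal (min 1 \<bar>Xp z0 r w - Xp z0 (S * real i / real N) w\<bar>) \<partial>lborel) \<partial>M)" for N
   have "0 < ennreal (e / (4 * vol\<^sup>2))" using e vol_pos by simp
   from order_tendstoD(2)[OF LIMSEQ_Suc[OF grid_modulus[OF Xp_progressive Xp_continuous S(1)]] this]
   have "\<forall>\<^sub>F k in sequentially. m (Suc k) < ennreal (e / (4 * vol\<^sup>2))" unfolding m_def by simp
   then show "\<forall>\<^sub>F k in sequentially. (\<integral>\<^sup>+w. (\<integral>\<^sup>+t\<in>{0..T}. ennreal ((simple_proc (Suc k) (g k) (\<xi> k) t w - - vol * sin (Xp z0 t w))\<^sup>2) \<partial>lborel) \<partial>M) \<le> ennreal e"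
   proof eventually_elim
    case (elim k)
    have "(\<integral>\<^sup>+w. (\<integral>\<^sup>+t\<in>{0..T}. ennreal ((simple_proc (Suc k) (g k) (\<xi> k) t w - - vol * sin (Xp z0 t w))\<^sup>2) \<partial>lborel) \<partial>M) \<le> ennreal (4 * vol\<^sup>2) * m (Suc k)"
     using ito_integrand_bound[OF S(1) zero_less_Suc[of k] S(2), of z0] unfolding m_def g_def[abs_def] \<xi>_def[abs_def] by simp
    also have "\<dots> \<le> ennreal (4 * vol\<^sup>2) * ennreal (e / (4 * vol\<^sup>2))" using elim by (intro mult_left_mono) auto
    also have "\<dots> = ennreal (4 * vol\<^sup>2 * (e / (4 * vol\<^sup>2)))" using e by (intro ennreal_mult[symmetric]) auto
    also have "4 * vol\<^sup>2 * (e / (4 * vol\<^sup>2)) = e" using vol_pos by simp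
    finally show ?case .
   qed
  qed
  have l2: "((%k. \<integral>\<^sup>+w. ennreal ((simple_int W (Suc k) (g k) (\<xi> k) t w - Yp z0 t w)\<^sup>2) \<partial>M) \<longlongrightarrow> 0) sequentially" if t: "t \<in> {0..T}" for t
  proof (rule ennreal_tendsto_zeroI)
   fix e :: real assume e: "e > 0"
   define D where "D = 16 * \<gamma>\<^sup>2 * S + 2 * C * S\<^sup>2"
   have "(%k. D * (S / real (Suc k))) \<longlonglongrightarrow> D * 0"
    by (intro tendsto_intros LIMSEQ_Suc[OF lim_const_over_n])
   then have ev: "\<forall>\<^sub>F k in sequentially. D * (S / real (Suc k)) < e" using e by (intro order_tendstoD(2)) auto
   have ev2: "\<forall>\<^sub>F k in sequentially. S \<le> real (Suc k)"
   proof -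
    obtain k0 :: nat where "S < real k0" using reals_Archimedean2 by blast
    then show ?thesis unfolding eventually_sequentially by (intro exI[of _ k0]) auto
   qed
   from ev ev2 show "\<forall>\<^sub>F k in sequentially. (\<integral>\<^sup>+w. ennreal ((simple_int W (Suc k) (g k) (\<xi> k) t w - Yp z0 t w)\<^sup>2) \<partial>M) \<le> ennreal e"
   proof eventually_elim
    case (elim k)
    have "(\<integral>\<^sup>+w. ennreal ((simple_int W (Suc k) (g k) (\<xi> k) t w - Yp z0 t w)\<^sup>2) \<partial>M) \<le> ennreal (D * (S / real (Suc k)))"
     unfolding g_def[abs_def] \<xi>_def[abs_def] D_def
     by (rule ito_l2_bound[OF S(1) zero_less_Suc elim(2) _ _ C]) (use t S in auto)
    also have "\<dots> \<le> ennreal e" using elim by (intro ennreal_leI) auto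
    finally show ?case .
   qed
  qed
  show ?thesis by (rule exI[of _ Suc], rule exI[of _ g], rule exI[of _ \<xi>]) (use ok l1 l2 in blast)
 qed
 show ?thesis unfolding ito_integral_def ve
  using Xp_noise_progressive[of z0] Yp_measurable fin approx by blast
qed

lemma Xp_solution: "sde_solution M F W \<gamma> (%_ _. \<Omega>) z0 (Xp z0)"
 unfolding sde_solution_def
proof (intro conjI)
 show "progressive M F (Xp z0)" by (rule Xp_progressive)
 show "\<forall>w\<in>space M. Xp z0 0 w = z0 \<and> continuous_on {0..} (%t. Xp z0 t w)" by (simp add: Xp_0 Xp_continuous)
 show "\<exists>Y. ito_integral M F W (%t w. - 2 * sqrt (2 * \<gamma>) * sin (Xp z0 t w)) Y \<and>
  (\<forall>t\<ge>0. AE w in M. Xp z0 t w = z0 + integral {0..t} (%s. \<Omega> - 2 * \<gamma> * sin (2 * Xp z0 s w)) + Y t w)"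
  using Xp_ito[of z0] by (intro exI[of _ "Yp z0"]) (simp add: Yp_def)
qed

lemma progressive_uminus:
 assumes "progressive M F X" shows "progressive M F (%t w. - X t w)"
 unfolding progressive_def
proof (intro allI impI)
 fix T :: real assume "0 \<le> T"
 then have "(%(t, w). X t w) \<in> borel_measurable (restrict_space borel {0..T} \<Otimes>\<^sub>M F T)" using assms by (simp add: progressive_def)
 then show "(%(t, w). - X t w) \<in> borel_measurable (restrict_space borel {0..T} \<Otimes>\<^sub>M F T)"
  unfolding split_beta' by (rule borel_measurable_uminus)
qed

text \<open>Negating the coefficients of the approximating simple processes negates both the
  integrand and the integral. This provides solutions for negative starting points by
  reflection.\<close>

lemma ito_integral_uminus:
 assumes ito: "ito_integral M F W H Y"
 shows "ito_integral M F W (%t w. - H t w) (%t w. - Y t w)"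
proof -
 have sp: "simple_proc n tt (%i w. - \<xi> i w) t w = - simple_proc n tt \<xi> t w" for n tt \<xi> t and w :: 'a
  by (simp add: simple_proc_def sum_negf)
 have si: "simple_int W n tt (%i w. - \<xi> i w) t w = - simple_int W n tt \<xi> t w" for n tt \<xi> t w
  by (simp add: simple_int_def sum_negf)
 have sq: "(- a - - b)\<^sup>2 = (a - b :: real)\<^sup>2" for a b by (simp add: power2_commute)
 have okm: "simple_ok M F n tt (%i w. - \<xi> i w)" if "simple_ok M F n tt \<xi>" for n tt \<xi>
  using that by (auto simp: simple_ok_def)
 have approx: "\<exists>n tt \<xi>. (\<forall>k. simple_ok M F (n k) (tt k) (\<xi> k)) \<and>
   ((%k. \<integral>\<^sup>+w. (\<integral>\<^sup>+t\<in>{0..T}. ennreal ((simple_proc (n k) (tt k) (\<xi> k) t w - - H t w)\<^sup>2) \<partial>lborel) \<partial>M) \<longlongrightarrow> 0) sequentially \<and>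
   (\<forall>t\<in>{0..T}. ((%k. \<integral>\<^sup>+w. ennreal ((simple_int W (n k) (tt k) (\<xi> k) t w - - Y t w)\<^sup>2) \<partial>M) \<longlongrightarrow> 0) sequentially)" if T: "0 \<le> T" for T
 proof -
  have "\<exists>n tt \<xi>. (\<forall>k. simple_ok M F (n k) (tt k) (\<xi> k)) \<and>
   ((%k. \<integral>\<^sup>+w. (\<integral>\<^sup>+t\<in>{0..T}. ennreal ((simple_proc (n k) (tt k) (\<xi> k) t w - H t w)\<^sup>2) \<partial>lborel) \<partial>M) \<longlongrightarrow> 0) sequentially \<and>
   (\<forall>t\<in>{0..T}. ((%k. \<integral>\<^sup>+w. ennreal ((simple_int W (n k) (tt k) (\<xi> k) t w - Y t w)\<^sup>2) \<partial>M) \<longlongrightarrow> 0) sequentially)"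
   using ito T unfolding ito_integral_def by blast
  then obtain n tt \<xi> where *: "\<forall>k. simple_ok M F (n k) (tt k) (\<xi> k)"
   "((%k. \<integral>\<^sup>+w. (\<integral>\<^sup>+t\<in>{0..T}. ennreal ((simple_proc (n k) (tt k) (\<xi> k) t w - H t w)\<^sup>2) \<partial>lborel) \<partial>M) \<longlongrightarrow> 0) sequentially"
   "\<forall>t\<in>{0..T}. ((%k. \<integral>\<^sup>+w. ennreal ((simple_int W (n k) (tt k) (\<xi> k) t w - Y t w)\<^sup>2) \<partial>M) \<longlongrightarrow> 0) sequentially" by blast
  show ?thesis
   by (rule exI[of _ n], rule exI[of _ tt], rule exI[of _ "%k i w. - \<xi> k i w"], unfold sp si sq) (use * okm in blast)
 qed
 have "progressive M F (%t w. - H t w)" using ito by (intro progressive_uminus) (simp add: ito_integral_def)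
 moreover have "\<forall>t\<ge>0. (%w. - Y t w) \<in> borel_measurable M" using ito by (auto simp: ito_integral_def)
 moreover have "\<forall>T\<ge>0. (\<integral>\<^sup>+w. (\<integral>\<^sup>+t\<in>{0..T}. ennreal ((- H t w)\<^sup>2) \<partial>lborel) \<partial>M) < \<infinity>" using ito by (simp add: ito_integral_def)
 ultimately show ?thesis unfolding ito_integral_def using approx by blast
qed

text \<open>Both \<open>sin (2 * x)\<close> and \<open>sin x\<close> are odd, so reflecting the path
  reflects the equation, with \<Omega> replaced by - \<Omega> and with the same Brownian
  motion.\<close>

lemma Xp_solution_uminus: "sde_solution M F W \<gamma> (%_ _. - \<Omega>) (- z0) (%t w. - Xp z0 t w)"
 unfolding sde_solution_def
proof (intro conjI)
 show "progressive M F (%t w. - Xp z0 t w)" by (intro progressive_uminus Xp_progressive)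
 show "\<forall>w\<in>space M. - Xp z0 0 w = - z0 \<and> continuous_on {0..} (%t. - Xp z0 t w)" by (auto simp: Xp_0 intro!: continuous_intros Xp_continuous)
 have "integral {0..t} (%s. - \<Omega> - 2 * \<gamma> * sin (2 * - Xp z0 s w)) = - integral {0..t} (%s. \<Omega> - 2 * \<gamma> * sin (2 * Xp z0 s w))" for t w
  unfolding integral_neg[symmetric] by (rule integral_cong) simp
 then show "\<exists>Y. ito_integral M F W (%t w. - 2 * sqrt (2 * \<gamma>) * sin (- Xp z0 t w)) Y \<and>
  (\<forall>t\<ge>0. AE w in M. - Xp z0 t w = - z0 + integral {0..t} (%s. - \<Omega> - 2 * \<gamma> * sin (2 * - Xp z0 s w)) + Y t w)"
  using ito_integral_uminus[OF Xp_ito[of z0]] by (intro exI[of _ "%t w. - Yp z0 t w"]) (simp add: Yp_def)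
qed

lemma admissible_const:
 assumes "c \<in> {-\<Omega>..\<Omega>}"
 shows "admissible M F \<Omega> (%_ _. c)"
 unfolding admissible_def progressive_def piecewise_continuous_def using assms by auto

end

section \<open>Verification\<close>

lemma sum_indicator_grid:
 fixes g :: "nat => real"
 assumes "\<And>k. g k \<le> g (Suc k)"
 shows "(\<Sum>k<N. indicator {g k..<g (Suc k)} s) = (indicator {g 0..<g N} s :: ennreal)"
proof (induction N)
 case (Suc N)
 have "g 0 \<le> g N" using lift_Suc_mono_le[of g 0 N] assms by auto
 then show ?case using Suc assms[of N] by (auto simp: indicator_def)
qed simp

lemma continuous_clamp:
 fixes u :: "real => real"
 assumes q: "0 \<le> q" and u: "continuous_on {-q..q} u"
 shows "continuous_on UNIV (%x. u (clamp_sym q x))" "\<exists>b\<ge>0. \<forall>x. \<bar>u (clamp_sym q x)\<bar> \<le> b"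
proof -
 have im: "clamp_sym q x \<in> {-q..q}" for x using clamp_sym_props(2)[OF q, of x] by auto
 show "continuous_on UNIV (%x. u (clamp_sym q x))"
  by (rule continuous_on_compose2[OF u clamp_sym_props(3)[OF q]]) (use im in blast)
 have "bounded (u ` {-q..q})" by (intro compact_imp_bounded compact_continuous_image u) auto
 then obtain b where b: "\<forall>y\<in>u ` {-q..q}. norm y \<le> b" unfolding bounded_iff by blast
 have "\<bar>u (clamp_sym q x)\<bar> \<le> \<bar>b\<bar>" for x using b im[of x] by force
 then show "\<exists>b\<ge>0. \<forall>x. \<bar>u (clamp_sym q x)\<bar> \<le> b" by (intro exI[of _ "\<bar>b\<bar>"]) auto
qed

section \<open>Barrier functions and their generator inequalities\<close>

context qubit_control
begin

text \<open>Dynkin's inequality wants bounded functions on the whole line and Taylor bounds for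
  arbitrary end points. The values are those of \<open>U H\<close> frozen outside
  \<open>[-q, q]\<close> with \<open>p < q < pi\<close>, the derivatives are frozen outside
  \<open>[-p, p]\<close> already; they are true derivatives on \<open>[-p, p]\<close>, where the
  generator is evaluated. Since \<open>U H\<close> decreases in the modulus, the extension stays
  below \<open>U H p\<close> beyond \<open>p\<close>.\<close>

lemma barrier_extension:
 assumes e: "0 < e" "e < pi" and H: "profile (cutoff e) H H1" and p: "0 < p" "p < pi"
 obtains f f1 f2 B C where
  "continuous_on UNIV f" "continuous_on UNIV f1" "continuous_on UNIV f2"
  "\<And>x. \<bar>f x\<bar> \<le> B" "\<And>x. \<bar>f1 x\<bar> \<le> B" "\<And>x. \<bar>f2 x\<bar> \<le> B" "1 \<le> B"
  "\<And>x. 0 \<le> f x \<and> f x \<le> 1 / lam" "\<And>x. p \<le> \<bar>x\<bar> ==> f x \<le> U H p"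
  "\<And>x. \<bar>x\<bar> \<le> p ==> f x = U H x \<and> f1 x = U1 H H1 x \<and> f2 x = U2 (cutoff e) H H1 x"
  "0 \<le> C" "\<And>x y. \<bar>x\<bar> \<le> p ==> \<bar>f y - f x - f1 x * (y - x) - f2 x / 2 * (y - x)\<^sup>2\<bar> \<le> C * (y - x)\<^sup>2"
  "\<And>\<kappa>. \<kappa> > 0 ==> \<exists>K\<ge>0. \<forall>x y. \<bar>x\<bar> \<le> p -->
   \<bar>f y - f x - f1 x * (y - x) - f2 x / 2 * (y - x)\<^sup>2\<bar> \<le> \<kappa> * (y - x)\<^sup>2 + K * \<bar>y - x\<bar> ^ 3"
proof -
 define q where "q = (p + pi) / 2"
 have q: "0 \<le> q" "p < q" "q < pi" using p by (auto simp: q_def)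
 note d = cut_profile[OF e H]
 have c1: "continuous_on {-r..r} (U1 H H1)" if "r < pi" for r
  by (rule DERIV_continuous_on, rule has_field_derivative_at_within, rule d(2)) (use that in auto)
 have c2: "continuous_on {-r..r} (U2 (cutoff e) H H1)" if "r < pi" for r
  using d(4) that by (intro continuous_at_imp_continuous_on ballI) auto
 have c0: "continuous_on {-q..q} (U H)" by (rule continuous_on_subset[OF U_continuous[OF H]]) (use q in auto)
 obtain C where C: "0 \<le> C"
  "\<And>x y. \<bar>x\<bar> \<le> p ==> \<bar>U H (clamp_sym q y) - U H x - U1 H H1 x * (y - x) - U2 (cutoff e) H H1 x / 2 * (y - x)\<^sup>2\<bar> \<le> C * (y - x)\<^sup>2"
  "\<And>\<kappa>. \<kappa> > 0 ==> \<exists>K\<ge>0. \<forall>x y. \<bar>x\<bar> \<le> p -->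
   \<bar>U H (clamp_sym q y) - U H x - U1 H H1 x * (y - x) - U2 (cutoff e) H H1 x / 2 * (y - x)\<^sup>2\<bar> \<le> \<kappa> * (y - x)\<^sup>2 + K * \<bar>y - x\<bar> ^ 3"
  by (rule taylor_clamp[OF p(1) q(2), of "U H" "U1 H H1" "U2 (cutoff e) H H1"]) (use d(1,2) c2[OF q(3)] q(3) in \<open>force+\<close>)
 have p0: "0 \<le> p" using p by simp
 obtain b0 where b0: "0 \<le> b0" "\<And>x. \<bar>U H (clamp_sym q x)\<bar> \<le> b0" using continuous_clamp(2)[OF q(1) c0] by blast
 obtain b1 where b1: "0 \<le> b1" "\<And>x. \<bar>U1 H H1 (clamp_sym p x)\<bar> \<le> b1" using continuous_clamp(2)[OF p0 c1[OF p(2)]] by blast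
 obtain b2 where b2: "0 \<le> b2" "\<And>x. \<bar>U2 (cutoff e) H H1 (clamp_sym p x)\<bar> \<le> b2" using continuous_clamp(2)[OF p0 c2[OF p(2)]] by blast
 have eqs: "clamp_sym q x = x \<and> clamp_sym p x = x" if "\<bar>x\<bar> \<le> p" for x
  using that q p by (intro conjI clamp_sym_props(1)) auto
 have cl: "\<bar>clamp_sym q x\<bar> \<le> pi" for x using clamp_sym_props(2)[OF q(1), of x] q by auto
 show ?thesis
 proof (rule that[of "%x. U H (clamp_sym q x)" "%x. U1 H H1 (clamp_sym p x)" "%x. U2 (cutoff e) H H1 (clamp_sym p x)" "b0 + b1 + b2 + 1" C])
  show "\<bar>U H (clamp_sym q x)\<bar> \<le> b0 + b1 + b2 + 1" for x using b0(2)[of x] b1(1) b2(1) by linarith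
  show "\<bar>U1 H H1 (clamp_sym p x)\<bar> \<le> b0 + b1 + b2 + 1" for x using b0(1) b1(2)[of x] b2(1) by linarith
  show "\<bar>U2 (cutoff e) H H1 (clamp_sym p x)\<bar> \<le> b0 + b1 + b2 + 1" for x using b0(1) b1(1) b2(2)[of x] by linarith
  show "0 \<le> U H (clamp_sym q x) \<and> U H (clamp_sym q x) \<le> 1 / lam" for x using U_nonneg[OF H cl] U_bound[OF H cl] by auto
  show "U H (clamp_sym q x) \<le> U H p" if "p \<le> \<bar>x\<bar>" for x
   by (rule U_antimono[OF H _ cl]) (use that p q in \<open>auto simp: clamp_sym_def\<close>)
  show "\<exists>K\<ge>0. \<forall>x y. \<bar>x\<bar> \<le> p --> \<bar>U H (clamp_sym q y) - U H (clamp_sym q x) - U1 H H1 (clamp_sym p x) * (y - x) - U2 (cutoff e) H H1 (clamp_sym p x) / 2 * (y - x)\<^sup>2\<bar> \<le> \<kappa> * (y - x)\<^sup>2 + K * \<bar>y - x\<bar> ^ 3"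
   if "\<kappa> > 0" for \<kappa>
  proof -
   from C(3)[OF that] obtain K where "0 \<le> K" "\<forall>x y. \<bar>x\<bar> \<le> p -->
    \<bar>U H (clamp_sym q y) - U H x - U1 H H1 x * (y - x) - U2 (cutoff e) H H1 x / 2 * (y - x)\<^sup>2\<bar> \<le> \<kappa> * (y - x)\<^sup>2 + K * \<bar>y - x\<bar> ^ 3" by blast
   then show ?thesis by (intro exI[of _ K]) (simp add: eqs)
  qed
  show "\<bar>U H (clamp_sym q y) - U H (clamp_sym q x) - U1 H H1 (clamp_sym p x) * (y - x) - U2 (cutoff e) H H1 (clamp_sym p x) / 2 * (y - x)\<^sup>2\<bar> \<le> C * (y - x)\<^sup>2"
   if "\<bar>x\<bar> \<le> p" for x y using C(2)[OF that] eqs[OF that] by simp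
  show "1 \<le> b0 + b1 + b2 + 1" using b0(1) b1(1) b2(1) by simp
  show "U H (clamp_sym q x) = U H x \<and> U1 H H1 (clamp_sym p x) = U1 H H1 x \<and> U2 (cutoff e) H H1 (clamp_sym p x) = U2 (cutoff e) H H1 x"
   if "\<bar>x\<bar> \<le> p" for x using eqs[OF that] by simp
 qed (fact C(1) continuous_clamp(1)[OF q(1) c0] continuous_clamp(1)[OF p0 c1[OF p(2)]] continuous_clamp(1)[OF p0 c2[OF p(2)]])+
qed

text \<open>The Hamiltonian is the supremum over all controls, so a nonpositive residual of the
  equation gives the inequality for each single control value.\<close>

lemma barrier_generator_lower:
 assumes e: "0 < e" "e < pi" and H: "profile (cutoff e) H H1" and x: "\<bar>x\<bar> < pi" and v: "\<bar>v\<bar> \<le> \<Omega>"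
 shows "(v - 2 * \<gamma> * sin (2 * x)) * U1 H H1 x + 4 * \<gamma> * (sin x)\<^sup>2 * U2 (cutoff e) H H1 x - lam * U H x \<ge> - 1"
proof -
 have "0 \<le> (1 - cutoff e \<bar>x\<bar>) * H \<bar>x\<bar> / H pi"
  using cutoff_props(3)[OF e(1)] profile_props(7)[OF H, of "\<bar>x\<bar>"] Gpi_ge[OF H] x by (intro divide_nonneg_nonneg mult_nonneg_nonneg) auto
 then have "pde x (U H x) (U1 H H1 x) (U2 (cutoff e) H H1 x) \<le> 0" unfolding cut_profile(3)[OF e H x] by (simp add: minus_mult_left[symmetric] del: minus_diff_eq mult_minus_left)
 moreover have "\<bar>v * U1 H H1 x\<bar> \<le> \<Omega> * \<bar>U1 H H1 x\<bar>" unfolding abs_mult using v by (intro mult_right_mono) auto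
 ultimately show ?thesis unfolding pde_eq by (simp add: algebra_simps abs_le_iff)
qed

text \<open>For \<open>x \<ge> 0\<close> the slope of \<open>U H\<close> is nonpositive, so the
  control \<Omega> attains the supremum and the inequality can be reversed. The loss is the residual
  \<open>(1 - cutoff e x) * H x / H pi\<close>, at most \<open>1 - cutoff e x\<close> because
  \<open>H x \<le> H pi\<close>; the running cost 1 is thus replaced by the cutoff.\<close>

lemma barrier_generator_upper:
 assumes e: "0 < e" "e < pi" and H: "profile (cutoff e) H H1" and x: "0 \<le> x" "x < pi"
 shows "(\<Omega> - 2 * \<gamma> * sin (2 * x)) * (- U1 H H1 x) + 4 * \<gamma> * (sin x)\<^sup>2 * (- U2 (cutoff e) H H1 x) - lam * (- U H x) \<ge> cutoff e x"
proof -
 have xa: "\<bar>x\<bar> < pi" "\<bar>x\<bar> = x" using x by auto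
 have h: "1 \<le> H pi" by (rule Gpi_ge[OF H])
 have minus_div: "- (1 - c) * a / b = - ((1 - c) * (a / b))" for a b c :: real
  by (simp only: minus_mult_left minus_divide_left times_divide_eq_right)
 have "H x / H pi \<le> 1" using profile_props(11)[OF H, of x pi] x h by simp
 then have "(1 - cutoff e x) * (H x / H pi) \<le> (1 - cutoff e x) * 1"
  using cutoff_props(3)[OF e(1)] by (intro mult_left_mono) auto
 then have r: "pde x (U H x) (U1 H H1 x) (U2 (cutoff e) H H1 x) \<ge> cutoff e x - 1" unfolding cut_profile(3)[OF e H xa(1)] xa(2) minus_div by simp
 have "U1 H H1 x \<le> 0" using profile_props(9)[OF H, of x] x h lam_pos by (simp add: U1_def sgn_if)
 then have "\<bar>U1 H H1 x\<bar> = - U1 H H1 x" by simp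
 then show ?thesis using r unfolding pde_eq by (simp add: algebra_simps)
qed

end

section \<open>Lower and upper bounds on the cost\<close>

context controlled_qubit
begin

text \<open>The sum telescopes up to the first grid index at which the path is no longer alive. It
  was alive one grid point earlier, so the departure from the interval happened within one mesh
  width of that index.\<close>

lemma alive_telescope:
 fixes m :: "nat => real"
 assumes X0: "X 0 w \<in> {a..b}" and T: "0 < T" and N: "0 < N"
 shows "\<exists>j\<le>N. (\<Sum>k<N. alive X a b (T * real k / real N) w * (m (Suc k) - m k)) = m j - m 0 \<and>
  (j = N \<or> (\<exists>r\<in>{0..T}. \<bar>r - T * real j / real N\<bar> \<le> T / real N \<and> X r w \<notin> {a..b}))"
proof -
 define g where "g k = T * real k / real N" for k
 have g: "g 0 = 0" "g (Suc k) = g k + T / real N" "0 \<le> g k" for k using T by (auto simp: g_def add_divide_distrib algebra_simps)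
 have gT: "g k \<le> T" if "k \<le> N" for k using that T N by (simp add: g_def field_simps)
 have h: "0 < T / real N" using T N by simp
 have "\<exists>j\<le>N. (\<Sum>k<N. alive X a b (g k) w * (m (Suc k) - m k)) = m j - m 0 \<and> (\<forall>i<j. alive X a b (g i) w = 1) \<and> (j = N \<or> alive X a b (g j) w = 0)"
 proof (rule telescope_until)
  show "alive X a b (g k) w = 0 \<or> alive X a b (g k) w = 1" for k by (auto simp: alive_def)
  show "alive X a b (g 0) w = 1" using X0 by (simp add: alive_def g(1))
  show "alive X a b (g (Suc k)) w = 0" if "alive X a b (g k) w = 0" for k
  proof -
   from that obtain r where "r \<in> {0..g k}" "X r w \<notin> {a..b}" by (auto simp: alive_def split: if_splits)
   then show ?thesis using g(2)[of k] h by (auto simp: alive_def intro: bexI[of _ r])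
  qed
 qed
 then obtain j where j: "j \<le> N" "(\<Sum>k<N. alive X a b (g k) w * (m (Suc k) - m k)) = m j - m 0"
  "\<forall>i<j. alive X a b (g i) w = 1" "j = N \<or> alive X a b (g j) w = 0" by blast
 have "j = N \<or> (\<exists>r\<in>{0..T}. \<bar>r - g j\<bar> \<le> T / real N \<and> X r w \<notin> {a..b})"
 proof (cases "j = N")
  case False
  then have "alive X a b (g j) w = 0" using j(4) by simp
  then obtain r where r: "r \<in> {0..g j}" "X r w \<notin> {a..b}" by (auto simp: alive_def split: if_splits)
  have "j \<noteq> 0" using r X0 by (cases j) (auto simp: g(1))
  then obtain i where i: "j = Suc i" by (cases j) auto
  have "alive X a b (g i) w = 1" using j(3) i by simp
  then have "r \<notin> {0..g i}" using r by (auto simp: alive_def split: if_splits)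
  then have "\<bar>r - g j\<bar> \<le> T / real N" using r g(2)[of i] i by auto
  then show ?thesis using r gT[OF j(1)] by (intro disjI2 bexI[of _ r]) auto
 qed simp
 then show ?thesis using j(1,2) unfolding g_def by blast
qed

lemma alive_exit_time:
 assumes al: "alive X a b t w \<noteq> 0" and ab: "- pi < a" "b < pi"
 shows "ereal t \<le> exit_time X w"
 unfolding exit_time_def
proof (rule Inf_greatest)
 fix y assume "y \<in> {ereal t |t. 0 \<le> t \<and> X t w \<in> {- pi, pi}}"
 then obtain r where r: "y = ereal r" "0 \<le> r" "X r w \<in> {-pi, pi}" by auto
 have "\<forall>r\<in>{0..t}. X r w \<in> {a..b}" using al by (auto simp: alive_def split: if_splits)
 then have "r \<notin> {0..t}" using r(3) ab by force
 then show "ereal t \<le> y" using r by auto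
qed

text \<open>A lower Riemann sum: being alive at the right end of a cell puts the whole cell before
  the exit time, and the discount is smallest at the right end.\<close>

lemma alive_sum_le_discounted:
 assumes ab: "- pi < a" "b < pi" and T: "0 < T" and N: "0 < N"
 shows "(\<Sum>k<N. ennreal (alive X a b (T * real (Suc k) / real N) w * (T / real N * exp (- lam * (T * real (Suc k) / real N)))))
  \<le> (\<integral>\<^sup>+s\<in>{s. 0 \<le> s \<and> ereal s < exit_time X w}. ennreal (exp (- lam * s)) \<partial>lborel)"
proof -
 define g where "g k = T * real k / real N" for k
 define h where "h = T / real N"
 have h: "0 < h" using T N by (simp add: h_def)
 have g: "g 0 = 0" "g (Suc k) = g k + h" "0 \<le> g k" for k using T by (auto simp: g_def h_def add_divide_distrib algebra_simps)
 let ?A = "%s. ennreal (exp (- lam * s)) * indicator {s. 0 \<le> s \<and> ereal s < exit_time X w} s"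
 let ?c = "%k. ennreal (alive X a b (g (Suc k)) w * exp (- lam * g (Suc k)))"
 have "ennreal (alive X a b (g (Suc k)) w * (h * exp (- lam * g (Suc k)))) = (\<integral>\<^sup>+s. ?c k * indicator {g k..<g (Suc k)} s \<partial>lborel)" for k
 proof -
  have "(\<integral>\<^sup>+s. ?c k * indicator {g k..<g (Suc k)} s \<partial>lborel) = ?c k * ennreal h"
   using g h by (simp add: nn_integral_cmult_indicator)
  also have "\<dots> = ennreal (alive X a b (g (Suc k)) w * exp (- lam * g (Suc k)) * h)"
   using h alive_bound(2) by (intro ennreal_mult[symmetric]) auto
  finally show ?thesis by (simp add: mult_ac)
 qed
 then have "(\<Sum>k<N. ennreal (alive X a b (g (Suc k)) w * (h * exp (- lam * g (Suc k))))) = (\<integral>\<^sup>+s. (\<Sum>k<N. ?c k * indicator {g k..<g (Suc k)} s) \<partial>lborel)"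
  by (subst nn_integral_sum) auto
 also have "\<dots> \<le> (\<integral>\<^sup>+s. ?A s \<partial>lborel)"
 proof (rule nn_integral_mono)
  fix s
  have "(\<Sum>k<N. ?c k * indicator {g k..<g (Suc k)} s) \<le> (\<Sum>k<N. ?A s * indicator {g k..<g (Suc k)} s)"
  proof (rule sum_mono)
   fix k
   show "?c k * indicator {g k..<g (Suc k)} s \<le> ?A s * indicator {g k..<g (Suc k)} s"
   proof (cases "s \<in> {g k..<g (Suc k)} \<and> alive X a b (g (Suc k)) w \<noteq> 0")
    case True
    have "ereal s < ereal (g (Suc k))" using True by simp
    also have "\<dots> \<le> exit_time X w" using True by (intro alive_exit_time[OF _ ab]) auto
    finally have ex: "ereal s < exit_time X w" .
    have s0: "0 \<le> s" using True g(3)[of k] by auto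
    have "alive X a b (g (Suc k)) w * exp (- lam * g (Suc k)) \<le> 1 * exp (- lam * s)"
     using True lam_pos alive_bound by (intro mult_mono) (auto simp: alive_def)
    then show ?thesis using ex s0 by (intro mult_right_mono) (auto intro: ennreal_leI)
   qed auto
  qed
  also have "\<dots> = ?A s * indicator {g 0..<g N} s"
   unfolding sum_distrib_left[symmetric] using g h by (subst sum_indicator_grid) auto
  also have "\<dots> \<le> ?A s" by (simp add: indicator_def)
  finally show "(\<Sum>k<N. ?c k * indicator {g k..<g (Suc k)} s) \<le> ?A s" .
 qed
 finally show ?thesis unfolding g_def h_def .
qed

text \<open>The discount has finite mass on the half-line, read off from the exponential density of
  rate \<open>lam\<close>. Hence \<open>enn2real\<close> in \<open>cost\<close> never turns an
  infinite value into 0.\<close>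

lemma discounted_time_finite:
 "(\<integral>\<^sup>+w. (\<integral>\<^sup>+s\<in>{s. 0 \<le> s \<and> ereal s < exit_time X w}. ennreal (exp (- lam * s)) \<partial>lborel) \<partial>M) < \<infinity>"
proof -
 define I where "I = (\<integral>\<^sup>+s\<in>{0..}. ennreal (exp (- lam * s)) \<partial>lborel)"
 interpret E: prob_space "density lborel (exponential_density lam)" by (rule prob_space_exponential_density[OF lam_pos])
 have "1 = (\<integral>\<^sup>+s. ennreal (exponential_density lam s) \<partial>lborel)"
  using E.emeasure_space_1 by (simp add: emeasure_density)
 also have "\<dots> = (\<integral>\<^sup>+s. ennreal lam * (ennreal (exp (- lam * s)) * indicator {0..} s) \<partial>lborel)"
  using lam_pos by (intro nn_integral_cong) (auto simp: exponential_density_def ennreal_mult indicator_def mult_ac)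
 also have "\<dots> = ennreal lam * I" unfolding I_def by (intro nn_integral_cmult) measurable
 finally have I: "I < \<infinity>" using lam_pos by (cases "I = \<infinity>") (auto simp: ennreal_mult_top less_top)
 have "(\<integral>\<^sup>+w. (\<integral>\<^sup>+s\<in>{s. 0 \<le> s \<and> ereal s < exit_time X w}. ennreal (exp (- lam * s)) \<partial>lborel) \<partial>M) \<le> (\<integral>\<^sup>+w. I \<partial>M)"
  unfolding I_def by (intro nn_integral_mono mult_left_mono) (auto simp: indicator_def)
 also have "\<dots> < \<infinity>" using I by (simp add: emeasure_space_1)
 finally show ?thesis .
qed

text \<open>Dynkin's inequality for \<open>U H\<close>, valid under every control, is run until the
  path leaves \<open>[-p, p]\<close> or the horizon \<open>T\<close> is reached. In the first case
  \<open>U H\<close> is small because \<open>p\<close> is close to pi, in the second because of the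
  discount, so the starting value \<open>U H x0\<close> is paid for by the accumulated running
  cost.\<close>

lemma cost_lower:
 assumes adm: "admissible M F \<Omega> v" and sol: "sde_solution M F W \<gamma> v x0 X"
  and x0: "\<bar>x0\<bar> < pi" and e: "0 < e" "e < pi" and H: "profile (cutoff e) H H1"
 shows "U H x0 \<le> cost M lam X"
proof (rule field_le_epsilon)
 fix \<epsilon>0 :: real assume "0 < \<epsilon>0"
 \<comment> \<open>Seven shares cover the errors collected in the final estimate: the stopped value,
   the tail expectation, the Dynkin error and the first cell.\<close>
 define \<epsilon> where "\<epsilon> = \<epsilon>0 / 7"
 have \<epsilon>: "0 < \<epsilon>" using \<open>0 < \<epsilon>0\<close> by (simp add: \<epsilon>_def)
 have "(U H \<longlongrightarrow> U H pi) (at pi within {-pi..pi})"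
  using U_continuous[OF H] pi_gt_zero by (auto simp: continuous_on_def)
 from order_tendstoD(2)[OF this, of \<epsilon>] obtain d where d: "d > 0" "\<And>y. y \<in> {-pi..pi} ==> y \<noteq> pi ==> dist y pi < d ==> U H y < \<epsilon>"
  using U_pi[OF H] \<epsilon> unfolding eventually_at by auto
 \<comment> \<open>Beyond the starting point, and so close to pi that
   \<open>U H p \<le> \<epsilon>\<close>.\<close>
 define p where "p = max ((\<bar>x0\<bar> + pi) / 2) (pi - d / 2)"
 have "(\<bar>x0\<bar> + pi) / 2 \<le> p" by (simp add: p_def)
 then have "0 < p" "\<bar>x0\<bar> < p" using x0 by (simp_all add: field_simps)
 moreover have "p < pi" using x0 d(1) by (simp add: p_def)
 ultimately have p: "0 < p" "p < pi" "\<bar>x0\<bar> < p" by auto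
 have Up: "U H p \<le> \<epsilon>"
 proof (rule less_imp_le[OF d(2)])
  have "pi - d / 2 \<le> p" by (simp add: p_def)
  then show "dist p pi < d" using p d(1) by (auto simp: dist_real_def)
 qed (use p in auto)
 \<comment> \<open>Solves \<open>exp (- lam * T) / lam \<le> \<epsilon>\<close>; the maximum with 1
   keeps the horizon positive.\<close>
 define T where "T = max 1 (- ln (lam * \<epsilon>) / lam)"
 have T: "0 < T" by (simp add: T_def)
 have eT: "exp (- lam * T) / lam \<le> \<epsilon>"
 proof -
  have "- ln (lam * \<epsilon>) / lam \<le> T" by (simp add: T_def)
  then have "- ln (lam * \<epsilon>) \<le> T * lam" by (simp only: pos_divide_le_eq[OF lam_pos])
  then have "- lam * T \<le> ln (lam * \<epsilon>)" by (simp add: mult.commute)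
  then have "exp (- lam * T) \<le> exp (ln (lam * \<epsilon>))" by (simp only: exp_le_cancel_iff)
  then show ?thesis using lam_pos \<epsilon> by (simp add: divide_le_eq mult.commute)
 qed
 obtain f f1 f2 B C where fc: "continuous_on UNIV f" "continuous_on UNIV f1" "continuous_on UNIV f2"
  and B: "\<And>x. \<bar>f x\<bar> \<le> B" "\<And>x. \<bar>f1 x\<bar> \<le> B" "\<And>x. \<bar>f2 x\<bar> \<le> B" "1 \<le> B"
  and f0: "\<And>x. 0 \<le> f x \<and> f x \<le> 1 / lam" and fp: "\<And>x. p \<le> \<bar>x\<bar> ==> f x \<le> U H p"
  and fe: "\<And>x. \<bar>x\<bar> \<le> p ==> f x = U H x \<and> f1 x = U1 H H1 x \<and> f2 x = U2 (cutoff e) H H1 x"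
  and C: "0 \<le> C" and R1: "\<And>x y. \<bar>x\<bar> \<le> p ==> \<bar>f y - f x - f1 x * (y - x) - f2 x / 2 * (y - x)\<^sup>2\<bar> \<le> C * (y - x)\<^sup>2"
  and R2: "\<And>\<kappa>. \<kappa> > 0 ==> \<exists>K\<ge>0. \<forall>x y. \<bar>x\<bar> \<le> p -->
   \<bar>f y - f x - f1 x * (y - x) - f2 x / 2 * (y - x)\<^sup>2\<bar> \<le> \<kappa> * (y - x)\<^sup>2 + K * \<bar>y - x\<bar> ^ 3"
  using barrier_extension[OF e H p(1,2)] by blast
 have abs: "x \<in> {-p..p} \<longleftrightarrow> \<bar>x\<bar> \<le> p" for x by auto
 have fm [measurable]: "f \<in> borel_measurable borel" "f1 \<in> borel_measurable borel" "f2 \<in> borel_measurable borel"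
  using fc by (auto intro: borel_measurable_continuous_onI)
 have prog: "progressive M F X" and X0: "\<And>w. w \<in> space M ==> X 0 w = x0"
  and Xc: "\<And>w. w \<in> space M ==> continuous_on {0..} (%t. X t w)"
  using sol by (auto simp: sde_solution_def)
 define g where "g N k = T * real k / real N" for N k
 define m where "m N k w = exp (- lam * g N k) * f (X (g N k) w)" for N k w
 define al where "al N k w = alive X (-p) p (g N k) w" for N k w
 have gnn: "0 \<le> g N k" for N k using T by (simp add: g_def)
 have Xm [measurable]: "X (g N k) \<in> borel_measurable M" for N k by (rule measurable_F_M[OF progressive_measurable[OF prog gnn]])
 have alm [measurable]: "al N k \<in> borel_measurable M" for N k unfolding al_def[abs_def] by (rule measurable_F_M[OF alive_measurable[OF prog Xc gnn]])
 have al01: "0 \<le> al N k w" "al N k w \<le> 1" for N k w using alive_bound[of X "-p" p "g N k" w] by (auto simp: al_def)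
 have mm [measurable]: "m N k \<in> borel_measurable M" for N k unfolding m_def[abs_def] by measurable
 have e1: "exp (- lam * g N k) \<le> 1" for N k using gnn lam_pos by simp
 have mb: "0 \<le> m N k w" "m N k w \<le> 1 / lam" for N k w
 proof -
  show "0 \<le> m N k w" using f0 by (simp add: m_def)
  have "m N k w \<le> 1 * (1 / lam)" unfolding m_def using f0 e1 by (intro mult_mono) auto
  then show "m N k w \<le> 1 / lam" by simp
 qed
 have "\<exists>N0. \<forall>N\<ge>N0. 0 < N -->
  (\<Sum>k<N. expectation (%w. alive X (-p) p (T * real k / real N) w *
    (exp (- lam * (T * real (Suc k) / real N)) * f (X (T * real (Suc k) / real N) w)
     - exp (- lam * (T * real k / real N)) * f (X (T * real k / real N) w))))
   \<ge> - (\<Sum>k<N. expectation (%w. alive X (-p) p (T * real k / real N) w *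
      (T / real N * exp (- lam * (T * real k / real N)) * (%_. 1) (X (T * real k / real N) w)))) - \<epsilon>"
 proof (rule dynkin_sum[OF adm sol T \<epsilon> fm _ B(1,2,3) _ C])
  fix t x :: real and w assume "0 \<le> t" "w \<in> space M" "x \<in> {-p..p}"
  then have x: "\<bar>x\<bar> \<le> p" and v: "\<bar>v t w\<bar> \<le> \<Omega>" using adm by (auto simp: admissible_def abs_le_iff minus_le_iff)
  have "\<bar>x\<bar> < pi" using x p by auto
  from barrier_generator_lower[OF e H this v]
  show "- 1 \<le> (v t w - 2 * \<gamma> * sin (2 * x)) * f1 x + 4 * \<gamma> * (sin x)\<^sup>2 * f2 x - lam * f x" using fe[OF x] by simp
 next
  fix \<kappa> :: real assume "\<kappa> > 0"
  from R2[OF this] show "\<exists>K\<ge>0. \<forall>x y. x \<in> {-p..p} --> \<bar>f y - f x - f1 x * (y - x) - f2 x / 2 * (y - x)\<^sup>2\<bar> \<le> \<kappa> * (y - x)\<^sup>2 + K * \<bar>y - x\<bar> ^ 3"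
   unfolding abs .
 next
  fix x y assume "x \<in> {-p..p}"
  then show "\<bar>f y - f x - f1 x * (y - x) - f2 x / 2 * (y - x)\<^sup>2\<bar> \<le> C * (y - x)\<^sup>2" unfolding abs by (rule R1)
 qed (use B(4) in simp_all)
 then obtain N0 where N0: "\<And>N. N \<ge> N0 ==> 0 < N ==>
   (\<Sum>k<N. expectation (%w. al N k w * (m N (Suc k) w - m N k w))) \<ge> - (\<Sum>k<N. expectation (%w. al N k w * (T / real N * exp (- lam * g N k)))) - \<epsilon>"
  unfolding al_def m_def g_def by auto
 \<comment> \<open>By telescoping this is the discounted barrier value at the grid index where the
   path stops, so it is bounded by \<open>1 / lam\<close>. Along each path it is eventually at most
   \<open>3 * \<epsilon>\<close>, and bounded convergence carries this to the expectation.\<close>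
 define Z where "Z N w = U H x0 + (\<Sum>k<N. al N k w * (m N (Suc k) w - m N k w))" for N w
 have Zj: "\<exists>j\<le>N. Z N w = m N j w \<and> (j = N \<or> (\<exists>r\<in>{0..T}. \<bar>r - g N j\<bar> \<le> T / real N \<and> X r w \<notin> {-p..p}))"
  if w: "w \<in> space M" and N: "0 < N" for N w
 proof -
  have "X 0 w \<in> {-p..p}" using X0[OF w] p by auto
  from alive_telescope[where X = X and w = w and m = "%k. m N k w", OF this T N] obtain j where
   j: "j \<le> N" "(\<Sum>k<N. al N k w * (m N (Suc k) w - m N k w)) = m N j w - m N 0 w"
   "j = N \<or> (\<exists>r\<in>{0..T}. \<bar>r - g N j\<bar> \<le> T / real N \<and> X r w \<notin> {-p..p})"
   unfolding al_def g_def by blast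
  have "m N 0 w = U H x0" using X0[OF w] fe[of x0] p by (simp add: m_def g_def)
  then show ?thesis using j by (intro exI[of _ j]) (simp add: Z_def)
 qed
 have Zb: "Z (Suc N) w \<le> 1 / lam" if "w \<in> space M" for N w
  using Zj[OF that, of "Suc N"] mb(2) by auto
 have Zm [measurable]: "Z N \<in> borel_measurable M" for N unfolding Z_def[abs_def] by measurable
 have hl: "(%N. T / real (Suc N)) \<longlonglongrightarrow> 0" by (rule LIMSEQ_Suc[OF lim_const_over_n])
 have path: "\<forall>\<^sub>F N in sequentially. Z (Suc N) w \<le> 3 * \<epsilon>" if w: "w \<in> space M" for w
 proof -
  have "continuous_on {0..T} (%t. f (X t w))"
   by (rule continuous_on_compose2[OF fc(1) continuous_on_subset[OF Xc[OF w]]]) auto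
  then have "uniformly_continuous_on {0..T} (%t. f (X t w))" by (rule compact_uniformly_continuous) simp
  then obtain \<delta> where \<delta>: "\<delta> > 0" "\<And>s t. s \<in> {0..T} ==> t \<in> {0..T} ==> dist t s < \<delta> ==> dist (f (X t w)) (f (X s w)) < \<epsilon>"
   using \<epsilon> unfolding uniformly_continuous_on_def by metis
  from order_tendstoD(2)[OF hl \<delta>(1)] show ?thesis
  proof eventually_elim
   case (elim N)
   obtain j where j: "j \<le> Suc N" "Z (Suc N) w = m (Suc N) j w"
    "j = Suc N \<or> (\<exists>r\<in>{0..T}. \<bar>r - g (Suc N) j\<bar> \<le> T / real (Suc N) \<and> X r w \<notin> {-p..p})" using Zj[OF w, of "Suc N"] by auto
   from j(3) show ?case
   proof
    assume "j = Suc N"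
    then have "g (Suc N) j = T" by (simp add: g_def)
    then have "m (Suc N) j w \<le> exp (- lam * T) * (1 / lam)" unfolding m_def using f0 by (intro mult_mono) auto
    also have "\<dots> \<le> \<epsilon>" using eT by simp
    finally show ?thesis using j(2) \<epsilon> by simp
   next
    assume "\<exists>r\<in>{0..T}. \<bar>r - g (Suc N) j\<bar> \<le> T / real (Suc N) \<and> X r w \<notin> {-p..p}"
    then obtain r where r: "r \<in> {0..T}" "\<bar>r - g (Suc N) j\<bar> \<le> T / real (Suc N)" "X r w \<notin> {-p..p}" by blast
    have gT: "g (Suc N) j \<in> {0..T}" using j(1) T gnn[of "Suc N" j] by (auto simp: g_def divide_le_eq)
    have "dist (f (X r w)) (f (X (g (Suc N) j) w)) < \<epsilon>"
     using r(1,2) gT elim by (intro \<delta>(2)) (auto simp: dist_real_def)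
    moreover have "f (X r w) \<le> \<epsilon>" using r(3) unfolding abs by (intro order.trans[OF fp Up]) simp
    ultimately have "f (X (g (Suc N) j) w) \<le> 2 * \<epsilon>" by (simp add: dist_real_def abs_less_iff)
    then have "m (Suc N) j w \<le> 1 * (2 * \<epsilon>)" unfolding m_def using f0 e1 by (intro mult_mono) auto
    then show ?thesis using j(2) \<epsilon> by simp
   qed
  qed
 qed
 have "(%N. expectation (%w. max 0 (Z (Suc N) w - 3 * \<epsilon>))) \<longlonglongrightarrow> expectation (%w. 0)"
 proof (rule integral_dominated_convergence[where w = "%_. 1 / lam"])
  show "AE w in M. (%N. max 0 (Z (Suc N) w - 3 * \<epsilon>)) \<longlonglongrightarrow> 0"
  proof (rule AE_I2)
   fix w assume "w \<in> space M"
   from path[OF this] have "\<forall>\<^sub>F N in sequentially. max 0 (Z (Suc N) w - 3 * \<epsilon>) = 0" by eventually_elim auto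
   then show "(%N. max 0 (Z (Suc N) w - 3 * \<epsilon>)) \<longlonglongrightarrow> 0" by (rule tendsto_eventually)
  qed
  show "AE w in M. norm (max 0 (Z (Suc N) w - 3 * \<epsilon>)) \<le> 1 / lam" for N
  proof (rule AE_I2)
   fix w assume "w \<in> space M"
   have "0 < 1 / lam" using lam_pos by simp
   then show "norm (max 0 (Z (Suc N) w - 3 * \<epsilon>)) \<le> 1 / lam" using Zb[OF \<open>w \<in> space M\<close>, of N] \<epsilon> by auto
  qed
 qed (auto simp: measurable_compose)
 then have "(%N. expectation (%w. max 0 (Z (Suc N) w - 3 * \<epsilon>))) \<longlonglongrightarrow> 0" by simp
 from order_tendstoD(2)[OF this \<epsilon>] order_tendstoD(2)[OF hl \<epsilon>] eventually_ge_at_top[of N0]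
 have "\<forall>\<^sub>F N in sequentially. expectation (%w. max 0 (Z (Suc N) w - 3 * \<epsilon>)) < \<epsilon> \<and> T / real (Suc N) < \<epsilon> \<and> N0 \<le> N"
  by eventually_elim auto
 from eventually_happens[OF this] obtain N' where N': "expectation (%w. max 0 (Z (Suc N') w - 3 * \<epsilon>)) < \<epsilon>" "T / real (Suc N') < \<epsilon>" "N0 \<le> N'" by auto
 define N where "N = Suc N'"
 have N: "0 < N" "N0 \<le> N" using N' by (auto simp: N_def)
 define h where "h = T / real N"
 have h: "0 < h" "h < \<epsilon>" using T N N' by (auto simp: h_def N_def)
 have bi: "integrable M u" if "u \<in> borel_measurable M" "\<And>w. w \<in> space M ==> \<bar>u w\<bar> \<le> b" for u :: "'a => real" and b
  by (rule integrable_const_bound[where B = b]) (use that in auto)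
 have sb: "\<bar>al N k w * (m N (Suc k) w - m N k w)\<bar> \<le> 1 / lam" for k w
 proof -
  have "\<bar>m N (Suc k) w - m N k w\<bar> \<le> 1 / lam" using mb[of N k w] mb[of N "Suc k" w] by auto
  then have "\<bar>al N k w\<bar> * \<bar>m N (Suc k) w - m N k w\<bar> \<le> 1 * (1 / lam)" using al01[of N k w] by (intro mult_mono) auto
  then show ?thesis by (simp add: abs_mult)
 qed
 have si: "integrable M (%w. al N k w * (m N (Suc k) w - m N k w))" for k by (rule bi[OF _ sb]) measurable
 have EZ: "expectation (Z N) = U H x0 + (\<Sum>k<N. expectation (%w. al N k w * (m N (Suc k) w - m N k w)))"
  unfolding Z_def[abs_def] using si by (simp add: prob_space)
 have Zi: "integrable M (Z N)" unfolding Z_def[abs_def] using si by auto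
 have "expectation (Z N) \<le> expectation (%w. 3 * \<epsilon> + max 0 (Z N w - 3 * \<epsilon>))"
  using Zi by (intro integral_mono) auto
 also have "\<dots> = 3 * \<epsilon> + expectation (%w. max 0 (Z N w - 3 * \<epsilon>))" using Zi by (simp add: prob_space)
 also have "\<dots> \<le> 4 * \<epsilon>" using N'(1) by (simp add: N_def)
 finally have EZ4: "expectation (Z N) \<le> 4 * \<epsilon>" .
 define a where "a k w = al N k w * (h * exp (- lam * g N k))" for k w
 have a0: "0 \<le> a k w" for k w using al01 h by (simp add: a_def)
 have ah: "a k w \<le> h" for k w
 proof -
  have "a k w \<le> 1 * (h * 1)" unfolding a_def using al01 h e1 by (intro mult_mono) auto
  then show ?thesis by simp
 qed
 have am [measurable]: "a k \<in> borel_measurable M" for k unfolding a_def[abs_def] by measurable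
 have ai: "integrable M (a k)" for k by (rule bi[of _ h]) (use a0 ah in \<open>auto simp: abs_le_iff intro: order.trans[of _ 0] less_imp_le[OF h(1)]\<close>)
 \<comment> \<open>Dynkin's inequality weighs cells by their left ends, the cost estimate by their
   right ends. Shifting the index by one leaves a single unmatched summand, at most the
   mesh.\<close>
 have Ea0: "expectation (a 0) \<le> h"
 proof -
  have "expectation (a 0) \<le> expectation (%_. h)" by (rule integral_mono[OF ai]) (use ah in auto)
  then show ?thesis by (simp add: prob_space)
 qed
 have "(\<Sum>k<N. expectation (a (Suc k))) \<le> cost M lam X"
 proof -
  have "ennreal (\<Sum>k<N. expectation (a (Suc k))) = ennreal (expectation (%w. \<Sum>k<N. a (Suc k) w))" using ai by simp
  also have "\<dots> = (\<integral>\<^sup>+w. ennreal (\<Sum>k<N. a (Suc k) w) \<partial>M)"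
   using ai a0 by (intro nn_integral_eq_integral[symmetric]) (auto intro!: AE_I2 sum_nonneg)
  also have "\<dots> \<le> (\<integral>\<^sup>+w. (\<integral>\<^sup>+s\<in>{s. 0 \<le> s \<and> ereal s < exit_time X w}. ennreal (exp (- lam * s)) \<partial>lborel) \<partial>M)"
  proof (rule nn_integral_mono)
   fix w
   have "ennreal (\<Sum>k<N. a (Suc k) w) = (\<Sum>k<N. ennreal (a (Suc k) w))" using a0 by (subst sum_ennreal) auto
   also have "\<dots> \<le> (\<integral>\<^sup>+s\<in>{s. 0 \<le> s \<and> ereal s < exit_time X w}. ennreal (exp (- lam * s)) \<partial>lborel)"
    unfolding a_def al_def g_def h_def by (rule alive_sum_le_discounted) (use p T N in auto)
   finally show "ennreal (\<Sum>k<N. a (Suc k) w) \<le> (\<integral>\<^sup>+s\<in>{s. 0 \<le> s \<and> ereal s < exit_time X w}. ennreal (exp (- lam * s)) \<partial>lborel)" .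
  qed
  also have "\<dots> = ennreal (cost M lam X)" unfolding cost_def using discounted_time_finite[of X] by (simp add: less_top)
  finally show ?thesis by (simp add: cost_def)
 qed
 moreover have "(\<Sum>k<N. expectation (a k)) \<le> (\<Sum>k<Suc N. expectation (a k))" using a0 by (simp add: integral_nonneg_AE)
 moreover have "(\<Sum>k<Suc N. expectation (a k)) = expectation (a 0) + (\<Sum>k<N. expectation (a (Suc k)))" by (rule sum.lessThan_Suc_shift)
 moreover have "(\<Sum>k<N. expectation (%w. al N k w * (m N (Suc k) w - m N k w))) \<ge> - (\<Sum>k<N. expectation (a k)) - \<epsilon>"
  using N0[OF N(2,1)] unfolding a_def[abs_def] h_def .
 ultimately have "U H x0 \<le> cost M lam X + 7 * \<epsilon>" using EZ EZ4 Ea0 h \<epsilon> by linarith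
 then show "U H x0 \<le> cost M lam X + \<epsilon>0" by (simp add: \<epsilon>_def)
qed

text \<open>Dynkin's inequality for \<open>- U H\<close> along the path with control \<Omega>, on
  \<open>[0, p]\<close>, where that control is optimal. The telescoped sum ends in minus a
  nonnegative number, so the starting value \<open>U H z0\<close> alone bounds the running cost
  weighted by the cutoff.\<close>

lemma discrete_upper:
 assumes z: "0 \<le> z0" "z0 \<le> p" and p: "0 < p" "p < pi" and e: "0 < e" "e < pi" and H: "profile (cutoff e) H H1"
  and T: "0 < T" and \<epsilon>: "0 < \<epsilon>"
 shows "\<exists>N0. \<forall>N\<ge>N0. 0 < N --> (\<Sum>k<N. expectation (%w. alive (Xp z0) 0 p (T * real k / real N) w *
  (T / real N * exp (- lam * (T * real k / real N)) * cutoff e (Xp z0 (T * real k / real N) w)))) \<le> U H z0 + \<epsilon>"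
proof -
 let ?X = "Xp z0"
 have adm: "admissible M F \<Omega> (%_ _. \<Omega>)" by (rule admissible_const) (use \<Omega>_pos in auto)
 obtain f f1 f2 B C where fc: "continuous_on UNIV f" "continuous_on UNIV f1" "continuous_on UNIV f2"
  and B: "\<And>x. \<bar>f x\<bar> \<le> B" "\<And>x. \<bar>f1 x\<bar> \<le> B" "\<And>x. \<bar>f2 x\<bar> \<le> B" "1 \<le> B"
  and f0: "\<And>x. 0 \<le> f x \<and> f x \<le> 1 / lam" and "\<And>x. p \<le> \<bar>x\<bar> ==> f x \<le> U H p"
  and fe: "\<And>x. \<bar>x\<bar> \<le> p ==> f x = U H x \<and> f1 x = U1 H H1 x \<and> f2 x = U2 (cutoff e) H H1 x"
  and C: "0 \<le> C" and R1: "\<And>x y. \<bar>x\<bar> \<le> p ==> \<bar>f y - f x - f1 x * (y - x) - f2 x / 2 * (y - x)\<^sup>2\<bar> \<le> C * (y - x)\<^sup>2"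
  and R2: "\<And>\<kappa>. \<kappa> > 0 ==> \<exists>K\<ge>0. \<forall>x y. \<bar>x\<bar> \<le> p -->
   \<bar>f y - f x - f1 x * (y - x) - f2 x / 2 * (y - x)\<^sup>2\<bar> \<le> \<kappa> * (y - x)\<^sup>2 + K * \<bar>y - x\<bar> ^ 3"
  using barrier_extension[OF e H p] by blast
 have neg: "\<bar>- f y - - f x - - f1 x * (y - x) - - f2 x / 2 * (y - x)\<^sup>2\<bar> = \<bar>f y - f x - f1 x * (y - x) - f2 x / 2 * (y - x)\<^sup>2\<bar>" for x y
 proof -
  have neg: "- a - - b - - c * d - - k / 2 * l = - (a - b - c * d - k / 2 * l)" for a b c d k l :: real by simp
  show ?thesis by (subst neg) (rule abs_minus_cancel)
 qed
 have fm [measurable]: "f \<in> borel_measurable borel" "f1 \<in> borel_measurable borel" "f2 \<in> borel_measurable borel" "cutoff e \<in> borel_measurable borel"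
  using fc cutoff_props(1)[OF e(1)] by (auto intro: borel_measurable_continuous_onI)
 have "\<exists>N0. \<forall>N\<ge>N0. 0 < N -->
  (\<Sum>k<N. expectation (%w. alive ?X 0 p (T * real k / real N) w *
    (exp (- lam * (T * real (Suc k) / real N)) * (%x. - f x) (?X (T * real (Suc k) / real N) w)
     - exp (- lam * (T * real k / real N)) * (%x. - f x) (?X (T * real k / real N) w))))
   \<ge> - (\<Sum>k<N. expectation (%w. alive ?X 0 p (T * real k / real N) w *
      (T / real N * exp (- lam * (T * real k / real N)) * (%x. - cutoff e x) (?X (T * real k / real N) w)))) - \<epsilon>"
 proof (rule dynkin_sum[OF adm Xp_solution T \<epsilon>, where f = "%x. - f x" and ?f1.0 = "%x. - f1 x" and ?f2.0 = "%x. - f2 x" and \<psi> = "%x. - cutoff e x" and C = C and B = B])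
  fix t :: real and w :: 'a and x assume x: "x \<in> {0..p}"
  have "\<bar>x\<bar> \<le> p" using x by auto
  from fe[OF this] barrier_generator_upper[OF e H, of x] x p
  show "- (- cutoff e x) \<le> (\<Omega> - 2 * \<gamma> * sin (2 * x)) * (- f1 x) + 4 * \<gamma> * (sin x)\<^sup>2 * (- f2 x) - lam * (- f x)" by auto
 next
  fix x show "\<bar>- cutoff e x\<bar> \<le> B" using cutoff_props(2,3)[OF e(1), of x] B(4) by auto
 next
  fix x y assume "x \<in> {0..p}"
  then show "\<bar>- f y - - f x - - f1 x * (y - x) - - f2 x / 2 * (y - x)\<^sup>2\<bar> \<le> C * (y - x)\<^sup>2" unfolding neg by (intro R1) auto
 next
  fix \<kappa> :: real assume "\<kappa> > 0"
  from R2[OF this] obtain K where "0 \<le> K" "\<forall>x y. \<bar>x\<bar> \<le> p --> \<bar>f y - f x - f1 x * (y - x) - f2 x / 2 * (y - x)\<^sup>2\<bar> \<le> \<kappa> * (y - x)\<^sup>2 + K * \<bar>y - x\<bar> ^ 3" by blast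
  then show "\<exists>K\<ge>0. \<forall>x y. x \<in> {0..p} --> \<bar>- f y - - f x - - f1 x * (y - x) - - f2 x / 2 * (y - x)\<^sup>2\<bar> \<le> \<kappa> * (y - x)\<^sup>2 + K * \<bar>y - x\<bar> ^ 3"
   unfolding neg by (intro exI[of _ K]) auto
 qed (use B C in \<open>simp_all\<close>)
 then obtain N0 where N0: "\<And>N. N \<ge> N0 ==> 0 < N ==>
  (\<Sum>k<N. expectation (%w. alive ?X 0 p (T * real k / real N) w *
    (- (exp (- lam * (T * real (Suc k) / real N)) * f (?X (T * real (Suc k) / real N) w))
     - - (exp (- lam * (T * real k / real N)) * f (?X (T * real k / real N) w)))))
   \<ge> - (\<Sum>k<N. expectation (%w. - (alive ?X 0 p (T * real k / real N) w *
      (T / real N * exp (- lam * (T * real k / real N)) * cutoff e (?X (T * real k / real N) w))))) - \<epsilon>"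
  unfolding mult_minus_right by blast
 show ?thesis
 proof (intro exI[of _ N0] allI impI)
  fix N assume N: "N0 \<le> N" "0 < N"
  define g where "g k = T * real k / real N" for k
  define m where "m k w = - (exp (- lam * g k) * f (?X (g k) w))" for k w
  define al where "al k w = alive ?X 0 p (g k) w" for k w
  have gnn: "0 \<le> g k" for k using T by (simp add: g_def)
  have Xm [measurable]: "?X (g k) \<in> borel_measurable M" for k by (rule Xp_measurable_M[OF gnn])
  have alm [measurable]: "al k \<in> borel_measurable M" for k unfolding al_def[abs_def] by (rule measurable_F_M[OF alive_measurable[OF Xp_progressive Xp_continuous gnn]])
  have al01: "0 \<le> al k w" "al k w \<le> 1" for k w using alive_bound[of ?X 0 p "g k" w] by (auto simp: al_def)
  have mb: "m k w \<le> 0" "- m k w \<le> 1 / lam" for k w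
  proof -
   show "m k w \<le> 0" using f0 by (simp add: m_def)
   have "exp (- lam * g k) \<le> 1" using gnn[of k] lam_pos by simp
   then have "- m k w \<le> 1 * (1 / lam)" unfolding m_def minus_minus using f0 by (intro mult_mono) auto
   then show "- m k w \<le> 1 / lam" by simp
  qed
  have sb: "\<bar>al k w * (m (Suc k) w - m k w)\<bar> \<le> 1 / lam" for k w
  proof -
   have "\<bar>m (Suc k) w - m k w\<bar> \<le> 1 / lam" using mb[of k w] mb[of "Suc k" w] by auto
   then have "\<bar>al k w\<bar> * \<bar>m (Suc k) w - m k w\<bar> \<le> 1 * (1 / lam)" using al01[of k w] by (intro mult_mono) auto
   then show ?thesis by (simp add: abs_mult)
  qed
  have mm [measurable]: "m k \<in> borel_measurable M" for k unfolding m_def[abs_def] by measurable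
  have si: "integrable M (%w. al k w * (m (Suc k) w - m k w))" for k
   by (rule integrable_const_bound[where B = "1 / lam"]) (use sb in auto)
  have "(\<Sum>k<N. expectation (%w. al k w * (m (Suc k) w - m k w))) = expectation (%w. \<Sum>k<N. al k w * (m (Suc k) w - m k w))"
   using si by simp
  also have "\<dots> \<le> expectation (%w. U H z0)"
  proof (rule integral_mono)
   fix w assume w: "w \<in> space M"
   have X0: "?X 0 w = z0" by (rule Xp_0[OF w])
   then have "?X 0 w \<in> {0..p}" using z by simp
   from alive_telescope[where X = ?X and w = w and m = "%k. m k w", OF this T N(2)] obtain j where
    j: "(\<Sum>k<N. al k w * (m (Suc k) w - m k w)) = m j w - m 0 w" unfolding al_def g_def by blast
   have "m 0 w = - U H z0" using X0 fe[of z0] z by (simp add: m_def g_def)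
   then show "(\<Sum>k<N. al k w * (m (Suc k) w - m k w)) \<le> U H z0" unfolding j using mb(1)[of j w] by simp
  qed (use si in auto)
  finally have up: "(\<Sum>k<N. expectation (%w. al k w * (m (Suc k) w - m k w))) \<le> U H z0" by (simp add: prob_space)
  from N0[OF N] have "- (\<Sum>k<N. expectation (%w. - (al k w * (T / real N * exp (- lam * g k) * cutoff e (?X (g k) w))))) - \<epsilon> \<le> (\<Sum>k<N. expectation (%w. al k w * (m (Suc k) w - m k w)))"
   unfolding al_def m_def g_def .
  with up have "(\<Sum>k<N. expectation (%w. al k w * (T / real N * exp (- lam * g k) * cutoff e (?X (g k) w)))) \<le> U H z0 + \<epsilon>"
   by (simp add: sum_negf)
  then show "(\<Sum>k<N. expectation (%w. alive ?X 0 p (T * real k / real N) w *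
  (T / real N * exp (- lam * (T * real k / real N)) * cutoff e (?X (T * real k / real N) w)))) \<le> U H z0 + \<epsilon>"
   unfolding al_def g_def .
 qed
qed

text \<open>A path started in \<open>[0, pi)\<close> stays nonnegative. To reach or pass pi by time
  \<open>s\<close> it would have to hit pi, by the intermediate value theorem, and so would have
  exited by then; compactness then keeps its maximum strictly below pi.\<close>

lemma Xp_before_exit:
 assumes w: "w \<in> space M" and z: "0 \<le> z0" "z0 < pi" and s: "0 < s" "ereal s < exit_time (Xp z0) w"
 shows "\<exists>m<pi. \<forall>r\<in>{0..s}. 0 \<le> Xp z0 r w \<and> Xp z0 r w \<le> m"
proof -
 have c: "continuous_on {0..r} (%t. Xp z0 t w)" for r by (rule continuous_on_subset[OF Xp_continuous[OF w]]) auto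
 have nn: "0 \<le> Xp z0 r w" if "0 \<le> r" for r
  using that z Xp_0[OF w, of z0] Xp_positive[OF w z(1), of r] by (cases "r = 0") auto
 have lt: "Xp z0 r w < pi" if r: "r \<in> {0..s}" for r
 proof (rule ccontr)
  assume "\<not> Xp z0 r w < pi"
  then obtain r' where r': "0 \<le> r'" "r' \<le> r" "Xp z0 r' w = pi"
   using IVT'[of "%t. Xp z0 t w" 0 pi r] c[of r] Xp_0[OF w, of z0] z r by auto
  have "exit_time (Xp z0) w \<le> ereal r'" unfolding exit_time_def using r' by (intro Inf_lower) auto
  also have "\<dots> \<le> ereal s" using r r' by simp
  finally show False using s by simp
 qed
 from continuous_attains_sup[OF compact_Icc _ c[of s]] s obtain m where "m \<in> {0..s}" "\<forall>r\<in>{0..s}. Xp z0 r w \<le> Xp z0 m w" by fastforce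
 then show ?thesis using lt nn by (intro exI[of _ "Xp z0 m w"]) auto
qed

text \<open>Along one diagonal sequence the horizon grows, the interval fills
  \<open>[0, pi)\<close>, and cutoff width and mesh shrink. The resulting step functions eventually
  dominate the discounted indicator of survival at each time \<open>s \<noteq> 0\<close>, because
  the path is strictly positive there and so outside the cutoff region. Fatou's lemma, in time and
  then over the probability space, yields the bound in the limit.\<close>

lemma cost_upper:
 assumes z: "0 \<le> z0" "z0 < pi" and G: "profile (%_. 1) G G1"
 shows "cost M lam (Xp z0) \<le> U G z0"
proof -
 let ?X = "Xp z0"
 define P where "P n = max z0 (pi - 1 / real (Suc n))" for n
 define T where "T n = real (Suc n)" for n
 have T: "0 < T n" for n by (simp add: T_def)
 have P: "0 < P n" "P n < pi" "z0 \<le> P n" for n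
 proof -
  have "1 / real (Suc n) \<le> 1" by simp
  then have "0 < pi - 1 / real (Suc n)" using pi_gt3 by linarith
  then show "0 < P n" by (simp add: P_def)
 qed (use z in \<open>auto simp: P_def\<close>)
 \<comment> \<open>The condition \<open>(T n)\<^sup>2 \<le> real N\<close> forces the mesh
   \<open>T n / N\<close> to be at most \<open>1 / T n\<close>, so that one small parameter controls
   mesh, cutoff width and error.\<close>
 define Q where "Q n N e \<longleftrightarrow> 0 < N \<and> (T n)\<^sup>2 \<le> real N \<and> 0 < e \<and> e < 1 / T n \<and>
  (\<Sum>k<N. expectation (%w. alive ?X 0 (P n) (T n * real k / real N) w *
  (T n / real N * exp (- lam * (T n * real k / real N)) * cutoff e (?X (T n * real k / real N) w)))) \<le> U G z0 + 2 / T n" for n N e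
 have "\<exists>N e. Q n N e" for n
 proof -
  have k: "0 < 1 / T n" using T by simp
  from cut_U_tendsto[OF G k] obtain e0 where e0: "e0 > 0"
   "\<And>e H H1 x. 0 < e ==> e < e0 ==> profile (cutoff e) H H1 ==> x\<in>{-pi..pi} ==> \<bar>U H x - U G x\<bar> \<le> 1 / T n" by blast
  define b where "b = min e0 (min (1 / T n) pi)"
  have b: "0 < b" "b \<le> e0" "b \<le> 1 / T n" "b \<le> pi" using e0(1) k by (auto simp: b_def)
  define e where "e = b / 2"
  have e: "0 < e" "e < e0" "e < 1 / T n" "e < pi" using b by (auto simp: e_def)
  obtain H H1 where H: "profile (cutoff e) H H1" using profile_cutoff_exists[OF e(1)] by blast
  have UH: "U H z0 \<le> U G z0 + 1 / T n" using e0(2)[OF e(1,2) H, of z0] z by auto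
  from discrete_upper[OF z(1) P(3)[of n] P(1,2)[of n] e(1,4) H T[of n] k] obtain N0 where N0: "\<And>N. N \<ge> N0 ==> 0 < N ==>
   (\<Sum>k<N. expectation (%w. alive ?X 0 (P n) (T n * real k / real N) w *
   (T n / real N * exp (- lam * (T n * real k / real N)) * cutoff e (?X (T n * real k / real N) w)))) \<le> U H z0 + 1 / T n" by blast
  define N where "N = max N0 ((Suc n)\<^sup>2)"
  have N: "N0 \<le> N" "(Suc n)\<^sup>2 \<le> N" by (auto simp: N_def)
  have "0 < (Suc n)\<^sup>2" by simp
  then have N1: "0 < N" using N(2) by (rule less_le_trans)
  have "real ((Suc n)\<^sup>2) \<le> real N" using N(2) by (simp only: of_nat_le_iff)
  then have "(T n)\<^sup>2 \<le> real N" by (simp add: T_def)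
  moreover have "U H z0 + 1 / T n \<le> U G z0 + 2 / T n" using UH by (simp add: add_divide_distrib[symmetric] field_simps)
  ultimately show ?thesis unfolding Q_def using e(1,3) N1 order.trans[OF N0[OF N(1) N1]] by blast
 qed
 then obtain N e where "\<And>n. Q n (N n) (e n)" by metis
 then have N: "\<And>n. 0 < N n" "\<And>n. (T n)\<^sup>2 \<le> real (N n)" and e: "\<And>n. 0 < e n" "\<And>n. e n < 1 / T n"
  and S: "\<And>n. (\<Sum>k<N n. expectation (%w. alive ?X 0 (P n) (T n * real k / real (N n)) w *
  (T n / real (N n) * exp (- lam * (T n * real k / real (N n))) * cutoff (e n) (?X (T n * real k / real (N n)) w)))) \<le> U G z0 + 2 / T n"
  by (simp_all only: Q_def)
 define g where "g n k = T n * real k / real (N n)" for n k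
 define h where "h n = T n / real (N n)" for n
 define c where "c n k w = alive ?X 0 (P n) (g n k) w * (exp (- lam * g n k) * cutoff (e n) (?X (g n k) w))" for n k w
 define \<Phi> where "\<Phi> n w s = (\<Sum>k<N n. ennreal (c n k w) * indicator {g n k..<g n (Suc k)} s)" for n w s
 define A where "A w s = ennreal (exp (- lam * s)) * indicator {s. 0 \<le> s \<and> ereal s < exit_time ?X w} s" for w s
 have h: "0 < h n" "h n \<le> 1 / T n" for n
 proof -
  show "0 < h n" using T N(1)[of n] by (simp add: h_def)
  have "T n * T n \<le> real (N n)" using N(2)[of n] by (simp add: power2_eq_square)
  then show "h n \<le> 1 / T n" unfolding h_def using T[of n] N(1)[of n] by (simp add: divide_le_eq le_divide_eq)
 qed
 have gh: "g n k = h n * real k" for n k by (simp add: g_def h_def)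
 have gnn: "0 \<le> g n k" for n k using h(1)[of n] by (simp add: gh)
 have gS: "g n (Suc k) = g n k + h n" for n k by (simp add: gh algebra_simps)
 have cb: "0 \<le> c n k w" "c n k w \<le> 1" for n k w
 proof -
  note q = cutoff_props(2,3)[OF e(1), of n "?X (g n k) w"] alive_bound[of ?X 0 "P n" "g n k" w]
  show "0 \<le> c n k w" using q by (simp add: c_def)
  have "exp (- lam * g n k) \<le> 1" using gnn[of n k] lam_pos by simp
  then have "c n k w \<le> 1 * (1 * 1)" unfolding c_def using q by (intro mult_mono) auto
  then show "c n k w \<le> 1" by simp
 qed
 have cm: "c n k \<in> borel_measurable M" for n k
 proof -
  have [measurable]: "?X (g n k) \<in> borel_measurable M" by (rule Xp_measurable_M[OF gnn])
  have [measurable]: "alive ?X 0 (P n) (g n k) \<in> borel_measurable M"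
   by (rule measurable_F_M[OF alive_measurable[OF Xp_progressive Xp_continuous gnn]])
  have [measurable]: "cutoff (e n) \<in> borel_measurable borel" by (rule borel_measurable_continuous_onI[OF cutoff_props(1)[OF e(1)]])
  show ?thesis unfolding c_def[abs_def] by measurable
 qed
 have \<Phi>m: "\<Phi> n w \<in> borel_measurable lborel" for n w unfolding \<Phi>_def[abs_def] by measurable
 have inner: "(\<integral>\<^sup>+s. \<Phi> n w s \<partial>lborel) = ennreal (\<Sum>k<N n. c n k w * h n)" for n w
 proof -
  have "(\<integral>\<^sup>+s. \<Phi> n w s \<partial>lborel) = (\<Sum>k<N n. \<integral>\<^sup>+s. ennreal (c n k w) * indicator {g n k..<g n (Suc k)} s \<partial>lborel)"
   unfolding \<Phi>_def by (rule nn_integral_sum) measurable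
  also have "\<dots> = (\<Sum>k<N n. ennreal (c n k w * h n))"
   using h(1)[of n] cb(1) by (intro sum.cong) (auto simp: nn_integral_cmult_indicator gS ennreal_mult)
  also have "\<dots> = ennreal (\<Sum>k<N n. c n k w * h n)" using h(1)[of n] cb(1) by (intro sum_ennreal) auto
  finally show ?thesis .
 qed
 have outer: "(\<integral>\<^sup>+w. (\<integral>\<^sup>+s. \<Phi> n w s \<partial>lborel) \<partial>M) \<le> ennreal (U G z0 + 2 / T n)" for n
 proof -
  have ci: "integrable M (c n k)" for k by (rule integrable_const_bound[where B = 1]) (use cb cm in auto)
  have "(\<integral>\<^sup>+w. (\<integral>\<^sup>+s. \<Phi> n w s \<partial>lborel) \<partial>M) = ennreal (expectation (%w. \<Sum>k<N n. c n k w * h n))"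
   unfolding inner using ci cb(1) h(1)[of n] by (intro nn_integral_eq_integral) (auto intro!: AE_I2 sum_nonneg)
  also have "expectation (%w. \<Sum>k<N n. c n k w * h n) = (\<Sum>k<N n. expectation (%w. c n k w * h n))" using ci by simp
  also have "\<dots> \<le> U G z0 + 2 / T n" using S[of n] unfolding c_def g_def h_def by (simp add: mult_ac)
  finally show ?thesis by (simp add: ennreal_leI)
 qed
 have Tl: "(%n. 1 / T n) \<longlonglongrightarrow> 0" unfolding T_def by (rule LIMSEQ_Suc[OF lim_const_over_n])
 \<comment> \<open>Time 0 is excluded since a path started at 0 lies in the cutoff region there; a
   single point is negligible for Lebesgue measure.\<close>
 have pt: "A w s \<le> liminf (%n. \<Phi> n w s)" if w: "w \<in> space M" and s0: "s \<noteq> 0" for w s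
 proof (cases "0 \<le> s \<and> ereal s < exit_time ?X w")
  case False
  then have "A w s = 0" by (auto simp: A_def)
  then show ?thesis by simp
 next
  case True
  then have s: "0 < s" "ereal s < exit_time ?X w" using s0 by auto
  obtain m where m: "m < pi" "\<And>r. r \<in> {0..s} ==> 0 \<le> ?X r w \<and> ?X r w \<le> m" using Xp_before_exit[OF w z s] by blast
  have Xs: "0 < ?X s w" by (rule Xp_positive[OF w z(1) s(1)])
  have "((%t. ?X t w) \<longlongrightarrow> ?X s w) (at s within {0..})" using Xp_continuous[OF w, of z0] s(1) by (auto simp: continuous_on_def)
  from order_tendstoD(1)[OF this, of "?X s w / 2"] Xs obtain d where d: "d > 0" "\<And>r. 0 \<le> r ==> r \<noteq> s ==> dist r s < d ==> ?X s w / 2 < ?X r w"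
   unfolding eventually_at by auto
  have d': "?X s w / 2 < ?X r w" if "0 \<le> r" "\<bar>r - s\<bar> < d" for r using d(2)[of r] that Xs by (cases "r = s") (auto simp: dist_real_def)
  have "0 < min d (min (pi - m) (?X s w / 4))" using d m Xs by simp
  from order_tendstoD(2)[OF Tl this] have ev1: "\<forall>\<^sub>F n in sequentially. 1 / T n < min d (min (pi - m) (?X s w / 4))" .
  have ev2: "\<forall>\<^sub>F n in sequentially. s < T n"
  proof -
   obtain k0 :: nat where "s < real k0" using reals_Archimedean2 by blast
   then show ?thesis unfolding eventually_sequentially T_def by (intro exI[of _ k0]) auto
  qed
  from ev1 ev2 have "\<forall>\<^sub>F n in sequentially. A w s \<le> \<Phi> n w s"
  proof eventually_elim
   case (elim n)
   \<comment> \<open>The index of the cell containing \<open>s\<close>. At its left end the path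
     exceeds half of its value at \<open>s\<close>, while \<open>2 * e n\<close> is below that half,
     so the cutoff is 1; the upper end \<open>P n\<close> of the interval exceeds the maximum
     \<open>m\<close> of the path up to time \<open>s\<close>, so the path is alive.\<close>
   define k where "k = nat \<lfloor>s / h n\<rfloor>"
   have q: "0 \<le> s / h n" using s h(1)[of n] by simp
   have "real k = of_int \<lfloor>s / h n\<rfloor>" using q by (simp add: k_def)
   then have kk: "real k \<le> s / h n" "s / h n < real k + 1" by linarith+
   have gk: "g n k \<le> s" "s < g n (Suc k)"
   proof -
    show "g n k \<le> s" using kk(1) h(1)[of n] by (simp add: gh le_divide_eq mult.commute)
    show "s < g n (Suc k)" using kk(2) h(1)[of n] by (simp add: gh divide_less_eq mult.commute algebra_simps)
   qed
   have kN: "k < N n"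
   proof (rule ccontr)
    assume "\<not> k < N n"
    then have "h n * real (N n) \<le> h n * real k" using h(1)[of n] by (intro mult_left_mono) auto
    moreover have "h n * real (N n) = T n" using N(1)[of n] by (simp add: h_def)
    ultimately show False using gk(1) elim(2) by (simp add: gh)
   qed
   have near: "\<bar>g n k - s\<bar> < d" using gk gS[of n k] h(2)[of n] elim(1) by simp
   have "?X s w / 2 < ?X (g n k) w" by (rule d'[OF gnn near])
   then have cut: "cutoff (e n) (?X (g n k) w) = 1" using e(2)[of n] elim(1) by (intro cutoff_props(5)[OF e(1)]) simp
   have "pi - 1 / T n \<le> P n" by (simp add: P_def T_def)
   then have mP: "m \<le> P n" using elim(1) by simp
   have "?X r w \<in> {0..P n}" if "r \<in> {0..g n k}" for r
    using m(2)[of r] that gk(1) mP by auto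
   then have al: "alive ?X 0 (P n) (g n k) w = 1" by (simp add: alive_def)
   have "exp (- lam * s) \<le> c n k w" using gk(1) lam_pos by (simp add: c_def cut al)
   then have "A w s \<le> ennreal (c n k w) * indicator {g n k..<g n (Suc k)} s"
    using gk by (auto simp: A_def indicator_def intro: ennreal_leI)
   also have "\<dots> \<le> \<Phi> n w s" unfolding \<Phi>_def by (rule member_le_sum) (use kN in auto)
   finally show ?case .
  qed
  then show ?thesis by (rule Liminf_bounded)
 qed
 have "(\<integral>\<^sup>+w. (\<integral>\<^sup>+s. A w s \<partial>lborel) \<partial>M) \<le> (\<integral>\<^sup>+w. (\<integral>\<^sup>+s. liminf (%n. \<Phi> n w s) \<partial>lborel) \<partial>M)"
 proof (rule nn_integral_mono)
  fix w assume w: "w \<in> space M"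
  have "AE s in lborel. s \<noteq> (0::real)" by (rule AE_lborel_singleton)
  then show "(\<integral>\<^sup>+s. A w s \<partial>lborel) \<le> (\<integral>\<^sup>+s. liminf (%n. \<Phi> n w s) \<partial>lborel)"
   by (intro nn_integral_mono_AE) (use pt[OF w] in auto)
 qed
 also have "\<dots> \<le> (\<integral>\<^sup>+w. liminf (%n. \<integral>\<^sup>+s. \<Phi> n w s \<partial>lborel) \<partial>M)"
  by (intro nn_integral_mono nn_integral_liminf \<Phi>m)
 also have "\<dots> \<le> liminf (%n. \<integral>\<^sup>+w. (\<integral>\<^sup>+s. \<Phi> n w s \<partial>lborel) \<partial>M)"
 proof (rule nn_integral_liminf)
  show "(%w. \<integral>\<^sup>+s. \<Phi> n w s \<partial>lborel) \<in> borel_measurable M" for n unfolding inner using cm by measurable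
 qed
 also have "\<dots> \<le> liminf (%n. ennreal (U G z0 + 2 / T n))" by (intro Liminf_mono always_eventually allI outer)
 also have "\<dots> = ennreal (U G z0)"
 proof (rule lim_imp_Liminf)
  have "(%n. U G z0 + 2 * (1 / T n)) \<longlonglongrightarrow> U G z0 + 2 * 0" by (intro tendsto_intros Tl)
  then have "(%n. U G z0 + 2 / T n) \<longlonglongrightarrow> U G z0" by simp
  then show "(%n. ennreal (U G z0 + 2 / T n)) \<longlonglongrightarrow> ennreal (U G z0)" by (rule tendsto_ennrealI)
 qed simp
 finally have "(\<integral>\<^sup>+w. (\<integral>\<^sup>+s. A w s \<partial>lborel) \<partial>M) \<le> ennreal (U G z0)" .
 moreover have "0 \<le> U G z0" by (rule U_nonneg[OF G]) (use z in auto)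
 ultimately show ?thesis unfolding cost_def A_def by (intro enn2real_leI)
qed

text \<open>The infimum is attained. No cost lies below \<open>U G x\<close>, as the cut profiles
  are lower bounds and converge to it; the constant control that pushes away from 0 on the side of
  \<open>x\<close> reaches it. At \<open>x = 0\<close> the control \<Omega> is taken.\<close>

lemma value_fn_eq:
 assumes G: "profile (%_. 1) G G1" and x: "x \<in> {-pi..pi}"
 shows "value_fn M F W \<gamma> \<Omega> lam x = U G x"
proof (cases "\<bar>x\<bar> < pi")
 case False
 then have "x = pi \<or> x = - pi" using x by auto
 then show ?thesis using U_pi[OF G] by (auto simp: value_fn_def)
next
 case True
 let ?S = "{cost M lam X | v X. admissible M F \<Omega> v \<and> sde_solution M F W \<gamma> v x X}"
 have lower: "U G x \<le> cost M lam X" if "admissible M F \<Omega> v" "sde_solution M F W \<gamma> v x X" for v X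
 proof (rule field_le_epsilon)
  fix \<kappa> :: real assume k: "\<kappa> > 0"
  from cut_U_tendsto[OF G k] obtain e0 where e0: "e0 > 0"
   "\<And>e H H1 x. 0 < e ==> e < e0 ==> profile (cutoff e) H H1 ==> x\<in>{-pi..pi} ==> \<bar>U H x - U G x\<bar> \<le> \<kappa>" by blast
  define e where "e = min e0 pi / 2"
  have e: "0 < e" "e < e0" "e < pi" using e0(1) by (auto simp: e_def min_def)
  obtain H H1 where H: "profile (cutoff e) H H1" using profile_cutoff_exists[OF e(1)] by blast
  have "\<bar>U H x - U G x\<bar> \<le> \<kappa>" by (rule e0(2)[OF e(1,2) H x])
  moreover have "U H x \<le> cost M lam X" by (rule cost_lower[OF that True e(1,3) H])
  ultimately show "U G x \<le> cost M lam X + \<kappa>" by simp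
 qed
 have "\<exists>v X. admissible M F \<Omega> v \<and> sde_solution M F W \<gamma> v x X \<and> cost M lam X \<le> U G x"
 proof (cases "0 \<le> x")
  case 1: True
  have "admissible M F \<Omega> (%_ _. \<Omega>)" by (rule admissible_const) (use \<Omega>_pos in auto)
  then show ?thesis using Xp_solution[of x] cost_upper[OF 1 _ G] True by fastforce
 next
  case 2: False
  \<comment> \<open>The exit set is symmetric, so reflection changes neither the exit time nor the
    cost.\<close>
  have "exit_time (%t w. - Xp (- x) t w) w = exit_time (Xp (- x)) w" for w
   unfolding exit_time_def by (auto simp: minus_equation_iff[of _ pi] intro!: arg_cong[where f = Inf])
  then have "cost M lam (%t w. - Xp (- x) t w) = cost M lam (Xp (- x))" by (simp add: cost_def)
  also have "\<dots> \<le> U G (- x)" using 2 True by (intro cost_upper[OF _ _ G]) auto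
  finally have "cost M lam (%t w. - Xp (- x) t w) \<le> U G x" by simp
  moreover have "admissible M F \<Omega> (%_ _. - \<Omega>)" by (rule admissible_const) (use \<Omega>_pos in auto)
  moreover have "sde_solution M F W \<gamma> (%_ _. - \<Omega>) x (%t w. - Xp (- x) t w)" using Xp_solution_uminus[of "- x"] by simp
  ultimately show ?thesis by blast
 qed
 then obtain v X where vX: "admissible M F \<Omega> v" "sde_solution M F W \<gamma> v x X" "cost M lam X \<le> U G x" by blast
 then have "cost M lam X = U G x" using lower by (intro antisym) auto
 then have "U G x \<in> ?S" using vX by force
 then have "Inf ?S = U G x" by (rule cInf_eq_minimum) (use lower in auto)
 then show ?thesis using True by (simp add: value_fn_def abs_less_iff)
qed

end

theorem theorem1:
 fixes M :: "'a measure" and F :: "real \<Rightarrow> 'a measure" and W :: "real \<Rightarrow> 'a \<Rightarrow> real"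
  and \<gamma> \<Omega> lam :: real
 assumes "prob_space M" and "time_filtration M F" and "brownian_motion M F W"
  and "\<gamma> > 0" and "\<Omega> > 2 * \<gamma>" and "lam > 0"
 shows "viscosity_solution \<gamma> \<Omega> lam (value_fn M F W \<gamma> \<Omega> lam) \<and>
  (\<forall>u. viscosity_solution \<gamma> \<Omega> lam u \<longrightarrow> (\<forall>x\<in>{-pi..pi}. u x = value_fn M F W \<gamma> \<Omega> lam x))"
proof -
 interpret controlled_qubit M F W \<gamma> \<Omega> lam
  unfolding controlled_qubit_def brownian_space_def brownian_space_axioms_def qubit_control_def using assms by simp
 obtain G G1 where G: "profile (\<lambda>_. 1) G G1" using profile_one_exists by blast
 have "viscosity_solution \<gamma> \<Omega> lam (value_fn M F W \<gamma> \<Omega> lam) = viscosity_solution \<gamma> \<Omega> lam (U G)"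
  by (rule viscosity_solution_cong) (rule value_fn_eq[OF G])
 moreover have "u x = value_fn M F W \<gamma> \<Omega> lam x" if "viscosity_solution \<gamma> \<Omega> lam u" "x \<in> {-pi..pi}" for u x
  unfolding value_fn_eq[OF G that(2)] by (intro antisym viscosity_le_U[OF G that] U_le_viscosity[OF G that])
 ultimately show ?thesis using U_viscosity[OF G] by blast
qed

end
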